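(* Let $(M,\mathcal F)$ be a compact Riemannian manifold with an isoparametric foliation and let $S(\mathcal F)\subseteq(0,D(\mathcal F))$ be the set of interior zeros of the content functions of the radial eigenfunctions (defined in the context). Then: (i) the isoparametric tube $\Omega_t$ fails the Pompeiu property for all $t\in S(\mathcal F)$; (ii) the set $S(\mathcal F)$ is countable and dense in $(0,D(\mathcal F))$.
   Context: $M$ is a compact connected Riemannian manifold without boundary, and $\Delta=-\mathrm{div}\,\nabla$ is its positive Laplacian. An isoparametric function on $M$ is a smooth function $F:M\to[a,b]$ with $F(M)=[a,b]$, $a<b$, such that $|\nabla F|^2=A\circ F$ and $\Delta F=B\circ F$ for some smooth functions $A,B:[a,b]\to\mathbb R$. The sets $M^+:=F^{-1}(a)$ and $M^-:=F^{-1}(b)$ are smooth closed submanifolds, called the focal sets; $F$ is called proper if both focal sets have codimension at least $2$ in $M$. All isoparametric functions are assumed proper. The isoparametric foliation $\mathcal F$ is the decomposition $M=\bigcup_{t\in[a,b]}F^{-1}(t)$ into level sets of $F$. Let $\rho(x)=\mathrm{dist}(x,M^+)$ and $D(\mathcal F)=\mathrm{dist}(M^+,M^-)$, so that $\rho:M\to[0,D(\mathcal F)]$; the leaves of $\mathcal F$ are also the level sets of $\rho$. For $t\in(0,D(\mathcal F))$ the isoparametric tube is $\Omega_t=\{x\in M:\rho(x)<t\}$. A function $f$ on $M$ is radial if $f=\psi\circ\rho$ for some $\psi:[0,D(\mathcal F)]\to\mathbb R$. An eigenvalue $\lambda$ of $\Delta$ is radial if there is a (nonzero) radial eigenfunction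 associated to $\lambda$. The radial eigenvalues form an infinite sequence $0=\lambda_1<\lambda_2<\cdots$, and each $\lambda_k$ has exactly one radial eigenfunction $\phi_k$ up to scalar multiplication. Set $\Psi_k(t)=\int_{\Omega_t}\phi_k$ (the content function), $S_k(\mathcal F)=\{t\in(0,D(\mathcal F)):\Psi_k(t)=0\}$, and $$S(\mathcal F)=\bigcup_{k=1}^\infty S_k(\mathcal F).$$ A bounded domain $\Omega\subseteq M$ has the Pompeiu property if the only continuous function $f:M\to\mathbb R$ with $\int_{h(\Omega)}f=0$ for all isometries $h$ of $M$ (integration with respect to the Riemannian measure) is $f=0$; otherwise $\Omega$ fails the Pompeiu property. *)

theory Defs
  imports "HOL-Analysis.Analysis"
begin

section \<open>Smooth functions on Euclidean space\<close>

primrec Ck_on :: "nat \<Rightarrow> 'e::euclidean_space set \<Rightarrow> ('e \<Rightarrow> 'f::real_normed_vector) \<Rightarrow> bool" where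
  "Ck_on 0 U f \<longleftrightarrow> continuous_on U f"
| "Ck_on (Suc k) U f \<longleftrightarrow> f differentiable_on U \<and>
     (\<forall>b\<in>Basis. Ck_on k U (\<lambda>y. frechet_derivative f (at y) b))"

text \<open>The predicate \<open>Ck_on\<close> is meaningful on open sets only. Smoothness on an arbitrary set,
  such as a closed interval, means that there is a smooth extension to an open neighbourhood;
  on an open set this is ordinary smoothness.\<close>

definition smooth_on :: "'e::euclidean_space set \<Rightarrow> ('e \<Rightarrow> 'f::real_normed_vector) \<Rightarrow> bool" where
  "smooth_on S f \<longleftrightarrow>
     (\<exists>U g. open U \<and> S \<subseteq> U \<and> (\<forall>k. Ck_on k U g) \<and> (\<forall>x\<in>S. g x = f x))"

definition partial :: "'n::finite \<Rightarrow> (real^'n \<Rightarrow> real) \<Rightarrow> real^'n \<Rightarrow> real" where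
  "partial i f y = frechet_derivative f (at y) (axis i 1)"


section \<open>Riemannian manifolds\<close>

text \<open>The points of the manifold are all the elements of the type \<open>'a\<close>, whose topology is the
  manifold topology; the dimension is \<open>CARD('n)\<close>. The map of a chart is irrelevant outside its
  domain.\<close>

record ('a, 'n) chart =
  domain :: "'a set"
  coords :: "'a \<Rightarrow> real^'n"

definition is_chart :: "('a::topological_space, 'n::finite) chart \<Rightarrow> bool" where
  "is_chart c \<longleftrightarrow> open (domain c) \<and> open (coords c ` domain c) \<and>
     (\<exists>inv_map. homeomorphism (domain c) (coords c ` domain c) (coords c) inv_map)"

definition param :: "('a, 'n::finite) chart \<Rightarrow> real^'n \<Rightarrow> 'a" where
  "param c = inv_into (domain c) (coords c)"

text \<open>A map in local coordinates, and the set on which this makes sense.\<close>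

definition local_rep :: "('a, 'n::finite) chart \<Rightarrow> ('a, 'n) chart \<Rightarrow> ('a \<Rightarrow> 'a) \<Rightarrow> real^'n \<Rightarrow> real^'n" where
  "local_rep c c' h = coords c' \<circ> h \<circ> param c"

definition local_dom :: "('a, 'n::finite) chart \<Rightarrow> ('a, 'n) chart \<Rightarrow> ('a \<Rightarrow> 'a) \<Rightarrow> (real^'n) set" where
  "local_dom c c' h = coords c ` (domain c \<inter> h -` domain c')"

definition compatible :: "('a, 'n::finite) chart \<Rightarrow> ('a, 'n) chart \<Rightarrow> bool" where
  "compatible c c' \<longleftrightarrow>
     smooth_on (local_dom c c' id) (local_rep c c' id) \<and>
     smooth_on (local_dom c' c id) (local_rep c' c id)"

text \<open>For a chart \<open>c\<close> of the atlas and a point \<open>x\<close> of its domain, \<open>metric M c x\<close> is the Gram matrix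
  of the Riemannian metric at \<open>x\<close> with respect to the coordinate vector fields of \<open>c\<close>.\<close>

record ('a, 'n) riemannian =
  atlas :: "('a, 'n) chart set"
  metric :: "('a, 'n) chart \<Rightarrow> 'a \<Rightarrow> real^'n^'n"

text \<open>The identity \<open>h\<^sup>* g = g\<close> in coordinates. For \<open>h = id\<close> it is the transformation law of a
  covariant 2-tensor under a change of charts.\<close>

definition preserves_metric :: "('a, 'n::finite) riemannian \<Rightarrow> ('a \<Rightarrow> 'a) \<Rightarrow> bool" where
  "preserves_metric M h \<longleftrightarrow>
     (\<forall>c\<in>atlas M. \<forall>c'\<in>atlas M. \<forall>x \<in> domain c \<inter> h -` domain c'.
        let J = jacobian (local_rep c c' h) (at (coords c x))
        in metric M c x = transpose J ** metric M c' (h x) ** J)"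

definition riemannian_manifold ::
    "('a::{t2_space,second_countable_topology}, 'n::finite) riemannian \<Rightarrow> bool" where
  "riemannian_manifold M \<longleftrightarrow>
     (\<forall>c\<in>atlas M. is_chart c) \<and>
     (\<Union>c\<in>atlas M. domain c) = UNIV \<and>
     (\<forall>c\<in>atlas M. \<forall>c'\<in>atlas M. compatible c c') \<and>
     (\<forall>c\<in>atlas M. \<forall>x\<in>domain c. transpose (metric M c x) = metric M c x \<and>
        (\<forall>v. v \<noteq> 0 \<longrightarrow> v \<bullet> (metric M c x *v v) > 0)) \<and>
     (\<forall>c\<in>atlas M. smooth_on (coords c ` domain c) (metric M c \<circ> param c)) \<and>
     preserves_metric M id"

text \<open>The quantities defined with \<open>chart_at\<close> below do not depend on the choice of the chart.\<close>

definition chart_at :: "('a, 'n::finite) riemannian \<Rightarrow> 'a \<Rightarrow> ('a, 'n) chart" where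
  "chart_at M x = (SOME c. c \<in> atlas M \<and> x \<in> domain c)"

definition smooth_map :: "('a::topological_space, 'n::finite) riemannian \<Rightarrow> ('a \<Rightarrow> 'a) \<Rightarrow> bool" where
  "smooth_map M h \<longleftrightarrow> continuous_on UNIV h \<and>
     (\<forall>c\<in>atlas M. \<forall>c'\<in>atlas M. smooth_on (local_dom c c' h) (local_rep c c' h))"

definition isometry :: "('a::topological_space, 'n::finite) riemannian \<Rightarrow> ('a \<Rightarrow> 'a) \<Rightarrow> bool" where
  "isometry M h \<longleftrightarrow> bij h \<and> smooth_map M h \<and> smooth_map M (inv h) \<and> preserves_metric M h"

definition smooth_fun :: "('a, 'n::finite) riemannian \<Rightarrow> ('a \<Rightarrow> real) \<Rightarrow> bool" where
  "smooth_fun M f \<longleftrightarrow> (\<forall>c\<in>atlas M. smooth_on (coords c ` domain c) (f \<circ> param c))"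


subsection \<open>Riemannian measure\<close>

definition volume :: "('a::topological_space, 'n::finite) riemannian \<Rightarrow> 'a measure" where
  "volume M = (THE \<mu>. sets \<mu> = sets borel \<and>
     (\<forall>c\<in>atlas M. \<forall>B\<in>sets borel. B \<subseteq> domain c \<longrightarrow>
        emeasure \<mu> B =
          (\<integral>\<^sup>+y \<in> coords c ` B. ennreal (sqrt (det (metric M c (param c y)))) \<partial>lborel)))"


subsection \<open>Riemannian distance\<close>

definition piecewise_C1_curve :: "('a::topological_space, 'n::finite) riemannian \<Rightarrow> (real \<Rightarrow> 'a) \<Rightarrow> bool" where
  "piecewise_C1_curve M \<gamma> \<longleftrightarrow> continuous_on {0..1} \<gamma> \<and>
     (\<exists>E. finite E \<and>
        (\<forall>c\<in>atlas M. (coords c \<circ> \<gamma>) C1_differentiable_on (({0..1} - E) \<inter> \<gamma> -` domain c)))"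

definition speed :: "('a, 'n::finite) riemannian \<Rightarrow> (real \<Rightarrow> 'a) \<Rightarrow> real \<Rightarrow> real" where
  "speed M \<gamma> s =
     (let c = chart_at M (\<gamma> s); v = vector_derivative (coords c \<circ> \<gamma>) (at s)
      in sqrt (v \<bullet> (metric M c (\<gamma> s) *v v)))"

definition curve_length :: "('a, 'n::finite) riemannian \<Rightarrow> (real \<Rightarrow> 'a) \<Rightarrow> ennreal" where
  "curve_length M \<gamma> = (\<integral>\<^sup>+s \<in> {0..1}. ennreal (speed M \<gamma> s) \<partial>lborel)"

definition rdist :: "('a::topological_space, 'n::finite) riemannian \<Rightarrow> 'a \<Rightarrow> 'a \<Rightarrow> real" where
  "rdist M x y =
     enn2real (INF \<gamma> \<in> {\<gamma>. piecewise_C1_curve M \<gamma> \<and> \<gamma> 0 = x \<and> \<gamma> 1 = y}. curve_length M \<gamma>)"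


subsection \<open>Gradient and Laplacian\<close>

definition gradient_in ::
    "('a, 'n::finite) riemannian \<Rightarrow> ('a, 'n) chart \<Rightarrow> ('a \<Rightarrow> real) \<Rightarrow> real^'n \<Rightarrow> real^'n" where
  "gradient_in M c f y =
     matrix_inv (metric M c (param c y)) *v (\<chi> i. partial i (f \<circ> param c) y)"

definition divergence_in ::
    "('a, 'n::finite) riemannian \<Rightarrow> ('a, 'n) chart \<Rightarrow> (real^'n \<Rightarrow> real^'n) \<Rightarrow> real^'n \<Rightarrow> real" where
  "divergence_in M c X y =
     (let w = (\<lambda>z. sqrt (det (metric M c (param c z))))
      in (\<Sum>i\<in>UNIV. partial i (\<lambda>z. w z * X z $ i) y) / w y)"

definition grad_norm_sq :: "('a, 'n::finite) riemannian \<Rightarrow> ('a \<Rightarrow> real) \<Rightarrow> 'a \<Rightarrow> real" where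
  "grad_norm_sq M f x =
     (let c = chart_at M x; v = gradient_in M c f (coords c x) in v \<bullet> (metric M c x *v v))"

text \<open>The positive Laplacian \<open>- div grad\<close>.\<close>

definition laplacian :: "('a, 'n::finite) riemannian \<Rightarrow> ('a \<Rightarrow> real) \<Rightarrow> 'a \<Rightarrow> real" where
  "laplacian M f x =
     (let c = chart_at M x in - divergence_in M c (gradient_in M c f) (coords c x))"


section \<open>Proper isoparametric functions\<close>

definition isoparametric ::
    "('a, 'n::finite) riemannian \<Rightarrow> ('a \<Rightarrow> real) \<Rightarrow> real \<Rightarrow> real \<Rightarrow> bool" where
  "isoparametric M F a b \<longleftrightarrow> a < b \<and> smooth_fun M F \<and> range F = {a..b} \<and>
     (\<exists>A B. smooth_on {a..b} A \<and> smooth_on {a..b} B \<and>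
        grad_norm_sq M F = A \<circ> F \<and> laplacian M F = B \<circ> F)"

text \<open>Near \<open>p\<close>, the set \<open>S\<close> is a submanifold of codimension \<open>d\<close>: in a suitable chart of the maximal
  atlas it is the common zero set of \<open>d\<close> of the coordinates.\<close>

definition submanifold_codim_at ::
    "('a::topological_space, 'n::finite) riemannian \<Rightarrow> 'a set \<Rightarrow> 'a \<Rightarrow> nat \<Rightarrow> bool" where
  "submanifold_codim_at M S p d \<longleftrightarrow>
     (\<exists>c I. is_chart c \<and> (\<forall>c'\<in>atlas M. compatible c c') \<and> p \<in> domain c \<and> card I = d \<and>
        S \<inter> domain c = {x \<in> domain c. \<forall>i\<in>I. coords c x $ i = 0})"

text \<open>The components of a focal set may have different dimensions.\<close>

definition proper_isoparametric ::
    "('a::topological_space, 'n::finite) riemannian \<Rightarrow> ('a \<Rightarrow> real) \<Rightarrow> real \<Rightarrow> real \<Rightarrow> bool" where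
  "proper_isoparametric M F a b \<longleftrightarrow> isoparametric M F a b \<and>
     (\<forall>p \<in> F -` {a}. \<exists>d\<ge>2. submanifold_codim_at M (F -` {a}) p d) \<and>
     (\<forall>p \<in> F -` {b}. \<exists>d\<ge>2. submanifold_codim_at M (F -` {b}) p d)"

text \<open>Here \<open>P\<close> stands for the focal set \<open>F -` {a}\<close> and \<open>Q\<close> for \<open>F -` {b}\<close>.\<close>

definition rho :: "('a::topological_space, 'n::finite) riemannian \<Rightarrow> 'a set \<Rightarrow> 'a \<Rightarrow> real" where
  "rho M P x = (INF p\<in>P. rdist M x p)"

definition focal_distance ::
    "('a::topological_space, 'n::finite) riemannian \<Rightarrow> 'a set \<Rightarrow> 'a set \<Rightarrow> real" where
  "focal_distance M P Q = (INF (p, q) \<in> P \<times> Q. rdist M p q)"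

definition tube :: "('a::topological_space, 'n::finite) riemannian \<Rightarrow> 'a set \<Rightarrow> real \<Rightarrow> 'a set" where
  "tube M P t = {x. rho M P x < t}"


section \<open>Radial eigenfunctions and content functions\<close>

definition eigenfunction :: "('a, 'n::finite) riemannian \<Rightarrow> real \<Rightarrow> ('a \<Rightarrow> real) \<Rightarrow> bool" where
  "eigenfunction M l f \<longleftrightarrow> smooth_fun M f \<and> (\<exists>x. f x \<noteq> 0) \<and> (\<forall>x. laplacian M f x = l * f x)"

definition radial ::
    "('a::topological_space, 'n::finite) riemannian \<Rightarrow> 'a set \<Rightarrow> ('a \<Rightarrow> real) \<Rightarrow> bool" where
  "radial M P f \<longleftrightarrow> (\<exists>\<psi> :: real \<Rightarrow> real. f = \<psi> \<circ> rho M P)"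

definition radial_eigenvalues ::
    "('a::topological_space, 'n::finite) riemannian \<Rightarrow> 'a set \<Rightarrow> real set" where
  "radial_eigenvalues M P = {l. \<exists>f. eigenfunction M l f \<and> radial M P f}"

text \<open>The \<open>k\<close>-th radial eigenvalue in increasing order, counted from \<open>k = 1\<close>.\<close>

definition radial_eigenvalue ::
    "('a::topological_space, 'n::finite) riemannian \<Rightarrow> 'a set \<Rightarrow> nat \<Rightarrow> real" where
  "radial_eigenvalue M P k =
     (THE l. l \<in> radial_eigenvalues M P \<and> finite {m \<in> radial_eigenvalues M P. m < l} \<and>
        Suc (card {m \<in> radial_eigenvalues M P. m < l}) = k)"

text \<open>A radial eigenfunction is unique up to a nonzero factor, so that the zeros of the content
  function do not depend on the choice.\<close>

definition radial_eigenfunction ::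
    "('a::topological_space, 'n::finite) riemannian \<Rightarrow> 'a set \<Rightarrow> nat \<Rightarrow> 'a \<Rightarrow> real" where
  "radial_eigenfunction M P k =
     (SOME f. eigenfunction M (radial_eigenvalue M P k) f \<and> radial M P f)"

definition content_function ::
    "('a::topological_space, 'n::finite) riemannian \<Rightarrow> 'a set \<Rightarrow> nat \<Rightarrow> real \<Rightarrow> real" where
  "content_function M P k t =
     set_lebesgue_integral (volume M) (tube M P t) (radial_eigenfunction M P k)"

definition content_zeros ::
    "('a::topological_space, 'n::finite) riemannian \<Rightarrow> 'a set \<Rightarrow> 'a set \<Rightarrow> nat \<Rightarrow> real set" where
  "content_zeros M P Q k = {t \<in> {0<..<focal_distance M P Q}. content_function M P k t = 0}"

definition all_content_zeros ::
    "('a::topological_space, 'n::finite) riemannian \<Rightarrow> 'a set \<Rightarrow> 'a set \<Rightarrow> real set" where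
  "all_content_zeros M P Q = (\<Union>k\<in>{1..}. content_zeros M P Q k)"


section \<open>Pompeiu property\<close>

definition pompeiu_property ::
    "('a::topological_space, 'n::finite) riemannian \<Rightarrow> 'a set \<Rightarrow> bool" where
  "pompeiu_property M \<Omega> \<longleftrightarrow>
     (\<forall>f :: 'a \<Rightarrow> real. continuous_on UNIV f \<and>
        (\<forall>h. isometry M h \<longrightarrow> set_lebesgue_integral (volume M) (h ` \<Omega>) f = 0)
        \<longrightarrow> (\<forall>x. f x = 0))"

end

theory Submission
 imports Defs "HOL-Complex_Analysis.Great_Picard"
begin

text \<open>The integral of an eigenfunction over the sublevel sets of the isoparametric function \<open>F\<close> obeys a law depending on the eigenvalue alone. Write \<open>A = |grad F|^2\<close> and \<open>B = Laplacian F\<close>, both functions of \<open>F\<close>, and let \<open>v\<close> be the density on \<open>(a, b)\<close> of the image of the Riemannian measure under \<open>F\<close>. For an eigenfunction \<open>f\<close> with eigenvalue \<open>l\<close>, radial or not, let \<open>G s\<close> be the integral of \<open>f\<close> over \<open>{F <= s}\<close> and \<open>phi s\<close> the mean of \<open>f\<close> over \<open>{F = s}\<close>. Then \<open>G' = phi v\<close> and, by the divergence theorem on \<open>{F <= s}\<close>, \<open>phi' = - l G / p\<close> with \<open>p = A v\<close>; this is \<open>eigen_system\<close>, proved by testing the weak equation with functions of \<open>F\<close>. The coefficient \<open>p\<close> vanishes at both ends, and the solutions with bounded \<open>phi\<close> and \<open>G a = 0\<close> are all proportional (\<open>sol_wronskian\<close>). So, if \<open>G\<close> vanishes at \<open>s\<close>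 for one radial eigenfunction \<open>f \<noteq> 0\<close>, then the integral over \<open>{F <= s}\<close> of every eigenfunction with the same eigenvalue vanishes (\<open>sol_common_zero\<close>).

An isometry \<open>h\<close> turns \<open>f\<close> into the eigenfunction \<open>f o h\<close> with the same eigenvalue, and the integral of \<open>f\<close> over \<open>h(\<Omega>)\<close> is that of \<open>f o h\<close> over \<open>\<Omega>\<close>. Therefore the radial eigenfunction itself is the counterexample to the Pompeiu property of the tubes at which its content function vanishes (\<open>tube_not_pompeiu\<close>).

Countability holds because a nontrivial solution \<open>(phi, G)\<close> never vanishes at an interior point, so that \<open>G\<close> has only simple zeros (\<open>sol_countable_zeros\<close>). Density is an oscillation theorem: for large \<open>l\<close> every solution has a zero of \<open>G\<close> in a given subinterval (\<open>sol_zeros_dense\<close>), and there are radial eigenvalues beyond every bound. The latter needs that the singular problem on \<open>[a, b]\<close> has infinitely many eigenvalues (\<open>infinite_eigenvalues\<close>), obtained from the compact symmetric inverse operator \<open>K\<close>, and that its solutions are smooth up to the ends (\<open>sol_smooth\<close>), so that composed with \<open>F\<close> they are eigenfunctions on \<open>M\<close>.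

Two facts about \<open>F\<close> carry the transfer between \<open>M\<close> and \<open>[a, b]\<close>. First, \<open>A\<close> vanishes to first order exactly at the ends and \<open>B a < 0 < B b\<close>; hence \<open>p\<close> tends to \<open>0\<close> and the focal sets are null sets. Secondly, the distance to \<open>F -` {a}\<close> is \<open>T (F x)\<close> with \<open>T' = 1 / sqrt A\<close> (\<open>rho_eq\<close>), which identifies tubes with sublevel sets and radial functions with functions of \<open>F\<close>. The lower bound is an estimate along curves; the upper bound minimises a perturbation of \<open>T o F\<close> in place of following the gradient flow.

The Riemannian measure, its invariance, Green's identity and the invariance of the Laplacian are proved in charts. Independence of the chart is always the special case of invariance under the identity isometry.\<close>

section \<open>Real analysis on an interval\<close>

lemmas DERIV_local = has_field_derivative_transform_within_open
 and lebesgue_integral_cong = Bochner_Integration.integral_cong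

text \<open>A simple zero is isolated, and a set without accumulation points in an open interval is countable.\<close>
lemma countable_simple_zeros:
 fixes g :: "real => real"
 assumes "!!s. s : {a<..<b} ==> EX d. DERIV g s :> d & (g s = 0 --> d ~= 0)"
 shows "countable {s : {a<..<b}. g s = 0}"
proof -
 have "{s. g s = 0} sparse_in {a<..<b}"
  unfolding sparse_in_eventually_iff[OF open_greaterThanLessThan]
 proof
  fix s assume s: "s : {a<..<b}"
  then obtain d where d: "DERIV g s :> d" "g s = 0 ==> d ~= 0"
   using assms by blast
  have "eventually (%y. g y ~= 0) (at s)"
  proof (cases "g s = 0")
   case True
   have lim: "tendsto (%y. (g y - g s) / (y - s)) d (at s)"
    using d(1) by (simp add: has_field_derivative_iff)
   have "eventually (%y. (g y - g s) / (y - s) ~= 0) (at s)"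
    by (rule tendsto_imp_eventually_ne[OF lim d(2)[OF True]])
   thus ?thesis
    by eventually_elim (use True in auto)
  next
   case False
   have "isCont g s" using d(1) DERIV_isCont by blast
   hence "tendsto g (g s) (at s)" by (simp add: isCont_def)
   from tendsto_imp_eventually_ne[OF this False] show ?thesis .
  qed
  thus "eventually (%y. y ~: {s. g s = 0}) (at s)" by simp
 qed
 from sparse_imp_countable[OF open_greaterThanLessThan this]
 show ?thesis by (simp add: Int_def conj_commute)
qed

text \<open>Gronwall's inequality: \<open>E s * exp (- k s)\<close> is nonincreasing. It is applied to squared norms, which it keeps at zero.\<close>
lemma gronwall_zero_right:
 fixes E :: "real => real"
 assumes "c <= d" and der: "!!s. c <= s ==> s <= d ==> (E has_real_derivative E' s) (at s within {c..d})"
  and le: "!!s. c <= s ==> s <= d ==> E' s <= k * E s" and "E c <= 0"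
 shows "E d <= 0"
proof -
 define H where "H = (%s. E s * exp (- (k * s)))"
 have "H d <= H c"
 proof (rule DERIV_nonpos_imp_decreasing_open[OF `c <= d`])
  fix s assume s: "c < s" "s < d"
  have "DERIV E s :> E' s"
   using der[of s] s at_within_interior[of s "{c..d}"] by auto
  hence "DERIV H s :> (E' s - k * E s) * exp (- (k * s))"
   unfolding H_def by (auto intro!: derivative_eq_intros simp: algebra_simps)
  moreover have "(E' s - k * E s) * exp (- (k * s)) <= 0"
   using le[of s] s by (intro mult_nonpos_nonneg) auto
  ultimately show "EX y. DERIV H s :> y & y <= 0" by blast
 next
  have "continuous_on {c..d} E"
   using der by (intro DERIV_continuous_on) auto
  thus "continuous_on {c..d} H" unfolding H_def by (intro continuous_intros)
 qed
 also have "H c <= 0" using `E c <= 0` by (simp add: H_def mult_nonpos_nonneg)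
 finally show ?thesis by (simp add: H_def mult_le_0_iff)
qed

lemma gronwall_zero_left:
 fixes E :: "real => real"
 assumes "c <= d" and der: "!!s. c <= s ==> s <= d ==> (E has_real_derivative E' s) (at s within {c..d})"
  and le: "!!s. c <= s ==> s <= d ==> - E' s <= k * E s" and "E d <= 0"
 shows "E c <= 0"
proof -
 have "E (- (- c)) <= 0"
 proof (rule gronwall_zero_right[where E = "%s. E (- s)" and c = "- d" and d = "- c" and E' = "%s. - E' (- s)" and k = k])
  fix s assume "- d <= s" "s <= - c"
  hence s: "c <= - s" "- s <= d" by auto
  have "(E has_real_derivative E' (- s)) (at (- s) within uminus ` {- d..- c})" using der[OF s] by simp
  moreover have "(uminus has_real_derivative - 1) (at s within {- d..- c})" by (auto intro!: derivative_eq_intros)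
  ultimately show "((%s. E (- s)) has_real_derivative - E' (- s)) (at s within {- d..- c})"
   using DERIV_image_chain[of E "E' (- s)" uminus] by (fastforce simp: o_def)
  show "- E' (- s) <= k * E (- s)" by (rule le[OF s])
 qed (use assms in auto)
 thus ?thesis by simp
qed

lemma eventually_inside_right:
 assumes "a < (b :: real)" shows "eventually (%s. a < s & s < b) (at_right a)"
 unfolding eventually_at_right[OF assms] using assms by blast

lemma eventually_inside_left:
 assumes "a < (b :: real)" shows "eventually (%s. a < s & s < b) (at_left b)"
 unfolding eventually_at_left[OF assms] using assms by blast

lemma continuous_on_Icc_extension:
 fixes g :: "real => real"
 assumes ab: "a < b" and g: "!!x. a < x ==> x < b ==> isCont g x"
  and lim: "tendsto g c (at_right a)" "tendsto g d (at_left b)"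
 shows "continuous_on {a..b} (%s. if s = a then c else if s = b then d else g s)" (is "continuous_on _ ?f")
proof (rule continuous_on_IccI[OF _ _ _ ab])
 show "tendsto ?f (?f a) (at_right a)"
  by (rule Lim_transform_eventually) (use lim eventually_at_right[OF ab] ab in auto)
 show "tendsto ?f (?f b) (at_left b)"
  by (rule Lim_transform_eventually) (use lim eventually_at_left[OF ab] ab in auto)
 fix x assume x: "a < x" "x < b"
 hence "eventually (%s. g s = ?f s) (at x)"
  using eventually_at_in_open'[of "{a<..<b}" x] by (auto elim!: eventually_mono)
 thus "tendsto ?f (?f x) (at x)" by (rule Lim_transform_eventually[rotated]) (use g[OF x] x in "simp add: isCont_def")
qed

lemma bounded_by:
 fixes g :: "real => real" assumes "continuous_on {c..d} g"
 shows "EX C. ALL s:{c..d}. abs (g s) <= C"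
 using compact_imp_bounded[OF compact_continuous_image[OF assms compact_Icc]]
 by (auto simp: bounded_iff)

text \<open>De l'Hospital's rule for \<open>H' / p' = h v / (- B v)\<close>, in which the weight \<open>v\<close>, possibly unbounded at the end, cancels.\<close>
lemma weighted_lhopital_right:
 fixes H h B p v :: "real => real"
 assumes ab: "a < b" and p_a: "tendsto p 0 (at_right a)"
  and v_pos: "!!s. a < s ==> s < b ==> 0 < v s" and p_pos: "!!s. a < s ==> s < b ==> 0 < p s"
  and derp: "!!s. a < s ==> s < b ==> DERIV p s :> - B s * v s"
  and contB: "continuous_on {a..b} B" and B_a: "B a < 0"
  and H_a: "tendsto H 0 (at_right a)" and h: "continuous_on {a..b} h"
  and der: "!!s. a < s ==> s < b ==> DERIV H s :> h s * v s"
 shows "tendsto (%s. H s / p s) (- h a / B a) (at_right a)"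
proof (rule lhopital_right[OF H_a p_a])
 have ev: "eventually (%s. a < s & s < b) (at_right a)"
  by (rule eventually_inside_right[OF ab])
 have lims: "tendsto h (h a) (at_right a)" "tendsto B (B a) (at_right a)"
  using continuous_on_Icc_at_rightD[OF h ab] continuous_on_Icc_at_rightD[OF contB ab] by auto
 have evB: "eventually (%s. B s ~= 0) (at_right a)"
  using tendsto_imp_eventually_ne[OF lims(2)] B_a by simp
 show "eventually (%s. p s ~= 0) (at_right a)" using ev by eventually_elim (use p_pos in force)
 show "eventually (%s. - B s * v s ~= 0) (at_right a)"
  using ev evB by eventually_elim (use v_pos in force)
 show "eventually (%s. DERIV H s :> h s * v s) (at_right a)"
  using ev by eventually_elim (use der in auto)
 show "eventually (%s. DERIV p s :> - B s * v s) (at_right a)"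
  using ev by eventually_elim (use derp in auto)
 have "tendsto (%s. - (h s / B s)) (- (h a / B a)) (at_right a)"
  using B_a by (intro tendsto_intros lims) auto
 hence L: "tendsto (%s. - (h s / B s)) (- h a / B a) (at_right a)" by simp
 have "eventually (%s. - (h s / B s) = h s * v s / (- B s * v s)) (at_right a)"
  using ev evB by eventually_elim (use v_pos in force)
 from Lim_transform_eventually[OF L this]
 show "tendsto (%s. h s * v s / (- B s * v s)) (- h a / B a) (at_right a)" .
qed

lemma weighted_lhopital_left:
 fixes H h B p v :: "real => real"
 assumes ab: "a < b" and p_b: "tendsto p 0 (at_left b)"
  and v_pos: "!!s. a < s ==> s < b ==> 0 < v s" and p_pos: "!!s. a < s ==> s < b ==> 0 < p s"
  and derp: "!!s. a < s ==> s < b ==> DERIV p s :> - B s * v s"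
  and contB: "continuous_on {a..b} B" and B_b: "0 < B b"
  and H_b: "tendsto H 0 (at_left b)" and h: "continuous_on {a..b} h"
  and der: "!!s. a < s ==> s < b ==> DERIV H s :> h s * v s"
 shows "tendsto (%s. H s / p s) (- h b / B b) (at_left b)"
proof -
 have d: "DERIV (%s. p (- s)) s :> B (- s) * v (- s)" if "- b < s" "s < - a" for s
  using derp[of "- s"] that by (simp add: DERIV_mirror)
 have "tendsto (%s. H (- s) / p (- s)) (- (- h (- (- b))) / (- B (- (- b)))) (at_right (- b))"
  by (rule weighted_lhopital_right[where v = "%s. v (- s)" and b = "- a"])
   (use assms d in "auto simp: filterlim_at_left_to_right intro!: continuous_intros
     intro: continuous_on_compose2[OF contB] continuous_on_compose2[OF h] simp flip: DERIV_mirror")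
 thus ?thesis by (simp add: filterlim_at_left_to_right)
qed

section \<open>A Sturm-Liouville operator with singular ends\<close>

text \<open>The operator is \<open>phi \<mapsto> - (p phi')' / v\<close>. The function \<open>V\<close> is the distribution function of the weight \<open>v\<close>, and \<open>p' = - B v\<close> with \<open>p = 0\<close> at both ends. The signs of \<open>B\<close> at the ends say that \<open>p\<close> is comparable there to the mass of \<open>v\<close> near the end.\<close>
locale sturm_liouville =
 fixes a b :: real and B p v V :: "real => real"
 assumes ab: "a < b"
  and V_a: "V a = 0" and contV: "continuous_on {a..b} V"
  and derV: "!!s. a < s ==> s < b ==> DERIV V s :> v s"
  and contv: "continuous_on {a<..<b} v"
  and v_pos: "!!s. a < s ==> s < b ==> 0 < v s"
  and p_pos: "!!s. a < s ==> s < b ==> 0 < p s"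
  and derp: "!!s. a < s ==> s < b ==> DERIV p s :> - B s * v s"
  and contB: "continuous_on {a..b} B" and B_a: "B a < 0" and B_b: "0 < B b"
  and p_a: "tendsto p 0 (at_right a)" and p_b: "tendsto p 0 (at_left b)"
begin

lemma V_strict: "[|a <= s; s < t; t <= b|] ==> V s < V t"
proof (rule DERIV_pos_imp_increasing_open[of s t V])
 fix x assume "a <= s" "t <= b" "s < x" "x < t"
 hence "a < x" "x < b" by auto
 thus "EX y. DERIV V x :> y & 0 < y"
  using derV v_pos by blast
qed (auto intro: continuous_on_subset[OF contV])

lemma V_mono: "[|a <= s; s <= t; t <= b|] ==> V s <= V t"
 using V_strict[of s t] by (cases "s = t") auto

lemma inj_V: "inj_on V {a..b}"
 by (rule inj_onI) (metis V_strict atLeastAtMost_iff less_irrefl linorder_neqE_linordered_idom)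

lemma image_V: "V ` {a..b} = {0..V b}"
proof -
 have "V ` {a..b} <= {0..V b}" using V_mono V_a by fastforce
 moreover have "{0..V b} <= V ` {a..b}"
 proof
  fix y assume "y : {0..V b}"
  thus "y : V ` {a..b}"
   using IVT'[of V a y b] contV ab V_a by auto
 qed
 ultimately show ?thesis by blast
qed

text \<open>Integration against \<open>v\<close> is done in the variable \<open>w = V s\<close>, in which the weight is constant.\<close>
definition W where "W = inv_into {a..b} V"

lemma W_V: "s : {a..b} ==> W (V s) = s"
 unfolding W_def by (rule inv_into_f_f[OF inj_V])

lemma contW: "continuous_on {0..V b} W"
 using continuous_on_inv[OF contV compact_Icc, of W] W_V image_V by auto

lemma W_mem: "y : {0..V b} ==> W y : {a..b}"
 using image_V W_V by (metis imageE)

lemma W_mem': "[|s : {a..b}; y : {0..V s}|] ==> W y : {a..b}"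
 using W_mem[of y] V_mono[of s b] by auto

definition I :: "(real => real) => real => real" where "I f s = integral {0..V s} (%y. f (W y))"

lemma cont_fW: "continuous_on {a..b} f ==> continuous_on {0..V b} (%y. f (W y))"
 using W_mem by (intro continuous_on_compose2[OF _ contW]) auto

lemma I_a [simp]: "I f a = 0"
 by (simp add: I_def V_a)

lemma I_cont:
 assumes "continuous_on {a..b} f" shows "continuous_on {a..b} (I f)"
proof -
 have "continuous_on {0..V b} (%y. integral {0..y} (%y. f (W y)))"
  by (intro indefinite_integral_continuous_1 integrable_continuous_real cont_fW assms)
 thus ?thesis unfolding I_def using image_V
  by (intro continuous_on_compose2[OF _ contV]) auto
qed

lemma I_deriv:
 assumes f: "continuous_on {a..b} f" and s: "a < s" "s < b"
 shows "DERIV (I f) s :> f s * v s"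
proof -
 have *: "0 < V s" "V s < V b" using V_strict[of a s] V_strict[of s b] s V_a by auto
 have "((%x. integral {0..x} (%y. f (W y))) has_real_derivative f (W (V s))) (at (V s) within {0..V b})"
  using * by (intro integral_has_real_derivative cont_fW f) auto
 hence "DERIV (%x. integral {0..x} (%y. f (W y))) (V s) :> f s"
  using * at_within_interior[of "V s" "{0..V b}"] W_V[of s] s by auto
 from DERIV_chain'[OF derV[OF s] this] show ?thesis
  unfolding I_def[abs_def] by (simp add: mult.commute)
qed

lemma I_unique:
 assumes h: "continuous_on {a..b} h" and H: "continuous_on {a..b} H"
  and der: "!!s. a < s ==> s < b ==> DERIV H s :> h s * v s"
  and s: "s : {a..b}"
 shows "I h s = H s - H a"
proof -
 have "(%s. H s - I h s) s = (%s. H s - I h s) a"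
 proof (cases "s = a")
  case False
  have "(%s. H s - I h s) s = (%s. H s - I h s) a"
  proof (rule DERIV_isconst2[OF ab])
   show "continuous_on {a..b} (%s. H s - I h s)" by (intro continuous_intros H I_cont h)
   show "DERIV (%s. H s - I h s) x :> 0" if "a < x" "x < b" for x
    using DERIV_diff[OF der[OF that] I_deriv[OF h that]] by simp
  qed (use s in auto)
  thus ?thesis .
 qed simp
 thus ?thesis by simp
qed

lemma I_cmult: "I (%x. c * f x) s = c * I f s"
 unfolding I_def by simp

lemma I_integrable:
 fixes f :: "real => real"
 assumes "continuous_on {a..b} f" "s : {a..b}" shows "(%y. f (W y)) integrable_on {0..V s}"
 by (intro integrable_continuous_real continuous_on_subset[OF cont_fW[OF assms(1)]])
   (use V_mono assms(2) in auto)

lemma I_add: "[|continuous_on {a..b} f; continuous_on {a..b} g; s : {a..b}|]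
  ==> I (%x. f x + g x) s = I f s + I g s"
 unfolding I_def by (intro Henstock_Kurzweil_Integration.integral_add I_integrable)

lemma I_diff: "[|continuous_on {a..b} f; continuous_on {a..b} g; s : {a..b}|]
  ==> I (%x. f x - g x) s = I f s - I g s"
 unfolding I_def by (intro Henstock_Kurzweil_Integration.integral_diff I_integrable)

lemma I_mono: "[|continuous_on {a..b} f; continuous_on {a..b} g; s : {a..b};
  !!x. x : {a..b} ==> f x <= g x|] ==> I f s <= I g s"
 unfolding I_def by (rule integral_le) (use I_integrable W_mem' in auto)

lemma I_cong: "[|!!x. x : {a..b} ==> f x = g x; s : {a..b}|] ==> I f s = I g s"
 unfolding I_def using W_mem'
 by (intro Henstock_Kurzweil_Integration.integral_cong) auto

lemma I_const: "s : {a..b} ==> I (%x. c) s = c * V s"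
 unfolding I_def using V_mono[of a s] V_a by simp

lemma I_abs_le: "[|continuous_on {a..b} f; s : {a..b}; !!x. x : {a..b} ==> abs (f x) <= K|]
  ==> abs (I f s) <= K * V s"
proof -
 assume *: "continuous_on {a..b} f" "s : {a..b}" "!!x. x : {a..b} ==> abs (f x) <= K"
 have "I f s <= I (%x. K) s" by (rule I_mono) (use * in "auto simp: abs_le_iff")
 moreover have "I (%x. - K) s <= I f s" by (rule I_mono) (use * in "auto simp: abs_le_iff minus_le_iff")
 ultimately show ?thesis using I_const[of s] * by (simp add: abs_le_iff)
qed

lemma I_incr:
 assumes "continuous_on {a..b} f" "s : {a..b}" "!!x. x : {a..b} ==> 0 <= f x" shows "I f s <= I f b"
 unfolding I_def
 by (rule integral_subset_le) (use assms I_integrable[OF assms(1)] V_mono[of s b] W_mem ab in auto)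

lemma I_tail_le:
 assumes f: "continuous_on {a..b} f" "s : {a..b}" and K: "!!x. x : {a..b} ==> abs (f x) <= K"
 shows "abs (I f b - I f s) <= K * (V b - V s)"
proof -
 have b: "b : {a..b}" using ab by simp
 have "I (%x. K - f x) s <= I (%x. K - f x) b" "I (%x. K + f x) s <= I (%x. K + f x) b"
  by (rule I_incr; use f K in \<open>force simp: abs_le_iff intro!: continuous_intros\<close>)+
 thus ?thesis using f b
  by (simp add: I_diff I_add I_const abs_le_iff algebra_simps)
qed

lemma I_nonneg_zero:
 assumes f: "continuous_on {a..b} f" and nn: "!!x. x : {a..b} ==> 0 <= f x"
  and z: "I f b = 0" and x: "x : {a..b}"
 shows "f x = 0"
proof -
 have "ALL y:{0..V b}. f (W y) = 0"
  using integral_eq_0_iff[of 0 "V b" "%y. f (W y)"] cont_fW[OF f] nn W_mem z V_strict[of a b] V_a ab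
  by (auto simp: I_def)
 thus ?thesis using x W_V[of x] image_V by (metis imageI)
qed

lemmas ev_a = eventually_inside_right[OF ab] and ev_b = eventually_inside_left[OF ab]
lemma lim_a:
 assumes "tendsto H 0 (at_right a)" "continuous_on {a..b} h"
  and "!!s. a < s ==> s < b ==> DERIV H s :> h s * v s"
 shows "tendsto (%s. H s / p s) (- h a / B a) (at_right a)"
 by (rule weighted_lhopital_right[of a b p v B]) (use ab p_a v_pos p_pos derp contB B_a assms in auto)

lemma lim_b:
 assumes "tendsto H 0 (at_left b)" "continuous_on {a..b} h"
  and "!!s. a < s ==> s < b ==> DERIV H s :> h s * v s"
 shows "tendsto (%s. H s / p s) (- h b / B b) (at_left b)"
 by (rule weighted_lhopital_left[of a b p v B]) (use ab p_b v_pos p_pos derp contB B_b assms in auto)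

text \<open>\<open>U f\<close> extends \<open>I f / p\<close> by its limits at the ends. It is \<open>- phi'\<close> for the solution \<open>phi\<close> of \<open>- (p phi')' = f v\<close>.\<close>
definition U :: "(real => real) => real => real" where
 "U f s = (if s = a then - f a / B a else if s = b then - f b / B b else I f s / p s)"

definition X :: "(real => real) set" where
 "X = {f. continuous_on {a..b} f & I f b = 0}"

lemma XD: "f : X ==> continuous_on {a..b} f" "f : X ==> I f b = 0"
 by (auto simp: X_def)

lemma cont_p: "continuous_on {a<..<b} p"
 using derp by (auto intro!: continuous_at_imp_continuous_on DERIV_isCont)

lemma U_cont:
 assumes f: "f : X" shows "continuous_on {a..b} (U f)"
proof -
 note fc = XD(1)[OF f]
 have "tendsto (I f) 0 (at_right a)" "tendsto (I f) 0 (at_left b)"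
  using continuous_on_Icc_at_rightD[OF I_cont[OF fc] ab] continuous_on_Icc_at_leftD[OF I_cont[OF fc] ab] XD(2)[OF f] by auto
 thus ?thesis unfolding U_def[abs_def]
  by (intro continuous_on_Icc_extension ab lim_a[OF _ fc I_deriv[OF fc]] lim_b[OF _ fc I_deriv[OF fc]] continuous_intros
   DERIV_isCont[OF I_deriv[OF fc]] DERIV_isCont[OF derp]) (use p_pos in force)+
qed

text \<open>Near an end \<open>I f\<close> is bounded by the mass between the point and that end, because \<open>I f\<close> vanishes at both ends; the quotient of this mass by \<open>p\<close> has a limit.\<close>
lemma U_bound: "EX C>0. ALL f K. f : X --> (ALL x:{a..b}. abs (f x) <= K) --> (ALL s:{a..b}. abs (U f s) <= C * K)"
proof -
 have "tendsto V 0 (at_right a)" using continuous_on_Icc_at_rightD[OF contV ab] V_a by simp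
 from order_tendstoD(2)[OF lim_a[OF this continuous_on_const[of _ 1]], of "1 - 1 / B a"] derV
 obtain m where m: "a < m" "!!s. a < s ==> s < m ==> V s / p s < 1 - 1 / B a"
  unfolding eventually_at_right[OF ab] by auto
 have "tendsto (%s. V b - V s) (V b - V b) (at_left b)"
  by (intro tendsto_intros continuous_on_Icc_at_leftD[OF contV ab])
 hence "tendsto (%s. V b - V s) 0 (at_left b)" by simp
 from order_tendstoD(2)[OF lim_b[OF this continuous_on_const[of _ "-1"]], of "1 + 1 / B b"]
  DERIV_diff[OF DERIV_const[of "V b"] derV]
 obtain n where n: "n < b" "!!s. n < s ==> s < b ==> (V b - V s) / p s < 1 + 1 / B b"
  unfolding eventually_at_left[OF ab] by auto
 have "continuous_on {m..n} (%s. V s / p s)"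
 proof (intro continuous_intros continuous_on_subset[OF contV] continuous_on_subset[OF cont_p] ballI)
  show "p s ~= 0" if "s : {m..n}" for s using p_pos[of s] that m(1) n(1) by auto
 qed (use m(1) n(1) in auto)
 then obtain D where D: "!!s. s : {m..n} ==> abs (V s / p s) <= D" using bounded_by by meson
 define C where "C = max (max (1 - 1 / B a) (1 + 1 / B b)) D"
 have C: "1 - 1 / B a <= C" "1 + 1 / B b <= C" "D <= C" by (auto simp: C_def)
 have "abs (U f s) <= C * K" if f: "f : X" and K: "ALL x:{a..b}. abs (f x) <= K" and s: "s : {a..b}" for f K s
 proof -
  have fs: "abs (f s) <= K" and K0: "0 <= K" using K s ab by force+
  consider "s = a" | "s = b" | "a < s" "s < b" using s by force
  thus ?thesis
  proof cases
   case 1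
   have "abs (f s) * (- 1 / B a) <= K * C" using C(1) B_a by (intro mult_mono fs K0) auto
   thus ?thesis using 1 B_a by (simp add: U_def abs_divide mult.commute)
  next
   case 2
   have "abs (f s) * (1 / B b) <= K * C" using C(2) B_b by (intro mult_mono fs K0) auto
   thus ?thesis using 2 B_b ab by (simp add: U_def abs_divide mult.commute)
  next
   case 3
   have "V s / p s <= C | (V b - V s) / p s <= C"
    using m(2)[of s] n(2)[of s] abs_le_D1[OF D[of s]] C 3 by (cases "s < m"; cases "n < s") auto
   hence "K * V s <= K * (C * p s) | K * (V b - V s) <= K * (C * p s)"
    using p_pos[OF 3] mult_left_mono[OF _ K0] by (auto simp: pos_divide_le_eq)
   moreover have "abs (I f s) <= K * V s" "abs (I f s) <= K * (V b - V s)"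
    using I_abs_le[OF XD(1)[OF f] s] I_tail_le[OF XD(1)[OF f] s] XD(2)[OF f] K by auto
   ultimately have "abs (I f s) <= C * K * p s" by (auto simp: algebra_simps)
   thus ?thesis using 3 p_pos[OF 3] by (simp add: U_def abs_divide pos_divide_le_eq)
  qed
 qed
 moreover have "0 < C" using C(2) B_b by (smt (verit) divide_pos_pos)
 ultimately show ?thesis by blast
qed

text \<open>\<open>K\<close> inverts the Sturm-Liouville operator on the functions of mean zero; the constant subtracted from the antiderivative \<open>S\<close> makes \<open>K f\<close> have mean zero again.\<close>
definition S :: "(real => real) => real => real" where "S f s = - integral {a..s} (U f)"
definition K :: "(real => real) => real => real" where "K f s = S f s - I (S f) b / V b"

lemma V_b: "0 < V b" using V_strict[of a b] V_a ab by simp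

lemma K_deriv_within:
 "[|f : X; s : {a..b}|] ==> (K f has_real_derivative - U f s) (at s within {a..b})"
 unfolding K_def[abs_def] S_def[abs_def]
 by (auto intro!: derivative_eq_intros integral_has_real_derivative U_cont)

lemma K_deriv:
 assumes "f : X" "a < s" "s < b" shows "DERIV (K f) s :> - (I f s / p s)"
 using K_deriv_within[of f s] at_within_interior[of s "{a..b}"] assms by (auto simp: U_def)

lemma K_cont: "f : X ==> continuous_on {a..b} (K f)"
 using K_deriv_within by (intro DERIV_continuous_on) auto

lemma K_in_X: assumes "f : X" shows "K f : X"
proof -
 have S: "continuous_on {a..b} (S f)"
  unfolding S_def[abs_def] using U_cont[OF assms]
  by (intro continuous_intros indefinite_integral_continuous_1 integrable_continuous_real)
 have "I (K f) b = I (S f) b - I (%x. I (S f) b / V b) b"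
  unfolding K_def[abs_def] by (rule I_diff) (use S ab in auto)
 also have "... = 0" using I_const[of b "I (S f) b / V b"] V_b ab by simp
 finally show ?thesis using K_cont[OF assms] by (simp add: X_def)
qed

definition ip where "ip f g = I (%x. f x * g x) b"

text \<open>The expression \<open>K f * I g - K g * I f\<close> vanishes at both ends.\<close>
lemma K_sym:
 assumes f: "f : X" and g: "g : X" shows "ip (K f) g = ip f (K g)"
proof -
 note c = XD(1)[OF f] XD(1)[OF g] K_cont[OF f] K_cont[OF g]
 have "I (%x. K f x * g x - f x * K g x) b =
   (%x. K f x * I g x - K g x * I f x) b - (%x. K f x * I g x - K g x * I f x) a"
 proof (rule I_unique)
  fix s assume s: "a < s" "s < b"
  show "DERIV (%x. K f x * I g x - K g x * I f x) s :> (K f s * g s - f s * K g s) * v s"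
   by (rule derivative_eq_intros K_deriv I_deriv c f g s refl)+ (use p_pos[OF s] in "simp add: algebra_simps")
 qed (use c ab I_cont in "auto intro!: continuous_intros")
 also have "... = 0" using XD(2)[OF f] XD(2)[OF g] by simp
 finally show ?thesis unfolding ip_def
  by (subst (asm) I_diff) (use c ab in "auto intro!: continuous_intros")
qed

lemma K_pos:
 assumes f: "f : X" shows "0 <= ip (K f) f" and "ip (K f) f = 0 ==> s : {a..b} ==> f s = 0"
proof -
 note c = XD(1)[OF f] K_cont[OF f]
 define E where "E = (%s. I (%x. K f x * f x) s - K f s * I f s)"
 have E': "(E has_real_derivative (I f s)\<^sup>2 / p s) (at s)" if s: "a < s" "s < b" for s
  unfolding E_def
  by (rule derivative_eq_intros K_deriv I_deriv c f s refl continuous_on_mult)+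
    (use p_pos[OF s] in "simp add: algebra_simps power2_eq_square")
 have cE: "continuous_on {a..b} E"
  unfolding E_def using c by (intro continuous_intros I_cont)
 have mono: "E s <= E t" if "a <= s" "s <= t" "t <= b" for s t
 proof (rule DERIV_nonneg_imp_increasing_open[OF that(2)])
  show "EX y. DERIV E x :> y & 0 <= y" if "s < x" "x < t" for x
   using E'[of x] that p_pos[of x] `a <= s` `t <= b` by (intro exI[of _ "(I f x)^2 / p x"]) auto
 qed (use that in "auto intro: continuous_on_subset[OF cE]")
 have Eab: "E a = 0" "E b = ip (K f) f" by (auto simp: E_def ip_def XD(2)[OF f])
 show "0 <= ip (K f) f" using mono[of a b] Eab ab by simp
 assume z: "ip (K f) f = 0" and s: "s : {a..b}"
 have E0: "E t = 0" if "t : {a..b}" for t using mono[of a t] mono[of t b] Eab z that by auto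
 have I0: "I f t = 0" if t: "a < t" "t < b" for t
 proof -
  have "DERIV E t :> 0"
   by (rule DERIV_local[OF DERIV_const[of 0], of "{a<..<b}"]) (use E0 t in auto)
  hence "(I f t)^2 / p t = 0" using E'[OF t] DERIV_unique by blast
  thus ?thesis using p_pos[OF t] by simp
 qed
 have "I (%x. f x * f x) b = 0 - 0"
 proof -
  have f0: "f t = 0" if t: "a < t" "t < b" for t
  proof -
   have "DERIV (I f) t :> 0"
    by (rule DERIV_local[OF DERIV_const[of 0], of "{a<..<b}"]) (use I0 t in auto)
   hence "f t * v t = 0" using I_deriv[OF c(1) t] DERIV_unique by blast
   thus ?thesis using v_pos[OF t] by simp
  qed
  show ?thesis
   using I_unique[of "%x. f x * f x" "%x. 0" b] f0 c ab by (auto intro!: continuous_intros)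
 qed
 thus "f s = 0"
  using I_nonneg_zero[of "%x. f x * f x" s] c s by (auto intro!: continuous_intros)
qed

lemma U_lin:
 assumes "f : X" "g : X" "s : {a..b}"
 shows "U (%x. c * f x + d * g x) s = c * U f s + d * U g s"
proof -
 have "I (%x. c * f x + d * g x) s = c * I f s + d * I g s"
  by (subst I_add) (use assms XD in "auto intro!: continuous_intros simp: I_cmult")
 thus ?thesis by (simp add: U_def add_divide_distrib diff_divide_distrib ring_distribs)
qed

lemma S_cont: "f : X ==> continuous_on {a..b} (S f)"
 unfolding S_def[abs_def]
 by (intro continuous_intros indefinite_integral_continuous_1 integrable_continuous_real U_cont)

lemma S_lin:
 assumes "f : X" "g : X" "s : {a..b}"
 shows "S (%x. c * f x + d * g x) s = c * S f s + d * S g s"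
proof -
 have "integral {a..s} (U (%x. c * f x + d * g x)) = integral {a..s} (%x. c * U f x + d * U g x)"
  by (intro Henstock_Kurzweil_Integration.integral_cong U_lin) (use assms in auto)
 also have "... = c * integral {a..s} (U f) + d * integral {a..s} (U g)"
  using assms
  by (subst Henstock_Kurzweil_Integration.integral_add)
    (auto intro!: integrable_continuous_real continuous_intros intro: continuous_on_subset[OF U_cont])
 finally show ?thesis by (simp add: S_def algebra_simps)
qed

lemma K_lin:
 assumes "f : X" "g : X" "s : {a..b}"
 shows "K (%x. c * f x + d * g x) s = c * K f s + d * K g s"
proof -
 have "I (S (%x. c * f x + d * g x)) b = I (%x. c * S f x + d * S g x) b"
  by (intro I_cong S_lin) (use assms ab in auto)
 also have "... = c * I (S f) b + d * I (S g) b"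
  by (subst I_add) (use assms S_cont ab in "auto intro!: continuous_intros simp: I_cmult")
 finally show ?thesis using S_lin[OF assms] by (simp add: K_def algebra_simps add_divide_distrib)
qed

lemma K_cong:
 assumes "!!x. x : {a..b} ==> f x = g x" "s : {a..b}"
 shows "K f s = K g s"
proof -
 have "U f x = U g x" if "x : {a..b}" for x
  using assms(1) that ab I_cong[of f g x] by (auto simp: U_def)
 hence "S f x = S g x" if "x : {a..b}" for x
  unfolding S_def using that by (auto intro!: Henstock_Kurzweil_Integration.integral_cong)
 thus ?thesis using assms(2) I_cong[of "S f" "S g" b] ab by (simp add: K_def)
qed

lemma X_lin: "[|f : X; g : X|] ==> (%x. c * f x + d * g x) : X"
 unfolding X_def using ab by (auto intro!: continuous_intros simp: I_add I_cmult continuous_on_mult_left)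

text \<open>The Lipschitz estimate makes \<open>K\<close> a compact operator for uniform convergence.\<close>
lemma K_bound: "EX C>0. ALL f M. f : X --> (ALL x:{a..b}. abs (f x) <= M) -->
  (ALL s:{a..b}. abs (K f s) <= C * M) & (ALL s:{a..b}. ALL t:{a..b}. abs (K f s - K f t) <= C * M * abs (s - t))"
proof -
 obtain C0 where C0: "C0 > 0" "!!f M s. f : X ==> (!!x. x:{a..b} ==> abs (f x) <= M) ==> s:{a..b} ==> abs (U f s) <= C0 * M"
  using U_bound by meson
 define C where "C = C0 * (1 + 2 * (b - a))"
 have "0 < C0 * (b - a)" using C0 ab by simp
 moreover have "C = C0 + 2 * (C0 * (b - a))" by (simp add: C_def algebra_simps)
 ultimately have C: "C > 0" "C0 <= C" "2 * (C0 * (b - a)) <= C" using C0 by auto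
 have "abs (K f s) <= C * M & (ALL t:{a..b}. abs (K f s - K f t) <= C * M * abs (s - t))"
  if f: "f : X" and M: "ALL x:{a..b}. abs (f x) <= M" and s: "s : {a..b}" for f M s
 proof -
  have M0: "0 <= M" using M[rule_format, of a] ab by auto
  have Ub: "abs (U f s) <= C0 * M" if "s : {a..b}" for s using C0(2)[OF f _ that] M by auto
  have Sb: "abs (S f x) <= C0 * M * (b - a)" if x: "x : {a..b}" for x
  proof -
   have "norm (integral {a..x} (U f)) <= (C0 * M) * (x - a)"
    by (rule integral_bound) (use x Ub continuous_on_subset[OF U_cont[OF f]] in auto)
   also have "... <= C0 * M * (b - a)"
    using x M0 C0 by (intro mult_left_mono) auto
   finally show ?thesis by (simp add: S_def)
  qed
  have "abs (I (S f) b) <= C0 * M * (b - a) * V b"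
   by (rule I_abs_le[OF S_cont[OF f]]) (use Sb ab in auto)
  hence "abs (I (S f) b / V b) <= C0 * M * (b - a)"
   using V_b by (simp add: abs_divide pos_divide_le_eq)
  hence "abs (K f s) <= 2 * (C0 * (b - a)) * M"
   using Sb[OF s] abs_triangle_ineq4[of "S f s" "I (S f) b / V b"]
   by (simp add: K_def algebra_simps del: abs_divide)
  also have "... <= C * M" by (rule mult_right_mono[OF C(3) M0])
  finally have 1: "abs (K f s) <= C * M" .
  have "abs (K f s - K f t) <= C * M * abs (s - t)" if t: "t : {a..b}" for t
  proof -
   have "norm (K f s - K f t) <= (C0 * M) * norm (s - t)"
    by (rule field_differentiable_bound[OF convex_real_interval(5)[of a b], of "K f" "%s. - U f s"])
      (use K_deriv_within[OF f] Ub s t in auto)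
   also have "... <= C * M * norm (s - t)"
    using C M0 by (intro mult_right_mono) auto
   finally show ?thesis by simp
  qed
  with 1 show ?thesis by blast
 qed
 thus ?thesis using C(1) by blast
qed

lemma ip_CS:
 assumes f: "continuous_on {a..b} f" and g: "continuous_on {a..b} g"
 shows "(ip f g)^2 <= ip f f * ip g g"
proof -
 have q: "0 <= ip f f + 2 * t * ip f g + t^2 * ip g g" for t
 proof -
  have "0 = I (%x. 0) b" using I_const[of b 0] ab by simp
  also have "... <= I (%x. (f x * f x + (2 * t) * (f x * g x)) + t^2 * (g x * g x)) b"
  proof (rule I_mono)
   show "0 <= (f x * f x + (2 * t) * (f x * g x)) + t^2 * (g x * g x)" for x
    using zero_le_square[of "f x + t * g x"] by (simp add: algebra_simps power2_eq_square)
  qed (use f g ab in "auto intro!: continuous_intros")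
  also have "... = ip f f + 2 * t * ip f g + t^2 * ip g g"
   unfolding ip_def using f g ab
   by (subst I_add I_cmult | (auto intro!: continuous_intros; fail))+
  finally show ?thesis .
 qed
 show ?thesis
 proof (cases "ip g g = 0")
  case True
  have "ip f g = 0"
  proof (rule ccontr)
   assume "ip f g ~= 0"
   thus False using q[of "- (ip f f + 1) / (2 * ip f g)"] True by (simp add: field_simps)
  qed
  thus ?thesis using True by simp
 next
  case False
  have "0 <= ip g g"
   using I_mono[of "%x. 0" "%x. g x * g x" b] I_const[of b 0] g ab
   by (auto simp: ip_def intro!: continuous_intros)
  with False have pos: "0 < ip g g" by simp
  have "0 <= ip f f - (ip f g)^2 / ip g g"
   using q[of "- ip f g / ip g g"] pos by (simp add: field_simps power2_eq_square)
  thus ?thesis using pos by (simp add: field_simps)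
 qed
qed

lemma I_uniform_limit:
 assumes c: "!!n. continuous_on {a..b} (f n)" "continuous_on {a..b} g"
  and u: "uniform_limit {a..b} f g sequentially"
 shows "(%n. I (f n) b) \<longlonglongrightarrow> I g b"
proof (rule LIMSEQ_I)
 fix r :: real assume r: "r > 0"
 define e where "e = r / (2 * V b)"
 have e: "e > 0" using r V_b by (simp add: e_def)
 from uniform_limitD[OF u e] obtain N where
  N: "!!n x. n >= N ==> x : {a..b} ==> dist (f n x) (g x) < e"
  unfolding eventually_sequentially by blast
 have "norm (I (f n) b - I g b) < r" if n: "n >= N" for n
 proof -
  have "abs (I (%x. f n x - g x) b) <= e * V b"
   by (rule I_abs_le) (use N[OF n] ab c in "force simp: dist_real_def intro!: continuous_intros")+
  also have "... < r" using V_b r by (simp add: e_def)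
  finally show ?thesis using I_diff[of "f n" g b] c ab by simp
 qed
 thus "EX no. ALL n>=no. norm (I (f n) b - I g b) < r" by blast
qed

lemma K_uniform_limit:
 assumes X: "!!n. f n : X" "g : X" and u: "uniform_limit {a..b} f g sequentially"
 shows "uniform_limit {a..b} (%n. K (f n)) (K g) sequentially"
proof (rule uniform_limitI)
 fix r :: real assume r: "r > 0"
 obtain C where C: "C > 0" "!!f M s. f : X ==> (!!x. x:{a..b} ==> abs (f x) <= M) ==> s:{a..b} ==> abs (K f s) <= C * M"
  using K_bound by meson
 have "r / (2 * C) > 0" using r C by simp
 from uniform_limitD[OF u this]
 show "eventually (%n. ALL x:{a..b}. dist (K (f n) x) (K g x) < r) sequentially"
 proof eventually_elim
  case (elim n)
  show ?case
  proof
   fix s assume s: "s : {a..b}"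
   have "abs (K (%x. 1 * f n x + (-1) * g x) s) <= C * (r / (2 * C))"
    by (rule C(2)[OF X_lin[OF X] _ s]) (use elim in "force simp: dist_real_def")
   also have "... < r" using C r by simp
   finally show "dist (K (f n) s) (K g s) < r"
    using K_lin[OF X s, where c = 1 and d = "-1"] by (simp add: dist_real_def)
  qed
 qed
qed

section \<open>Existence of eigenfunctions\<close>

text \<open>Kellogg's iteration: start with \<open>f\<close> orthogonal to the known eigenfunctions and iterate \<open>K\<close>. The quotients \<open>r n\<close> of consecutive squared norms increase, by the Cauchy-Schwarz inequality, to a limit \<open>rh\<close>. A subsequence of the iterates, normalised in the sup norm, converges uniformly by the theorem of Arzela and Ascoli to some \<open>g\<close> with \<open>K (K g) = rh * g\<close>, and \<open>K g + sqrt rh * g\<close> is an eigenfunction. Orthogonality to \<open>E\<close> is inherited throughout because \<open>K\<close> is symmetric.\<close>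
theorem K_eigenfunction:
 assumes E: "!!e. e : E ==> e : X & (EX m. ALL s:{a..b}. K e s = m * e s)"
  and f: "f : X" "!!e. e : E ==> ip f e = 0" and f0: "EX s:{a..b}. f s ~= 0"
 obtains psi mu where "psi : X" "0 < mu" "ALL s:{a..b}. K psi s = mu * psi s"
  "EX s:{a..b}. psi s ~= 0" "!!e. e : E ==> ip psi e = 0"
proof -
 obtain C where C: "C > 0" and C': "ALL f M. f : X --> (ALL x:{a..b}. abs (f x) <= M) -->
  (ALL s:{a..b}. abs (K f s) <= C * M) & (ALL s:{a..b}. ALL t:{a..b}. abs (K f s - K f t) <= C * M * abs (s - t))"
  using K_bound by (elim exE conjE)
 have Cb: "abs (K f s) <= C * M" if "f : X" "!!x. x:{a..b} ==> abs (f x) <= M" "s:{a..b}" for f M s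
  using C'[rule_format, of f M] that by blast
 have CL: "abs (K f s - K f t) <= C * M * abs (s - t)"
  if "f : X" "!!x. x:{a..b} ==> abs (f x) <= M" "s:{a..b}" "t:{a..b}" for f M s t
  using C'[rule_format, of f M] that by blast
 define F where "F = (%n. (K ^^ n) f)"
 have F0: "F 0 = f" and FS: "F (Suc n) = K (F n)" for n by (auto simp: F_def)
 have FX: "F n : X" for n by (induction n) (auto simp: F0 FS f K_in_X)
 note Fc = XD(1)[OF FX]
 have ip_cong: "ip g h = ip g' h'" if "!!x. x : {a..b} ==> g x = g' x" "!!x. x : {a..b} ==> h x = h' x" for g h g' h'
  unfolding ip_def using that ab by (intro I_cong) auto
 have ip_K: "ip (K g) e = 0" if g: "g : X" "ip g e = 0" and e: "e : E" for g e
 proof -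
  obtain m where m: "ALL s:{a..b}. K e s = m * e s" using E[OF e] by blast
  have "ip (K g) e = ip g (K e)" using K_sym[OF g(1)] E[OF e] by blast
  also have "... = ip g (%x. m * e x)" by (rule ip_cong) (use m in auto)
  also have "... = I (%x. m * (g x * e x)) b" unfolding ip_def by (simp add: ac_simps)
  also have "... = m * ip g e" unfolding ip_def by (rule I_cmult)
  finally show ?thesis using g by simp
 qed
 have Fe: "ip (F n) e = 0" if "e : E" for n e
 proof (induction n)
  case 0 show ?case using f(2)[OF that] by (simp add: F0)
 next
  case (Suc n) show ?case unfolding FS by (rule ip_K[OF FX Suc that])
 qed
 define beta where "beta = (%n. ip (F n) (F n))"
 have ip0: "ip g g >= 0" if "continuous_on {a..b} g" for g
  using I_mono[of "%x. 0" "%x. g x * g x" b] I_const[of b 0] that ab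
  by (auto simp: ip_def intro!: continuous_intros)
 have ipz: "g s = 0" if "continuous_on {a..b} g" "ip g g = 0" "s : {a..b}" for g s
  using I_nonneg_zero[OF continuous_on_mult[OF that(1) that(1)], of s] that(2,3) by (simp add: ip_def)
 have Fnz: "EX s:{a..b}. F n s ~= 0" for n
 proof (induction n)
  case (Suc n)
  show ?case
  proof (rule ccontr)
   assume "~ ?case"
   hence "K (F n) s = 0" if "s : {a..b}" for s using that by (auto simp: FS)
   hence "ip (K (F n)) (F n) = I (%x. 0) b"
    unfolding ip_def by (intro I_cong) (use ab in auto)
   also have "... = 0" using I_const[of b 0] ab by simp
   finally show False using K_pos(2)[OF FX] Suc by blast
  qed
 qed (use f0 in "simp add: F0")
 have betapos: "beta n > 0" for n
 proof -
  have "beta n ~= 0" using ipz[OF Fc[of n]] Fnz[of n] unfolding beta_def by blast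
  thus ?thesis using ip0[OF Fc[of n]] by (simp add: beta_def less_le)
 qed
 have shift: "ip (F n) (F (Suc (Suc n))) = beta (Suc n)" for n
  using K_sym[OF FX FX, of n "Suc n"] by (simp add: FS beta_def)
 have conv: "(beta (Suc n))^2 <= beta n * beta (Suc (Suc n))" for n
  using ip_CS[OF Fc Fc, of n "Suc (Suc n)"] shift by (simp add: beta_def)
 define r where "r = (%n. beta (Suc n) / beta n)"
 have rpos: "r n > 0" for n using betapos by (simp add: r_def)
 have rSuc: "r n <= r (Suc n)" for n
  using conv[of n] betapos[of n] betapos[of "Suc n"] by (simp add: r_def field_simps power2_eq_square)
 hence rmono: "incseq r" by (rule incseq_SucI)
 have betaS: "beta (Suc n) = r n * beta n" for n using betapos[of n] by (simp add: r_def)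
 have betage: "beta (N + k) >= beta N * (r N) ^ k" for N k
 proof (induction k)
  case (Suc k)
  have "beta N * r N ^ Suc k = r N * (beta N * r N ^ k)" by simp
  also have "... <= r (N + k) * beta (N + k)"
   using Suc rpos[of N] rpos[of "N + k"] betapos[of N] incseqD[OF rmono, of N "N + k"] by (intro mult_mono) auto
  finally show ?case by (simp add: betaS)
 qed simp
 define M where "M = (%g. SUP s\<in>{a..b}. abs (g s) :: real)"
 have M_ub: "abs (g s) <= M g" if "continuous_on {a..b} g" "s : {a..b}" for g s
  unfolding M_def
 proof (rule cSUP_upper[OF that(2)])
  show "bdd_above ((%s. abs (g s)) ` {a..b})"
   using bounded_by[OF that(1)] by (auto intro: bdd_aboveI2)
 qed
 have M_lub: "M g <= L" if "!!s. s : {a..b} ==> abs (g s) <= L" for g L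
  unfolding M_def using that ab by (intro cSUP_least) auto
 have M_att: "EX s:{a..b}. abs (g s) = M g" if g: "continuous_on {a..b} g" for g
 proof -
  have "continuous_on {a..b} (%s. abs (g s))" using g by (intro continuous_intros)
  from continuous_attains_sup[OF compact_Icc _ this] ab obtain x where
   x: "x : {a..b}" "ALL y:{a..b}. abs (g y) <= abs (g x)" by auto
  thus ?thesis using M_ub[OF g x(1)] M_lub[of g "abs (g x)"] by (intro bexI[of _ x]) auto
 qed
 have MK: "M (K g) <= C * M g" if "g : X" for g
  by (rule M_lub, rule Cb[OF that]) (use M_ub[OF XD(1)[OF that]] in auto)
 have betaM: "beta n <= V b * (M (F n))^2" for n
 proof -
  have "abs (ip (F n) (F n)) <= (M (F n))^2 * V b" unfolding ip_def
  proof (rule I_abs_le)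
   fix x assume "x : {a..b}"
   hence "abs (F n x) * abs (F n x) <= M (F n) * M (F n)" using M_ub[OF Fc] by (intro mult_mono) (auto intro: order_trans[OF abs_ge_zero])
   thus "abs (F n x * F n x) <= (M (F n))^2" by (simp add: abs_mult power2_eq_square)
  qed (use Fc ab in "auto intro!: continuous_intros")
  thus ?thesis by (simp add: beta_def mult.commute)
 qed
 have Mpos: "M (F n) > 0" for n
 proof -
  obtain s where s: "s : {a..b}" "F n s ~= 0" using Fnz by blast
  hence "0 < abs (F n s)" by simp
  also have "... <= M (F n)" by (rule M_ub[OF Fc s(1)])
  finally show ?thesis .
 qed
 have grow: False if "!!k. c * x ^ k <= d * y ^ k" "c > 0" "0 < y" "y < x" for c d x y :: real
 proof -
  have "1 < x / y" using that by simp
  from real_arch_pow[OF this, of "d / c"] obtain k where "d / c < (x / y) ^ k" by blast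
  hence "d * y ^ k < c * x ^ k" using that by (simp add: power_divide field_simps)
  thus False using that(1)[of k] by simp
 qed
 have rbdd: "r N <= C^2" for N
 proof (rule ccontr)
  assume neg: "~ ?thesis"
  have MN: "M (F (N + k)) <= C ^ k * M (F N)" for k
  proof (induction k)
   case (Suc k)
   have "M (F (N + Suc k)) <= C * M (F (N + k))" using MK[OF FX] by (simp add: FS)
   also have "... <= C * (C ^ k * M (F N))" using Suc C by (intro mult_left_mono) auto
   finally show ?case by simp
  qed simp
  have "beta N * (r N) ^ k <= (V b * (M (F N))^2) * (C^2) ^ k" for k
  proof -
   have "beta N * (r N) ^ k <= V b * (M (F (N + k)))^2" using betage[of N k] betaM[of "N + k"] by linarith
   also have "... <= V b * (C ^ k * M (F N))^2"
    using MN[of k] Mpos[of "N + k"] V_b by (intro mult_left_mono power_mono) auto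
   finally show ?thesis by (simp add: power_mult_distrib power_mult[symmetric] ac_simps)
  qed
  from grow[OF this betapos] C neg show False by simp
 qed
 obtain rh where rh: "r \<longlonglongrightarrow> rh" "!!n. r n <= rh"
  using incseq_convergent[OF rmono] rbdd by blast
 have rhpos: "rh > 0" using rpos[of 0] rh(2)[of 0] by linarith
 \<comment> \<open>For infinitely many steps the sup norm shrinks at most by the factor \<open>eps\<close>, since otherwise it would decay faster than the L2 norm. After such steps the normalised iterates are equicontinuous.\<close>
 define eps where "eps = sqrt (r 0) / 2"
 have eps: "eps > 0" "eps^2 = r 0 / 4" using rpos[of 0] by (auto simp: eps_def power_divide)
 define Q where "Q = {n. M (F (Suc n)) >= eps * M (F n)}"
 have "infinite Q"
 proof
  assume "finite Q"
  then obtain N where N: "!!n. n : Q ==> n < N" using finite_nat_set_iff_bounded by auto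
  have MN: "M (F (N + k)) <= eps ^ k * M (F N)" for k
  proof (induction k)
   case (Suc k)
   have "N + k ~: Q" using N[of "N + k"] by auto
   hence "M (F (N + Suc k)) <= eps * M (F (N + k))" by (simp add: Q_def)
   also have "... <= eps * (eps ^ k * M (F N))" using Suc eps by (intro mult_left_mono) auto
   finally show ?case by simp
  qed simp
  have "beta N * (r 0) ^ k <= (V b * (M (F N))^2) * (eps^2) ^ k" for k
  proof -
   have "beta N * (r 0) ^ k <= beta N * (r N) ^ k"
    using incseqD[OF rmono, of 0 N] rpos[of 0] betapos[of N] by (intro mult_left_mono power_mono) auto
   also have "... <= V b * (M (F (N + k)))^2" using betage[of N k] betaM[of "N + k"] by linarith
   also have "... <= V b * (eps ^ k * M (F N))^2"
    using MN[of k] Mpos[of "N + k"] V_b by (intro mult_left_mono power_mono) auto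
   finally show ?thesis by (simp add: power_mult_distrib power_mult[symmetric] ac_simps)
  qed
  from grow[OF this betapos] eps rpos[of 0] show False by simp
 qed
 from infinite_enumerate[OF this] obtain q :: "nat => nat" where q: "strict_mono q" "!!n. q n : Q" by blast
 define y where "y = (%n s. F (Suc (q n)) s / M (F (Suc (q n))))"
 have y_bd: "norm (y n s) <= 1" if "s : {a..b}" for n s
  using M_ub[OF Fc that, of "Suc (q n)"] Mpos[of "Suc (q n)"] by (simp add: y_def abs_divide)
 have y_lip: "abs (y n s - y n t) <= C / eps * abs (s - t)" if "s : {a..b}" "t : {a..b}" for n s t
 proof -
  have "abs (y n s - y n t) = abs (K (F (q n)) s - K (F (q n)) t) / M (F (Suc (q n)))"
   using Mpos[of "Suc (q n)"] by (simp add: y_def FS diff_divide_distrib[symmetric] abs_divide)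
  also have "... <= C * M (F (q n)) * abs (s - t) / M (F (Suc (q n)))"
   using CL[OF FX M_ub[OF Fc] that] Mpos by (intro divide_right_mono) (auto simp: less_imp_le)
  also have "... <= C * M (F (q n)) * abs (s - t) / (eps * M (F (q n)))"
   using q(2)[of n] Mpos eps C less_imp_le[OF Mpos] by (intro divide_left_mono) (auto simp: Q_def)
  also have "... = C / eps * abs (s - t)" using Mpos[of "q n"] by simp
  finally show ?thesis .
 qed
 obtain g k where g: "continuous_on {a..b} g" and k: "strict_mono (k :: nat => nat)"
  and lim: "!!e. 0 < e ==> EX N. ALL n x. n >= N & x : {a..b} --> norm (y (k n) x - g x) < e"
 proof (rule Arzela_Ascoli[of "{a..b}" y 1])
  fix x e :: real assume x: "x : {a..b}" and e: "0 < e"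
  have "abs (y n x - y n z) < e" if "z : {a..b}" "abs (x - z) < e * eps / C" for n z
  proof -
   have "abs (y n x - y n z) <= C / eps * abs (x - z)" by (rule y_lip[OF x that(1)])
   also have "... < C / eps * (e * eps / C)" using that C eps by (intro mult_strict_left_mono) auto
   also have "... = e" using C eps by simp
   finally show ?thesis .
  qed
  thus "EX d. 0 < d & (ALL n z. z : {a..b} & norm (x - z) < d --> norm (y n x - y n z) < e)"
   using e C eps by (intro exI[of _ "e * eps / C"]) auto
 qed (use y_bd in auto)
 define z where "z = (%n. y (k n))"
 have zg: "uniform_limit {a..b} z g sequentially"
  by (rule uniform_limitI) (use lim in "force simp: z_def eventually_sequentially dist_real_def")
 have zX: "z n : X" for n
  using X_lin[OF FX FX, of "1 / M (F (Suc (q (k n))))" "Suc (q (k n))" 0 0] by (simp add: z_def y_def)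
 note zc = XD(1)[OF zX]
 have gX: "g : X"
  using I_uniform_limit[OF zc g zg] XD(2)[OF zX] g by (auto simp: X_def LIMSEQ_const_iff)
 have ul_mult: "uniform_limit {a..b} (%n x. u n x * w n x) (%x. u' x * w' x) sequentially"
  if "uniform_limit {a..b} u u' sequentially" "uniform_limit {a..b} w w' sequentially"
   "continuous_on {a..b} u'" "continuous_on {a..b} w'" for u w :: "nat => real => real" and u' w'
  by (rule uniform_lim_mult) (use that compact_imp_bounded[OF compact_continuous_image] in auto)
 have ge: "ip g e = 0" if e: "e : E" for e
 proof -
  have ec: "continuous_on {a..b} e" using E[OF e] XD by blast
  have "(%n. ip (z n) e) \<longlonglongrightarrow> ip g e" unfolding ip_def
   by (rule I_uniform_limit) (use ul_mult[OF zg _ g ec] uniform_limit_const zc g ec in "auto intro!: continuous_intros")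
  moreover have "ip (z n) e = 0" for n
  proof -
   have "ip (z n) e = (1 / M (F (Suc (q (k n))))) * ip (F (Suc (q (k n)))) e"
    unfolding ip_def I_cmult[symmetric] z_def y_def by simp
   thus ?thesis using Fe[OF e] by simp
  qed
  ultimately show ?thesis by (simp add: LIMSEQ_const_iff)
 qed
 have gnz: "EX s:{a..b}. g s ~= 0"
 proof (rule ccontr)
  assume neg: "~ ?thesis"
  from uniform_limitD[OF zg, of "1/2"] obtain n where n: "ALL x:{a..b}. dist (z n x) (g x) < 1/2"
   by (auto simp: eventually_sequentially)
  obtain s where s: "s : {a..b}" "abs (F (Suc (q (k n))) s) = M (F (Suc (q (k n))))"
   using M_att[OF Fc] by blast
  hence "abs (z n s) = 1" using Mpos[of "Suc (q (k n))"] by (simp add: z_def y_def abs_divide)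
  thus False using n s(1) neg by (fastforce simp: dist_real_def)
 qed
 define h where "h = (%s. K (K g) s - rh * g s)"
 have hc: "continuous_on {a..b} h" unfolding h_def by (intro continuous_intros g K_cont K_in_X gX)
 have "ip h h = 0"
 proof -
  define hn where "hn = (%n s. K (K (z n)) s - rh * z n s)"
  have hnc: "continuous_on {a..b} (hn n)" for n unfolding hn_def by (intro continuous_intros zc K_cont K_in_X zX)
  have "uniform_limit {a..b} hn h sequentially" unfolding hn_def h_def
   by (intro uniform_limit_intros ul_mult K_uniform_limit K_in_X zX gX zg uniform_limit_const g continuous_on_const)
  from ul_mult[OF this this hc hc]
  have L: "(%n. ip (hn n) (hn n)) \<longlonglongrightarrow> ip h h" unfolding ip_def
   by (intro I_uniform_limit) (use hnc hc in "auto intro!: continuous_intros")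
  define m where "m = (%n. Suc (q (k n)))"
  \<comment> \<open>In terms of the quotients \<open>r\<close>, the defect of the limit equation tends to \<open>rh\<^sup>2 - 2 rh\<^sup>2 + rh\<^sup>2 = 0\<close>.\<close>
  have eq: "ip (hn n) (hn n) = beta (m n) / (M (F (m n)))^2 * (r (Suc (m n)) * r (m n) - 2 * rh * r (m n) + rh^2)" for n
  proof -
   define c where "c = 1 / M (F (m n))"
   have K1: "K (z n) s = c * F (Suc (m n)) s" if "s : {a..b}" for s
    using K_lin[OF FX FX that, of c "m n" 0 0] by (simp add: z_def y_def c_def m_def FS[symmetric])
   have K2: "K (K (z n)) s = c * F (Suc (Suc (m n))) s" if "s : {a..b}" for s
    using K_lin[OF FX FX that, of c "Suc (m n)" 0 0] K_cong[OF K1 that] by (simp add: FS[symmetric])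
   have z': "z n s = c * F (m n) s" for s by (simp add: z_def y_def c_def m_def)
   have "ip (hn n) (hn n) = I (%x. c^2 * ((F (Suc (Suc (m n))) x * F (Suc (Suc (m n))) x
     + (- 2 * rh) * (F (m n) x * F (Suc (Suc (m n))) x)) + rh^2 * (F (m n) x * F (m n) x))) b"
    unfolding ip_def by (rule I_cong) (use ab in "auto simp: hn_def K2 z' algebra_simps power2_eq_square")
   also have "... = c^2 * (beta (Suc (Suc (m n))) - 2 * rh * beta (Suc (m n)) + rh^2 * beta (m n))"
   proof -
    have c1: "continuous_on {a..b} (%x. F i x * F j x)" for i j by (intro continuous_intros Fc)
    have bb: "b : {a..b}" using ab by simp
    have i1: "I (%x. F (Suc (Suc (m n))) x * F (Suc (Suc (m n))) x) b = beta (Suc (Suc (m n)))"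
     "I (%x. F (m n) x * F (m n) x) b = beta (m n)"
     "I (%x. F (m n) x * F (Suc (Suc (m n))) x) b = beta (Suc (m n))"
     using shift[of "m n"] by (auto simp: beta_def ip_def)
    show ?thesis
     unfolding I_cmult I_add[OF continuous_on_add[OF c1 continuous_on_mult_left[OF c1]] continuous_on_mult_left[OF c1] bb]
      I_add[OF c1 continuous_on_mult_left[OF c1] bb] i1 by simp
   qed
   also have "... = beta (m n) / (M (F (m n)))^2 * (r (Suc (m n)) * r (m n) - 2 * rh * r (m n) + rh^2)"
    by (simp add: betaS c_def power_divide algebra_simps)
   finally show ?thesis .
  qed
  have mlim: "filterlim m sequentially sequentially"
   unfolding m_def by (intro filterlim_compose[OF filterlim_Suc] filterlim_compose[OF filterlim_subseq[OF q(1)]] filterlim_subseq k)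
  have rm: "(%n. r (m n)) \<longlonglongrightarrow> rh" "(%n. r (Suc (m n))) \<longlonglongrightarrow> rh"
   using filterlim_compose[OF rh(1) mlim] filterlim_compose[OF LIMSEQ_Suc[OF rh(1)] mlim] by auto
  have "(%n. r (Suc (m n)) * r (m n) - 2 * rh * r (m n) + rh^2) \<longlonglongrightarrow> rh * rh - 2 * rh * rh + rh^2"
   by (intro tendsto_intros rm)
  hence L0: "(%n. V b * abs (r (Suc (m n)) * r (m n) - 2 * rh * r (m n) + rh^2)) \<longlonglongrightarrow> 0"
   by (intro tendsto_mult_right_zero tendsto_rabs_zero) (simp add: power2_eq_square)
  have "(%n. ip (hn n) (hn n)) \<longlonglongrightarrow> 0"
  proof (rule tendsto_sandwich[OF _ _ tendsto_const L0])
   show "eventually (%n. 0 <= ip (hn n) (hn n)) sequentially" using ip0[OF hnc] by simp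
   have "ip (hn n) (hn n) <= V b * abs (r (Suc (m n)) * r (m n) - 2 * rh * r (m n) + rh^2)" for n
   proof -
    have "beta (m n) / (M (F (m n)))^2 <= V b" using betaM[of "m n"] Mpos[of "m n"] by (simp add: divide_le_eq)
    moreover have "0 <= beta (m n) / (M (F (m n)))^2" using betapos[of "m n"] by simp
    ultimately show ?thesis unfolding eq
     by (intro order_trans[OF mult_left_mono[OF abs_ge_self] mult_right_mono]) auto
   qed
   thus "eventually (%n. ip (hn n) (hn n) <= V b * abs (r (Suc (m n)) * r (m n) - 2 * rh * r (m n) + rh^2)) sequentially" by simp
  qed
  with L show ?thesis using LIMSEQ_unique by blast
 qed
 hence KK: "K (K g) s = rh * g s" if "s : {a..b}" for s
  using ipz[OF hc _ that] by (simp add: h_def)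
 define mu where "mu = sqrt rh"
 have mu: "mu > 0" "mu * mu = rh" using rhpos by (auto simp: mu_def)
 define psi where "psi = (%s. 1 * K g s + mu * g s)"
 have psiX: "psi : X" unfolding psi_def by (intro X_lin K_in_X gX)
 show thesis
 proof (rule that[OF psiX mu(1)])
  show "ALL s:{a..b}. K psi s = mu * psi s"
   using K_lin[OF K_in_X[OF gX] gX, of _ 1 mu] KK mu(2) by (auto simp: psi_def algebra_simps)
  show "EX s:{a..b}. psi s ~= 0"
  proof (rule ccontr)
   assume neg: "~ ?thesis"
   hence "K g s = - mu * g s" if "s : {a..b}" for s using that by (force simp: psi_def)
   hence "ip (K g) g = I (%x. - mu * (g x * g x)) b"
    unfolding ip_def using ab by (intro I_cong) auto
   hence "ip (K g) g = - mu * ip g g" by (simp only: I_cmult ip_def)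
   moreover have "ip g g ~= 0" using ipz[OF g] gnz by blast
   moreover have "ip g g >= 0" by (rule ip0[OF g])
   ultimately show False using K_pos(1)[OF gX] mu(1) by (simp add: mult_le_0_iff)
  qed
  show "ip psi e = 0" if e: "e : E" for e
  proof -
   have ec: "continuous_on {a..b} e" using E[OF e] XD by blast
   have "ip psi e = I (%x. K g x * e x + mu * (g x * e x)) b"
    unfolding ip_def psi_def by (simp add: algebra_simps)
   also have "... = ip (K g) e + mu * ip g e"
    unfolding ip_def by (subst I_add) (use K_cont[OF gX] g ec ab in "auto intro!: continuous_intros simp: I_cmult")
   finally show ?thesis using ge[OF e] ip_K[OF gX ge[OF e] e] by simp
  qed
 qed
qed

section \<open>Solutions and their zeros\<close>

text \<open>The system for \<open>phi\<close> and its integral \<open>G\<close>. The condition at \<open>b\<close> is on \<open>l * G\<close>, since for \<open>l = 0\<close> the total integral is not zero.\<close>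
definition sol :: "real => (real => real) => (real => real) => bool" where
 "sol l phi G \<longleftrightarrow>
   (ALL s. a < s --> s < b --> DERIV phi s :> - (l * G s / p s) &
              DERIV G s :> phi s * v s) &
   (EX C. ALL s. a < s --> s < b --> abs (phi s) <= C) &
   tendsto G 0 (at_right a) & tendsto (%s. l * G s) 0 (at_left b)"

lemma sol_deriv:
 assumes "sol l phi G" "a < s" "s < b"
 shows "DERIV phi s :> - (l * G s / p s)" "DERIV G s :> phi s * v s"
 using assms by (auto simp: sol_def)

lemma sol_cont:
 assumes "sol l phi G" shows "continuous_on {a<..<b} phi" "continuous_on {a<..<b} G"
 using DERIV_isCont[OF sol_deriv(1)[OF assms]] DERIV_isCont[OF sol_deriv(2)[OF assms]]
 by (auto intro!: continuous_at_imp_continuous_on)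

lemma sol_lin:
 assumes 1: "sol l phi1 G1" and 2: "sol l phi2 G2"
 shows "sol l (%s. c * phi1 s + d * phi2 s) (%s. c * G1 s + d * G2 s)"
 unfolding sol_def
proof (intro conjI allI impI)
 fix s assume s: "a < s" "s < b"
 show "DERIV (%s. c * phi1 s + d * phi2 s) s :> - (l * (c * G1 s + d * G2 s) / p s)"
  by (rule derivative_eq_intros sol_deriv[OF 1 s] sol_deriv[OF 2 s] refl)+ (simp add: algebra_simps add_divide_distrib)
 show "DERIV (%s. c * G1 s + d * G2 s) s :> (c * phi1 s + d * phi2 s) * v s"
  by (rule derivative_eq_intros sol_deriv[OF 1 s] sol_deriv[OF 2 s] refl)+ (simp add: algebra_simps)
next
 obtain C1 C2 where C: "!!s. a < s ==> s < b ==> abs (phi1 s) <= C1" "!!s. a < s ==> s < b ==> abs (phi2 s) <= C2"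
  using 1 2 unfolding sol_def by blast
 have "abs (c * phi1 s + d * phi2 s) <= abs c * C1 + abs d * C2" if "a < s" "s < b" for s
 proof -
  have "abs (c * phi1 s + d * phi2 s) <= abs c * abs (phi1 s) + abs d * abs (phi2 s)"
   by (metis abs_mult abs_triangle_ineq)
  also have "... <= abs c * C1 + abs d * C2" using C[OF that] by (intro add_mono mult_left_mono) auto
  finally show ?thesis .
 qed
 thus "EX C. ALL s. a < s --> s < b --> abs (c * phi1 s + d * phi2 s) <= C" by blast
next
 have "tendsto (%s. c * G1 s + d * G2 s) (c * 0 + d * 0) (at_right a)"
  by (intro tendsto_intros) (use 1 2 in "auto simp: sol_def")
 thus "tendsto (%s. c * G1 s + d * G2 s) 0 (at_right a)" by simp
 have "tendsto (%s. c * (l * G1 s) + d * (l * G2 s)) (c * 0 + d * 0) (at_left b)"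
  by (intro tendsto_intros) (use 1 2 in "auto simp: sol_def")
 thus "tendsto (%s. l * (c * G1 s + d * G2 s)) 0 (at_left b)" by (simp add: algebra_simps)
qed

text \<open>In the interior the system is regular, so \<open>phi\<^sup>2 + G\<^sup>2\<close> satisfies Gronwall's inequality in both directions.\<close>
lemma sol_unique:
 assumes sol: "sol l phi G" and t: "a < t" "t < b" "phi t = 0" "G t = 0" and s: "a < s" "s < b"
 shows "phi s = 0 & G s = 0"
proof -
 define E where "E = (%s. (phi s)^2 + (G s)^2)"
 define E' where "E' = (%s. 2 * phi s * G s * (v s - l / p s))"
 have der: "DERIV E s :> E' s" if "a < s" "s < b" for s
  unfolding E_def E'_def
  by (rule derivative_eq_intros sol_deriv[OF sol that] refl)+ (simp add: algebra_simps)
 have bd: "EX k. ALL x:{c..d}. abs (E' x) <= k * E x" if cd: "a < c" "d < b" for c d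
 proof -
  have "continuous_on {c..d} (%s. v s - l / p s)"
   by (intro continuous_intros continuous_on_subset[OF contv] continuous_on_subset[OF cont_p])
     (use cd less_imp_neq[OF p_pos] in "fastforce+")
  then obtain k where k: "!!x. x : {c..d} ==> abs (v x - l / p x) <= k" using bounded_by by meson
  have "abs (E' x) <= k * E x" if "x : {c..d}" for x
  proof -
   have "2 * abs (phi x) * abs (G x) <= (phi x)^2 + (G x)^2"
    using zero_le_power2[of "abs (phi x) - abs (G x)"] by (simp add: power2_diff)
   hence "2 * abs (phi x) * abs (G x) * abs (v x - l / p x) <= ((phi x)^2 + (G x)^2) * k"
    using k[OF that] by (intro mult_mono) auto
   thus ?thesis by (simp add: E'_def E_def abs_mult mult.commute)
  qed
  thus ?thesis by blast
 qed
 have "E s <= 0"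
 proof (cases "t <= s")
  case True
  obtain k where k: "!!x. x : {t..s} ==> abs (E' x) <= k * E x" using bd[of t s] t s by meson
  show ?thesis
  proof (rule gronwall_zero_right[OF True])
   show "(E has_real_derivative E' x) (at x within {t..s})" if "t <= x" "x <= s" for x
    using der[of x] that t s by (auto intro: has_field_derivative_at_within)
   show "E' x <= k * E x" if "t <= x" "x <= s" for x using k[of x] that by auto
  qed (use t in "simp add: E_def")
 next
  case False
  obtain k where k: "!!x. x : {s..t} ==> abs (E' x) <= k * E x" using bd[of s t] t s by meson
  show ?thesis
  proof (rule gronwall_zero_left[of s t])
   show "(E has_real_derivative E' x) (at x within {s..t})" if "s <= x" "x <= t" for x
    using der[of x] that t s by (auto intro: has_field_derivative_at_within)
   show "- E' x <= k * E x" if "s <= x" "x <= t" for x using k[of x] that by auto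
  qed (use t False in "auto simp: E_def")
 qed
 thus ?thesis by (auto simp: E_def sum_power2_le_zero_iff)
qed

text \<open>The expression \<open>phi1 * G2 - phi2 * G1\<close> has derivative zero and tends to \<open>0\<close> at \<open>a\<close>. Here boundedness of \<open>phi\<close> singles out one solution among the two at the singular end.\<close>
lemma sol_wronskian:
 assumes 1: "sol l phi1 G1" and 2: "sol l phi2 G2" and s: "a < s" "s < b"
 shows "phi1 s * G2 s = phi2 s * G1 s"
proof -
 define D where "D = (%s. phi1 s * G2 s - phi2 s * G1 s)"
 have "DERIV D s :> 0" if "a < s" "s < b" for s
  unfolding D_def
  by (rule derivative_eq_intros sol_deriv[OF 1 that] sol_deriv[OF 2 that] refl)+ (simp add: algebra_simps)
 hence const: "D x = D s" if "a < x" "x < b" for x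
  using DERIV_isconst3[of a b x s D] that s ab by auto
 have prod: "tendsto (%s. phi s * G s) 0 (at_right a)" if H: "sol l phi H" "sol l psi G" for phi psi G H
 proof -
  obtain C where C: "!!s. a < s ==> s < b ==> abs (phi s) <= C" using H(1) unfolding sol_def by blast
  show ?thesis
  proof (rule Lim_null_comparison)
   show "eventually (%s. norm (phi s * G s) <= C * abs (G s)) (at_right a)"
    using ev_a by eventually_elim (use C in "auto simp: abs_mult intro!: mult_right_mono")
   show "tendsto (%s. C * abs (G s)) 0 (at_right a)"
    by (intro tendsto_mult_right_zero tendsto_rabs_zero) (use H in "auto simp: sol_def")
  qed
 qed
 have "tendsto D (0 - 0) (at_right a)" unfolding D_def
  by (intro tendsto_diff prod[OF 1 2] prod[OF 2 1])
 moreover have "tendsto D (D s) (at_right a)"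
 proof (rule Lim_transform_eventually[OF tendsto_const])
  show "eventually (%x. D s = D x) (at_right a)" using ev_a by eventually_elim (use const in auto)
 qed
 ultimately have "D s = 0" using tendsto_unique trivial_limit_at_right_real by fastforce
 thus ?thesis by (simp add: D_def)
qed

lemma sol_common_zero:
 assumes 1: "sol l phi1 G1" and 2: "sol l phi2 G2" and t: "a < t" "t < b" "G1 t = 0"
  and nz: "a < s" "s < b" "phi1 s ~= 0"
 shows "G2 t = 0"
 using sol_wronskian[OF 1 2 t(1,2)] sol_unique[OF 1 t(1,2) _ t(3) nz(1,2)] nz t by auto

lemma sol_countable_zeros:
 assumes sol: "sol l phi G" and nz: "a < t" "t < b" "phi t ~= 0"
 shows "countable {s : {a<..<b}. G s = 0}"
proof (rule countable_simple_zeros)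
 fix s assume s: "s : {a<..<b}"
 show "EX d. DERIV G s :> d & (G s = 0 --> d ~= 0)"
  using s sol_deriv(2)[OF sol, of s] v_pos[of s] sol_unique[OF sol, of s t] nz by force
qed

lemma sol_proportional:
 assumes 1: "sol l phi1 G1" and 2: "sol l phi2 G2" and nz: "a < t" "t < b" "phi1 t ~= 0"
 shows "EX c. ALL s. a < s --> s < b --> phi2 s = c * phi1 s"
proof -
 define c where "c = phi2 t / phi1 t"
 have "1 * phi2 s + (- c) * phi1 s = 0" if s: "a < s" "s < b" for s
  using sol_unique[OF sol_lin[OF 2 1, of 1 "- c"] nz(1,2) _ _ s] sol_wronskian[OF 1 2 nz(1,2)] nz(3)
  by (auto simp: c_def field_simps)
 thus ?thesis by (intro exI[of _ c]) auto
qed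

lemma sol_antimono:
 assumes sol: "sol l phi G" and l: "0 <= l" and xy: "a < x" "y < b"
  and G: "!!s. s : {x..y} ==> 0 < G s" and st: "x <= s" "s <= t" "t <= y"
 shows "phi t <= phi s"
proof (rule DERIV_nonpos_imp_nonincreasing[OF st(2)])
 fix r assume "s <= r" "r <= t"
 hence r: "r : {x..y}" "a < r" "r < b" using st xy by auto
 hence "0 <= l * G r / p r" using l G[OF r(1)] p_pos[of r] by simp
 thus "EX y. DERIV phi r :> y & y <= 0"
  using sol_deriv(1)[OF sol r(2,3)] by (intro exI[of _ "- (l * G r / p r)"]) auto
qed

text \<open>If \<open>G > 0\<close> and \<open>phi\<close> keeps its sign on \<open>[x, y]\<close>, then \<open>G\<close> at the midpoint bounds the change of \<open>phi\<close> on one half of the interval from below by a multiple of \<open>l\<close>, and this change bounds \<open>G\<close> at the midpoint from below. Comparing the two estimates bounds \<open>l\<close>.\<close>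
lemma zero_core:
 assumes sol: "sol l phi G" and l: "0 <= l" and xy: "a < x" "x < y" "y < b"
  and P: "!!s. s : {x..y} ==> p s <= P" and w: "0 < w" "!!s. s : {x..y} ==> w <= v s"
  and G: "!!s. s : {x..y} ==> 0 < G s"
  and sg: "(ALL s:{x..y}. 0 <= phi s) | (ALL s:{x..y}. phi s <= 0)"
 shows "l * w * (y - x)^2 <= 4 * P"
proof -
 define m where "m = (x + y) / 2"
 define h where "h = (y - x) / 2"
 have m: "x < m" "m < y" "m - x = h" "y - m = h" "0 < h" using xy by (auto simp: m_def h_def field_simps)
 have Ppos: "0 < P" using P[of x] p_pos[of x] xy by auto
 note dec = sol_antimono[OF sol l xy(1,3) G]
 have phi_drop: "phi s - phi t >= l * g / P * (t - s)"
  if st: "x <= s" "s < t" "t <= y" and g: "!!r. s < r ==> r < t ==> g <= G r" "0 <= g" for s t g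
 proof -
  obtain r where r: "s < r" "r < t" "phi t - phi s = (t - s) * - (l * G r / p r)"
   using MVT2[OF st(2), of phi "%r. - (l * G r / p r)"] sol_deriv(1)[OF sol] st xy by auto
  have r': "r : {x..y}" "a < r" "r < b" using r st xy by auto
  have "l * g / P <= l * G r / p r"
   using l g(1)[OF r(1,2)] g(2) P[OF r'(1)] p_pos[OF r'(2,3)] by (intro frac_le mult_left_mono) auto
  hence "l * g / P * (t - s) <= l * G r / p r * (t - s)" using st by (intro mult_right_mono) auto
  thus ?thesis using r(3) by (simp add: algebra_simps)
 qed
 have concl: ?thesis if "G m >= w * q * h" "q >= l * G m / P * h" for q
 proof -
  have "w * (l * G m / P * h) * h <= w * q * h"
   using that w m by (intro mult_right_mono mult_left_mono) auto
  also have "... <= G m" by (rule that(1))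
  finally have "G m * (l * w * h^2) <= G m * P" using Ppos by (simp add: field_simps power2_eq_square)
  hence "l * w * h^2 <= P" using G[of m] m by simp
  thus ?thesis by (simp add: h_def power_divide)
 qed
 from sg show ?thesis
 proof
  assume nn: "ALL s:{x..y}. 0 <= phi s"
  have inc: "G s <= G t" if "x <= s" "s <= t" "t <= y" for s t
  proof (rule DERIV_nonneg_imp_nondecreasing[OF that(2)])
   fix r assume "s <= r" "r <= t"
   hence r: "r : {x..y}" "a < r" "r < b" using that xy by auto
   thus "EX y. DERIV G r :> y & 0 <= y"
    using sol_deriv(2)[OF sol r(2,3)] nn v_pos[of r] by (intro exI[of _ "phi r * v r"]) auto
  qed
  obtain r where r: "x < r" "r < m" "G m - G x = (m - x) * (phi r * v r)"
   using MVT2[OF m(1), of G "%r. phi r * v r"] sol_deriv(2)[OF sol] m xy by auto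
  have "phi m * w <= phi r * v r" using dec[of r m] w r m nn by (intro mult_mono) auto
  hence "w * phi m * h <= G m - G x" using r(3) m by (simp add: mult.commute)
  hence 1: "G m >= w * phi m * h" using G[of x] xy by auto
  have "l * G m / P * (y - m) <= phi m - phi y"
   by (rule phi_drop) (use m G[of m] inc in auto)
  hence "phi m >= l * G m / P * h" using nn xy m by (auto dest: bspec[of _ _ y])
  from concl[OF 1 this] show ?thesis .
 next
  assume np: "ALL s:{x..y}. phi s <= 0"
  have dec': "G t <= G s" if "x <= s" "s <= t" "t <= y" for s t
  proof (rule DERIV_nonpos_imp_nonincreasing[OF that(2)])
   fix r assume "s <= r" "r <= t"
   hence r: "r : {x..y}" "a < r" "r < b" using that xy by auto
   thus "EX y. DERIV G r :> y & y <= 0"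
    using sol_deriv(2)[OF sol r(2,3)] np v_pos[of r]
    by (intro exI[of _ "phi r * v r"]) (auto intro: mult_nonpos_nonneg)
  qed
  obtain r where r: "m < r" "r < y" "G y - G m = (y - m) * (phi r * v r)"
   using MVT2[OF m(2), of G "%r. phi r * v r"] sol_deriv(2)[OF sol] m xy by auto
  have "- phi m * w <= - phi r * v r" using dec[of m r] w r m np by (intro mult_mono) auto
  hence "w * (- phi m) * h <= G m - G y" using r(3) m mult_left_mono[of "- phi m * w" "- phi r * v r" h]
   by (simp add: algebra_simps)
  hence 1: "G m >= w * (- phi m) * h" using G[of y] xy by auto
  have "l * G m / P * (m - x) <= phi x - phi m"
   by (rule phi_drop) (use m G[of m] dec' in auto)
  hence "- phi m >= l * G m / P * h" using np xy m by (auto dest: bspec[of _ _ x])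
  from concl[OF 1 this] show ?thesis .
 qed
qed

text \<open>If \<open>G > 0\<close> on the interval, then \<open>phi\<close> decreases there, so it keeps its sign on one of the two halves.\<close>
theorem sol_zeros_dense:
 assumes cd: "a < c" "c < d" "d < b"
 shows "EX L. ALL l>L. ALL phi G. sol l phi G --> (EX s:{c..d}. G s = 0)"
proof -
 have cp: "continuous_on {c..d} p" "continuous_on {c..d} v"
  using cd by (auto intro: continuous_on_subset[OF cont_p] continuous_on_subset[OF contv])
 obtain P where P: "!!s. s : {c..d} ==> abs (p s) <= P" using bounded_by[OF cp(1)] by meson
 obtain x0 where x0: "x0 : {c..d}" "!!s. s : {c..d} ==> v x0 <= v s"
  using continuous_attains_inf[OF compact_Icc _ cp(2)] cd by auto
 define w where "w = v x0"
 have w: "0 < w" using v_pos x0 cd by (auto simp: w_def)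
 define m where "m = (c + d) / 2"
 have m: "c < m" "m < d" "m - c = (d - c) / 2" "d - m = (d - c) / 2" using cd by (auto simp: m_def field_simps)
 have pos: False if sol: "sol l phi G" and l: "0 <= l" "16 * P < l * w * (d - c)^2" and G: "!!s. s : {c..d} ==> 0 < G s" for l phi G
 proof -
  note dec = sol_antimono[OF sol l(1) cd(1,3) G]
  show False
  proof (cases "0 <= phi m")
   case True
   have "l * w * (m - c)^2 <= 4 * P"
   proof (rule zero_core[OF sol l(1)])
    show "p s <= P" if "s : {c..m}" for s using P[of s] that m by auto
    show "w <= v s" if "s : {c..m}" for s using x0(2)[of s] that m by (auto simp: w_def)
    show "0 < G s" if "s : {c..m}" for s using G[of s] that m by auto
    have "ALL s:{c..m}. 0 <= phi s"
    proof
     fix s assume "s : {c..m}" thus "0 <= phi s" using dec[of s m] True m by auto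
    qed
    thus "(ALL s:{c..m}. 0 <= phi s) | (ALL s:{c..m}. phi s <= 0)" ..
   qed (use cd m w in auto)
   thus False using l by (simp add: m(3) power_divide)
  next
   case False
   have "l * w * (d - m)^2 <= 4 * P"
   proof (rule zero_core[OF sol l(1)])
    show "p s <= P" if "s : {m..d}" for s using P[of s] that m by auto
    show "w <= v s" if "s : {m..d}" for s using x0(2)[of s] that m by (auto simp: w_def)
    show "0 < G s" if "s : {m..d}" for s using G[of s] that m by auto
    have "ALL s:{m..d}. phi s <= 0"
    proof
     fix s assume "s : {m..d}" thus "phi s <= 0" using dec[of m s] False m by auto
    qed
    thus "(ALL s:{m..d}. 0 <= phi s) | (ALL s:{m..d}. phi s <= 0)" ..
   qed (use cd m w in auto)
   thus False using l by (simp add: m(4) power_divide)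
  qed
 qed
 have "EX s:{c..d}. G s = 0" if sol: "sol l phi G" and l: "l > max 0 (16 * P / (w * (d - c)^2))" for l phi G
 proof (rule ccontr)
  assume no: "~ (EX s:{c..d}. G s = 0)"
  have l': "0 <= l" "16 * P < l * w * (d - c)^2"
   using l w cd by (auto simp: field_simps)
  have cG: "continuous_on {c..d} G" using sol_cont(2)[OF sol] cd by (auto intro: continuous_on_subset)
  have sgn: "(ALL s:{c..d}. 0 < G s) | (ALL s:{c..d}. G s < 0)"
  proof (rule ccontr)
   assume "~ ?thesis"
   then obtain s t where st: "s : {c..d}" "t : {c..d}" "G s <= 0" "0 <= G t" using not_less by blast
   have "connected (G ` {c..d})" using cG by (intro connected_continuous_image) auto
   hence "0 : G ` {c..d}" using st unfolding connected_iff_interval by blast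
   thus False using no by auto
  qed
  thus False
  proof
   assume "ALL s:{c..d}. 0 < G s" thus False using pos[OF sol l'] by blast
  next
   assume "ALL s:{c..d}. G s < 0"
   thus False using pos[OF sol_lin[OF sol sol, of "-1" 0] l'] by auto
  qed
 qed
 thus ?thesis by blast
qed

section \<open>The spectrum\<close>

lemma nonzero_inside:
 assumes c: "continuous_on {a..b} (phi :: real => real)" and nz: "EX s:{a..b}. phi s ~= 0"
 obtains t where "a < t" "t < b" "phi t ~= 0"
proof -
 have cl: "closure {a<..<b} = {a..b}" using ab by simp
 have "EX t:{a<..<b}. phi t ~= 0"
 proof (rule ccontr)
  assume "~ ?thesis"
  hence "phi s = 0" if "s : {a..b}" for s
   using continuous_constant_on_closure[of "{a<..<b}" phi 0 s] c cl that by auto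
  thus False using nz by blast
 qed
 thus thesis using that by auto
qed

lemma I_lim:
 assumes "continuous_on {a..b} f"
 shows "tendsto (I f) 0 (at_right a)" "tendsto (%s. l * I f s) (l * I f b) (at_left b)"
proof -
 show "tendsto (I f) 0 (at_right a)"
  using continuous_on_Icc_at_rightD[OF I_cont[OF assms] ab] by simp
 show "tendsto (%s. l * I f s) (l * I f b) (at_left b)"
  by (intro tendsto_intros continuous_on_Icc_at_leftD[OF I_cont[OF assms] ab])
qed

lemma solI:
 assumes c: "continuous_on {a..b} phi"
  and der: "!!s. a < s ==> s < b ==> DERIV phi s :> - (l * I phi s / p s)"
  and z: "l * I phi b = 0"
 shows "sol l phi (I phi)"
proof -
 have "EX C. ALL s. a < s --> s < b --> abs (phi s) <= C" using bounded_by[OF c] by fastforce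
 thus ?thesis unfolding sol_def
  using der I_deriv[OF c] I_lim(1)[OF c] I_lim(2)[OF c, of l] z by auto
qed

lemma sol_end:
 assumes c: "continuous_on {a..b} phi" and sol: "sol l phi (I phi)"
 shows "l * I phi b = 0"
proof -
 have "tendsto (%s. l * I phi s) 0 (at_left b)" using sol by (simp add: sol_def)
 thus ?thesis by (rule tendsto_unique[OF trivial_limit_at_left_real I_lim(2)[OF c]])
qed

text \<open>The expression \<open>m * phi * I psi - l * psi * I phi\<close> has derivative \<open>(m - l) * phi * psi * v\<close> and vanishes at both ends, even if \<open>l\<close> or \<open>m\<close> is \<open>0\<close>.\<close>
lemma sol_orthogonal:
 assumes c: "continuous_on {a..b} phi" "continuous_on {a..b} psi"
  and sol: "sol l phi (I phi)" "sol m psi (I psi)" and ne: "l ~= m"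
 shows "ip phi psi = 0"
proof -
 have "I (%x. (m - l) * (phi x * psi x)) b =
   (%s. m * phi s * I psi s - l * psi s * I phi s) b - (%s. m * phi s * I psi s - l * psi s * I phi s) a"
 proof (rule I_unique)
  fix s assume s: "a < s" "s < b"
  show "DERIV (%s. m * phi s * I psi s - l * psi s * I phi s) s :> (m - l) * (phi s * psi s) * v s"
   by (rule derivative_eq_intros sol_deriv(1)[OF sol(1) s] sol_deriv(1)[OF sol(2) s] I_deriv c s refl)+
     (simp add: algebra_simps)
 qed (use c I_cont ab in "auto intro!: continuous_intros")
 also have "... = 0" using sol_end[OF c(1) sol(1)] sol_end[OF c(2) sol(2)] by auto
 finally have "(m - l) * ip phi psi = 0" unfolding ip_def I_cmult .
 thus ?thesis using ne by simp
qed

lemma sol_eigenvalue_nonneg: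
 assumes c: "continuous_on {a..b} phi" and sol: "sol l phi (I phi)" and nz: "EX s:{a..b}. phi s ~= 0"
 shows "0 <= l"
proof (rule ccontr)
 assume neg: "~ 0 <= l"
 define E where "E = (%s. I (%x. phi x * phi x) s - phi s * I phi s)"
 have E': "(E has_real_derivative l * (I phi s)^2 / p s) (at s)" if s: "a < s" "s < b" for s
  unfolding E_def
  by (rule derivative_eq_intros sol_deriv(1)[OF sol s] I_deriv c s refl continuous_on_mult)+
    (simp add: algebra_simps power2_eq_square)
 have "E b <= E a"
 proof (rule DERIV_nonpos_imp_decreasing_open[of a b E])
  show "EX y. DERIV E x :> y & y <= 0" if "a < x" "x < b" for x
   using E'[OF that] neg p_pos[OF that]
   by (intro exI[of _ "l * (I phi x)^2 / p x"]) (auto intro!: divide_nonpos_nonneg mult_nonpos_nonneg)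
 qed (use ab c in "auto simp: E_def intro!: continuous_intros I_cont")
 moreover have "I phi b = 0" using sol_end[OF c sol] neg by auto
 ultimately have "ip phi phi <= 0" by (simp add: E_def ip_def)
 moreover have "0 <= ip phi phi"
  using I_mono[of "%x. 0" "%x. phi x * phi x" b] I_const[of b 0] c ab
  by (auto simp: ip_def intro!: continuous_intros)
 ultimately have "I (%x. phi x * phi x) b = 0" by (simp add: ip_def)
 from I_nonneg_zero[OF continuous_on_mult[OF c c] _ this] nz show False by auto
qed

lemma K_to_sol:
 assumes X: "psi : X" and mu: "0 < mu" and K: "ALL s:{a..b}. K psi s = mu * psi s"
 shows "sol (1 / mu) psi (I psi)"
proof (rule solI[OF XD(1)[OF X]])
 fix s assume s: "a < s" "s < b"
 have "DERIV (%s. K psi s / mu) s :> - (I psi s / p s) / mu"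
  by (rule DERIV_cdivide[OF K_deriv[OF X s]])
 hence "DERIV psi s :> - (I psi s / p s) / mu"
  by (rule DERIV_local[of _ _ _ "{a<..<b}"]) (use K s mu in auto)
 thus "DERIV psi s :> - (1 / mu * I psi s / p s)"
  by (simp add: mult.commute divide_divide_eq_left)
qed (simp add: XD(2)[OF X])

lemma sol_to_K:
 assumes c: "continuous_on {a..b} phi" and sol: "sol l phi (I phi)" and l: "l ~= 0"
 shows "phi : X" "s : {a..b} ==> phi s = l * K phi s"
proof -
 show X: "phi : X" using sol_end[OF c sol] l c by (simp add: X_def)
 define D where "D = (%s. phi s - l * K phi s)"
 have cD: "continuous_on {a..b} D" unfolding D_def by (intro continuous_intros c K_cont X)
 have D0: "D s = D a" if "s : {a..b}" for s
 proof (cases "s = a")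
  case False
  show ?thesis
  proof (rule DERIV_isconst2[OF ab cD])
   show "DERIV D x :> 0" if "a < x" "x < b" for x
    using DERIV_diff[OF sol_deriv(1)[OF sol that] DERIV_cmult[OF K_deriv[OF X that], of l]]
    by (simp add: D_def)
  qed (use that in auto)
 qed simp
 have "I D b = I phi b - I (%s. l * K phi s) b"
  unfolding D_def by (rule I_diff) (use c K_cont[OF X] ab in "auto intro!: continuous_intros")
 also have "... = 0" using XD(2)[OF X] XD(2)[OF K_in_X[OF X]] by (simp add: I_cmult)
 also have "I D b = I (%s. D a) b" by (rule I_cong[OF D0]) (use ab in auto)
 finally have "I (%s. D a) b = 0" .
 hence "D a = 0" using I_const[of b "D a"] V_b ab by simp
 hence "D s = 0" if "s : {a..b}" using D0[OF that] by metis
 thus "phi s = l * K phi s" if "s : {a..b}" using that by (simp add: D_def)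
qed

definition eigenvalues :: "real set" where
 "eigenvalues = {l. EX phi. continuous_on {a..b} phi & (EX s:{a..b}. phi s ~= 0) & sol l phi (I phi)}"

text \<open>Induction on \<open>E\<close>: two functions with disjoint supports, orthogonal to the previous elements, have a nonzero combination orthogonal to the new one.\<close>
lemma exists_orthogonal:
 assumes "finite E" "!!e. e : E ==> continuous_on {a..b} e" "a <= c" "c < d" "d <= b"
 shows "EX f. continuous_on UNIV f & (EX s:{c<..<d}. f s ~= 0) & (ALL s. s ~: {c<..<d} --> f s = 0) & (ALL e:E. ip f e = 0)"
 using assms
proof (induction E arbitrary: c d rule: finite_induct)
 case empty
 define f where "f = (%s. max 0 ((s - c) * (d - s)))"
 have "continuous_on UNIV f" unfolding f_def by (intro continuous_intros)
 moreover have "f ((c + d) / 2) ~= 0"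
 proof -
  have "0 < ((c + d) / 2 - c) * (d - (c + d) / 2)" using empty by (intro mult_pos_pos) (auto simp: field_simps)
  thus ?thesis by (auto simp: f_def)
 qed
 moreover have "f s = 0" if "s ~: {c<..<d}" for s
 proof -
  have "(s - c) * (d - s) <= 0" using that empty by (auto simp: mult_le_0_iff)
  thus ?thesis by (simp add: f_def)
 qed
 ultimately show ?case using empty by (intro exI[of _ f] conjI bexI[of _ "(c + d) / 2"]) (auto simp: field_simps)
next
 case (insert g E)
 define m where "m = (c + d) / 2"
 have m: "c < m" "m < d" using insert.prems by (auto simp: m_def field_simps)
 obtain f1 where f1: "continuous_on UNIV f1" "EX s:{c<..<m}. f1 s ~= 0" "!!s. s ~: {c<..<m} ==> f1 s = 0" "ALL e:E. ip f1 e = 0"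
  using insert.IH[of c m] insert.prems m by auto
 obtain f2 where f2: "continuous_on UNIV f2" "EX s:{m<..<d}. f2 s ~= 0" "!!s. s ~: {m<..<d} ==> f2 s = 0" "ALL e:E. ip f2 e = 0"
  using insert.IH[of m d] insert.prems m by auto
 define alpha where "alpha = (if ip f2 g = 0 then 0 else ip f2 g)"
 define beta where "beta = (if ip f2 g = 0 then 1 else - ip f1 g)"
 define f where "f = (%s. alpha * f1 s + beta * f2 s)"
 have c12: "continuous_on {a..b} f1" "continuous_on {a..b} f2" using f1(1) f2(1) continuous_on_subset by blast+
 have lin: "ip f e = alpha * ip f1 e + beta * ip f2 e" if e: "continuous_on {a..b} e" for e
 proof -
  have "ip f e = I (%x. alpha * (f1 x * e x) + beta * (f2 x * e x)) b"
   unfolding ip_def f_def by (simp add: algebra_simps)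
  also have "... = I (%x. alpha * (f1 x * e x)) b + I (%x. beta * (f2 x * e x)) b"
   by (rule I_add) (use c12 e ab in "auto intro!: continuous_intros")
  finally show ?thesis by (simp add: I_cmult ip_def)
 qed
 have "ip f e = 0" if "e : insert g E" for e
  using lin[of e] insert.prems(1)[OF that] that f1(4) f2(4) by (auto simp: alpha_def beta_def)
 moreover have "EX s:{c<..<d}. f s ~= 0"
 proof (cases "ip f2 g = 0")
  case True
  obtain s where s: "s : {m<..<d}" "f2 s ~= 0" using f2(2) by blast
  hence "f s ~= 0" using f1(3)[of s] True by (auto simp: f_def alpha_def beta_def)
  thus ?thesis using s m by (intro bexI[of _ s]) auto
 next
  case False
  obtain s where s: "s : {c<..<m}" "f1 s ~= 0" using f1(2) by blast
  hence "f s ~= 0" using f2(3)[of s] False by (auto simp: f_def alpha_def beta_def)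
  thus ?thesis using s m by (intro bexI[of _ s]) auto
 qed
 moreover have "f s = 0" if "s ~: {c<..<d}" for s using that m f1(3)[of s] f2(3)[of s] by (auto simp: f_def)
 moreover have "continuous_on UNIV f" unfolding f_def by (intro continuous_intros f1 f2)
 ultimately show ?case by (intro exI[of _ f] conjI allI ballI impI)
qed

text \<open>Given finitely many eigenvalues, take one eigenfunction for each. Iteration of \<open>K\<close> yields an eigenfunction orthogonal to all of them. It belongs to one of the given eigenvalues and is then a multiple of the eigenfunction chosen for it, hence orthogonal to itself.\<close>
theorem infinite_eigenvalues: "infinite eigenvalues"
proof
 assume fin: "finite eigenvalues"
 have "ALL l:eigenvalues. EX phi. continuous_on {a..b} phi & (EX s:{a..b}. phi s ~= 0) & sol l phi (I phi)"
  by (simp add: eigenvalues_def)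
 then obtain e where e: "!!l. l : eigenvalues ==> continuous_on {a..b} (e l)"
  "!!l. l : eigenvalues ==> EX s:{a..b}. e l s ~= 0" "!!l. l : eigenvalues ==> sol l (e l) (I (e l))"
  by (rule bchoice[THEN exE]) blast
 define E where "E = e ` (eigenvalues - {0})"
 have EX: "g : X & (EX m. ALL s:{a..b}. K g s = m * g s)" if gE: "g : E" for g
 proof -
  obtain l where l: "l : eigenvalues" "l ~= 0" "g = e l" using gE by (auto simp: E_def)
  have "ALL s:{a..b}. K g s = (1 / l) * g s"
   using sol_to_K(2)[OF e(1)[OF l(1)] e(3)[OF l(1)] l(2)] l by auto
  thus ?thesis using sol_to_K(1)[OF e(1)[OF l(1)] e(3)[OF l(1)] l(2)] l(3) by blast
 qed
 obtain f where f: "continuous_on UNIV f" "EX s:{a<..<b}. f s ~= 0" "ALL g:insert (%x. 1) E. ip f g = 0"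
 proof -
  have "continuous_on {a..b} g" if "g : insert (%x. 1) E" for g using that XD(1) EX by auto
  moreover have "finite (insert (%x. 1) E)" using fin by (simp add: E_def)
  ultimately show thesis using exists_orthogonal[of "insert (%x. 1) E" a b] ab that by blast
 qed
 have fX: "f : X" using f(1,3) continuous_on_subset by (auto simp: X_def ip_def)
 have f0: "EX s:{a..b}. f s ~= 0" using f(2) by force
 have orth: "ip f g = 0" if "g : E" for g using f(3) that by blast
 have "EX psi mu. psi : X & 0 < mu & (ALL s:{a..b}. K psi s = mu * psi s) & (EX s:{a..b}. psi s ~= 0) &
  (ALL g:E. ip psi g = 0)"
 proof (rule K_eigenfunction[of E f])
  show "g : X & (EX m. ALL s:{a..b}. K g s = m * g s)" if "g : E" for g by (rule EX[OF that])
  show "ip f g = 0" if "g : E" for g by (rule orth[OF that])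
  fix psi mu assume *: "psi : X" "0 < mu" "ALL s:{a..b}. K psi s = mu * psi s" "EX s:{a..b}. psi s ~= 0"
   "!!e. e : E ==> ip psi e = 0"
  show "EX psi mu. psi : X & 0 < mu & (ALL s:{a..b}. K psi s = mu * psi s) & (EX s:{a..b}. psi s ~= 0) &
   (ALL g:E. ip psi g = 0)"
   using * by (intro exI[of _ psi] exI[of _ mu]) simp
 qed (rule fX, rule f0)
 then obtain psi mu where psi: "psi : X" "0 < mu" "ALL s:{a..b}. K psi s = mu * psi s" "EX s:{a..b}. psi s ~= 0"
  "ALL g:E. ip psi g = 0" by (elim exE conjE)
 define l where "l = 1 / mu"
 have sol: "sol l psi (I psi)" unfolding l_def by (rule K_to_sol[OF psi(1-3)])
 have l: "l : eigenvalues" "l ~= 0" using sol psi XD(1) by (auto simp: eigenvalues_def l_def)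
 have "e l : E" using l by (simp add: E_def)
 note el = e(1)[OF l(1)] e(3)[OF l(1)]
 obtain t where t: "a < t" "t < b" "e l t ~= 0" using nonzero_inside[OF el(1) e(2)[OF l(1)]] by blast
 obtain c where c: "!!s. a < s ==> s < b ==> psi s = c * e l s"
  using sol_proportional[OF el(2) sol t] by blast
 have c': "psi s = c * e l s" if "s : {a..b}" for s
 proof -
  have "psi s - c * e l s = 0"
  proof (rule continuous_constant_on_closure[of "{a<..<b}" "%s. psi s - c * e l s"])
   show "continuous_on (closure {a<..<b}) (%s. psi s - c * e l s)"
    using ab XD(1)[OF psi(1)] el by (auto intro!: continuous_intros)
  qed (use c that ab in auto)
  thus ?thesis by simp
 qed
 have "ip psi psi = I (%x. c * (psi x * e l x)) b" unfolding ip_def using c' ab by (intro I_cong) auto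
 also have "... = 0" using psi(5)[rule_format, OF `e l : E`] by (simp add: I_cmult ip_def)
 finally have "I (%x. psi x * psi x) b = 0" by (simp add: ip_def)
 from I_nonneg_zero[OF continuous_on_mult[OF XD(1)[OF psi(1)] XD(1)[OF psi(1)]] _ this] psi(4)
 show False by auto
qed

text \<open>Eigenfunctions of sup norm one with bounded eigenvalues are uniformly Lipschitz, because \<open>phi = l * K phi\<close>. A uniform limit of a sequence of them would be orthogonal to itself.\<close>
theorem finite_eigenvalues_below: "finite {l : eigenvalues. l <= L}"
proof (rule ccontr)
 assume inf: "infinite {l : eigenvalues. l <= L}"
 define Q where "Q = {l : eigenvalues. l <= L & l ~= 0}"
 have "{l : eigenvalues. l <= L} <= insert 0 Q" by (auto simp: Q_def)
 hence "infinite Q" using inf finite_subset by blast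
 then obtain lam :: "nat => real" where lam: "inj lam" "range lam <= Q" using infinite_countable_subset by blast
 have "ALL n. EX phi. continuous_on {a..b} phi & (EX s:{a..b}. phi s ~= 0) & sol (lam n) phi (I phi)"
 proof
  fix n
  have "lam n : eigenvalues" using lam(2) by (auto simp: Q_def)
  thus "EX phi. continuous_on {a..b} phi & (EX s:{a..b}. phi s ~= 0) & sol (lam n) phi (I phi)"
   by (simp add: eigenvalues_def)
 qed
 then obtain e where e: "!!n. continuous_on {a..b} (e n)" "!!n. EX s:{a..b}. e n s ~= 0" "!!n. sol (lam n) (e n) (I (e n))"
  by metis
 have ln: "0 < lam n" "lam n <= L" for n
  using sol_eigenvalue_nonneg[OF e(1) e(3) e(2), of n] lam by (auto simp: Q_def less_le)
 have "EX x:{a..b}. ALL y:{a..b}. abs (e n y) <= abs (e n x)" for n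
 proof -
  have "continuous_on {a..b} (%s. abs (e n s))" using e(1) by (intro continuous_intros)
  from continuous_attains_sup[OF compact_Icc _ this] ab show ?thesis by auto
 qed
 then obtain x where x: "!!n. x n : {a..b}" "!!n y. y : {a..b} ==> abs (e n y) <= abs (e n (x n))" by metis
 define M where "M = (%n. abs (e n (x n)))"
 have M: "M n > 0" for n
 proof -
  obtain s where "s : {a..b}" "e n s ~= 0" using e(2) by blast
  thus ?thesis using x(2)[of s n] by (simp add: M_def)
 qed
 define y where "y = (%n s. e n s / M n)"
 have yc: "continuous_on {a..b} (y n)" for n unfolding y_def using M[of n] by (intro continuous_intros e) auto
 have ybd: "abs (y n s) <= 1" if "s : {a..b}" for n s
  using x(2)[OF that, of n] M[of n] by (simp add: y_def M_def abs_divide)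
 have ysol: "sol (lam n) (y n) (I (y n))" for n
 proof -
  have "sol (lam n) (%s. 1 / M n * e n s + 0 * e n s) (%s. 1 / M n * I (e n) s + 0 * I (e n) s)"
   by (rule sol_lin[OF e(3) e(3)])
  moreover have "(%s. 1 / M n * e n s + 0 * e n s) = y n" by (simp add: y_def)
  moreover have "(%s. 1 / M n * I (e n) s + 0 * I (e n) s) = I (y n)"
   using I_cmult[of "1 / M n" "e n"] by (auto simp: y_def)
  ultimately show ?thesis by simp
 qed
 obtain C where C: "C > 0" and C': "ALL f M. f : X --> (ALL x:{a..b}. abs (f x) <= M) -->
  (ALL s:{a..b}. abs (K f s) <= C * M) & (ALL s:{a..b}. ALL t:{a..b}. abs (K f s - K f t) <= C * M * abs (s - t))"
  using K_bound by (elim exE conjE)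
 have yK: "y n : X" "s : {a..b} ==> y n s = lam n * K (y n) s" for n s
  using sol_to_K[OF yc ysol] ln(1)[of n] by auto
 have L0: "0 < L" using ln[of 0] by linarith
 have ylip: "abs (y n s - y n t) <= L * C * abs (s - t)" if st: "s : {a..b}" "t : {a..b}" for n s t
 proof -
  have "abs (y n s - y n t) = lam n * abs (K (y n) s - K (y n) t)"
   using yK(2)[OF st(1), of n] yK(2)[OF st(2), of n] ln(1)[of n] by (simp add: abs_mult right_diff_distrib[symmetric])
  also have "... <= L * (C * 1 * abs (s - t))"
   using C'[rule_format, of "y n" 1] yK(1) ybd st ln[of n] by (intro mult_mono) auto
  finally show ?thesis by simp
 qed
 obtain g k where g: "continuous_on {a..b} g" and k: "strict_mono (k :: nat => nat)"
  and lim: "!!e. 0 < e ==> EX N. ALL n x. n >= N & x : {a..b} --> norm (y (k n) x - g x) < e"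
 proof (rule Arzela_Ascoli[of "{a..b}" y 1])
  fix x e :: real assume x: "x : {a..b}" and e: "0 < e"
  have "abs (y n x - y n z) < e" if "z : {a..b}" "abs (x - z) < e / (L * C)" for n z
  proof -
   have "abs (y n x - y n z) <= L * C * abs (x - z)" by (rule ylip[OF x that(1)])
   also have "... < L * C * (e / (L * C))" using that C L0 by (intro mult_strict_left_mono) auto
   also have "... = e" using C L0 by simp
   finally show ?thesis .
  qed
  thus "EX d. 0 < d & (ALL n z. z : {a..b} & norm (x - z) < d --> norm (y n x - y n z) < e)"
   using e C L0 by (intro exI[of _ "e / (L * C)"]) auto
 qed (use ybd in auto)
 have u: "uniform_limit {a..b} (%n. y (k n)) g sequentially"
  by (rule uniform_limitI) (use lim in "force simp: eventually_sequentially dist_real_def")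
 have u2: "uniform_limit {a..b} (%n. y (k (Suc n))) g sequentially"
  by (rule filterlim_compose[OF u filterlim_Suc])
 have "uniform_limit {a..b} (%n x. y (k n) x * y (k (Suc n)) x) (%x. g x * g x) sequentially"
  by (rule uniform_lim_mult[OF u u2]) (use g compact_imp_bounded[OF compact_continuous_image] in auto)
 hence "(%n. I (%x. y (k n) x * y (k (Suc n)) x) b) \<longlonglongrightarrow> I (%x. g x * g x) b"
  by (intro I_uniform_limit) (auto intro!: continuous_intros yc g)
 moreover have "I (%x. y (k n) x * y (k (Suc n)) x) b = 0" for n
 proof -
  have "k n ~= k (Suc n)" using strict_monoD[OF k, of n "Suc n"] by auto
  hence "lam (k n) ~= lam (k (Suc n))" using lam(1) by (auto dest: injD)
  from sol_orthogonal[OF yc yc ysol ysol this] show ?thesis by (simp add: ip_def)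
 qed
 ultimately have "I (%x. g x * g x) b = 0" by (simp add: LIMSEQ_const_iff)
 hence g0: "g s = 0" if "s : {a..b}" for s
  using I_nonneg_zero[OF continuous_on_mult[OF g g], of s] that by simp
 obtain N where "ALL n x. n >= N & x : {a..b} --> norm (y (k n) x - g x) < 1/2" using lim[of "1/2"] by auto
 hence "abs (y (k N) (x (k N)) - g (x (k N))) < 1/2" using x(1) by auto
 thus False using g0[OF x(1)] M[of "k N"] by (simp add: y_def abs_divide M_def)
qed

end

primrec C_seg :: "nat => real => real => (real => real) => bool" where
 "C_seg 0 a b f \<longleftrightarrow> continuous_on {a..b} f"
| "C_seg (Suc k) a b f \<longleftrightarrow>
   (EX f'. (ALL x:{a..b}. (f has_real_derivative f' x) (at x within {a..b})) & C_seg k a b f')"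

section \<open>Regularity up to the singular ends\<close>

lemma C_seg_cont: "C_seg k a b f ==> continuous_on {a..b} f"
 by (cases k) (auto intro: DERIV_continuous_on)

lemma C_seg_Suc: "C_seg (Suc k) a b f ==> C_seg k a b f"
proof (induction k arbitrary: f)
 case 0 thus ?case using C_seg_cont[of "Suc 0"] by simp
next
 case (Suc k)
 from Suc.prems obtain f' where "ALL x:{a..b}. (f has_real_derivative f' x) (at x within {a..b})" "C_seg (Suc k) a b f'"
  by (auto simp del: C_seg.simps(2) simp: C_seg.simps(2)[of "Suc k"])
 thus ?case using Suc.IH by auto
qed

lemma C_seg_cong: "C_seg k a b f ==> (!!x. x : {a..b} ==> f x = g x) ==> C_seg k a b g"
proof (cases k)
 case 0
 assume "C_seg k a b f" "!!x. x : {a..b} ==> f x = g x"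
 thus ?thesis using 0 continuous_on_eq[of "{a..b}" f g] by simp
next
 case (Suc j)
 assume *: "C_seg k a b f" "!!x. x : {a..b} ==> f x = g x"
 then obtain f' where f': "ALL x:{a..b}. (f has_real_derivative f' x) (at x within {a..b})" "C_seg j a b f'"
  using Suc by auto
 have "(g has_real_derivative f' x) (at x within {a..b})" if "x : {a..b}" for x
  by (rule has_field_derivative_transform_within[OF f'(1)[rule_format, OF that] zero_less_one that]) (use * in auto)
 hence "ALL x:{a..b}. (g has_real_derivative f' x) (at x within {a..b})" by blast
 thus ?thesis using Suc f'(2) C_seg.simps(2) by blast
qed

lemma C_seg_add: "C_seg k a b f ==> C_seg k a b g ==> C_seg k a b (%x. f x + g x)"
proof (induction k arbitrary: f g)
 case (Suc k)
 then obtain f' g' where "ALL x:{a..b}. (f has_real_derivative f' x) (at x within {a..b})" "C_seg k a b f'"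
  "ALL x:{a..b}. (g has_real_derivative g' x) (at x within {a..b})" "C_seg k a b g'" by auto
 thus ?case using Suc.IH[of f' g'] by (auto intro!: exI[of _ "%x. f' x + g' x"] DERIV_add)
qed (auto intro: continuous_intros)

lemma C_seg_mult: "C_seg k a b f ==> C_seg k a b g ==> C_seg k a b (%x. f x * g x)"
proof (induction k arbitrary: f g)
 case (Suc k)
 then obtain f' g' where *: "ALL x:{a..b}. (f has_real_derivative f' x) (at x within {a..b})" "C_seg k a b f'"
  "ALL x:{a..b}. (g has_real_derivative g' x) (at x within {a..b})" "C_seg k a b g'" by auto
 have "C_seg k a b (%x. f' x * g x + g' x * f x)"
  by (intro C_seg_add Suc.IH) (use * Suc.prems C_seg_Suc in blast)+
 moreover have "ALL x:{a..b}. ((%x. f x * g x) has_real_derivative f' x * g x + g' x * f x) (at x within {a..b})"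
  using * by (auto intro: DERIV_mult)
 ultimately show ?case by auto
qed (auto intro: continuous_intros)

lemma C_seg_const: "C_seg k a b (%x. c)"
 by (induction k arbitrary: c) (auto intro!: exI[of _ "%x. 0"])

lemma C_seg_cmult: "C_seg k a b f ==> C_seg k a b (%x. c * f x)"
 by (rule C_seg_mult[OF C_seg_const])

lemma deriv_within_of_interior:
 fixes f :: "real => real"
 assumes ab: "a < b" and f: "continuous_on {a..b} f" and g: "continuous_on {a..b} g"
  and der: "!!s. a < s ==> s < b ==> DERIV f s :> g s"
  and x: "x : {a..b}"
 shows "(f has_real_derivative g x) (at x within {a..b})"
proof -
 have eq: "integral {a..s} g + f a = f s" if s: "s : {a..b}" for s
 proof -
  have "(g has_integral (f s - f a)) {a..s}"
  proof (rule fundamental_theorem_of_calculus_interior)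
   show "(f has_vector_derivative g y) (at y)" if "y : {a<..<s}" for y
    using der[of y] that s by (auto simp: has_real_derivative_iff_has_vector_derivative)
  qed (use s f in "auto intro: continuous_on_subset")
  thus ?thesis by (simp add: integral_unique)
 qed
 have "((%s. integral {a..s} g + f a) has_real_derivative g x) (at x within {a..b})"
  using DERIV_add[OF integral_has_real_derivative[OF g x] DERIV_const[of "f a"]] by simp
 thus ?thesis
  by (rule has_field_derivative_transform_within[OF _ zero_less_one x]) (use eq in auto)
qed

text \<open>Induction on the order of differentiability. The rule of de l'Hospital gives continuity of \<open>y\<close> at the ends. The derivative \<open>y' = (B y + h) / A\<close> solves an equation of the same form, with \<open>B - A'\<close> in place of \<open>B\<close> and \<open>p A\<close> in place of \<open>p\<close>; the sign conditions on \<open>A'\<close> at the ends preserve those on \<open>B\<close>.\<close>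
lemma singular_first_order_regular:
 fixes A A' :: "real => real"
 assumes ab: "a < b"
  and A: "!!x. x : {a..b} ==> (A has_real_derivative A' x) (at x within {a..b})"
  and A': "!!k. C_seg k a b A'"
  and Apos: "!!s. a < s ==> s < b ==> 0 < A s" and A'a: "0 <= A' a" and A'b: "A' b <= 0"
 shows "[|!!k. C_seg k a b B; B a < 0; 0 < B b; !!s. a < s ==> s < b ==> 0 < p s;
   !!s. a < s ==> s < b ==> DERIV p s :> - B s * (p s / A s);
   tendsto p 0 (at_right a); tendsto p 0 (at_left b); C_seg k a b h;
   !!s. a < s ==> s < b ==> DERIV y s :> (B s * y s + h s) / A s;
   tendsto (%s. p s * y s) 0 (at_right a); tendsto (%s. p s * y s) 0 (at_left b)|]
   ==> EX z. C_seg k a b z & (ALL s. a < s --> s < b --> z s = y s)"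
proof (induction k arbitrary: B p h y)
 case 0
 note B = 0(1) and Ba = 0(2) and Bb = 0(3) and p = 0(4) and p' = 0(5) and pa = 0(6) and pb = 0(7)
  and h = 0(8) and y' = 0(9) and ya = 0(10) and yb = 0(11)
 have py: "DERIV (%s. p s * y s) s :> h s * (p s / A s)" if s: "a < s" "s < b" for s
  using DERIV_mult[OF p'[OF s] y'[OF s]] Apos[OF s] by (simp add: field_simps)
 have hc: "continuous_on {a..b} h" and Bc: "continuous_on {a..b} B" using h B[of 0] by auto
 have v: "0 < p s / A s" if "a < s" "s < b" for s using p[OF that] Apos[OF that] by simp
 have La: "tendsto (%s. p s * y s / p s) (- h a / B a) (at_right a)"
  by (rule weighted_lhopital_right[OF ab pa v p p' Bc Ba ya hc py])
 have Lb: "tendsto (%s. p s * y s / p s) (- h b / B b) (at_left b)"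
  by (rule weighted_lhopital_left[OF ab pb v p p' Bc Bb yb hc py])
 define z where "z = (%s. if s = a then - h a / B a else if s = b then - h b / B b else p s * y s / p s)"
 have "continuous_on {a..b} z" unfolding z_def
  by (intro continuous_on_Icc_extension ab La Lb continuous_intros DERIV_isCont[OF y'] DERIV_isCont[OF p']) (use p in force)+
 thus ?case using p by (intro exI[of _ z]) (force simp: z_def)
next
 case (Suc k)
 note B = Suc.prems(1) and Ba = Suc.prems(2) and Bb = Suc.prems(3) and p = Suc.prems(4) and p' = Suc.prems(5)
  and pa = Suc.prems(6) and pb = Suc.prems(7) and h = Suc.prems(8) and y' = Suc.prems(9)
  and ya = Suc.prems(10) and yb = Suc.prems(11)
 obtain h' where h': "!!x. x : {a..b} ==> (h has_real_derivative h' x) (at x within {a..b})" "C_seg k a b h'"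
  using h unfolding C_seg.simps by blast
 obtain B' where B': "!!x. x : {a..b} ==> (B has_real_derivative B' x) (at x within {a..b})" "C_seg k a b B'"
  using B[of "Suc k"] unfolding C_seg.simps by blast
 have hk: "C_seg k a b h" by (rule C_seg_Suc[OF h])
 obtain z0 where z0: "C_seg k a b z0" "!!s. a < s ==> s < b ==> z0 s = y s"
  using Suc.IH[OF B Ba Bb p p' pa pb hk y' ya yb] by blast
 have at: "DERIV f s :> d" if "(f has_real_derivative d) (at s within {a..b})" "a < s" "s < b" for f d s
  using that at_within_interior[of s "{a..b}"] by auto
 define B2 where "B2 = (%s. B s + (-1) * A' s)"
 define h2 where "h2 = (%s. B' s * z0 s + h' s)"
 define p2 where "p2 = (%s. p s * A s)"
 define y2 where "y2 = (%s. (B s * y s + h s) / A s)"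
 have cA: "continuous_on {a..b} A" using A by (intro DERIV_continuous_on) auto
 have limA: "tendsto A (A a) (at_right a)" "tendsto A (A b) (at_left b)"
  using continuous_on_Icc_at_rightD[OF cA ab] continuous_on_Icc_at_leftD[OF cA ab] by auto
 have ch: "continuous_on {a..b} h" and cB: "continuous_on {a..b} B" using C_seg_cont[OF h] B[of 0] by auto
 have limh: "tendsto h (h a) (at_right a)" "tendsto h (h b) (at_left b)"
  using continuous_on_Icc_at_rightD[OF ch ab] continuous_on_Icc_at_leftD[OF ch ab] by auto
 have limB: "tendsto B (B a) (at_right a)" "tendsto B (B b) (at_left b)"
  using continuous_on_Icc_at_rightD[OF cB ab] continuous_on_Icc_at_leftD[OF cB ab] by auto
 have p2y2: "p2 s * y2 s = B s * (p s * y s) + p s * h s" if "a < s" "s < b" for s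
  using Apos[OF that] by (simp add: p2_def y2_def field_simps)
 have "EX z. C_seg k a b z & (ALL s. a < s --> s < b --> z s = y2 s)"
 proof (rule Suc.IH[where B = B2 and p = p2 and h = h2])
  show "C_seg k a b B2" for k unfolding B2_def by (intro C_seg_add B C_seg_cmult A')
  show "B2 a < 0" "0 < B2 b" using Ba Bb A'a A'b by (auto simp: B2_def)
  show "0 < p2 s" if "a < s" "s < b" for s using p[OF that] Apos[OF that] by (simp add: p2_def)
  show "DERIV p2 s :> - B2 s * (p2 s / A s)" if s: "a < s" "s < b" for s
   using DERIV_mult[OF p'[OF s] at[OF A s]] s Apos[OF s] by (simp add: p2_def[abs_def] B2_def field_simps)
  show "tendsto p2 0 (at_right a)" using tendsto_mult[OF pa limA(1)] by (simp add: p2_def[abs_def])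
  show "tendsto p2 0 (at_left b)" using tendsto_mult[OF pb limA(2)] by (simp add: p2_def[abs_def])
  show "C_seg k a b h2" unfolding h2_def by (intro C_seg_add C_seg_mult B' z0 h')
  show "DERIV y2 s :> (B2 s * y2 s + h2 s) / A s" if s: "a < s" "s < b" for s
  proof -
   have s': "s : {a..b}" using s by auto
   have "DERIV (%s. B s * y s + h s) s :> B' s * y s + (B s * y s + h s) / A s * B s + h' s"
    by (intro DERIV_add DERIV_mult y'[OF s] at[OF B'(1)[OF s'] s] at[OF h'(1)[OF s'] s])
   from DERIV_divide[OF this at[OF A[OF s'] s]] Apos[OF s]
   have "DERIV y2 s :> ((B' s * y s + (B s * y s + h s) / A s * B s + h' s) * A s - (B s * y s + h s) * A' s) / (A s * A s)"
    by (simp add: y2_def[abs_def])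
   moreover have "((B' s * y s + (B s * y s + h s) / A s * B s + h' s) * A s - (B s * y s + h s) * A' s) / (A s * A s)
     = (B2 s * y2 s + h2 s) / A s"
    using Apos[OF s] z0(2)[OF s] by (simp add: B2_def y2_def h2_def field_simps)
   ultimately show ?thesis by simp
  qed
  have "tendsto (%s. B s * (p s * y s) + p s * h s) (B a * 0 + 0 * h a) (at_right a)"
   by (intro tendsto_intros limB ya pa limh)
  hence L: "tendsto (%s. B s * (p s * y s) + p s * h s) 0 (at_right a)" by simp
  show "tendsto (%s. p2 s * y2 s) 0 (at_right a)"
  proof (rule Lim_transform_eventually[OF L])
   show "eventually (%s. B s * (p s * y s) + p s * h s = p2 s * y2 s) (at_right a)"
    using eventually_inside_right[OF ab] by eventually_elim (use p2y2 in simp)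
  qed
  have "tendsto (%s. B s * (p s * y s) + p s * h s) (B b * 0 + 0 * h b) (at_left b)"
   by (intro tendsto_intros limB yb pb limh)
  hence L: "tendsto (%s. B s * (p s * y s) + p s * h s) 0 (at_left b)" by simp
  show "tendsto (%s. p2 s * y2 s) 0 (at_left b)"
  proof (rule Lim_transform_eventually[OF L])
   show "eventually (%s. B s * (p s * y s) + p s * h s = p2 s * y2 s) (at_left b)"
    using eventually_inside_left[OF ab] by eventually_elim (use p2y2 in simp)
  qed
 qed
 then obtain z where z: "C_seg k a b z" "!!s. a < s ==> s < b ==> z s = y2 s" by blast
 have "(z0 has_real_derivative z x) (at x within {a..b})" if "x : {a..b}" for x
 proof (rule deriv_within_of_interior[OF ab C_seg_cont[OF z0(1)] C_seg_cont[OF z(1)] _ that])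
  fix s assume s: "a < s" "s < b"
  have "DERIV z0 s :> y2 s" unfolding y2_def
   by (rule DERIV_local[OF y'[OF s], of "{a<..<b}"]) (use z0(2) s in auto)
  thus "DERIV z0 s :> z s" using z(2)[OF s] by simp
 qed
 hence "ALL x:{a..b}. (z0 has_real_derivative z x) (at x within {a..b})" by blast
 hence "C_seg (Suc k) a b z0" using z(1) C_seg.simps(2) by blast
 thus ?case using z0(2) by blast
qed

text \<open>The derivative \<open>y = phi'\<close> satisfies \<open>A y' = B y - l phi\<close>, so each order of regularity of \<open>phi\<close> gives one more.\<close>
lemma (in sturm_liouville) sol_smooth:
 assumes A: "!!x. x : {a..b} ==> (A has_real_derivative A' x) (at x within {a..b})"
  and A': "!!k. C_seg k a b A'"
  and Apos: "!!s. a < s ==> s < b ==> 0 < A s" and A'a: "0 <= A' a" and A'b: "A' b <= 0"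
  and B: "!!k. C_seg k a b B" and pA: "!!s. a < s ==> s < b ==> p s = A s * v s"
  and c: "continuous_on {a..b} phi" and sol: "sol l phi (I phi)"
 shows "C_seg k a b phi"
proof (induction k)
 case 0 thus ?case using c by simp
next
 case (Suc k)
 define y where "y = (%s. - (l * I phi s / p s))"
 have v: "v s = p s / A s" if "a < s" "s < b" for s using pA[OF that] Apos[OF that] by simp
 have "EX z. C_seg k a b z & (ALL s. a < s --> s < b --> z s = y s)"
 proof (rule singular_first_order_regular[OF ab A A' Apos A'a A'b B B_a B_b p_pos])
  show "C_seg k a b (%s. - l * phi s)" by (rule C_seg_cmult[OF Suc])
  show "DERIV p s :> - B s * (p s / A s)" if "a < s" "s < b" for s
   using derp[OF that] v[OF that] by simp
  show "DERIV y s :> (B s * y s + - l * phi s) / A s" if s: "a < s" "s < b" for s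
  proof -
   have "((%s. - (l * I phi s / p s)) has_real_derivative
     - ((l * (phi s * v s) * p s - l * I phi s * (- B s * v s)) / (p s * p s))) (at s)"
    by (intro DERIV_minus DERIV_divide DERIV_cmult I_deriv[OF c s] derp[OF s]) (use p_pos[OF s] in simp)
   moreover have "- ((l * (phi s * v s) * p s - l * I phi s * (- B s * v s)) / (p s * p s)) = (B s * y s + - l * phi s) / A s"
    using Apos[OF s] v_pos[OF s] by (simp add: y_def pA[OF s] field_simps)
   ultimately show ?thesis by (simp add: y_def[abs_def])
  qed
  have eq: "- l * I phi s = p s * y s" if "a < s" "s < b" for s
   using p_pos[OF that] by (simp add: y_def)
  show "tendsto (%s. p s * y s) 0 (at_right a)"
  proof (rule Lim_transform_eventually)
   show "eventually (%s. - l * I phi s = p s * y s) (at_right a)" using ev_a by eventually_elim (use eq in auto)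
   show "tendsto (%s. - l * I phi s) 0 (at_right a)" using I_lim(1)[OF c] by (rule tendsto_mult_right_zero)
  qed
  show "tendsto (%s. p s * y s) 0 (at_left b)"
  proof (rule Lim_transform_eventually)
   show "eventually (%s. - l * I phi s = p s * y s) (at_left b)" using ev_b by eventually_elim (use eq in auto)
   have "tendsto (%s. - (l * I phi s)) (- 0) (at_left b)"
    by (intro tendsto_minus) (use sol in "simp add: sol_def")
   thus "tendsto (%s. - l * I phi s) 0 (at_left b)" by simp
  qed
 qed (use p_a p_b in auto)
 then obtain z where z: "C_seg k a b z" "!!s. a < s ==> s < b ==> z s = y s" by blast
 have "(phi has_real_derivative z x) (at x within {a..b})" if "x : {a..b}" for x
 proof (rule deriv_within_of_interior[OF ab c C_seg_cont[OF z(1)] _ that])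
  show "DERIV phi s :> z s" if "a < s" "s < b" for s
   using sol_deriv(1)[OF sol that] z(2)[OF that] by (simp add: y_def)
 qed
 hence "ALL x:{a..b}. (phi has_real_derivative z x) (at x within {a..b})" by blast
 thus ?case using z(1) C_seg.simps(2) by blast
qed

lemma (in sturm_liouville) sol_equation:
 assumes A: "!!x. x : {a..b} ==> (A has_real_derivative A' x) (at x within {a..b})"
  and pA: "!!s. a < s ==> s < b ==> p s = A s * v s"
  and c: "continuous_on {a..b} phi" and sol: "sol l phi (I phi)"
  and 1: "!!x. x : {a..b} ==> (phi has_real_derivative phi1 x) (at x within {a..b})"
  and 2: "!!x. x : {a..b} ==> (phi1 has_real_derivative phi2 x) (at x within {a..b})"
  and c2: "continuous_on {a..b} phi2" and x: "x : {a..b}"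
 shows "A x * phi2 x - B x * phi1 x + l * phi x = 0"
proof (rule continuous_constant_on_closure[of "{a<..<b}" "%x. A x * phi2 x - B x * phi1 x + l * phi x"])
 have cA: "continuous_on {a..b} A" using A by (intro DERIV_continuous_on) auto
 have c1: "continuous_on {a..b} phi1" using 2 by (intro DERIV_continuous_on) auto
 show "continuous_on (closure {a<..<b}) (%x. A x * phi2 x - B x * phi1 x + l * phi x)"
  using ab cA c1 c2 c contB by (auto intro!: continuous_intros)
 show "x : closure {a<..<b}" using x ab by simp
 have at: "DERIV f s :> d" if "(f has_real_derivative d) (at s within {a..b})" "a < s" "s < b" for f d s
  using that at_within_interior[of s "{a..b}"] by auto
 fix s assume "s : {a<..<b}"
 hence s: "a < s" "s < b" "s : {a..b}" by auto
 have p1: "p t * phi1 t = - (l * I phi t)" if t: "a < t" "t < b" for t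
  using DERIV_unique[OF at[OF 1 t] sol_deriv(1)[OF sol t]] t p_pos[OF t] by simp
 have "DERIV (%t. p t * phi1 t) s :> - (l * (phi s * v s))"
  by (rule DERIV_local[OF DERIV_minus[OF DERIV_cmult[OF I_deriv[OF c s(1,2)]]], of "{a<..<b}"])
    (use p1 s in auto)
 from DERIV_unique[OF this DERIV_mult[OF derp[OF s(1,2)] at[OF 2[OF s(3)] s(1,2)]]]
 have "v s * (A s * phi2 s - B s * phi1 s + l * phi s) = 0" using pA[OF s(1,2)] by (simp add: algebra_simps)
 thus "A s * phi2 s - B s * phi1 s + l * phi s = 0" using v_pos[OF s(1,2)] by simp
qed

section \<open>Calculus of finitely differentiable functions\<close>

lemma Ck_on_subset: "Ck_on k U f ==> V <= U ==> Ck_on k V f"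
 by (induction k arbitrary: f) (auto intro: continuous_on_subset differentiable_on_subset)

lemma differentiable_onD: "f differentiable_on U ==> open U ==> x : U ==> f differentiable (at x)"
 by (metis differentiable_on_def at_within_open)

lemma Ck_on_cong:
 assumes "open U"
 shows "Ck_on k U f ==> (!!x. x : U ==> f x = g x) ==> Ck_on k U g"
proof (induction k arbitrary: f g)
 case 0 thus ?case using continuous_on_eq by fastforce
next
 case (Suc k)
 have d: "f differentiable (at x)" if "x : U" for x
  by (rule differentiable_onD[OF _ assms that]) (use Suc.prems(1) in simp)
 have e: "frechet_derivative f (at x) = frechet_derivative g (at x)" if "x : U" for x
  by (rule frechet_derivative_transform_within_open[OF d[OF that] assms that Suc.prems(2)])
 have "g differentiable (at x)" if xU: "x : U" for x
 proof -
  obtain D where "(f has_derivative D) (at x)" using d[OF xU] by (auto simp: differentiable_def)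
  hence "(g has_derivative D) (at x)"
   by (rule has_derivative_transform_within_open[OF _ assms xU Suc.prems(2)])
  thus ?thesis by (auto simp: differentiable_def)
 qed
 hence "g differentiable_on U"
  by (simp add: differentiable_at_imp_differentiable_on)
 moreover have "Ck_on k U (%y. frechet_derivative g (at y) b)" if "b : Basis" for b
  by (rule Suc.IH[of "%y. frechet_derivative f (at y) b"]) (use Suc.prems(1) that e in auto)
 ultimately show ?case by simp
qed

lemma Ck_on_Suc: "Ck_on (Suc k) U f ==> Ck_on k U f"
proof (induction k arbitrary: f)
 case 0 thus ?case by (simp add: differentiable_imp_continuous_on)
next
 case (Suc k)
 show ?case unfolding Ck_on.simps(2)[of k]
 proof (intro conjI ballI)
  show "f differentiable_on U" using Suc.prems by simp
  fix b :: 'a assume "b : Basis"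
  hence "Ck_on (Suc k) U (%y. frechet_derivative f (at y) b)"
   using Suc.prems unfolding Ck_on.simps(2)[of "Suc k"] by blast
  thus "Ck_on k U (%y. frechet_derivative f (at y) b)" by (rule Suc.IH)
 qed
qed

lemma Ck_on_le: "Ck_on k U f ==> j <= k ==> Ck_on j U f"
 by (induction k) (auto simp del: Ck_on.simps(2) simp: le_Suc_eq intro: Ck_on_Suc)

lemma Ck_on_cont: "Ck_on k U f ==> continuous_on U f"
 using Ck_on_le[of k U f 0] by simp

lemma Ck_on_differentiable: "Ck_on (Suc k) U f ==> open U ==> x : U ==> f differentiable (at x)"
 using differentiable_onD by auto

lemma Ck_on_has_derivative:
 "Ck_on (Suc k) U f ==> open U ==> x : U ==> (f has_derivative frechet_derivative f (at x)) (at x)"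
 using Ck_on_differentiable frechet_derivative_works by blast

lemma Ck_on_SucI:
 fixes f :: "'e::euclidean_space => 'f::real_normed_vector"
 assumes U: "open U" and der: "!!x. x : U ==> (f has_derivative D x) (at x)"
  and k: "!!b. b : Basis ==> Ck_on k U (%x. D x b)"
 shows "Ck_on (Suc k) U f"
proof -
 have "f differentiable_on U"
  using der unfolding differentiable_def by (intro differentiable_at_imp_differentiable_on) (auto simp: differentiable_def)
 moreover have "Ck_on k U (%y. frechet_derivative f (at y) b)" if "b : Basis" for b
  by (rule Ck_on_cong[OF U k[OF that]]) (use frechet_derivative_at[OF der] in auto)
 ultimately show ?thesis by simp
qed

lemma Ck_on_const: "Ck_on k U (%x. c)"
 by (induction k arbitrary: c) (auto simp: frechet_derivative_const)

lemma Ck_on_add: "open U ==> Ck_on k U f ==> Ck_on k U g ==> Ck_on k U (%x. f x + g x)"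
proof (induction k arbitrary: f g)
 case 0 thus ?case by (auto intro: continuous_intros)
next
 case (Suc k)
 show ?case
  by (rule Ck_on_SucI[OF Suc.prems(1) has_derivative_add[OF Ck_on_has_derivative[OF Suc.prems(2,1)] Ck_on_has_derivative[OF Suc.prems(3,1)]]])
    (use Suc in auto)
qed

lemma Ck_on_mult:
 fixes f g :: "'e::euclidean_space => real"
 shows "open U ==> Ck_on k U f ==> Ck_on k U g ==> Ck_on k U (%x. f x * g x)"
proof (induction k arbitrary: f g)
 case 0 thus ?case by (auto intro: continuous_intros)
next
 case (Suc k)
 note fk = Ck_on_Suc[OF Suc.prems(2)] and gk = Ck_on_Suc[OF Suc.prems(3)]
 show ?case
  by (rule Ck_on_SucI[OF Suc.prems(1) has_derivative_mult[OF Ck_on_has_derivative[OF Suc.prems(2,1)] Ck_on_has_derivative[OF Suc.prems(3,1)]]])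
    (use Suc fk gk in "auto intro!: Ck_on_add")
qed

lemma Ck_on_cmult:
 fixes f :: "'e::euclidean_space => real"
 shows "open U ==> Ck_on k U f ==> Ck_on k U (%x. c * f x)"
 by (intro Ck_on_mult Ck_on_const)

lemma Ck_on_diff:
 fixes f g :: "'e::euclidean_space => real"
 shows "open U ==> Ck_on k U f ==> Ck_on k U g ==> Ck_on k U (%x. f x - g x)"
 using Ck_on_add[of U k f "%x. (-1) * g x"] Ck_on_cmult[of U k g "-1"] by simp

lemma Ck_on_sum: "open U ==> (!!i. i : S ==> Ck_on k U (f i)) ==> Ck_on k U (%x. SUM i:S. f i x)"
 by (induction S rule: infinite_finite_induct) (auto intro: Ck_on_const Ck_on_add)

lemma Ck_on_prod:
 fixes f :: "'i => 'e::euclidean_space => real"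
 shows "open U ==> (!!i. i : S ==> Ck_on k U (f i)) ==> Ck_on k U (%x. PROD i:S. f i x)"
 by (induction S rule: infinite_finite_induct) (auto intro: Ck_on_const Ck_on_mult)

lemma Ck_on_bounded_linear:
 assumes L: "bounded_linear L"
 shows "open U ==> Ck_on k U f ==> Ck_on k U (%x. L (f x))"
proof (induction k arbitrary: f)
 case 0 thus ?case using bounded_linear.continuous_on[OF L] by auto
next
 case (Suc k)
 show ?case
  by (rule Ck_on_SucI[OF Suc.prems(1) bounded_linear.has_derivative[OF L Ck_on_has_derivative[OF Suc.prems(2,1)]]])
    (use Suc in auto)
qed

lemma Ck_on_id: "open U ==> Ck_on k U (%x. x)"
proof (induction k)
 case (Suc k)
 show ?case by (rule Ck_on_SucI[OF Suc.prems has_derivative_ident]) (rule Ck_on_const)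
qed auto

lemma Ck_on_compose:
 fixes f :: "'e::euclidean_space => real" and tau :: "'d::euclidean_space => 'e"
 assumes U: "open U" and V: "open V" and im: "tau ` V <= U"
 shows "Ck_on k U f ==> Ck_on k V tau ==> Ck_on k V (%x. f (tau x))"
proof (induction k arbitrary: f)
 case 0 thus ?case using im by (auto intro: continuous_on_compose2)
next
 case (Suc k)
 have tau: "(tau has_derivative frechet_derivative tau (at x)) (at x)" if "x : V" for x
  by (rule Ck_on_has_derivative[OF Suc.prems(2) V that])
 have f: "(f has_derivative frechet_derivative f (at (tau x))) (at (tau x))" if "x : V" for x
  by (rule Ck_on_has_derivative[OF Suc.prems(1) U]) (use that im in auto)
 have exp: "frechet_derivative f (at (tau x)) v = (SUM i:Basis. (v \<bullet> i) * frechet_derivative f (at (tau x)) i)" if "x : V" for x v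
 proof -
  have lin: "linear (frechet_derivative f (at (tau x)))" using has_derivative_linear[OF f[OF that]] .
  have "frechet_derivative f (at (tau x)) (SUM i:Basis. (v \<bullet> i) *\<^sub>R i) = (SUM i:Basis. (v \<bullet> i) *\<^sub>R frechet_derivative f (at (tau x)) i)"
   by (simp add: linear_sum[OF lin] linear_cmul[OF lin])
  thus ?thesis by (simp add: euclidean_representation)
 qed
 show ?case
 proof (rule Ck_on_SucI[OF V])
  show "((%x. f (tau x)) has_derivative (%v. SUM i:Basis. (frechet_derivative tau (at x) v \<bullet> i) * frechet_derivative f (at (tau x)) i)) (at x)"
   if "x : V" for x
   using diff_chain_at[OF tau[OF that] f[OF that]] unfolding o_def exp[OF that, symmetric] .
  show "Ck_on k V (%x. SUM i:Basis. (frechet_derivative tau (at x) b \<bullet> i) * frechet_derivative f (at (tau x)) i)" if "b : Basis" for b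
  proof (intro Ck_on_sum V Ck_on_mult)
   fix i :: 'e assume i: "i : Basis"
   show "Ck_on k V (%x. frechet_derivative tau (at x) b \<bullet> i)"
    using Suc.prems(2) that by (intro Ck_on_bounded_linear[OF bounded_linear_inner_left] V) auto
   show "Ck_on k V (%x. frechet_derivative f (at (tau x)) i)"
    by (rule Suc.IH[OF _ Ck_on_Suc[OF Suc.prems(2)]]) (use Suc.prems i in auto)
  qed
 qed
qed

text \<open>The outer function is differentiable only within \<open>{a..b}\<close>, possibly at an end, where \<open>f\<close> has an extremum.\<close>
lemma Ck_on_C_seg_compose:
 fixes f :: "'e::euclidean_space => real"
 assumes U: "open U" and im: "f ` U <= {a..b}"
 shows "C_seg k a b psi ==> Ck_on k U f ==> Ck_on k U (%x. psi (f x))"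
proof (induction k arbitrary: psi)
 case 0 thus ?case using im by (auto intro: continuous_on_compose2)
next
 case (Suc k)
 obtain psi' where psi': "ALL x:{a..b}. (psi has_real_derivative psi' x) (at x within {a..b})" "C_seg k a b psi'"
  using Suc.prems(1) by auto
 show ?case
 proof (rule Ck_on_SucI[OF U])
  fix x assume x: "x : U"
  have 1: "(f has_derivative frechet_derivative f (at x)) (at x within U)"
   by (rule has_derivative_at_withinI[OF Ck_on_has_derivative[OF Suc.prems(2) U x]])
  have 2: "(psi has_derivative (*) (psi' (f x))) (at (f x) within f ` U)"
   by (rule has_derivative_subset[OF _ im]) (use psi'(1) x im in "auto simp: has_field_derivative_def")
  show "((%x. psi (f x)) has_derivative (%v. psi' (f x) * frechet_derivative f (at x) v)) (at x)"
   using has_derivative_in_compose[OF 1 2] at_within_open[OF x U] by simp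
 next
  fix b :: 'e assume "b : Basis"
  thus "Ck_on k U (%x. psi' (f x) * frechet_derivative f (at x) b)"
   using Suc.prems by (intro Ck_on_mult[OF U Suc.IH[OF psi'(2) Ck_on_Suc[OF Suc.prems(2)]]]) auto
 qed
qed

lemma C_seg_of_Ck_on:
 fixes g :: "real => real"
 assumes U: "open U" and sub: "{a..b} <= U"
 shows "Ck_on k U g ==> C_seg k a b g"
proof (induction k arbitrary: g)
 case 0 thus ?case using continuous_on_subset[OF _ sub] by simp
next
 case (Suc k)
 have "(g has_real_derivative frechet_derivative g (at x) 1) (at x within {a..b})" if "x : {a..b}" for x
 proof -
  have d: "(g has_derivative frechet_derivative g (at x)) (at x)"
   by (rule Ck_on_has_derivative[OF Suc.prems U]) (use that sub in auto)
  have "frechet_derivative g (at x) = (*) (frechet_derivative g (at x) 1)"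
  proof
   fix r show "frechet_derivative g (at x) r = frechet_derivative g (at x) 1 * r"
    using linear_cmul[OF has_derivative_linear[OF d], of r 1] by simp
  qed
  hence "DERIV g x :> frechet_derivative g (at x) 1"
   unfolding has_field_derivative_def by (rule has_derivative_eq_rhs[OF d])
  thus ?thesis by (rule has_field_derivative_at_within)
 qed
 moreover have "C_seg k a b (%x. frechet_derivative g (at x) 1)"
  by (rule Suc.IH) (use Suc.prems in auto)
 ultimately show ?case unfolding C_seg.simps
  by (intro exI[of _ "%x. frechet_derivative g (at x) 1"] conjI ballI)
qed

lemma Ck_on_real_fun:
 fixes f f' :: "real => real"
 assumes "open J" "!!x. x : J ==> DERIV f x :> f' x" "Ck_on k J f'"
 shows "Ck_on (Suc k) J f"
proof (rule Ck_on_SucI[OF assms(1), of f "%x. (*) (f' x)"])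
 show "(f has_derivative (*) (f' x)) (at x)" if "x : J" for x
  using assms(2)[OF that] by (simp add: has_field_derivative_def)
 show "Ck_on k J (%x. f' x * b)" if "b : Basis" for b
  using assms(3) that by simp
qed

lemma C1_on_inverse:
 fixes f :: "'e::euclidean_space => real"
 assumes "open U" "Ck_on (Suc 0) U f" "!!x. x : U ==> f x ~= 0"
 shows "Ck_on (Suc 0) U (%x. inverse (f x))"
proof (rule Ck_on_compose[of "- {0}" U f "Suc 0" inverse])
 show "Ck_on (Suc 0) (- {0::real}) inverse"
 proof (rule Ck_on_real_fun[of _ _ "%x. - (inverse x ^ Suc (Suc 0))"])
  show "DERIV inverse x :> - (inverse x ^ Suc (Suc 0))" if "x : - {0}" for x :: real
   using that by (intro DERIV_inverse) simp
  show "Ck_on 0 (- {0::real}) (%x. - (inverse x ^ Suc (Suc 0)))"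
   by (auto intro!: continuous_intros)
 qed auto
qed (use assms in auto)

lemma C1_on_divide:
 fixes f g :: "'e::euclidean_space => real"
 assumes "open U" "Ck_on (Suc 0) U f" "Ck_on (Suc 0) U g" "!!x. x : U ==> g x ~= 0"
 shows "Ck_on (Suc 0) U (%x. f x / g x)"
 unfolding divide_inverse by (intro Ck_on_mult C1_on_inverse assms)

lemma C1_on_sqrt:
 fixes f :: "'e::euclidean_space => real"
 assumes "open U" "Ck_on (Suc 0) U f" "!!x. x : U ==> 0 < f x"
 shows "Ck_on (Suc 0) U (%x. sqrt (f x))"
proof (rule Ck_on_compose[of "{0<..}" U f "Suc 0" sqrt])
 show "Ck_on (Suc 0) {0<..} sqrt"
 proof (rule Ck_on_real_fun[of _ _ "%x. inverse (sqrt x) / 2"])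
  show "DERIV sqrt x :> inverse (sqrt x) / 2" if "x : {0<..}" for x :: real
   using that by (intro DERIV_real_sqrt) simp
  show "Ck_on 0 {0<..} (%x::real. inverse (sqrt x) / 2)"
   by (auto intro!: continuous_intros)
 qed auto
qed (use assms in auto)

lemma Ck_on_det:
 fixes g :: "'e::euclidean_space => real^'n^'n"
 assumes "open U" "!!i j. Ck_on k U (%x. g x $ i $ j)"
 shows "Ck_on k U (%x. det (g x))"
 unfolding det_def by (intro Ck_on_sum Ck_on_mult Ck_on_const Ck_on_prod assms)

lemma matrix_inv_works:
 fixes A :: "real^'n^'n"
 assumes "det A ~= 0" shows "A ** matrix_inv A = mat 1" "matrix_inv A ** A = mat 1"
 using assms invertible_det_nz[of A] someI_ex[of "%B. A ** B = mat 1 & B ** A = mat 1"]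
 by (auto simp: invertible_def matrix_inv_def)

text \<open>Cramer's rule turns regularity of the inverse metric into that of determinants.\<close>
lemma matrix_inv_cramer:
 fixes A :: "real^'n^'n"
 assumes "det A ~= 0"
 shows "(matrix_inv A *v d) $ k = det (\<chi> i j. if j = k then d $ i else A $ i $ j) / det A"
proof -
 have "A *v (matrix_inv A *v d) = d"
  by (simp add: matrix_vector_mul_assoc matrix_inv_works[OF assms])
 hence "matrix_inv A *v d = (\<chi> k. det (\<chi> i j. if j = k then d $ i else A $ i $ j) / det A)"
  using cramer[OF assms] by blast
 thus ?thesis by simp
qed

lemma C1_on_matrix_inv:
 fixes g :: "'e::euclidean_space => real^'n^'n" and d :: "'e => real^'n"
 assumes U: "open U" and g: "!!i j. Ck_on (Suc 0) U (%x. g x $ i $ j)"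
  and d: "!!i. Ck_on (Suc 0) U (%x. d x $ i)" and nz: "!!x. x : U ==> det (g x) ~= 0"
 shows "Ck_on (Suc 0) U (%x. (matrix_inv (g x) *v d x) $ k)"
proof (rule Ck_on_cong[OF U])
 have "Ck_on (Suc 0) U (%x. (\<chi> i j. if j = k then d x $ i else g x $ i $ j) $ i $ j)" for i j :: 'n
  using g d by (cases "j = k") auto
 thus "Ck_on (Suc 0) U (%x. det (\<chi> i j. if j = k then d x $ i else g x $ i $ j) / det (g x))"
  by (intro C1_on_divide Ck_on_det U g nz)
qed (use matrix_inv_cramer[OF nz] in auto)

lemma smooth_on_openD: "smooth_on S f ==> open S ==> Ck_on k S f"
 unfolding smooth_on_def by (metis Ck_on_cong Ck_on_subset)

lemma smooth_on_openI: "open S ==> (!!k. Ck_on k S f) ==> smooth_on S f"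
 unfolding smooth_on_def by blast

lemma smooth_on_C_seg: "smooth_on {a..b} (f :: real => real) ==> C_seg k a b f"
 unfolding smooth_on_def using C_seg_of_Ck_on C_seg_cong by metis

lemma axis_Basis: "axis i (1::real) : Basis"
 by (rule axis_in_Basis_iff[THEN iffD2]) simp

lemma Ck_on_partial: "Ck_on (Suc k) U f ==> Ck_on k U (partial i f)"
 unfolding partial_def[abs_def] using axis_Basis by auto

lemma partial_eq: "(f has_derivative D) (at y) ==> partial i f y = D (axis i 1)"
 unfolding partial_def using frechet_derivative_at by metis

lemma frechet_eq_partial:
 fixes f :: "real^'n => real"
 assumes "f differentiable (at y)"
 shows "frechet_derivative f (at y) v = (SUM i:UNIV. v $ i * partial i f y)"
proof -
 have lin: "linear (frechet_derivative f (at y))"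
  using assms frechet_derivative_works has_derivative_linear by blast
 have "frechet_derivative f (at y) v = frechet_derivative f (at y) (SUM i:UNIV. v $ i *\<^sub>R axis i 1)"
  by (simp add: basis_expansion scalar_mult_eq_scaleR[symmetric])
 thus ?thesis by (simp add: linear_sum[OF lin] linear_cmul[OF lin] partial_def)
qed

lemma partial_cong:
 assumes "open U" "y : U" "!!x. x : U ==> f x = g x"
 shows "partial i f y = partial i g y"
proof (cases "f differentiable (at y)")
 case True
 thus ?thesis unfolding partial_def using frechet_derivative_transform_within_open[OF True assms] by simp
next
 case False
 have "(%f'. (f has_derivative f') (at y)) = (%f'. (g has_derivative f') (at y))"
  using has_derivative_transform_within_open[OF _ assms(1,2)] assms(3) by (metis (full_types))
 thus ?thesis by (simp add: partial_def frechet_derivative_def)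
qed

lemma C1_on_UNIV_extend:
 fixes f :: "'e::euclidean_space => real"
 assumes U: "open U" and f: "Ck_on k U f" and K: "compact K" "K <= U" and z: "!!x. x : U - K ==> f x = 0"
 shows "Ck_on k UNIV (%x. if x : U then f x else 0)"
proof -
 have open_union: "Ck_on k A h ==> Ck_on k B h ==> open A ==> open B ==> Ck_on k (A Un B) h" for A B and h :: "'e => real"
 proof (induction k arbitrary: h)
  case 0 thus ?case by (auto intro: continuous_on_open_Un)
 next
  case (Suc k)
  hence "h differentiable (at x)" if "x : A Un B" for x
   using that Ck_on_differentiable[OF Suc.prems(1,3)] Ck_on_differentiable[OF Suc.prems(2,4)] by blast
  thus ?case using Suc by (auto intro: differentiable_at_imp_differentiable_on)
 qed
 define h where "h = (%x. if x : U then f x else 0)"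
 have oK: "open (- K)" using K(1) by (simp add: compact_imp_closed open_Compl)
 have "Ck_on k (U Un - K) h"
 proof (rule open_union[OF _ _ U oK])
  show "Ck_on k U h" by (rule Ck_on_cong[OF U f]) (simp add: h_def)
  show "Ck_on k (- K) h" by (rule Ck_on_cong[OF oK Ck_on_const[of k _ 0]]) (use z in "auto simp: h_def")
 qed
 moreover have "U Un - K = UNIV" using K by auto
 ultimately show ?thesis by (simp add: h_def)
qed

text \<open>Fubini's theorem reduces the claim to the one-dimensional fundamental theorem of calculus, applied in the direction \<open>axis i 1\<close>.\<close>
lemma integral_partial_zero:
 fixes h :: "real^'n => real"
 assumes h: "Ck_on (Suc 0) UNIV h" and K: "compact K" and z: "!!x. x ~: K ==> h x = 0"
 shows "integrable lborel (partial i h)" "(LINT x|lborel. partial i h x) = 0"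
proof -
 define e where "e = (axis i 1 :: real^'n)"
 have ne: "norm e = 1" by (simp add: e_def)
 have hc: "continuous_on UNIV h" by (rule Ck_on_cont[OF h])
 have pc: "continuous_on UNIV (partial i h)" using Ck_on_partial[OF h] by simp
 have oK: "open (- K)" using K by (simp add: compact_imp_closed open_Compl)
 have pz: "partial i h x = 0" if "x ~: K" for x
 proof -
  have "partial i h x = partial i (%x. 0) x" by (rule partial_cong[OF oK]) (use that z in auto)
  thus ?thesis by (simp add: partial_def frechet_derivative_const)
 qed
 obtain R where R: "!!x. x : K ==> norm x <= R" using compact_imp_bounded[OF K] by (auto simp: bounded_iff)
 define S where "S = cball (0::real^'n) (R + 1)"
 have S: "compact S" by (simp add: S_def)
 obtain C where C: "!!x. x : S ==> abs (partial i h x) <= C" "0 <= C"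
 proof -
  have "bounded (partial i h ` S)"
   using compact_continuous_image[OF continuous_on_subset[OF pc] S] compact_imp_bounded by blast
  then obtain C where "!!x. x : S ==> abs (partial i h x) <= C" by (auto simp: bounded_iff)
  thus thesis using that[of "abs C"] by fastforce
 qed
 have Cb: "abs (partial i h x) <= C" for x
  using C pz[of x] R[of x] by (cases "x : K") (force simp: S_def)+
 have intc: "integrable lborel f" if "continuous_on UNIV f" "!!x. x ~: S ==> f x = 0" for f :: "real^'n => real"
 proof -
  have "integrable lborel (%x. indicator S x *\<^sub>R f x)"
   by (rule borel_integrable_compact[OF S continuous_on_subset[OF that(1)]]) simp
  moreover have "(%x. indicator S x *\<^sub>R f x) = f" using that(2) by (auto simp: indicator_def fun_eq_iff)
  ultimately show ?thesis by simp
 qed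
 show int: "integrable lborel (partial i h)"
  by (rule intc[OF pc]) (use pz R in "force simp: S_def")
 define q where "q = (%n x. real (Suc n) * (h ((1 / real (Suc n)) *\<^sub>R e + x) - h x))"
 have line: "DERIV (%t. h (t *\<^sub>R e + x)) t :> partial i h (t *\<^sub>R e + x)" for t x
 proof -
  have d: "(h has_derivative frechet_derivative h (at (t *\<^sub>R e + x))) (at (t *\<^sub>R e + x))"
   by (rule Ck_on_has_derivative[OF h]) auto
  have "((%t. t *\<^sub>R e + x) has_derivative (%s. s *\<^sub>R e)) (at t)"
   by (auto intro!: derivative_eq_intros)
  from diff_chain_at[OF this d]
  have "((%t. h (t *\<^sub>R e + x)) has_derivative (%s. frechet_derivative h (at (t *\<^sub>R e + x)) (s *\<^sub>R e))) (at t)"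
   by (simp add: o_def)
  moreover have "frechet_derivative h (at (t *\<^sub>R e + x)) (s *\<^sub>R e) = partial i h (t *\<^sub>R e + x) * s" for s
   using linear_cmul[OF has_derivative_linear[OF d]] by (simp add: partial_def e_def)
  ultimately show ?thesis by (simp add: has_field_derivative_def)
 qed
 have qbd: "norm (q n x) <= C * indicator S x" for n x
 proof -
  have b: "abs (q n x) <= C"
  proof -
   have "norm (h ((1 / real (Suc n)) *\<^sub>R e + x) - h (0 *\<^sub>R e + x)) <= C * norm (1 / real (Suc n) - 0)"
    by (rule field_differentiable_bound[of UNIV "%t. h (t *\<^sub>R e + x)" "%t. partial i h (t *\<^sub>R e + x)"])
      (use line Cb in auto)
   hence "abs (h ((1 / real (Suc n)) *\<^sub>R e + x) - h x) <= C / real (Suc n)" by simp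
   hence "real (Suc n) * abs (h ((1 / real (Suc n)) *\<^sub>R e + x) - h x) <= real (Suc n) * (C / real (Suc n))"
    by (intro mult_left_mono) auto
   thus ?thesis unfolding q_def by (simp add: abs_mult)
  qed
  show ?thesis
  proof (cases "x : S")
   case False
   hence 1: "R + 1 < norm x" by (simp add: S_def)
   have "norm ((1 / real (Suc n)) *\<^sub>R e) <= 1" using ne by simp
   hence "R < norm ((1 / real (Suc n)) *\<^sub>R e + x)"
    using 1 norm_triangle_ineq4[of "(1 / real (Suc n)) *\<^sub>R e + x" "(1 / real (Suc n)) *\<^sub>R e"]
    unfolding add_diff_cancel_left' by linarith
   hence "h ((1 / real (Suc n)) *\<^sub>R e + x) = 0" "h x = 0"
    using z[of x] z[of "(1 / real (Suc n)) *\<^sub>R e + x"] R 1 by force+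
   thus ?thesis using False by (simp add: q_def)
  qed (use b in simp)
 qed
 have qlim: "(%n. q n x) \<longlonglongrightarrow> partial i h x" for x
 proof -
  have "tendsto (%t. (h (t *\<^sub>R e + x) - h x) / t) (partial i h x) (at 0)"
   using line[of x 0] by (simp add: has_field_derivative_iff)
  moreover have "filterlim (%n. 1 / real (Suc n)) (at 0) sequentially"
   using LIMSEQ_inverse_real_of_nat by (simp add: filterlim_at inverse_eq_divide)
  ultimately have "(%n. (h ((1 / real (Suc n)) *\<^sub>R e + x) - h x) / (1 / real (Suc n))) \<longlonglongrightarrow> partial i h x"
   by (rule filterlim_compose)
  thus ?thesis by (simp add: q_def mult.commute)
 qed
 have hint: "integrable lborel h" by (rule intc[OF hc]) (use z R in "force simp: S_def")
 have shift: "integrable lborel (%x. h (c + x))" "(LINT x|lborel. h (c + x)) = (LINT x|lborel. h x)" for c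
 proof -
  have m: "h : borel_measurable borel" using hc by (rule borel_measurable_continuous_onI)
  show "integrable lborel (%x. h (c + x))"
   using hint integrable_distr_eq[of "(+) c" lborel borel h] m by (simp add: lborel_distr_plus)
  show "(LINT x|lborel. h (c + x)) = (LINT x|lborel. h x)"
   using integral_distr[of "(+) c" lborel borel h] m by (simp add: lborel_distr_plus)
 qed
 have q0: "(LINT x|lborel. q n x) = 0" for n
  unfolding q_def using shift hint by (simp add: Bochner_Integration.integral_diff)
 have "(%n. \<integral>x. q n x \<partial>lborel) \<longlonglongrightarrow> (LINT x|lborel. partial i h x)"
 proof (rule integral_dominated_convergence[where w = "%x. C * indicator S x"])
  show "integrable lborel (%x. C * indicator S x)"
   using borel_integrable_compact[OF S continuous_on_const[of S C]] by (simp add: mult.commute)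
  show "q n : borel_measurable lborel" for n
   unfolding q_def using shift(1) hint by (intro borel_measurable_times borel_measurable_diff) auto
 qed (use int qlim qbd in auto)
 thus "(LINT x|lborel. partial i h x) = 0" by (simp add: q0 LIMSEQ_const_iff)
qed

section \<open>Change of variables\<close>

text \<open>The change of variables formula for images of sets requires a well-ordered index type, whereas the dimension of a manifold is an arbitrary finite type \<open>'n\<close>. The type \<open>'n ordered_copy\<close> is a copy of \<open>'n\<close> ordered by an arbitrary enumeration, and the formula is transported along the relabelling of coordinates, which preserves Lebesgue measure and determinants.\<close>
typedef 'n ordered_copy = "UNIV :: 'n set"
 morphisms of_copy to_copy by simp

lemma bij_of_copy: "bij of_copy"
 by (rule bij_betw_byWitness[where f' = to_copy]) (auto simp: of_copy_inverse to_copy_inverse)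

lemma bij_to_copy: "bij to_copy"
 by (rule bij_betw_byWitness[where f' = of_copy]) (auto simp: of_copy_inverse to_copy_inverse)

definition copy_index :: "'n::finite => nat" where
 "copy_index = (SOME f. inj f)"

lemma inj_copy_index: "inj (copy_index :: 'n::finite => nat)"
proof -
 obtain f :: "'n => nat" where "inj f"
  using finite_imp_inj_to_nat_seg[OF finite_class.finite_UNIV] by blast
 thus ?thesis unfolding copy_index_def by (rule someI[of inj f])
qed

instance ordered_copy :: (finite) finite
proof
 have "finite (range (to_copy :: 'a => 'a ordered_copy))" by simp
 moreover have "range (to_copy :: 'a => 'a ordered_copy) = UNIV" by (rule bij_is_surj[OF bij_to_copy])
 ultimately show "finite (UNIV :: 'a ordered_copy set)" by metis
qed

instantiation ordered_copy :: (finite) wellorder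
begin

definition less_eq_ordered_copy :: "'a ordered_copy => 'a ordered_copy => bool" where
 "x <= y \<longleftrightarrow> copy_index (of_copy x) <= copy_index (of_copy y)"

definition less_ordered_copy :: "'a ordered_copy => 'a ordered_copy => bool" where
 "x < y \<longleftrightarrow> copy_index (of_copy x) < copy_index (of_copy y)"

instance
proof (standard, goal_cases)
 case (1 x y) show ?case unfolding less_eq_ordered_copy_def less_ordered_copy_def by linarith
next
 case (2 x) show ?case unfolding less_eq_ordered_copy_def by simp
next
 case (3 x y z) thus ?case unfolding less_eq_ordered_copy_def by linarith
next
 case (4 x y)
 hence "copy_index (of_copy x) = copy_index (of_copy y)" unfolding less_eq_ordered_copy_def by linarith
 hence "of_copy x = of_copy y" by (rule injD[OF inj_copy_index])
 thus ?case unfolding of_copy_inject .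
next
 case (5 x y) show ?case unfolding less_eq_ordered_copy_def by linarith
next
 case (6 P x)
 show ?case
 proof (rule measure_induct_rule[of "%x :: 'a ordered_copy. copy_index (of_copy x)"])
  fix x :: "'a ordered_copy" assume IH: "!!y. copy_index (of_copy y) < copy_index (of_copy x) ==> P y"
  show "P x"
  proof (rule 6)
   fix y assume "y < x" thus "P y" unfolding less_ordered_copy_def by (rule IH)
  qed
 qed
qed

end

definition relabel :: "real^'n => real^('n::finite ordered_copy)" where
 "relabel x = (\<chi> i. x $ of_copy i)"

definition unrelabel :: "real^('n::finite ordered_copy) => real^'n" where
 "unrelabel y = (\<chi> i. y $ to_copy i)"

lemma relabel_inverse [simp]: "unrelabel (relabel x) = x" "relabel (unrelabel y) = y"
 by (simp_all add: relabel_def unrelabel_def vec_eq_iff to_copy_inverse of_copy_inverse)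

lemma linear_relabel: "linear relabel" "linear unrelabel"
 by (simp_all add: linear_iff relabel_def unrelabel_def vec_eq_iff)

lemma bounded_linear_relabel: "bounded_linear relabel" "bounded_linear unrelabel"
 by (simp_all add: linear_relabel linear_conv_bounded_linear[symmetric])

lemma relabel_measurable: "relabel : borel_measurable borel" "unrelabel : borel_measurable borel"
 by (intro borel_measurable_continuous_onI linear_continuous_on bounded_linear_relabel)+

lemma prod_Basis_vec: "(PROD b:Basis. z \<bullet> b) = (PROD i:UNIV. z $ i)" for z :: "real^'n"
proof -
 have "Basis = range (%i::'n. axis i (1::real))" by (auto simp: Basis_vec_def)
 moreover have "inj (%i::'n. axis i (1::real))" by (auto simp: inj_def axis_eq_axis)
 hence "(PROD b:range (%i::'n. axis i (1::real)). z \<bullet> b) = (PROD i:UNIV. z $ i)"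
  by (subst prod.reindex) (auto simp: inner_axis)
 ultimately show ?thesis by metis
qed

lemma ball_Basis_vec: "(ALL b:Basis. P b) \<longleftrightarrow> (ALL i. P (axis i 1))" for P :: "real^'n => bool"
 by (auto simp: Basis_vec_def)

lemma distr_relabel: "distr lborel borel relabel = (lborel :: (real^('n::finite ordered_copy)) measure)"
proof (rule sym, rule lborel_eqI)
 fix l u :: "real^('n ordered_copy)"
 assume le: "!!b. b : Basis ==> l \<bullet> b <= u \<bullet> b"
 have le': "l $ i <= u $ i" for i using le[OF axis_Basis[of i]] by (simp add: inner_axis)
 have "relabel -` box l u = box (unrelabel l) (unrelabel u)"
 proof (intro set_eqI)
  fix x
  have "(ALL i. l $ i < x $ of_copy i & x $ of_copy i < u $ i) \<longleftrightarrow> (ALL i. l $ to_copy i < x $ i & x $ i < u $ to_copy i)"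
  proof safe
   fix i assume *: "ALL i. l $ i < x $ of_copy i & x $ of_copy i < u $ i"
   show "l $ to_copy i < x $ i" "x $ i < u $ to_copy i"
    using *[rule_format, of "to_copy i"] by (auto simp: to_copy_inverse)
  next
   fix i assume *: "ALL i. l $ to_copy i < x $ i & x $ i < u $ to_copy i"
   show "l $ i < x $ of_copy i" "x $ of_copy i < u $ i"
    using *[rule_format, of "of_copy i"] by (auto simp: of_copy_inverse)
  qed
  thus "x : relabel -` box l u \<longleftrightarrow> x : box (unrelabel l) (unrelabel u)"
   by (simp add: mem_box ball_Basis_vec inner_axis relabel_def unrelabel_def)
 qed
 moreover have "emeasure lborel (box (unrelabel l) (unrelabel u)) = ennreal (PROD b:Basis. (unrelabel u - unrelabel l) \<bullet> b)"
  by (rule emeasure_lborel_box) (use le' in "auto simp: Basis_vec_def inner_axis unrelabel_def")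
 moreover have "(PROD b:Basis. (unrelabel u - unrelabel l) \<bullet> b) = (PROD b:Basis. (u - l) \<bullet> b)"
 proof -
  have "(PROD i:UNIV. (u - l) $ i) = (PROD i:UNIV. (u - l) $ to_copy i)"
   by (rule prod.reindex_bij_betw[OF bij_to_copy, symmetric])
  thus ?thesis unfolding prod_Basis_vec by (simp add: unrelabel_def)
 qed
 ultimately show "emeasure (distr lborel borel relabel) (box l u) = ennreal (PROD b:Basis. (u - l) \<bullet> b)"
  by (simp add: emeasure_distr relabel_measurable)
qed simp

lemma image_relabel: "relabel ` S = unrelabel -` S"
 by (auto simp: image_iff) (metis relabel_inverse(2))

lemma image_relabel_borel: "S : sets borel ==> relabel ` S : sets borel"
 unfolding image_relabel by (rule measurable_sets_borel[OF relabel_measurable(2)])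

lemma emeasure_relabel:
 assumes "S : sets borel" shows "emeasure lborel (relabel ` S) = emeasure lborel S"
proof -
 have "emeasure lborel (relabel ` S) = emeasure (distr lborel borel relabel) (relabel ` S)"
  by (simp add: distr_relabel)
 also have "... = emeasure lborel (relabel -` relabel ` S)"
  using image_relabel_borel[OF assms] by (simp add: emeasure_distr relabel_measurable)
 also have "relabel -` relabel ` S = S"
  by (metis inj_vimage_image_eq injI relabel_inverse(1))
 finally show ?thesis .
qed

lemma det_relabel:
 fixes A :: "real^'n^'n"
 shows "det (\<chi> i j. A $ of_copy i $ of_copy j :: real^('n::finite ordered_copy)^('n ordered_copy)) = det A"
proof -
 let ?m = "map_permutation (UNIV :: 'n ordered_copy set) of_copy"
 let ?m' = "map_permutation (UNIV :: 'n set) to_copy"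
 have bij: "bij_betw (of_copy :: 'n ordered_copy => 'n) UNIV UNIV" using bij_of_copy by simp
 have bij': "bij_betw (to_copy :: 'n => 'n ordered_copy) UNIV UNIV"
  by (rule bij_to_copy)
 have app: "?m p (of_copy x) = of_copy (p x)" for p x
  by (rule map_permutation_apply) (use bij in "auto simp: bij_betw_def")
 have app': "?m' p (to_copy x) = to_copy (p x)" for p x
  by (rule map_permutation_apply) (use bij' in "auto simp: bij_betw_def")
 have mm': "?m (?m' p) = p" for p
 proof
  fix x
  have "?m (?m' p) (of_copy (to_copy x)) = p x" unfolding app app' by (simp add: to_copy_inverse)
  thus "?m (?m' p) x = p x" by (simp add: to_copy_inverse)
 qed
 have m'm: "?m' (?m p) = p" for p
 proof
  fix x
  have "?m' (?m p) (to_copy (of_copy x)) = p x" unfolding app app' by (simp add: of_copy_inverse)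
  thus "?m' (?m p) x = p x" by (simp add: of_copy_inverse)
 qed
 have "det A = (SUM p:{p. p permutes (UNIV :: 'n ordered_copy set)}. of_int (sign (?m p)) * (PROD i:UNIV. A $ i $ ?m p i))"
  unfolding det_def
  by (rule sum.reindex_bij_witness[of _ ?m ?m'])
    (auto simp: mm' m'm map_permutation_permutes[OF bij] map_permutation_permutes[OF bij'])
 also have "... = (SUM p:{p. p permutes (UNIV :: 'n ordered_copy set)}. of_int (sign p) * (PROD i:UNIV. A $ of_copy i $ of_copy (p i)))"
 proof (rule sum.cong[OF refl])
  fix p assume "p : {p. p permutes (UNIV :: 'n ordered_copy set)}"
  hence "sign (?m p) = sign p"
   using bij by (intro sign_map_permutation) (auto simp: bij_betw_def)
  moreover have "(PROD i:UNIV. A $ i $ ?m p i) = (PROD i:UNIV. A $ of_copy i $ ?m p (of_copy i))"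
   by (rule prod.reindex_bij_betw[OF bij, symmetric])
  ultimately show "of_int (sign (?m p)) * (PROD i:UNIV. A $ i $ ?m p i) = of_int (sign p) * (PROD i:UNIV. A $ of_copy i $ of_copy (p i))"
   by (simp add: app)
 qed
 finally show ?thesis by (simp add: det_def)
qed

lemma emeasure_image_wellorder:
 fixes tau :: "real^'m::{finite,wellorder} => real^'m::_"
 assumes B: "B : sets borel" and der: "!!x. x : B ==> (tau has_derivative tau' x) (at x)"
  and inj: "inj_on tau B" and im: "tau ` B : sets borel"
  and meas: "(%x. abs (det (matrix (tau' x))) * indicator B x) : borel_measurable borel"
 shows "emeasure lborel (tau ` B) = (nn_integral lborel (%x. ennreal (abs (det (matrix (tau' x))) * indicator B x)))"
proof -
 define g where "g = (%x. abs (det (matrix (tau' x))) * indicator B x :: real)"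
 have iff: "(g has_integral m) UNIV \<longleftrightarrow> tau ` B : lmeasurable & measure lebesgue (tau ` B) = m" for m
 proof -
  have "g = (%x. if x : B then abs (det (matrix (tau' x))) else 0)" by (auto simp: g_def indicator_def)
  hence "(g has_integral m) UNIV \<longleftrightarrow> ((%x. abs (det (matrix (tau' x)))) has_integral m) B"
   by (simp add: has_integral_restrict_UNIV)
  also have "... \<longleftrightarrow> tau ` B : lmeasurable & measure lebesgue (tau ` B) = m"
   by (rule has_measure_differentiable_image[symmetric]) (use B der inj in "auto intro: has_derivative_at_withinI")
  finally show ?thesis .
 qed
 have em: "emeasure lebesgue (tau ` B) = emeasure lborel (tau ` B)" using im by simp
 have "emeasure lborel (tau ` B) = (nn_integral lborel (%x. ennreal (g x)))"
 proof (cases "(nn_integral lborel (%x. ennreal (g x))) < \<infinity>")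
  case True
  then obtain r where r: "(nn_integral lborel (%x. ennreal (g x))) = ennreal r" "0 <= r"
   by (metis ennreal_cases infinity_ennreal_def less_irrefl)
  have "(g has_integral r) UNIV"
   by (rule nn_integral_has_integral[OF _ _ r]) (use meas in "auto simp: g_def")
  hence "tau ` B : lmeasurable" "measure lebesgue (tau ` B) = r" using iff by auto
  hence "emeasure lebesgue (tau ` B) = ennreal r" by (simp add: emeasure_eq_measure2)
  thus ?thesis using r em by simp
 next
  case False
  have "~ emeasure lborel (tau ` B) < \<infinity>"
  proof
   assume "emeasure lborel (tau ` B) < \<infinity>"
   hence "tau ` B : lmeasurable" using im em by (intro fmeasurableI) auto
   hence "(g has_integral measure lebesgue (tau ` B)) UNIV" using iff by blast
   from nn_integral_has_integral_lborel[OF _ _ this] False meas show False by (auto simp: g_def)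
  qed
  thus ?thesis using False by (metis infinity_ennreal_def less_top)
 qed
 thus ?thesis by (simp add: g_def)
qed

lemma emeasure_image_diffeo:
 fixes tau :: "real^'n => real^'n"
 assumes B: "B : sets borel" and der: "!!x. x : B ==> (tau has_derivative tau' x) (at x)"
  and inj: "inj_on tau B" and im: "tau ` B : sets borel"
  and meas: "(%x. abs (det (matrix (tau' x))) * indicator B x) : borel_measurable borel"
 shows "emeasure lborel (tau ` B) = (nn_integral lborel (%x. ennreal (abs (det (matrix (tau' x))) * indicator B x)))"
proof -
 define T where "T = (%y. relabel (tau (unrelabel y)))"
 define T' where "T' = (%y v. relabel (tau' (unrelabel y) (unrelabel v)))"
 have det: "det (matrix (T' y)) = det (matrix (tau' (unrelabel y)))" for y
 proof -
  have "unrelabel (axis j 1) = axis (of_copy j) 1" for j :: "'n ordered_copy"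
   by (auto simp: unrelabel_def vec_eq_iff axis_def to_copy_inverse of_copy_inverse)
  hence "matrix (T' y) = (\<chi> i j. matrix (tau' (unrelabel y)) $ of_copy i $ of_copy j)"
   by (simp add: matrix_def T'_def relabel_def)
  thus ?thesis by (simp add: det_relabel)
 qed
 have ind: "indicator (relabel ` B) y = (indicator B (unrelabel y) :: real)" for y
  by (simp add: image_relabel indicator_def)
 have "T ` relabel ` B = relabel ` tau ` B" by (auto simp: T_def image_image)
 hence "emeasure lborel (tau ` B) = emeasure lborel (T ` relabel ` B)"
  using emeasure_relabel[OF im] by simp
 also have "... = (nn_integral lborel (%y. ennreal (abs (det (matrix (T' y))) * indicator (relabel ` B) y)))"
 proof (rule emeasure_image_wellorder)
  show "relabel ` B : sets borel" by (rule image_relabel_borel[OF B])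
  show "T ` relabel ` B : sets borel" using image_relabel_borel[OF im] \<open>T ` relabel ` B = relabel ` tau ` B\<close> by simp
  show "inj_on T (relabel ` B)" using inj by (auto simp: inj_on_def T_def) (metis relabel_inverse(1))
  show "(T has_derivative T' x) (at x)" if "x : relabel ` B" for x
  proof -
   have "(tau has_derivative tau' (unrelabel x)) (at (unrelabel x))" using der that by auto
   from diff_chain_at[OF bounded_linear_imp_has_derivative[OF bounded_linear_relabel(2)] this]
   have "(tau o unrelabel has_derivative tau' (unrelabel x) o unrelabel) (at x)" .
   from diff_chain_at[OF this bounded_linear_imp_has_derivative[OF bounded_linear_relabel(1)]]
   show ?thesis by (simp add: T_def T'_def o_def)
  qed
  show "(%x. abs (det (matrix (T' x))) * indicator (relabel ` B) x) : borel_measurable borel"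
   unfolding det ind using measurable_compose[OF relabel_measurable(2) meas] .
 qed
 also have "... = (\<integral>\<^sup>+y. ennreal (abs (det (matrix (tau' (unrelabel y)))) * indicator B (unrelabel y)) \<partial>distr lborel borel relabel)"
  by (simp add: det ind distr_relabel)
 also have "... = (nn_integral lborel (%x. ennreal (abs (det (matrix (tau' x))) * indicator B x)))"
  using measurable_compose[OF relabel_measurable(2) meas]
  by (subst nn_integral_distr) (auto simp: relabel_measurable)
 finally show ?thesis .
qed

theorem nn_integral_change_of_variables:
 fixes tau sigma :: "real^'n => real^'n" and f :: "real^'n => ennreal"
 assumes W: "open W" "open W'" and tau: "tau ` W = W'" "!!x. x : W ==> sigma (tau x) = x"
  and sigma: "continuous_on W' sigma"
  and der: "!!x. x : W ==> (tau has_derivative tau' x) (at x)"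
  and cont: "continuous_on W (%x. det (matrix (tau' x)))"
  and f: "f : borel_measurable borel"
 shows "(nn_integral lborel (%y. f y * indicator W' y)) =
     (nn_integral lborel (%x. f (tau x) * ennreal (abs (det (matrix (tau' x)))) * indicator W x))"
proof -
 define d where "d = (%x. if x : W then abs (det (matrix (tau' x))) else 0)"
 define T where "T = (%x. if x : W then tau x else 0)"
 have tauc: "continuous_on W tau" using der by (auto intro!: continuous_at_imp_continuous_on has_derivative_continuous)
 have Wb: "W : sets borel" "W' : sets borel" using W by auto
 have dm: "d : borel_measurable borel" unfolding d_def
  using Wb cont by (intro borel_measurable_continuous_on_if) (auto intro!: continuous_intros)
 have Tm: "T : borel_measurable borel" unfolding T_def
  using Wb tauc by (intro borel_measurable_continuous_on_if) (auto intro!: continuous_intros)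
 define S where "S = (%y. if y : W' then sigma y else 0)"
 have Sm: "S : borel_measurable borel" unfolding S_def
  using Wb sigma by (intro borel_measurable_continuous_on_if) (auto intro!: continuous_intros)
 have eq: "distr (density lborel d) borel T = density lborel (indicator W')"
 proof (rule measure_eqI)
  fix A assume "A : sets (distr (density lborel d) borel T)"
  hence A: "A : sets borel" by simp
  define B where "B = W Int T -` A"
  have B: "B : sets borel" unfolding B_def using Wb(1) measurable_sets_borel[OF Tm A] by auto
  have TB: "tau ` B = A Int W'" using tau(1) by (auto simp: B_def T_def)
  have "emeasure (distr (density lborel d) borel T) A = emeasure (density lborel d) (T -` A)"
   using A Tm by (simp add: emeasure_distr)
  also have "... = (nn_integral lborel (%x. ennreal (d x) * indicator (T -` A) x))"
   using dm measurable_sets_borel[OF Tm A] by (intro emeasure_density) auto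
  also have "... = (nn_integral lborel (%x. ennreal (abs (det (matrix (tau' x))) * indicator B x)))"
   by (intro nn_integral_cong) (auto simp: d_def B_def indicator_def)
  also have "... = emeasure lborel (tau ` B)"
  proof (rule emeasure_image_diffeo[symmetric, OF B])
   show "inj_on tau B" using tau(2) by (intro inj_on_inverseI[of _ sigma]) (auto simp: B_def)
   show "tau ` B : sets borel" using TB A Wb by simp
   have "(%x. abs (det (matrix (tau' x))) * indicator B x) = (%x. d x * indicator B x)"
    by (auto simp: d_def B_def indicator_def)
   thus "(%x. abs (det (matrix (tau' x))) * indicator B x) : borel_measurable borel"
    using dm B by simp
  qed (use der in "auto simp: B_def")
  also have "... = emeasure (density lborel (indicator W')) A"
   using TB A Wb by (simp add: emeasure_density nn_integral_cmult_indicator nn_integral_indicator indicator_inter_arith[symmetric] Int_commute)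
  finally show "emeasure (distr (density lborel d) borel T) A = emeasure (density lborel (indicator W')) A" .
 qed simp
 have "(nn_integral lborel (%y. f y * indicator W' y)) = (\<integral>\<^sup>+y. f y \<partial>density lborel (indicator W'))"
  using f Wb by (subst nn_integral_density) (auto simp: mult.commute)
 also have "... = (\<integral>\<^sup>+y. f y \<partial>distr (density lborel d) borel T)" by (simp add: eq)
 also have "... = (\<integral>\<^sup>+x. f (T x) \<partial>density lborel d)" using f Tm by (simp add: nn_integral_distr)
 also have "... = (nn_integral lborel (%x. ennreal (d x) * f (T x)))"
  using f Tm dm by (subst nn_integral_density) (auto intro: measurable_compose)
 also have "... = (nn_integral lborel (%x. f (tau x) * ennreal (abs (det (matrix (tau' x)))) * indicator W x))"
  by (intro nn_integral_cong) (auto simp: d_def T_def indicator_def mult.commute)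
 finally show ?thesis .
qed

section \<open>Charts and isometries\<close>

text \<open>The segment from the identity matrix to \<open>A\<close> consists of positive definite, hence invertible, matrices.\<close>
lemma det_pos_of_posdef:
 fixes A :: "real^'n^'n"
 assumes pd: "!!v. v ~= 0 ==> 0 < v \<bullet> (A *v v)"
 shows "0 < det A"
proof -
 define P where "P = (%t::real. (1 - t) *\<^sub>R mat 1 + t *\<^sub>R A)"
 have nz: "det (P t) ~= 0" if t: "0 <= t" "t <= 1" for t
 proof
  assume "det (P t) = 0"
  then obtain v where v: "v ~= 0" "P t *v v = 0"
   using invertible_det_nz matrix_left_invertible_ker invertible_left_inverse by blast
  have "v \<bullet> (P t *v v) = (1 - t) * (v \<bullet> v) + t * (v \<bullet> (A *v v))"
   by (simp add: P_def matrix_vector_mult_add_rdistrib scaleR_matrix_vector_assoc[symmetric] inner_add_right)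
  moreover have "0 < v \<bullet> v" "0 < v \<bullet> (A *v v)" using v pd by auto
  hence "0 < (1 - t) * (v \<bullet> v) + t * (v \<bullet> (A *v v))"
   using t by (cases "t = 1") (auto intro!: add_pos_nonneg)
  ultimately show False using v(2) by simp
 qed
 have cont: "continuous_on {0..1} (%t. det (P t))"
  unfolding det_def P_def by (auto intro!: continuous_intros)
 show ?thesis
 proof (rule ccontr)
  assume "~ 0 < det A"
  hence "det (P 1) <= 0" "0 <= det (P 0)" by (auto simp: P_def)
  from IVT2'[OF this(1) this(2) _ cont] obtain t where "0 <= t" "t <= 1" "det (P t) = 0" by auto
  thus False using nz by blast
 qed
qed

locale riemannian_mfd =
 fixes M :: "('a::{t2_space,second_countable_topology}, 'n::finite) riemannian"
 assumes M: "riemannian_manifold M"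
begin

abbreviation U where "U c == coords c ` domain c"

lemma chart: "c : atlas M ==> is_chart c"
 using M by (simp add: riemannian_manifold_def)

lemma open_domain: "c : atlas M ==> open (domain c)"
 and open_U: "c : atlas M ==> open (U c)"
 using chart by (auto simp: is_chart_def)

lemma chart_cover: "EX c:atlas M. x : domain c"
 using M by (auto simp: riemannian_manifold_def)

lemma chart_at: "chart_at M x : atlas M" "x : domain (chart_at M x)"
 using someI_ex[of "%c. c : atlas M & x : domain c"] chart_cover[of x] by (auto simp: chart_at_def)

lemma inj_coords: assumes "c : atlas M" shows "inj_on (coords c) (domain c)"
 using chart[OF assms] unfolding is_chart_def homeomorphism_def by (metis inj_on_inverseI)

lemma param_coords [simp]: "c : atlas M ==> x : domain c ==> param c (coords c x) = x"
 unfolding param_def by (rule inv_into_f_f[OF inj_coords])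

lemma coords_param [simp]: "y : U c ==> coords c (param c y) = y"
 unfolding param_def by (rule f_inv_into_f)

lemma param_domain [simp]: "y : U c ==> param c y : domain c"
 unfolding param_def by (rule inv_into_into)

lemma cont_coords: assumes "c : atlas M" shows "continuous_on (domain c) (coords c)"
 using chart[OF assms] unfolding is_chart_def homeomorphism_def by blast

lemma cont_param: assumes "c : atlas M" shows "continuous_on (U c) (param c)"
proof -
 obtain i where i: "homeomorphism (domain c) (U c) (coords c) i"
  using chart[OF assms] unfolding is_chart_def by blast
 have "continuous_on (U c) i" using i by (simp add: homeomorphism_def)
 moreover have "i y = param c y" if "y : U c" for y
  using that i assms by (auto simp: homeomorphism_def)
 ultimately show ?thesis using continuous_on_eq by blast
qed

lemma open_coords_image:
 assumes c: "c : atlas M" and S: "open S" "S <= domain c"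
 shows "open (coords c ` S)"
proof -
 have "coords c ` S = U c Int param c -` S" using S c by (auto simp: image_iff)
 thus ?thesis using continuous_on_open_vimage[OF open_U[OF c]] cont_param[OF c] S(1) by (metis Int_commute)
qed

lemma open_param_image:
 assumes c: "c : atlas M" and S: "open S" "S <= U c"
 shows "open (param c ` S)"
proof -
 have "param c ` S = domain c Int coords c -` S"
 proof safe
  fix x assume "x : domain c" "coords c x : S"
  thus "x : param c ` S" using c by (metis image_eqI param_coords)
 qed (use S in "auto dest!: subsetD")
 thus ?thesis using continuous_on_open_vimage[OF open_domain[OF c]] cont_coords[OF c] S(1) by (metis Int_commute)
qed

definition g where "g c y = metric M c (param c y)"

lemma metric_coords: "c : atlas M ==> x : domain c ==> metric M c x = g c (coords c x)"
 by (simp add: g_def)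

lemma g_sym: "c : atlas M ==> y : U c ==> transpose (g c y) = g c y"
 and g_pos: "c : atlas M ==> y : U c ==> v ~= 0 ==> 0 < v \<bullet> (g c y *v v)"
 using M param_domain[of y c] by (auto simp: riemannian_manifold_def g_def simp del: param_domain)

lemma g_nonneg: "c : atlas M ==> y : U c ==> 0 <= v \<bullet> (g c y *v v)"
 using g_pos[of c y v] by (cases "v = 0") auto

lemma det_g: "c : atlas M ==> y : U c ==> 0 < det (g c y)"
 by (rule det_pos_of_posdef[OF g_pos])

lemma g_smooth: assumes c: "c : atlas M" shows "Ck_on k (U c) (%y. g c y $ i $ j)"
proof -
 have "smooth_on (U c) (metric M c o param c)" using M c by (simp add: riemannian_manifold_def)
 hence "Ck_on k (U c) (metric M c o param c)" by (rule smooth_on_openD[OF _ open_U[OF c]])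
 moreover have "bounded_linear (%A :: real^'n^'n. A $ i $ j)"
  by (intro bounded_linear_compose[OF bounded_linear_vec_nth bounded_linear_vec_nth])
 ultimately show ?thesis using Ck_on_bounded_linear[OF _ open_U[OF c]] by (fastforce simp: g_def)
qed

definition w where "w c y = sqrt (det (g c y))"

lemma w_pos: "c : atlas M ==> y : U c ==> 0 < w c y"
 using det_g by (simp add: w_def)

lemma w_C1: "c : atlas M ==> Ck_on (Suc 0) (U c) (w c)"
 unfolding w_def[abs_def] by (intro C1_on_sqrt Ck_on_det g_smooth det_g open_U)

lemma w_cont: "c : atlas M ==> continuous_on (U c) (w c)"
 using Ck_on_cont[OF w_C1] .

end

locale riemannian_isometry = riemannian_mfd M
 for M :: "('a::{t2_space,second_countable_topology}, 'n::finite) riemannian" +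
 fixes h :: "'a => 'a"
 assumes h: "isometry M h"
begin

lemma bij_h: "bij h" and cont_h: "continuous_on UNIV h" and cont_inv_h: "continuous_on UNIV (inv h)"
 using h by (auto simp: isometry_def smooth_map_def)

lemma inv_h [simp]: "inv h (h x) = x" "h (inv h x) = x"
 using bij_h by (auto simp: bij_is_inj bij_is_surj surj_f_inv_f)

abbreviation W where "W c c' == local_dom c c' h"
abbreviation W' where "W' c c' == local_dom c' c (inv h)"
abbreviation tau where "tau c c' == local_rep c c' h"
abbreviation sigma where "sigma c c' == local_rep c' c (inv h)"

lemma W_sub: "W c c' <= U c" "W' c c' <= U c'"
 by (auto simp: local_dom_def)

lemma W_iff: "c : atlas M ==> y : W c c' \<longleftrightarrow> y : U c & h (param c y) : domain c'"
 by (auto simp: local_dom_def image_iff)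

lemma W'_iff: "c' : atlas M ==> y : W' c c' \<longleftrightarrow> y : U c' & inv h (param c' y) : domain c"
 by (auto simp: local_dom_def image_iff)

lemma open_pre: "c' : atlas M ==> open (h -` domain c')" "c : atlas M ==> open (inv h -` domain c)"
 using cont_h cont_inv_h open_domain by (auto intro: open_vimage)

lemma open_W: "c : atlas M ==> c' : atlas M ==> open (W c c')"
 unfolding local_dom_def by (intro open_coords_image open_Int open_domain open_pre) auto

lemma open_W': "c : atlas M ==> c' : atlas M ==> open (W' c c')"
 unfolding local_dom_def by (intro open_coords_image open_Int open_domain open_pre) auto

lemma tau_smooth: "c : atlas M ==> c' : atlas M ==> Ck_on k (W c c') (tau c c')"
 using h by (intro smooth_on_openD[OF _ open_W]) (simp_all add: isometry_def smooth_map_def)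

lemma sigma_smooth: "c : atlas M ==> c' : atlas M ==> Ck_on k (W' c c') (sigma c c')"
 using h by (intro smooth_on_openD[OF _ open_W']) (simp_all add: isometry_def smooth_map_def)

lemma param_tau: "c : atlas M ==> c' : atlas M ==> y : W c c' ==> param c' (tau c c' y) = h (param c y)"
 by (simp add: W_iff local_rep_def)

lemma tau_coords: "c : atlas M ==> x : domain c ==> tau c c' (coords c x) = coords c' (h x)"
 by (simp add: local_rep_def)

lemma tau_W: "c : atlas M ==> c' : atlas M ==> y : W c c' ==> tau c c' y : W' c c'"
 by (auto simp: W_iff W'_iff local_rep_def)

lemma sigma_tau: "c : atlas M ==> c' : atlas M ==> y : W c c' ==> sigma c c' (tau c c' y) = y"
 by (auto simp: W_iff local_rep_def)

lemma tau_image: assumes "c : atlas M" "c' : atlas M" shows "tau c c' ` W c c' = W' c c'"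
proof
 show "tau c c' ` W c c' <= W' c c'" using tau_W[OF assms] by blast
 show "W' c c' <= tau c c' ` W c c'"
 proof
  fix y assume y: "y : W' c c'"
  hence 1: "sigma c c' y : W c c'" "tau c c' (sigma c c' y) = y"
   using assms by (auto simp: W_iff W'_iff local_rep_def)
  thus "y : tau c c' ` W c c'" by (metis image_eqI)
 qed
qed

lemma tau_sub_U: "c : atlas M ==> c' : atlas M ==> tau c c' ` W c c' <= U c'"
 using tau_image W_sub by blast

definition J where "J c c' y = jacobian (tau c c') (at y)"

lemma tau_deriv: "c : atlas M ==> c' : atlas M ==> y : W c c' ==>
  (tau c c' has_derivative (%v. J c c' y *v v)) (at y)"
 using Ck_on_differentiable[OF tau_smooth open_W] unfolding J_def jacobian_works by blast

text \<open>An isometry preserves the metric; in charts this is the transformation rule of a quadratic form. All chart independence below follows from it.\<close>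
lemma g_pullback:
 assumes "c : atlas M" "c' : atlas M" "y : W c c'"
 shows "g c y = transpose (J c c' y) ** g c' (tau c c' y) ** J c c' y"
proof -
 have x: "param c y : domain c Int h -` domain c'" "coords c (param c y) = y"
  using assms by (auto simp: W_iff)
 have "preserves_metric M h" using h by (simp add: isometry_def)
 hence "metric M c (param c y) = transpose (jacobian (tau c c') (at (coords c (param c y)))) **
   metric M c' (h (param c y)) ** jacobian (tau c c') (at (coords c (param c y)))"
  using assms(1,2) x(1) unfolding preserves_metric_def Let_def by blast
 thus ?thesis using x(2) param_tau[OF assms] by (simp add: g_def J_def)
qed

lemma w_pullback:
 assumes "c : atlas M" "c' : atlas M" "y : W c c'"
 shows "w c y = abs (det (J c c' y)) * w c' (tau c c' y)"
proof -
 have "det (g c y) = (det (J c c' y))^2 * det (g c' (tau c c' y))"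
  unfolding g_pullback[OF assms] by (simp add: det_mul det_transpose power2_eq_square)
 thus ?thesis by (simp add: w_def real_sqrt_mult)
qed

lemma det_J:
 assumes "c : atlas M" "c' : atlas M" "y : W c c'"
 shows "det (J c c' y) ~= 0"
proof -
 have "y : U c" using W_sub(1) assms(3) by blast
 thus ?thesis using w_pullback[OF assms] w_pos[OF assms(1)] by force
qed

lemma det_J_cont: "c : atlas M ==> c' : atlas M ==> continuous_on (W c c') (%y. det (J c c' y))"
proof -
 assume c: "c : atlas M" "c' : atlas M"
 have "Ck_on 0 (W c c') (%y. det (J c c' y))"
 proof (rule Ck_on_det[OF open_W[OF c]])
  fix i j
  have "Ck_on 0 (W c c') (%y. frechet_derivative (tau c c') (at y) (axis j 1))"
   using tau_smooth[OF c, of "Suc 0"] axis_Basis unfolding Ck_on.simps(2) by blast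
  from Ck_on_bounded_linear[OF bounded_linear_vec_nth[of i] open_W[OF c] this]
  show "Ck_on 0 (W c c') (%y. J c c' y $ i $ j)"
   by (simp add: J_def jacobian_def matrix_def)
 qed
 thus ?thesis by simp
qed

lemma grad_pullback:
 fixes f :: "'a => real"
 assumes c: "c : atlas M" "c' : atlas M" and y: "y : W c c'"
  and f: "(f o param c') differentiable (at (tau c c' y))"
 shows "((f o h) o param c) differentiable (at y)"
  and "partial i ((f o h) o param c) y = (SUM k:UNIV. J c c' y $ k $ i * partial k (f o param c') (tau c c' y))"
proof -
 let ?F = "f o param c'"
 have 1: "(?F has_derivative frechet_derivative ?F (at (tau c c' y))) (at (tau c c' y))"
  using f frechet_derivative_works by blast
 have "((%z. ?F (tau c c' z)) has_derivative (%v. frechet_derivative ?F (at (tau c c' y)) (J c c' y *v v))) (at y)"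
  using diff_chain_at[OF tau_deriv[OF c y] 1] by (simp add: o_def)
 hence d: "(((f o h) o param c) has_derivative (%v. frechet_derivative ?F (at (tau c c' y)) (J c c' y *v v))) (at y)"
  by (rule has_derivative_transform_within_open[OF _ open_W[OF c] y]) (simp add: param_tau[OF c])
 thus "((f o h) o param c) differentiable (at y)" by (auto simp: differentiable_def)
 have "partial i ((f o h) o param c) y = frechet_derivative ?F (at (tau c c' y)) (J c c' y *v axis i 1)"
  by (rule partial_eq[OF d])
 also have "... = (SUM k:UNIV. (J c c' y *v axis i 1) $ k * partial k ?F (tau c c' y))"
  by (rule frechet_eq_partial[OF f])
 finally show "partial i ((f o h) o param c) y = (SUM k:UNIV. J c c' y $ k $ i * partial k ?F (tau c c' y))"
  by (simp add: matrix_vector_mul_component inner_axis inner_axis')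
qed

end

context riemannian_mfd begin

lemma isometry_id: "isometry M id"
proof -
 have "smooth_map M id"
  using M unfolding smooth_map_def riemannian_manifold_def compatible_def by simp
 moreover have "preserves_metric M id" using M by (simp add: riemannian_manifold_def)
 ultimately show ?thesis by (simp add: isometry_def)
qed

sublocale ident: riemannian_isometry M id
 by unfold_locales (rule isometry_id)

definition dv :: "('a, 'n) chart => ('a => real) => real^'n => real^'n" where
 "dv c f y = (\<chi> i. partial i (f o param c) y)"

definition ginner :: "('a, 'n) chart => ('a => real) => ('a => real) => real^'n => real" where
 "ginner c f1 f2 y = dv c f1 y \<bullet> gradient_in M c f2 y"

lemma gradient_in_eq: "gradient_in M c f y = matrix_inv (g c y) *v dv c f y"
 by (simp add: gradient_in_def dv_def g_def)

lemma g_gradient: "c : atlas M ==> y : U c ==> g c y *v gradient_in M c f y = dv c f y"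
 using det_g[of c y] by (simp add: gradient_in_eq matrix_vector_mul_assoc matrix_inv_works)

lemma g_symm_inner:
 assumes "c : atlas M" "y : U c"
 shows "(g c y *v u) \<bullet> v = u \<bullet> (g c y *v v)"
proof -
 have "u \<bullet> (g c y *v v) = (u v* g c y) \<bullet> v" by (simp add: dot_lmul_matrix)
 also have "u v* g c y = transpose (g c y) *v u" by (simp only: transpose_matrix_vector)
 finally show ?thesis unfolding g_sym[OF assms] by simp
qed

lemma ginner_commute:
 assumes "c : atlas M" "y : U c"
 shows "ginner c f1 f2 y = ginner c f2 f1 y"
proof -
 have "ginner c f1 f2 y = (g c y *v gradient_in M c f1 y) \<bullet> gradient_in M c f2 y"
  unfolding ginner_def g_gradient[OF assms] ..
 also have "... = gradient_in M c f1 y \<bullet> (g c y *v gradient_in M c f2 y)" by (rule g_symm_inner[OF assms])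
 also have "... = ginner c f2 f1 y" unfolding ginner_def g_gradient[OF assms] by (rule inner_commute)
 finally show ?thesis .
qed

end

lemma (in riemannian_isometry) ginner_pullback:
 assumes c: "c : atlas M" "c' : atlas M" and y: "y : W c c'"
  and f: "(f1 o param c') differentiable (at (tau c c' y))" "(f2 o param c') differentiable (at (tau c c' y))"
 shows "ginner c (f1 o h) (f2 o h) y = ginner c' f1 f2 (tau c c' y)"
proof -
 let ?J = "J c c' y" and ?z = "tau c c' y"
 have dv: "dv c (f o h) y = transpose ?J *v dv c' f ?z" if "(f o param c') differentiable (at ?z)" for f
  using grad_pullback(2)[OF c y that] by (simp add: dv_def vec_eq_iff matrix_vector_mult_def transpose_def)
 have yU: "y : U c" "?z : U c'" using y W_sub tau_sub_U[OF c] by blast+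
 define v where "v = gradient_in M c (f2 o h) y"
 define v' where "v' = gradient_in M c' f2 ?z"
 have "transpose ?J *v (g c' ?z *v (?J *v v)) = transpose ?J *v (g c' ?z *v v')"
  using g_gradient[OF c(1) yU(1), of "f2 o h"] g_gradient[OF c(2) yU(2), of f2] dv[OF f(2)]
  unfolding g_pullback[OF c y] v_def v'_def by (simp add: matrix_vector_mul_assoc matrix_mul_assoc)
 hence "g c' ?z *v (?J *v v) = g c' ?z *v v'"
  by (rule injD[rotated]) (use det_J[OF c y] in "simp add: inj_matrix_vector_mult invertible_det_nz det_transpose
     del: transpose_matrix_vector")
 hence Jv: "?J *v v = v'"
  by (rule injD[rotated]) (use det_g[OF c(2) yU(2)] in "simp add: inj_matrix_vector_mult invertible_det_nz")
 have "ginner c' f1 f2 ?z = dv c' f1 ?z \<bullet> (?J *v v)" by (simp add: ginner_def v'_def Jv)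
 also have "... = (dv c' f1 ?z v* ?J) \<bullet> v" by (simp add: dot_lmul_matrix)
 also have "... = (transpose ?J *v dv c' f1 ?z) \<bullet> v" by (simp only: transpose_matrix_vector)
 finally show ?thesis using dv[OF f(1)] by (simp add: ginner_def v_def)
qed

context riemannian_mfd begin

section \<open>Riemannian measure\<close>

definition N :: "('a, 'n) chart => 'a measure" where
 "N c = distr (density (restrict_space lborel (U c)) (%y. ennreal (w c y))) borel (param c)"

lemma U_borel: "c : atlas M ==> U c : sets borel"
 and domain_borel: "c : atlas M ==> domain c : sets borel"
 using open_U open_domain by auto

lemma measurable_restrict_lborel:
 fixes S :: "'e::euclidean_space set"
 shows "f : restrict_space borel S \<rightarrow>\<^sub>M K ==> f : restrict_space lborel S \<rightarrow>\<^sub>M K"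
 using measurable_cong_sets[OF sets_restrict_space_cong[OF sets_lborel, of S] refl[of "sets K"]] by simp

lemma w_meas: "c : atlas M ==> w c : borel_measurable (restrict_space lborel (U c))"
 by (intro measurable_restrict_lborel borel_measurable_continuous_on_restrict w_cont)

lemma param_meas: "c : atlas M ==> param c : restrict_space lborel (U c) \<rightarrow>\<^sub>M borel"
 by (intro measurable_restrict_lborel borel_measurable_continuous_on_restrict cont_param)

lemma sets_N [simp]: "sets (N c) = sets borel" "space (N c) = UNIV"
 by (auto simp: N_def)

lemma coords_image_eq: "c : atlas M ==> coords c ` (B Int domain c) = U c Int param c -` B"
 by (auto simp: image_iff)

lemma coords_image_borel:
 assumes c: "c : atlas M" and B: "B : sets borel"
 shows "coords c ` (B Int domain c) : sets borel"
proof -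
 have "param c -` B Int space (restrict_space lborel (U c)) : sets (restrict_space lborel (U c))"
  by (rule measurable_sets[OF param_meas[OF c] B])
 hence "U c Int param c -` B : sets (restrict_space lborel (U c))"
  by (simp add: space_restrict_space Int_commute)
 thus ?thesis unfolding coords_image_eq[OF c]
  using U_borel[OF c] by (subst (asm) sets_restrict_space_iff) auto
qed

lemma nn_integral_N:
 assumes c: "c : atlas M" and f: "f : borel_measurable borel"
 shows "(\<integral>\<^sup>+x. f x \<partial>N c) = (\<integral>\<^sup>+y\<in>U c. ennreal (w c y) * f (param c y) \<partial>lborel)"
proof -
 have "(\<integral>\<^sup>+x. f x \<partial>N c) = (\<integral>\<^sup>+y. f (param c y) \<partial>density (restrict_space lborel (U c)) (%y. ennreal (w c y)))"
  unfolding N_def using f param_meas[OF c] by (intro nn_integral_distr) (simp_all cong: measurable_cong_sets)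
 also have "... = (\<integral>\<^sup>+y. ennreal (w c y) * f (param c y) \<partial>restrict_space lborel (U c))"
  using w_meas[OF c] measurable_compose[OF param_meas[OF c] f] by (intro nn_integral_density) auto
 also have "... = (\<integral>\<^sup>+y\<in>U c. ennreal (w c y) * f (param c y) \<partial>lborel)"
  using U_borel[OF c] by (intro nn_integral_restrict_space) auto
 finally show ?thesis .
qed

lemma emeasure_N:
 assumes c: "c : atlas M" and B: "B : sets borel"
 shows "emeasure (N c) B = (\<integral>\<^sup>+y \<in> coords c ` (B Int domain c). ennreal (w c y) \<partial>lborel)"
proof -
 have "emeasure (N c) B = (\<integral>\<^sup>+x. indicator B x \<partial>N c)" using B by simp
 also have "... = (\<integral>\<^sup>+y\<in>U c. ennreal (w c y) * indicator B (param c y) \<partial>lborel)"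
  using B by (intro nn_integral_N[OF c]) auto
 also have "... = (\<integral>\<^sup>+y \<in> coords c ` (B Int domain c). ennreal (w c y) \<partial>lborel)"
  unfolding coords_image_eq[OF c] by (intro nn_integral_cong) (auto simp: indicator_def)
 finally show ?thesis .
qed

end

context riemannian_isometry begin

lemma h_borel: "B : sets borel ==> h -` B : sets borel" "B : sets borel ==> h ` B : sets borel"
proof -
 assume B: "B : sets borel"
 have m: "h : borel_measurable borel" "inv h : borel_measurable borel"
  using cont_h cont_inv_h by (auto intro: borel_measurable_continuous_onI)
 show "h -` B : sets borel" by (rule measurable_sets_borel[OF m(1) B])
 have "h ` B = inv h -` B" by (auto simp: image_iff) (metis inv_h(2))
 thus "h ` B : sets borel" using measurable_sets_borel[OF m(2) B] by simp
qed

text \<open>Change of variables, with \<open>w = |det J| * w'\<close>.\<close>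
lemma emeasure_N_isometry:
 assumes c: "c : atlas M" "c' : atlas M" and B: "B : sets borel" "B <= domain c" "h ` B <= domain c'"
 shows "emeasure (N c) B = emeasure (N c') (h ` B)"
proof -
 have hB: "h ` B : sets borel" by (rule h_borel(2)[OF B(1)])
 define S' where "S' = coords c' ` (h ` B)"
 have S': "S' : sets borel" using coords_image_borel[OF c(2) hB] B(3) by (simp add: S'_def Int_absorb2)
 have S'W: "S' <= W' c c'"
 proof
  fix y assume "y : S'"
  then obtain x where "x : B" "y = coords c' (h x)" by (auto simp: S'_def)
  thus "y : W' c c'" using B unfolding local_dom_def by (intro image_eqI[of _ _ "h x"]) auto
 qed
 define f where "f = (%y. ennreal (if y : U c' then w c' y else 0) * indicator S' y)"
 have fm: "f : borel_measurable borel"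
 proof -
  have "(%y. if y : U c' then w c' y else 0) : borel_measurable borel"
   using U_borel[OF c(2)] w_cont[OF c(2)] by (intro borel_measurable_continuous_on_if) (auto intro!: continuous_intros)
  thus ?thesis unfolding f_def using S' by auto
 qed
 have mat: "matrix (%v. J c c' y *v v) = J c c' y" for y by (rule matrix_of_matrix_vector_mul)
 have "emeasure (N c') (h ` B) = (nn_integral lborel (%y. f y * indicator (W' c c') y))"
  unfolding emeasure_N[OF c(2) hB] using B(3) S'W W_sub
  by (intro nn_integral_cong) (auto simp: f_def S'_def Int_absorb2 indicator_def)
 also have "... = (nn_integral lborel (%y. f (tau c c' y) * ennreal (abs (det (matrix (%v. J c c' y *v v)))) * indicator (W c c') y))"
 proof (rule nn_integral_change_of_variables[OF open_W[OF c] open_W'[OF c] tau_image[OF c] sigma_tau[OF c] _ tau_deriv[OF c] _ fm])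
  show "continuous_on (W' c c') (sigma c c')" by (rule Ck_on_cont[OF sigma_smooth[OF c, of 0]])
  show "continuous_on (W c c') (%y. det (matrix (%v. J c c' y *v v)))" unfolding mat by (rule det_J_cont[OF c])
 qed
 also have "... = (\<integral>\<^sup>+y \<in> coords c ` (B Int domain c). ennreal (w c y) \<partial>lborel)"
 proof (intro nn_integral_cong)
  fix y
  show "f (tau c c' y) * ennreal (abs (det (matrix (%v. J c c' y *v v)))) * indicator (W c c') y =
   ennreal (w c y) * indicator (coords c ` (B Int domain c)) y"
  proof (cases "y : coords c ` (B Int domain c)")
   case True
   then obtain x where x: "x : B" "x : domain c" "y = coords c x" by auto
   hence yW: "y : W c c'" using B(3) by (auto simp: local_dom_def)
   have ty: "tau c c' y = coords c' (h x)" using x tau_coords[OF c(1)] by simp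
   hence "tau c c' y : S'" "tau c c' y : U c'" using x B(3) by (auto simp: S'_def)
   hence "f (tau c c' y) = ennreal (w c' (tau c c' y))" by (simp add: f_def)
   thus ?thesis using True yW w_pullback[OF c yW] unfolding mat
    by (simp add: ennreal_mult'[symmetric] mult.commute)
  next
   case False
   have "tau c c' y ~: S'" if yW: "y : W c c'"
   proof
    assume "tau c c' y : S'"
    then obtain x where x: "x : B" "tau c c' y = coords c' (h x)" by (auto simp: S'_def)
    have "h (param c y) = h x"
     using param_tau[OF c yW] x B(3) c(2) by (metis image_subset_iff param_coords)
    hence "param c y = x" using bij_h by (metis inv_h(1))
    moreover have "y : U c" using yW W_sub(1) by blast
    ultimately have "coords c x = y" using coords_param by metis
    thus False using False x(1) B(2) by blast
   qed
   thus ?thesis using False by (auto simp: f_def indicator_def)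
  qed
 qed
 finally show ?thesis unfolding emeasure_N[OF c(1) B(1)] by simp
qed

end

locale compact_riemannian = riemannian_mfd M
 for M :: "('a::{t2_space,second_countable_topology}, 'n::finite) riemannian" +
 assumes compact_M: "compact (UNIV :: 'a set)"
begin

definition cs :: "nat => ('a, 'n) chart" where
 "cs = (SOME f. range f <= atlas M & (UN n. domain (f n)) = UNIV)"

lemma cs: "cs n : atlas M" "(UN n. domain (cs n)) = UNIV"
proof -
 have cov: "UNIV <= (UN c:atlas M. domain c)" using chart_cover by blast
 obtain C where C: "C <= atlas M" "finite C" "UNIV <= (UN c:C. domain c)"
  by (rule compactE_image[OF compact_M, of "atlas M" domain]) (use open_domain cov in auto)
 have ne: "C ~= {}" using C(3) by auto
 have r: "range (from_nat_into C) = C" by (rule range_from_nat_into[OF ne countable_finite[OF C(2)]])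
 have "range (from_nat_into C) <= atlas M & (UN n. domain (from_nat_into C n)) = UNIV"
 proof
  show "range (from_nat_into C) <= atlas M" using r C by simp
  have "(UN n. domain (from_nat_into C n)) = (UN c:range (from_nat_into C). domain c)" by simp
  thus "(UN n. domain (from_nat_into C n)) = UNIV" unfolding r using C(3) by auto
 qed
 from someI[of "%f. range f <= atlas M & (UN n. domain (f n)) = UNIV", OF this]
 have "range cs <= atlas M & (UN n. domain (cs n)) = UNIV" unfolding cs_def .
 thus "cs n : atlas M" "(UN n. domain (cs n)) = UNIV" by auto
qed

text \<open>A Borel partition of \<open>M\<close> subordinate to countably many charts, on which the local measures are glued.\<close>
definition D :: "nat => 'a set" where "D = disjointed (%n. domain (cs n))"

lemma D: "disjoint_family D" "(UN n. D n) = UNIV" "D n <= domain (cs n)" "D n : sets borel"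
proof -
 show "disjoint_family D" unfolding D_def by (rule disjoint_family_disjointed)
 show "(UN n. D n) = UNIV" unfolding D_def UN_disjointed_eq by (rule cs)
 show "D n <= domain (cs n)" unfolding D_def by (rule disjointed_subset)
 show "D n : sets borel" unfolding D_def disjointed_def using domain_borel[OF cs(1)] by auto
qed

lemma emeasure_split:
 assumes B: "B : sets mu" and mu: "sets mu = sets borel"
 shows "emeasure mu B = (\<Sum>n. emeasure mu (B Int D n))"
proof -
 have "(\<Sum>n. emeasure mu (B Int D n)) = emeasure mu (UN n. B Int D n)"
  by (rule suminf_emeasure) (use B mu D(1,4) in "auto simp: disjoint_family_on_def")
 also have "(UN n. B Int D n) = B" using D(2) by auto
 finally show ?thesis by simp
qed

definition is_volume :: "'a measure => bool" where
 "is_volume mu \<longleftrightarrow> sets mu = sets borel &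
   (ALL c:atlas M. ALL B:sets borel. B <= domain c --> emeasure mu B = emeasure (N c) B)"

lemma is_volume_exists: "EX mu. is_volume mu"
proof -
 define m where "m = (%B. \<Sum>n. emeasure (N (cs n)) (B Int D n))"
 define mu where "mu = measure_of UNIV (sets borel) m"
 have "countably_additive (sets borel) m"
  unfolding countably_additive_def
 proof (intro allI impI)
  fix A :: "nat => 'a set" assume A: "range A <= sets borel" "disjoint_family A"
  have "(\<Sum>i. m (A i)) = (\<Sum>i. \<Sum>n. emeasure (N (cs n)) (A i Int D n))" by (simp add: m_def)
  also have "... = (\<integral>\<^sup>+i. (\<integral>\<^sup>+n. emeasure (N (cs n)) (A i Int D n) \<partial>count_space UNIV) \<partial>count_space UNIV)"
   by (simp add: nn_integral_count_space_nat)
  also have "... = (\<Sum>n. \<integral>\<^sup>+i. emeasure (N (cs n)) (A i Int D n) \<partial>count_space UNIV)"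
   by (subst nn_integral_suminf[symmetric]) (simp_all add: nn_integral_count_space_nat)
  also have "... = (\<Sum>n. emeasure (N (cs n)) (UN i. A i Int D n))"
  proof (intro suminf_cong)
   fix n
   have "(\<Sum>i. emeasure (N (cs n)) (A i Int D n)) = emeasure (N (cs n)) (UN i. A i Int D n)"
    by (rule suminf_emeasure) (use A D(4) in "auto simp: disjoint_family_on_def")
   thus "(\<integral>\<^sup>+i. emeasure (N (cs n)) (A i Int D n) \<partial>count_space UNIV) = emeasure (N (cs n)) (UN i. A i Int D n)"
    by (simp add: nn_integral_count_space_nat)
  qed
  finally show "(\<Sum>i. m (A i)) = m (UN i. A i)" by (simp add: m_def)
 qed
 hence em: "emeasure mu B = m B" if "B : sets borel" for B
  using that by (intro emeasure_measure_of[OF mu_def]) (auto simp: positive_def m_def mu_def sets.sigma_sets_eq[of borel, simplified])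
 have sets: "sets mu = sets borel"
  unfolding mu_def using sets.sigma_sets_eq[of "borel :: 'a measure"] by (simp add: sets_measure_of_conv)
 have "emeasure mu B = emeasure (N c) B" if c: "c : atlas M" and B: "B : sets borel" "B <= domain c" for c B
 proof -
  have "emeasure (N (cs n)) (B Int D n) = emeasure (N c) (B Int D n)" for n
   using ident.emeasure_N_isometry[OF cs(1) c, of "B Int D n" n] B D(3,4) by auto
  hence "m B = (\<Sum>n. emeasure (N c) (B Int D n))" by (simp add: m_def)
  thus ?thesis using em[OF B(1)] emeasure_split[of B "N c"] B(1) by simp
 qed
 thus ?thesis using sets unfolding is_volume_def by blast
qed

lemma is_volume_unique: "is_volume mu ==> is_volume mu' ==> mu = mu'"
proof (rule measure_eqI)
 assume v: "is_volume mu" "is_volume mu'"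
 thus "sets mu = sets mu'" by (simp add: is_volume_def)
 fix B assume B: "B : sets mu"
 hence Bb: "B : sets borel" using v by (simp add: is_volume_def)
 have s: "sets mu = sets borel" "sets mu' = sets borel" using v by (auto simp: is_volume_def)
 have "emeasure mu (B Int D n) = emeasure mu' (B Int D n)" for n
 proof -
  have "B Int D n : sets borel" "B Int D n <= domain (cs n)" using Bb D(3,4)[of n] by auto
  thus ?thesis using v cs(1)[of n] unfolding is_volume_def by metis
 qed
 thus "emeasure mu B = emeasure mu' B"
  using emeasure_split[of B mu] emeasure_split[of B mu'] B s by simp
qed

lemma volume: "is_volume (volume M)"
proof -
 obtain mu where mu: "is_volume mu" using is_volume_exists by blast
 have "volume M = (THE mu. is_volume mu)"
  unfolding volume_def is_volume_def
 proof (intro arg_cong[where f = The] ext conj_cong refl ball_cong imp_cong)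
  fix mu :: "'a measure" and c B assume "c : atlas M" "B : sets borel" "B <= domain c"
  thus "(emeasure mu B = (\<integral>\<^sup>+y \<in> coords c ` B. ennreal (sqrt (det (metric M c (param c y)))) \<partial>lborel))
   \<longleftrightarrow> (emeasure mu B = emeasure (N c) B)"
   using emeasure_N[of c B] by (simp add: Int_absorb2 w_def g_def)
 qed
 thus ?thesis using theI[of is_volume, OF mu] is_volume_unique[OF _ mu] by simp
qed

abbreviation vol where "vol == volume M"

lemma sets_vol [simp]: "sets vol = sets borel" and space_vol [simp]: "space vol = UNIV"
 and emeasure_vol: "c : atlas M ==> B : sets borel ==> B <= domain c ==> emeasure vol B = emeasure (N c) B"
 using volume sets_eq_imp_space_eq[of vol borel] by (auto simp: is_volume_def)

lemma measurable_vol: "measurable vol K = measurable borel K"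
 by (rule measurable_cong_sets) auto

lemma vol_chart:
 assumes c: "c : atlas M"
 shows "density vol (indicator (domain c)) = N c"
proof (rule measure_eqI)
 fix B assume "B : sets (density vol (indicator (domain c)))"
 hence B: "B : sets borel" by simp
 have "emeasure (density vol (indicator (domain c))) B = (nn_integral vol (%x. indicator (domain c) x * indicator B x))"
  using B domain_borel[OF c] by (intro emeasure_density) (auto simp: measurable_vol)
 also have "... = (nn_integral vol (%x. indicator (domain c Int B) x))" by (simp add: indicator_inter_arith)
 also have "... = emeasure vol (domain c Int B)" using B domain_borel[OF c] by (intro nn_integral_indicator) auto
 finally have "emeasure (density vol (indicator (domain c))) B = emeasure vol (domain c Int B)" .
 also have "... = emeasure (N c) (domain c Int B)"
  using B domain_borel[OF c] by (intro emeasure_vol[OF c]) auto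
 also have "... = emeasure (N c) B"
  using B domain_borel[OF c] by (simp add: emeasure_N[OF c] Int_ac)
 finally show "emeasure (density vol (indicator (domain c))) B = emeasure (N c) B" .
qed simp

lemma integral_vol_chart:
 fixes f :: "'a => real"
 assumes c: "c : atlas M" and f: "f : borel_measurable borel" and z: "!!x. x ~: domain c ==> f x = 0"
 shows "(LINT x|vol. f x) = (LINT y|lborel. (if y : U c then w c y * f (param c y) else 0))"
proof -
 have "(LINT x|vol. f x) = (LINT x|vol. indicator (domain c) x *\<^sub>R f x)"
  by (intro lebesgue_integral_cong) (use z in "auto simp: indicator_def")
 also have "... = (\<integral>x. f x \<partial>density vol (%x. ennreal (indicator (domain c) x)))"
  using f domain_borel[OF c] by (intro integral_density[symmetric]) (auto simp: measurable_vol)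
 also have "... = (\<integral>x. f x \<partial>N c)"
  using vol_chart[OF c] by (simp add: ennreal_indicator)
 also have "... = (\<integral>y. f (param c y) \<partial>density (restrict_space lborel (U c)) (%y. ennreal (w c y)))"
  unfolding N_def using f param_meas[OF c] by (intro integral_distr) (simp_all cong: measurable_cong_sets)
 also have "... = (\<integral>y. w c y *\<^sub>R f (param c y) \<partial>restrict_space lborel (U c))"
  using w_meas[OF c] measurable_compose[OF param_meas[OF c] f] w_pos[OF c]
  by (intro integral_density) (auto intro!: AE_I2 simp: space_restrict_space less_imp_le)
 also have "... = (LINT y|lborel. indicator (U c) y *\<^sub>R (w c y *\<^sub>R f (param c y)))"
  using U_borel[OF c] by (intro integral_restrict_space) auto
 also have "... = (LINT y|lborel. (if y : U c then w c y * f (param c y) else 0))"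
  by (intro lebesgue_integral_cong) (auto simp: indicator_def)
 finally show ?thesis .
qed

lemma finite_vol: "finite_measure vol"
proof
 have loc: "EX V. open V & x : V & emeasure vol V < \<infinity>" for x
 proof -
  obtain c where c: "c : atlas M" "x : domain c" using chart_cover by blast
  obtain r where r: "r > 0" "cball (coords c x) r <= U c"
   using open_contains_cball[of "U c"] open_U[OF c(1)] c(2) by blast
  define V where "V = param c ` ball (coords c x) r"
  have sub: "ball (coords c x) r <= U c" using r(2) by auto
  have V: "open V" unfolding V_def by (rule open_param_image[OF c(1) open_ball sub])
  have xV: "x : V" unfolding V_def using c r by (intro image_eqI[of _ _ "coords c x"]) auto
  have VD: "V <= domain c" unfolding V_def using sub by auto
  have im: "coords c ` (V Int domain c) <= cball (coords c x) r" unfolding V_def using sub by auto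
  obtain C where C: "!!y. y : cball (coords c x) r ==> abs (w c y) <= C"
  proof -
   have "bounded (w c ` cball (coords c x) r)"
    using compact_continuous_image[OF continuous_on_subset[OF w_cont[OF c(1)] r(2)] compact_cball] compact_imp_bounded by blast
   then obtain B where B: "ALL x:w c ` cball (coords c x) r. norm x <= B" unfolding bounded_iff by blast
   show thesis by (rule that[of B]) (metis B imageI real_norm_def)
  qed
  have "emeasure vol V = (\<integral>\<^sup>+y \<in> coords c ` (V Int domain c). ennreal (w c y) \<partial>lborel)"
   using emeasure_vol[OF c(1) _ VD] emeasure_N[OF c(1)] V by simp
  also have "... <= (nn_integral lborel (%y. ennreal C * indicator (cball (coords c x) r) y))"
  proof (intro nn_integral_mono)
   fix y
   show "ennreal (w c y) * indicator (coords c ` (V Int domain c)) y <= ennreal C * indicator (cball (coords c x) r) y"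
   proof (cases "y : coords c ` (V Int domain c)")
    case True
    hence "y : cball (coords c x) r" using im by blast
    thus ?thesis using True abs_le_D1[OF C] by (simp add: ennreal_leI)
   qed simp
  qed
  also have "... = ennreal C * emeasure lborel (cball (coords c x) r)"
   by (simp add: nn_integral_cmult_indicator)
  also have "... < \<infinity>" using emeasure_bounded_finite[OF bounded_cball, of "coords c x" r] by (simp add: ennreal_mult_less_top)
  finally show ?thesis using V xV by blast
 qed
 then obtain V where V: "!!x. open (V x)" "!!x. x : V x" "!!x. emeasure vol (V x) < \<infinity>" by metis
 obtain F where F: "finite F" "UNIV <= (UN x:F. V x)"
  by (rule compactE_image[OF compact_M, of UNIV V]) (use V in auto)
 have "emeasure vol UNIV <= emeasure vol (UN x:F. V x)"
  using F V(1) by (intro emeasure_mono) auto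
 also have "... <= (SUM x:F. emeasure vol (V x))"
  using F V(1) by (intro emeasure_subadditive_finite) auto
 also have "... < \<infinity>" using V(3) F(1) unfolding infinity_ennreal_def by (subst ennreal_sum_less_top) auto
 finally show "emeasure vol (space vol) ~= \<infinity>" unfolding space_vol by (rule less_imp_neq)
qed

lemma open_vol_pos:
 assumes V: "open V" "x : V" shows "emeasure vol V > 0"
proof -
 obtain c where c: "c : atlas M" "x : domain c" using chart_cover by blast
 have o: "open (coords c ` (V Int domain c))"
  by (rule open_coords_image[OF c(1)]) (use V open_domain[OF c(1)] in auto)
 have sub: "coords c ` (V Int domain c) <= U c" by auto
 have VD: "V Int domain c : sets borel" using V open_domain[OF c(1)] by auto
 have "0 < emeasure (N c) (V Int domain c)"
 proof (rule ccontr)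
  assume "~ ?thesis"
  hence "(\<integral>\<^sup>+y \<in> coords c ` (V Int domain c). ennreal (w c y) \<partial>lborel) = 0"
   using emeasure_N[OF c(1) VD] by (simp add: Int_assoc)
  moreover have "(%y. ennreal (w c y) * indicator (coords c ` (V Int domain c)) y) : borel_measurable lborel"
  proof -
   have "(%y. if y : U c then w c y else 0) : borel_measurable borel"
    using U_borel[OF c(1)] w_cont[OF c(1)] by (intro borel_measurable_continuous_on_if) (auto intro!: continuous_intros)
   hence "(%y. ennreal (if y : U c then w c y else 0) * indicator (coords c ` (V Int domain c)) y) : borel_measurable borel"
    using o by (intro borel_measurable_times_ennreal measurable_compose[OF _ measurable_ennreal] borel_measurable_indicator) auto
   moreover have "(%y. ennreal (if y : U c then w c y else 0) * indicator (coords c ` (V Int domain c)) y) =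
     (%y. ennreal (w c y) * indicator (coords c ` (V Int domain c)) y)"
    using sub by (auto simp: indicator_def fun_eq_iff)
   ultimately show ?thesis by simp
  qed
  ultimately have "AE y in lborel. ennreal (w c y) * indicator (coords c ` (V Int domain c)) y = 0"
   by (simp add: nn_integral_0_iff_AE)
  hence "AE y in lborel. y ~: coords c ` (V Int domain c)"
   by eventually_elim (use w_pos[OF c(1)] sub in "force simp: indicator_def ennreal_eq_0_iff split: if_splits")
  hence "coords c ` (V Int domain c) : null_sets lborel"
   using o by (simp add: AE_iff_null_sets[of "coords c ` (V Int domain c)"] AE_not_in)
  hence "negligible (coords c ` (V Int domain c))"
   using negligible_iff_null_sets null_sets_completionI by blast
  thus False using open_not_negligible[OF o] V c(2) by auto
 qed
 also have "emeasure (N c) (V Int domain c) = emeasure vol (V Int domain c)"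
  using emeasure_vol[OF c(1) VD] by simp
 also have "... <= emeasure vol V" using V by (intro emeasure_mono) auto
 finally show ?thesis .
qed

end

locale compact_isometry = compact_riemannian M + riemannian_isometry M h
 for M :: "('a::{t2_space,second_countable_topology}, 'n::finite) riemannian" and h
begin

text \<open>The image measure has the characteristic property of the Riemannian measure, locally by \<open>emeasure_N_isometry\<close>.\<close>
lemma distr_h: "distr vol borel h = vol"
proof (rule measure_eqI)
 show "sets (distr vol borel h) = sets vol" by simp
 have hm: "h : vol \<rightarrow>\<^sub>M borel"
  using cont_h by (simp add: borel_measurable_continuous_onI cong: measurable_cong_sets)
 fix B assume "B : sets (distr vol borel h)"
 hence B: "B : sets borel" by simp
 define A where "A = h -` B"
 have A: "A : sets borel" unfolding A_def by (rule h_borel(1)[OF B])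
 have hA: "h ` A = B" unfolding A_def using bij_h by (simp add: bij_is_surj surj_image_vimage_eq)
 define P where "P = (%(n, m). A Int D n Int h -` D m)"
 have Pm: "P z : sets borel" for z unfolding P_def using A D(4) h_borel(1)[OF D(4)] by (auto split: prod.split)
 have hP: "h ` P z : sets borel" for z by (rule h_borel(2)[OF Pm])
 have eq: "emeasure vol (P z) = emeasure vol (h ` P z)" for z
 proof -
  obtain n m where z: "z = (n, m)" by (cases z)
  have s1: "P z <= domain (cs n)" and s2: "h ` P z <= domain (cs m)" using D(3) by (auto simp: P_def z)
  have "emeasure vol (P z) = emeasure (N (cs n)) (P z)" by (rule emeasure_vol[OF cs(1) Pm s1])
  also have "... = emeasure (N (cs m)) (h ` P z)" by (rule emeasure_N_isometry[OF cs(1) cs(1) Pm s1 s2])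
  also have "... = emeasure vol (h ` P z)" by (rule emeasure_vol[OF cs(1) hP s2, symmetric])
  finally show ?thesis .
 qed
 have UP: "A = (UN z. P z)" unfolding P_def using D(2) by (auto simp: set_eq_iff)
 have disj: "P z Int P z' = {}" if "z ~= z'" for z z'
 proof -
  obtain n m n' m' where z: "z = (n, m)" "z' = (n', m')" by (cases z; cases z') auto
  hence "n ~= n' | m ~= m'" using that by auto
  hence "D n Int D n' = {} | D m Int D m' = {}" using D(1) unfolding disjoint_family_on_def by blast
  thus ?thesis unfolding z P_def by auto
 qed
 define q where "q = (%k. P (prod_decode k))"
 have q: "A = (UN k. q k)" "disjoint_family q" "disjoint_family (%k. h ` q k)" "B = (UN k. h ` q k)"
 proof -
  show 1: "A = (UN k. q k)" unfolding UP q_def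
   using image_image[of P prod_decode UNIV] surj_prod_decode by simp
  show 2: "disjoint_family q" unfolding disjoint_family_on_def q_def
   using disj inj_prod_decode[of UNIV] by (metis injD)
  show "disjoint_family (%k. h ` q k)"
   using 2 bij_is_inj[OF bij_h] unfolding disjoint_family_on_def by (metis image_Int image_empty)
  show "B = (UN k. h ` q k)" using hA 1 by auto
 qed
 have "emeasure (distr vol borel h) B = emeasure vol A"
  using B hm by (simp add: emeasure_distr A_def)
 also have "... = (\<Sum>k. emeasure vol (q k))"
 proof -
  have "range q <= sets vol" unfolding q_def by (intro image_subsetI) (metis Pm sets_vol)
  thus ?thesis unfolding q(1) using q(2) by (intro suminf_emeasure[symmetric])
 qed
 also have "... = (\<Sum>k. emeasure vol (h ` q k))" by (simp add: q_def eq)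
 also have "... = emeasure vol B"
 proof -
  have "range (%k. h ` q k) <= sets vol" unfolding q_def by (intro image_subsetI) (metis hP sets_vol)
  thus ?thesis unfolding q(4) using q(3) by (intro suminf_emeasure)
 qed
 finally show "emeasure (distr vol borel h) B = emeasure vol B" .
qed

lemma integral_h:
 fixes f :: "'a => real"
 assumes f: "f : borel_measurable borel"
 shows "(LINT x|vol. f (h x)) = (LINT x|vol. f x)"
proof -
 have hm: "h : vol \<rightarrow>\<^sub>M borel"
  using cont_h by (simp add: borel_measurable_continuous_onI cong: measurable_cong_sets)
 have "(\<integral>x. f x \<partial>distr vol borel h) = (LINT x|vol. f (h x))"
  by (rule integral_distr[OF hm]) (use f in simp)
 thus ?thesis by (simp add: distr_h)
qed

end

section \<open>The Laplacian in weak form\<close>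

lemma Ck_on_local:
 assumes "!!x. x : U ==> EX V. open V & x : V & V <= U & Ck_on k V f"
 shows "Ck_on k U f"
 using assms
proof (induction k arbitrary: f)
 case 0
 have "isCont f x" if x: "x : U" for x
 proof -
  obtain V where "open V" "x : V" "continuous_on V f" using 0[OF x] by auto
  thus ?thesis using continuous_on_eq_continuous_at by blast
 qed
 thus ?case by (auto intro: continuous_at_imp_continuous_on)
next
 case (Suc k)
 have "f differentiable (at x)" if x: "x : U" for x
 proof -
  obtain V where V: "open V" "x : V" "Ck_on (Suc k) V f" using Suc.prems[OF x] by blast
  show ?thesis by (rule Ck_on_differentiable[OF V(3,1,2)])
 qed
 hence "f differentiable_on U" by (simp add: differentiable_at_imp_differentiable_on)
 moreover have "Ck_on k U (%y. frechet_derivative f (at y) b)" if b: "b : Basis" for b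
 proof (rule Suc.IH)
  fix x assume "x : U"
  then obtain V where V: "open V" "x : V" "V <= U" "Ck_on (Suc k) V f" using Suc.prems by blast
  thus "EX V. open V & x : V & V <= U & Ck_on k V (%y. frechet_derivative f (at y) b)"
   using b by auto
 qed
 ultimately show ?case by simp
qed

text \<open>This function gives compactly supported bump functions of class C1, which is enough regularity to integrate by parts once.\<close>
lemma C1_max0_sq: "Ck_on (Suc 0) UNIV (%t::real. (max 0 t)^2)"
proof (rule Ck_on_real_fun)
 show "DERIV (%t. (max 0 t)^2) x :> 2 * max 0 x" for x :: real
 proof -
  consider "x < 0" | "x = 0" | "x > 0" by linarith
  thus ?thesis
  proof cases
   case 1
   have "DERIV (%t. 0) x :> 0" by simp
   hence "DERIV (%t. (max 0 t)^2) x :> 0"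
    by (rule DERIV_local[of _ _ _ "{..<0}"]) (use 1 in auto)
   thus ?thesis using 1 by simp
  next
   case 2
   have "tendsto (%t::real. (max 0 t)^2 / t) 0 (at 0)"
   proof (rule Lim_null_comparison)
    show "eventually (%t. norm ((max 0 t)^2 / t) <= abs t) (at 0)" for t :: real
     by (intro always_eventually allI) (auto simp: max_def power2_eq_square)
    show "tendsto (%t::real. abs t) 0 (at 0)" by (intro tendsto_rabs_zero tendsto_ident_at)
   qed
   thus ?thesis using 2 by (simp add: has_field_derivative_iff)
  next
   case 3
   have "DERIV (%t. t^2) x :> 2 * x" by (auto intro!: derivative_eq_intros)
   hence "DERIV (%t. (max 0 t)^2) x :> 2 * x"
    by (rule DERIV_local[of _ _ _ "{0<..}"]) (use 3 in auto)
   thus ?thesis using 3 by simp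
  qed
 qed
 show "Ck_on 0 UNIV (%x::real. 2 * max 0 x)" by (auto intro!: continuous_intros)
qed simp

context riemannian_mfd begin

definition C_fun :: "nat => ('a => real) => bool" where
 "C_fun k f = (ALL c:atlas M. Ck_on k (U c) (f o param c))"

lemma C_funD: "C_fun k f ==> c : atlas M ==> Ck_on k (U c) (f o param c)"
 by (simp add: C_fun_def)

lemma smooth_fun_iff: "smooth_fun M f = (ALL k. C_fun k f)"
proof
 show "smooth_fun M f ==> ALL k. C_fun k f"
  unfolding smooth_fun_def C_fun_def using smooth_on_openD[OF _ open_U] by blast
 show "ALL k. C_fun k f ==> smooth_fun M f"
  unfolding smooth_fun_def C_fun_def by (intro ballI smooth_on_openI open_U) auto
qed

lemma C_fun_Suc: "C_fun (Suc k) f ==> C_fun k f"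
 unfolding C_fun_def using Ck_on_Suc by blast

lemma C_fun_cont: assumes f: "C_fun k f" shows "continuous_on UNIV f"
proof -
 have "isCont f x" for x
 proof -
  obtain c where c: "c : atlas M" "x : domain c" using chart_cover by blast
  have "continuous_on (domain c) (%x. (f o param c) (coords c x))"
   using Ck_on_cont[OF C_funD[OF f c(1)]] cont_coords[OF c(1)] by (rule continuous_on_compose2) auto
  hence "continuous_on (domain c) f" by (rule continuous_on_eq) (use c in auto)
  thus ?thesis using c open_domain[OF c(1)] continuous_on_eq_continuous_at by blast
 qed
 thus ?thesis by (simp add: continuous_at_imp_continuous_on)
qed

lemma C_fun_differentiable:
 "C_fun (Suc k) f ==> c : atlas M ==> y : U c ==> (f o param c) differentiable (at y)"
 by (rule Ck_on_differentiable[OF C_funD open_U])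

lemma C_fun_const: "C_fun k (%x. c)"
 unfolding C_fun_def o_def using Ck_on_const by blast

lemma C_fun_mult: "C_fun k f ==> C_fun k f' ==> C_fun k (%x. f x * f' x)"
 unfolding C_fun_def o_def using Ck_on_mult[OF open_U] by blast

lemma C_fun_sum: "(!!i. i : S ==> C_fun k (f i)) ==> C_fun k (%x. SUM i:S. f i x)"
 unfolding C_fun_def o_def by (intro ballI Ck_on_sum open_U) auto

lemma C_fun_divide: "C_fun (Suc 0) f ==> C_fun (Suc 0) f' ==> (!!x. f' x ~= 0) ==> C_fun (Suc 0) (%x. f x / f' x)"
 unfolding C_fun_def o_def by (intro ballI C1_on_divide open_U) auto

lemma C_fun_compose_smooth_map:
 assumes k: "smooth_map M k" and f: "C_fun j f"
 shows "C_fun j (f o k)"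
 unfolding C_fun_def
proof
 fix c assume c: "c : atlas M"
 have kc: "continuous_on UNIV k" using k by (simp add: smooth_map_def)
 show "Ck_on j (U c) (f o k o param c)"
 proof (rule Ck_on_local)
  fix y assume y: "y : U c"
  obtain c' where c': "c' : atlas M" "k (param c y) : domain c'" using chart_cover by blast
  define V where "V = local_dom c c' k"
  have V: "open V" unfolding V_def local_dom_def
   using open_vimage[OF open_domain[OF c'(1)] kc] open_domain[OF c]
   by (intro open_coords_image[OF c]) auto
  have yV: "y : V" unfolding V_def local_dom_def using y c c' by (intro image_eqI[of _ _ "param c y"]) auto
  have sub: "V <= U c" by (auto simp: V_def local_dom_def)
  have inD: "k (param c z) : domain c'" if "z : V" for z using that c by (auto simp: V_def local_dom_def)
  have "smooth_on V (local_rep c c' k)" using k c c' by (simp add: smooth_map_def V_def)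
  hence sm: "Ck_on j V (local_rep c c' k)" by (rule smooth_on_openD[OF _ V])
  have "Ck_on j V (%z. (f o param c') (local_rep c c' k z))"
   by (rule Ck_on_compose[OF open_U[OF c'(1)] V _ C_funD[OF f c'(1)] sm]) (use inD in "auto simp: local_rep_def")
  hence "Ck_on j V (f o k o param c)"
   by (rule Ck_on_cong[OF V]) (use inD c' in "auto simp: local_rep_def")
  thus "EX V. open V & y : V & V <= U c & Ck_on j V (f o k o param c)" using V yV sub by blast
 qed
qed

lemma compact_param_image: "c : atlas M ==> compact K ==> K <= U c ==> compact (param c ` K)"
 by (intro compact_continuous_image continuous_on_subset[OF cont_param])

lemma bump_exists:
 assumes S: "open S" "x0 : S"
 obtains phi K where "C_fun (Suc 0) phi" "compact K" "K <= S" "ALL x. 0 <= phi x" "0 < phi x0" "ALL x. x ~: K --> phi x = 0"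
proof -
 obtain c where c: "c : atlas M" "x0 : domain c" using chart_cover by blast
 define O' where "O' = coords c ` (S Int domain c)"
 have "open O'" unfolding O'_def by (rule open_coords_image[OF c(1)]) (use S open_domain[OF c(1)] in auto)
 moreover have "coords c x0 : O'" using c S by (auto simp: O'_def)
 ultimately obtain r where r: "r > 0" "cball (coords c x0) r <= O'" using open_contains_cball by blast
 define b where "b = (%y. (max 0 (r^2 - (norm (y - coords c x0))^2))^2)"
 have bC: "Ck_on (Suc 0) UNIV b"
 proof -
  have "Ck_on (Suc 0) UNIV (%y. r^2 - (SUM i:UNIV. (y $ i - coords c x0 $ i) * (y $ i - coords c x0 $ i)))"
   by (intro Ck_on_diff Ck_on_const Ck_on_sum Ck_on_mult Ck_on_bounded_linear[OF bounded_linear_vec_nth] Ck_on_id open_UNIV)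
  moreover have "(norm (y - coords c x0))^2 = (SUM i:UNIV. (y $ i - coords c x0 $ i) * (y $ i - coords c x0 $ i))" for y
   by (simp add: power2_norm_eq_inner inner_vec_def)
  ultimately have "Ck_on (Suc 0) UNIV (%y. r^2 - (norm (y - coords c x0))^2)" by simp
  from Ck_on_compose[OF open_UNIV open_UNIV _ C1_max0_sq this] show ?thesis by (simp add: b_def)
 qed
 define K where "K = param c ` cball (coords c x0) r"
 have sub: "cball (coords c x0) r <= U c" using r(2) by (auto simp: O'_def)
 have K: "compact K" unfolding K_def by (rule compact_param_image[OF c(1) compact_cball sub])
 have KS: "K <= S" using r(2) c by (force simp: K_def O'_def)
 define phi where "phi = (%x. if x : domain c then b (coords c x) else 0)"
 have z: "phi x = 0" if "x ~: K" for x
 proof (cases "x : domain c")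
  case True
  have "coords c x ~: cball (coords c x0) r"
   using that True c by (auto simp: K_def image_iff) (metis mem_cball param_coords)
  hence "r < norm (coords c x - coords c x0)" by (simp add: dist_norm norm_minus_commute)
  hence "r^2 < (norm (coords c x - coords c x0))^2" using r(1) by (intro power_strict_mono) auto
  thus ?thesis by (simp add: phi_def b_def)
 qed (simp add: phi_def)
 have "C_fun (Suc 0) phi" unfolding C_fun_def
 proof
  fix c' assume c': "c' : atlas M"
  show "Ck_on (Suc 0) (U c') (phi o param c')"
  proof (rule Ck_on_local)
   fix y assume y: "y : U c'"
   show "EX V. open V & y : V & V <= U c' & Ck_on (Suc 0) V (phi o param c')"
   proof (cases "param c' y : domain c")
    case True
    define V where "V = local_dom c' c id"
    have V: "open V" unfolding V_def by (rule ident.open_W[OF c' c(1)])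
    have yV: "y : V" unfolding V_def using y True by (simp add: ident.W_iff[OF c'])
    have "Ck_on (Suc 0) V (local_rep c' c id)" unfolding V_def by (rule ident.tau_smooth[OF c' c(1)])
    hence "Ck_on (Suc 0) V (%z. b (local_rep c' c id z))"
     by (rule Ck_on_compose[OF open_UNIV V subset_UNIV bC])
    hence "Ck_on (Suc 0) V (phi o param c')"
     by (rule Ck_on_cong[OF V]) (auto simp: V_def ident.W_iff[OF c'] phi_def local_rep_def)
    thus ?thesis using V yV ident.W_sub(1)[of c' c] unfolding V_def by blast
   next
    case False
    define V where "V = coords c' ` (domain c' Int - K)"
    have V: "open V" unfolding V_def using K compact_imp_closed
     by (intro open_coords_image[OF c'] open_Int open_domain[OF c'] open_Compl) auto
    have "K <= domain c" using sub by (auto simp: K_def)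
    hence yV: "y : V" unfolding V_def using y False by (intro image_eqI[of _ _ "param c' y"]) auto
    have "Ck_on (Suc 0) V (phi o param c')"
     by (rule Ck_on_cong[OF V Ck_on_const[of _ _ 0]]) (use z c' in "auto simp: V_def")
    thus ?thesis using V yV unfolding V_def by blast
   qed
  qed
 qed
 moreover have "0 < phi x0" using c r(1) by (simp add: phi_def b_def)
 moreover have "0 <= phi x" for x by (simp add: phi_def b_def)
 ultimately show thesis using that K KS z by blast
qed

definition lap :: "('a, 'n) chart => ('a => real) => real^'n => real" where
 "lap c f y = - divergence_in M c (gradient_in M c f) y"

lemma laplacian_lap: "laplacian M f x = lap (chart_at M x) f (coords (chart_at M x) x)"
 by (simp add: laplacian_def lap_def Let_def)

lemma dv_C: "C_fun (Suc k) f ==> c : atlas M ==> Ck_on k (U c) (%y. dv c f y $ i)"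
 unfolding dv_def using Ck_on_partial[OF C_funD] by simp

lemma gradient_C1: "C_fun (Suc (Suc 0)) f ==> c : atlas M ==> Ck_on (Suc 0) (U c) (%y. gradient_in M c f y $ i)"
 unfolding gradient_in_eq
 by (intro C1_on_matrix_inv open_U g_smooth dv_C) (use det_g in force)+

lemma w_gradient_C1: "C_fun (Suc (Suc 0)) f ==> c : atlas M ==> Ck_on (Suc 0) (U c) (%y. w c y * gradient_in M c f y $ i)"
 by (intro Ck_on_mult open_U w_C1 gradient_C1)

lemma lap_eq: "lap c f y = - (SUM i:UNIV. partial i (%z. w c z * gradient_in M c f z $ i) y) / w c y"
 by (simp add: lap_def divergence_in_def w_def g_def Let_def)

lemma lap_cont: assumes f: "C_fun (Suc (Suc 0)) f" and c: "c : atlas M" shows "continuous_on (U c) (lap c f)"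
proof -
 have "continuous_on (U c) (%y. partial i (%z. w c z * gradient_in M c f z $ i) y)" for i
  using Ck_on_partial[OF w_gradient_C1[OF f c]] by simp
 thus ?thesis unfolding lap_eq[abs_def] using w_pos[OF c]
  by (intro continuous_intros w_cont[OF c]) (auto simp: less_imp_neq[symmetric])
qed

lemma ginner_cont: assumes f: "C_fun (Suc 0) f1" "C_fun (Suc (Suc 0)) f2" and c: "c : atlas M"
 shows "continuous_on (U c) (ginner c f1 f2)"
proof -
 have "continuous_on (U c) (%y. dv c f1 y $ i)" for i using dv_C[OF f(1) c] by simp
 moreover have "continuous_on (U c) (%y. gradient_in M c f2 y $ i)" for i
  using Ck_on_cont[OF gradient_C1[OF f(2) c]] .
 ultimately show ?thesis unfolding ginner_def[abs_def] inner_vec_def inner_real_def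
  by (intro continuous_on_sum continuous_on_mult)
qed

lemma dv_zero_off:
 assumes K: "compact K" and z: "!!x. x ~: K ==> phi x = 0" and c: "c : atlas M" and x: "x : domain c" "x ~: K"
 shows "dv c phi (coords c x) = 0"
proof -
 define V where "V = coords c ` (domain c Int - K)"
 have V: "open V" unfolding V_def using K compact_imp_closed
  by (intro open_coords_image[OF c] open_Int open_domain[OF c] open_Compl) auto
 have xV: "coords c x : V" using x by (auto simp: V_def)
 have "partial i (phi o param c) (coords c x) = partial i (%y. 0) (coords c x)" for i
  by (rule partial_cong[OF V xV]) (use z c in "auto simp: V_def")
 thus ?thesis by (simp add: dv_def vec_eq_iff partial_def frechet_derivative_const)
qed

text \<open>Integration by parts in a chart: the divergence of \<open>phi * w * grad f\<close> has integral zero.\<close>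
lemma weak_chart:
 assumes c: "c : atlas M" and phi: "C_fun (Suc 0) phi" and f: "C_fun (Suc (Suc 0)) f"
  and K: "compact K" "K <= domain c" and z: "!!x. x ~: K ==> phi x = 0"
 shows "(LINT y|lborel. (if y : U c then w c y * (phi (param c y) * lap c f y) else 0)) =
     (LINT y|lborel. (if y : U c then w c y * ginner c phi f y else 0))"
proof -
 define K' where "K' = coords c ` K"
 have K': "compact K'" "K' <= U c" unfolding K'_def
  using K cont_coords[OF c] by (auto intro: compact_continuous_image continuous_on_subset)
 have z': "phi (param c y) = 0" if "y : U c - K'" for y
  using that c by (intro z) (auto simp: K'_def image_iff)
 define X where "X = (%i y. w c y * gradient_in M c f y $ i)"
 have XC: "Ck_on (Suc 0) (U c) (X i)" for i unfolding X_def by (rule w_gradient_C1[OF f c])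
 define h where "h = (%i y. if y : U c then (phi o param c) y * X i y else 0)"
 have hC: "Ck_on (Suc 0) UNIV (h i)" for i unfolding h_def
  by (rule C1_on_UNIV_extend[OF open_U[OF c] _ K'])
    (use Ck_on_mult[OF open_U[OF c] C_funD[OF phi c] XC] z' in auto)
 have hz: "h i y = 0" if "y ~: K'" for i y using that z'[of y] by (auto simp: h_def)
 define F1 where "F1 = (%y. if y : U c then w c y * (phi (param c y) * lap c f y) else 0)"
 define F2 where "F2 = (%y. if y : U c then w c y * ginner c phi f y else 0)"
 have ph: "(SUM i:UNIV. partial i (h i) y) = F2 y - F1 y" for y
 proof (cases "y : U c")
  case True
  have p: "partial i (h i) y = partial i (phi o param c) y * X i y + phi (param c y) * partial i (X i) y" for i
  proof -
   have "partial i (h i) y = partial i (%y. (phi o param c) y * X i y) y"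
    by (rule partial_cong[OF open_U[OF c] True]) (simp add: h_def)
   also have "... = (phi o param c) y * frechet_derivative (X i) (at y) (axis i 1) + frechet_derivative (phi o param c) (at y) (axis i 1) * X i y"
    by (rule partial_eq[OF has_derivative_mult[OF Ck_on_has_derivative[OF C_funD[OF phi c] open_U[OF c] True]
       Ck_on_has_derivative[OF XC open_U[OF c] True]]])
   finally show ?thesis by (simp add: partial_def)
  qed
  have 2: "F2 y = (SUM i:UNIV. partial i (phi o param c) y * X i y)"
   using True by (simp add: F2_def ginner_def dv_def inner_vec_def X_def sum_distrib_left mult_ac)
  have 1: "F1 y = - (SUM i:UNIV. phi (param c y) * partial i (X i) y)"
  proof -
   have "F1 y = - (phi (param c y) * (SUM i:UNIV. partial i (X i) y))"
    using True w_pos[OF c True] by (simp add: F1_def lap_eq X_def)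
   thus ?thesis by (simp add: sum_distrib_left)
  qed
  show ?thesis unfolding 1 2 p by (simp add: sum.distrib)
 next
  case False
  hence "y ~: K'" using K'(2) by blast
  have "partial i (h i) y = partial i (%y. 0) y" for i
   by (rule partial_cong[of "- K'"]) (use K'(1) hz `y ~: K'` in "auto intro: compact_imp_closed")
  thus ?thesis using False by (simp add: F1_def F2_def partial_def frechet_derivative_const)
 qed
 have "Ck_on 0 UNIV F1" unfolding F1_def
 proof (rule C1_on_UNIV_extend[OF open_U[OF c] _ K'])
  show "Ck_on 0 (U c) (%y. w c y * (phi (param c y) * lap c f y))"
   using w_cont[OF c] lap_cont[OF f c] Ck_on_cont[OF C_funD[OF phi c]] by (auto intro!: continuous_intros simp: o_def)
 qed (use z' in auto)
 hence "integrable lborel (%x. indicator K' x *\<^sub>R F1 x)"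
  using K'(1) continuous_on_subset[of UNIV F1 K'] by (intro borel_integrable_compact) auto
 moreover have "(%x. indicator K' x *\<^sub>R F1 x) = F1"
  using z' by (auto simp: F1_def indicator_def fun_eq_iff)
 ultimately have i1: "integrable lborel F1" by simp
 have ip: "integrable lborel (%y. SUM i:UNIV. partial i (h i) y)"
  by (intro Bochner_Integration.integrable_sum integral_partial_zero(1)[OF hC K'(1) hz])
 have "(LINT y|lborel. F2 y) = (LINT y|lborel. (SUM i:UNIV. partial i (h i) y) + F1 y)"
  unfolding ph by simp
 also have "... = (LINT y|lborel. (SUM i:UNIV. partial i (h i) y)) + (LINT y|lborel. F1 y)"
  by (rule Bochner_Integration.integral_add[OF ip i1])
 also have "(LINT y|lborel. (SUM i:UNIV. partial i (h i) y)) = (SUM i:UNIV. \<integral>y. partial i (h i) y \<partial>lborel)"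
  by (rule Bochner_Integration.integral_sum) (rule integral_partial_zero(1)[OF hC K'(1) hz])
 also have "... = 0" using integral_partial_zero(2)[OF hC K'(1) hz] by simp
 finally show ?thesis by (simp add: F1_def F2_def)
qed

end

context compact_riemannian begin

lemma measurable_piecewise:
 assumes "open S" "continuous_on S (f :: 'a => real)"
 shows "(%x. if x : S then f x else 0) : borel_measurable borel"
 using assms by (intro borel_measurable_continuous_on_if) (auto intro!: continuous_intros)

lemma cont_chart_fun: "c : atlas M ==> continuous_on (U c) F ==> continuous_on (domain c) (%x. F (coords c x))"
 by (rule continuous_on_compose2[OF _ cont_coords]) auto

lemma weak_vol:
 assumes c: "c : atlas M" and phi: "C_fun (Suc 0) phi" and f: "C_fun (Suc (Suc 0)) f"
  and K: "compact K" "K <= domain c" and z: "!!x. x ~: K ==> phi x = 0"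
 shows "(LINT x|vol. (if x : domain c then phi x * lap c f (coords c x) else 0)) =
     (LINT x|vol. (if x : domain c then ginner c phi f (coords c x) else 0))"
proof -
 have 1: "(LINT x|vol. (if x : domain c then phi x * lap c f (coords c x) else 0)) =
   (LINT y|lborel. (if y : U c then w c y * (phi (param c y) * lap c f y) else 0))"
 proof (subst integral_vol_chart[OF c])
  show "(%x. if x : domain c then phi x * lap c f (coords c x) else 0) : borel_measurable borel"
   using C_fun_cont[OF phi] cont_chart_fun[OF c lap_cont[OF f c]]
   by (intro measurable_piecewise open_domain c continuous_intros) (auto intro: continuous_on_subset)
 qed (auto intro!: lebesgue_integral_cong)
 have 2: "(LINT x|vol. (if x : domain c then ginner c phi f (coords c x) else 0)) =
   (LINT y|lborel. (if y : U c then w c y * ginner c phi f y else 0))"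
 proof (subst integral_vol_chart[OF c])
  show "(%x. if x : domain c then ginner c phi f (coords c x) else 0) : borel_measurable borel"
   using cont_chart_fun[OF c ginner_cont[OF phi f c]]
   by (intro measurable_piecewise open_domain c)
 qed (auto intro!: lebesgue_integral_cong)
 show ?thesis unfolding 1 2 by (rule weak_chart[OF c phi f K z])
qed

end

context compact_isometry begin

lemma C_fun_h: "C_fun k f ==> C_fun k (f o h)" "C_fun k f ==> C_fun k (f o inv h)"
 using h by (auto simp: isometry_def intro: C_fun_compose_smooth_map)

text \<open>The weak form determines the Laplacian. If the two sides differed at a point, a bump function near it would give different integrals, yet the weak form involves only gradients and the measure, which isometries preserve.\<close>
theorem lap_isometry:
 assumes f: "C_fun (Suc (Suc 0)) f" and c: "c : atlas M" "c' : atlas M"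
  and x: "x : domain c" "h x : domain c'"
 shows "lap c (f o h) (coords c x) = lap c' f (coords c' (h x))"
proof (rule ccontr)
 assume ne: "lap c (f o h) (coords c x) ~= lap c' f (coords c' (h x))"
 have fh: "C_fun (Suc (Suc 0)) (f o h)" by (rule C_fun_h(1)[OF f])
 define Q where "Q = domain c Int h -` domain c'"
 have Q: "open Q" unfolding Q_def by (intro open_Int open_domain open_pre c)
 define A where "A = (%x. lap c (f o h) (coords c x))"
 define B where "B = (%x. lap c' f (coords c' (h x)))"
 have cA: "continuous_on Q A" unfolding A_def
  by (rule continuous_on_subset[OF cont_chart_fun[OF c(1) lap_cont[OF fh c(1)]]]) (auto simp: Q_def)
 have cB: "continuous_on Q B" unfolding B_def
  by (rule continuous_on_compose2[OF cont_chart_fun[OF c(2) lap_cont[OF f c(2)]] continuous_on_subset[OF cont_h]]) (auto simp: Q_def)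
 define s where "s = sgn (A x - B x)"
 have s: "s * (A x - B x) > 0" using ne by (simp add: s_def A_def B_def sgn_if)
 define S where "S = {x : Q. 0 < s * (A x - B x)}"
 have "open S"
 proof -
  have "continuous_on Q (%x. s * (A x - B x))" by (intro continuous_intros cA cB)
  from continuous_on_open_vimage[OF Q, THEN iffD1, OF this, rule_format, of "{0<..}"]
  have "open ((%x. s * (A x - B x)) -` {0<..} Int Q)" by simp
  moreover have "(%x. s * (A x - B x)) -` {0<..} Int Q = S" by (auto simp: S_def)
  ultimately show ?thesis by simp
 qed
 moreover have xS: "x : S" using x s by (simp add: S_def Q_def)
 ultimately obtain phi K where phi: "C_fun (Suc 0) phi" and K: "compact K" "K <= S" and pos': "ALL x. 0 <= phi x" "0 < phi x"
  and z': "ALL x. x ~: K --> phi x = 0"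
  by (rule bump_exists)
 have pos: "!!x. 0 <= phi x" "0 < phi x" and z: "!!x. x ~: K ==> phi x = 0" using pos' z' by auto
 have KQ: "K <= domain c" "K <= Q" using K by (auto simp: S_def Q_def)
 define psi where "psi = phi o inv h"
 have psi: "C_fun (Suc 0) psi" unfolding psi_def by (rule C_fun_h(2)[OF phi])
 have psih: "psi o h = phi" by (simp add: psi_def fun_eq_iff)
 have hK: "compact (h ` K)" "h ` K <= domain c'"
  using K(1) KQ(2) cont_h by (auto simp: Q_def intro: compact_continuous_image continuous_on_subset)
 have zpsi: "psi y = 0" if "y ~: h ` K" for y
  unfolding psi_def o_def by (rule z) (use that in "metis image_eqI inv_h(2)")
 have phiA: "(if x : domain c then phi x * lap c (f o h) (coords c x) else 0) = phi x * A x" for x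
  using z[of x] KQ(1) by (auto simp: A_def)
 have phiB: "(if h x : domain c' then psi (h x) * lap c' f (coords c' (h x)) else 0) = phi x * B x" for x
  using z[of x] KQ(2) by (auto simp: B_def psi_def Q_def)
 define G where "G = (%y. if y : domain c' then ginner c' psi f (coords c' y) else 0)"
 have Gm: "G : borel_measurable borel" unfolding G_def
  by (rule measurable_piecewise[OF open_domain[OF c(2)] cont_chart_fun[OF c(2) ginner_cont[OF psi f c(2)]]])
 have Hm: "(%y. if y : domain c' then psi y * lap c' f (coords c' y) else 0) : borel_measurable borel"
  using C_fun_cont[OF psi] cont_chart_fun[OF c(2) lap_cont[OF f c(2)]]
  by (intro measurable_piecewise open_domain c continuous_intros) (auto intro: continuous_on_subset)
 have Gh: "G (h x) = (if x : domain c then ginner c phi (f o h) (coords c x) else 0)" for x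
 proof (cases "x : K")
  case True
  hence xQ: "x : domain c" "h x : domain c'" using KQ by (auto simp: Q_def)
  have y: "coords c x : W c c'" using xQ by (auto simp: local_dom_def)
  have ty: "tau c c' (coords c x) = coords c' (h x)" using xQ c by (simp add: tau_coords)
  have "ginner c (psi o h) (f o h) (coords c x) = ginner c' psi f (tau c c' (coords c x))"
   by (rule ginner_pullback[OF c y]) (use C_fun_differentiable[OF psi c(2)] C_fun_differentiable[OF f c(2)] xQ in "auto simp: ty")
  thus ?thesis using xQ by (simp add: G_def psih ty)
 next
  case False
  hence "h x ~: h ` K" using bij_h by (metis image_iff inv_h(1))
  hence "G (h x) = 0" using dv_zero_off[OF hK(1) zpsi c(2)] by (simp add: G_def ginner_def)
  moreover have "x : domain c ==> ginner c phi (f o h) (coords c x) = 0"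
   using dv_zero_off[OF K(1) z c(1) _ False] by (simp add: ginner_def)
  ultimately show ?thesis by simp
 qed
 have "(LINT x|vol. phi x * A x) = (LINT x|vol. (if x : domain c then ginner c phi (f o h) (coords c x) else 0))"
  using weak_vol[OF c(1) phi fh K(1) KQ(1) z] unfolding phiA .
 also have "... = (LINT x|vol. G (h x))" unfolding Gh ..
 also have "... = (LINT y|vol. G y)" by (rule integral_h[OF Gm])
 also have "... = (LINT y|vol. (if y : domain c' then psi y * lap c' f (coords c' y) else 0))"
  unfolding G_def by (rule weak_vol[OF c(2) psi f hK zpsi, symmetric])
 also have "... = (LINT x|vol. phi x * B x)" unfolding integral_h[OF Hm, symmetric] phiB ..
 finally have eq: "(LINT x|vol. phi x * A x) = (LINT x|vol. phi x * B x)" .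
 define R where "R = (%x. s * (phi x * A x - phi x * B x))"
 have Rnn: "0 <= R x" for x
 proof (cases "x : K")
  case True
  hence "0 < s * (A x - B x)" using K(2) by (auto simp: S_def)
  hence "0 <= phi x * (s * (A x - B x))" using pos(1)[of x] by simp
  thus ?thesis by (simp add: R_def algebra_simps)
 qed (use z in "simp add: R_def")
 interpret finite_measure vol by (rule finite_vol)
 have intg: "integrable vol (%x. phi x * E x)" if E: "continuous_on Q E" for E
 proof -
  have eqE: "(%x. phi x * E x) = (%x. if x : Q then phi x * E x else 0)" using z KQ(2) by (auto simp: fun_eq_iff)
  have m: "(%x. phi x * E x) : borel_measurable borel" unfolding eqE
   by (rule measurable_piecewise[OF Q]) (intro continuous_intros E continuous_on_subset[OF C_fun_cont[OF phi]]; simp)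
  have "bounded ((%x. phi x * E x) ` K)"
   by (intro compact_imp_bounded compact_continuous_image K(1) continuous_intros continuous_on_subset[OF C_fun_cont[OF phi]] continuous_on_subset[OF E KQ(2)]) auto
  then obtain C where C: "ALL v:(%x. phi x * E x) ` K. norm v <= C" unfolding bounded_iff by blast
  have "norm (phi x * E x) <= abs C" for x
   using C z[of x] by (cases "x : K") force+
  thus ?thesis by (intro integrable_const_bound[of _ "abs C"]) (use m in "auto simp: measurable_vol")
 qed
 have iA: "integrable vol (%x. phi x * A x)" "integrable vol (%x. phi x * B x)"
  by (rule intg[OF cA]) (rule intg[OF cB])
 have iR: "integrable vol R" unfolding R_def using iA by auto
 have "(LINT x|vol. R x) = 0" unfolding R_def using iA eq by simp
 hence AE: "AE x in vol. R x = 0"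
  using integral_nonneg_eq_0_iff_AE[OF iR] Rnn by simp
 define V where "V = {x : Q. 0 < phi x * (s * (A x - B x))}"
 have V: "open V"
 proof -
  have "continuous_on Q (%x. phi x * (s * (A x - B x)))"
   by (intro continuous_intros cA cB continuous_on_subset[OF C_fun_cont[OF phi]]) auto
  from continuous_on_open_vimage[OF Q, THEN iffD1, OF this, rule_format, of "{0<..}"]
  have "open ((%x. phi x * (s * (A x - B x))) -` {0<..} Int Q)" by simp
  moreover have "(%x. phi x * (s * (A x - B x))) -` {0<..} Int Q = V" by (auto simp: V_def)
  ultimately show ?thesis by simp
 qed
 have xV: "x : V" using xS pos(2) s by (simp add: V_def S_def)
 have "AE y in vol. y ~: V" using AE
  by eventually_elim (auto simp: V_def R_def algebra_simps)
 hence "emeasure vol V = 0" using V by (simp add: AE_iff_measurable[of V])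
 thus False using open_vol_pos[OF V xV] by simp
qed

end

context compact_riemannian begin

section \<open>Green's identity\<close>

sublocale ident_c: compact_isometry M id
 by unfold_locales

lemma laplacian_chart:
 assumes f: "C_fun (Suc (Suc 0)) f" and c: "c : atlas M" "x : domain c"
 shows "laplacian M f x = lap c f (coords c x)"
 using ident_c.lap_isometry[OF f chart_at(1) c(1), of x] chart_at(2)[of x] c(2)
 by (simp add: laplacian_lap)

definition Gam where "Gam f1 f2 x = ginner (chart_at M x) f1 f2 (coords (chart_at M x) x)"

lemma Gam_chart:
 assumes f: "C_fun (Suc 0) f1" "C_fun (Suc 0) f2" and c: "c : atlas M" "x : domain c"
 shows "Gam f1 f2 x = ginner c f1 f2 (coords c x)"
proof -
 let ?c = "chart_at M x"
 have y: "coords ?c x : ident.W ?c c" using c chart_at(2)[of x] by (auto simp: local_dom_def)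
 have t: "ident.tau ?c c (coords ?c x) = coords c x" using chart_at by (simp add: ident.tau_coords)
 show ?thesis
  using ident.ginner_pullback[OF chart_at(1) c(1) y, of f1 f2]
   C_fun_differentiable[OF f(1) c(1), of "coords c x"] C_fun_differentiable[OF f(2) c(1), of "coords c x"] c(2)
  by (simp add: t Gam_def)
qed

lemma cont_from_charts:
 assumes "!!c. c : atlas M ==> continuous_on (U c) (G c)"
  and "!!c x. c : atlas M ==> x : domain c ==> f x = G c (coords c x)"
 shows "continuous_on UNIV (f :: 'a => real)"
proof -
 have "isCont f x" for x
 proof -
  obtain c where c: "c : atlas M" "x : domain c" using chart_cover by blast
  have "continuous_on (domain c) f"
   by (rule continuous_on_eq[OF cont_chart_fun[OF c(1) assms(1)[OF c(1)]]]) (use assms(2)[OF c(1)] in simp)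
  thus ?thesis using c open_domain[OF c(1)] continuous_on_eq_continuous_at by blast
 qed
 thus ?thesis by (simp add: continuous_at_imp_continuous_on)
qed

lemma laplacian_cont: "C_fun (Suc (Suc 0)) f ==> continuous_on UNIV (laplacian M f)"
 by (rule cont_from_charts[of "%c. lap c f"]) (auto intro: lap_cont laplacian_chart)

lemma Gam_cont: "C_fun (Suc 0) f1 ==> C_fun (Suc (Suc 0)) f2 ==> continuous_on UNIV (Gam f1 f2)"
 by (rule cont_from_charts[of "%c. ginner c f1 f2"]) (auto intro: ginner_cont Gam_chart C_fun_Suc)

lemma cont_bounded:
 assumes "continuous_on UNIV (f :: 'a => real)" obtains C where "!!x. abs (f x) <= C"
proof -
 have "bounded (range f)" using compact_continuous_image[OF assms compact_M] compact_imp_bounded by blast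
 then obtain C where "ALL y:range f. norm y <= C" unfolding bounded_iff by blast
 thus thesis using that by force
qed

lemma integrable_bounded_vol:
 fixes f :: "'a => real"
 assumes "f : borel_measurable borel" "!!x. abs (f x) <= C"
 shows "integrable vol f"
 by (rule finite_measure.integrable_const_bound[OF finite_vol, of _ C]) (use assms in "auto simp: measurable_vol")

lemma integrable_cont:
 assumes f: "continuous_on UNIV (f :: 'a => real)" shows "integrable vol f"
proof -
 obtain C where "!!x. abs (f x) <= C" using cont_bounded[OF f] by blast
 thus ?thesis using borel_measurable_continuous_onI[OF f] by (rule integrable_bounded_vol[rotated])
qed

lemma partition_of_unity:
 obtains I :: "'a set" and kappa c K where "finite I"
  "ALL i:I. C_fun (Suc 0) (kappa i) & c i : atlas M & compact (K i) & K i <= domain (c i) & (ALL x. x ~: K i --> kappa i x = (0::real))"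
  "ALL x. (SUM i:I. kappa i x) = 1"
proof -
 have "EX b c K. C_fun (Suc 0) b & c : atlas M & compact K & K <= domain c & (ALL x. 0 <= b x) & 0 < b p & (ALL x. x ~: K --> b x = 0)" for p
 proof -
  obtain c where c: "c : atlas M" "p : domain c" using chart_cover by blast
  obtain b K where "C_fun (Suc 0) b" "compact K" "K <= domain c" "ALL x. 0 <= b x" "0 < b p" "ALL x. x ~: K --> b x = 0"
   by (rule bump_exists[OF open_domain[OF c(1)] c(2)])
  thus ?thesis using c(1) by blast
 qed
 then obtain b c K where b: "!!p. C_fun (Suc 0) (b p)" "!!p. c p : atlas M" "!!p. compact (K p)" "!!p. K p <= domain (c p)"
  "!!p x. 0 <= b p x" "!!p. 0 < b p p" "!!p x. x ~: K p ==> b p x = 0"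
  by metis
 define V where "V = (%p. {x. 0 < b p x})"
 have V: "open (V p)" for p unfolding V_def
  by (rule open_Collect_less[OF continuous_on_const C_fun_cont[OF b(1)]])
 have "UNIV <= (UN p:UNIV. V p)" using b(6) by (auto simp: V_def)
 then obtain I where I: "finite I" "UNIV <= (UN p:I. V p)"
  using compactE_image[OF compact_M, of UNIV V] V by (metis top_greatest)
 define s where "s = (%x. SUM p:I. b p x)"
 have s: "C_fun (Suc 0) s" unfolding s_def by (intro C_fun_sum b)
 have spos: "0 < s x" for x
 proof -
  obtain p where "p : I" "0 < b p x" using I(2) by (auto simp: V_def)
  thus ?thesis unfolding s_def using I(1) b(5) by (intro sum_pos2[of I p]) auto
 qed
 show thesis
 proof (rule that[of I "%p x. b p x / s x" c K])
  show "ALL i:I. C_fun (Suc 0) (%x. b i x / s x) & c i : atlas M & compact (K i) & K i <= domain (c i) &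
    (ALL x. x ~: K i --> b i x / s x = 0)"
   using b C_fun_divide[OF b(1) s] spos by (auto simp: less_imp_neq[symmetric])
  show "ALL x. (SUM i:I. b i x / s x) = 1"
  proof
   fix x
   have "(SUM i:I. b i x / s x) = s x / s x" unfolding s_def by (rule sum_divide_distrib[symmetric])
   thus "(SUM i:I. b i x / s x) = 1" using spos[of x] by simp
  qed
 qed (rule I(1))
qed

lemma green_local:
 assumes c: "c : atlas M" and phi: "C_fun (Suc 0) phi" and f: "C_fun (Suc (Suc 0)) f"
  and K: "compact K" "K <= domain c" and z: "!!x. x ~: K ==> phi x = 0"
 shows "(LINT x|vol. phi x * laplacian M f x) = (LINT x|vol. Gam phi f x)"
proof -
 have "(if x : domain c then phi x * lap c f (coords c x) else 0) = phi x * laplacian M f x" for x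
  using laplacian_chart[OF f c] z K(2) by auto
 moreover have "(if x : domain c then ginner c phi f (coords c x) else 0) = Gam phi f x" for x
 proof (cases "x : domain c")
  case True thus ?thesis using Gam_chart[OF phi C_fun_Suc[OF f] c] by simp
 next
  case False
  hence "x ~: K" using K(2) by blast
  thus ?thesis using False dv_zero_off[OF K(1) z chart_at(1) chart_at(2)[of x]]
   by (simp add: Gam_def ginner_def)
 qed
 ultimately show ?thesis using weak_vol[OF c phi f K z] by simp
qed

text \<open>A partition of unity reduces the identity to charts; the gradients of its members add up to zero.\<close>
theorem green:
 assumes f: "C_fun (Suc 0) f" and u: "C_fun (Suc (Suc 0)) u"
 shows "(LINT x|vol. f x * laplacian M u x) = (LINT x|vol. Gam f u x)"
proof -
 obtain I :: "'a set" and kappa c K where I: "finite I"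
  and P: "ALL i:I. C_fun (Suc 0) (kappa i) & c i : atlas M & compact (K i) & K i <= domain (c i) & (ALL x. x ~: K i --> kappa i x = (0::real))"
  and one: "ALL x. (SUM i:I. kappa i x) = 1"
  by (rule partition_of_unity)
 define phi where "phi = (%i x. kappa i x * f x)"
 have phi: "C_fun (Suc 0) (phi i)" if "i : I" for i unfolding phi_def using P that f by (intro C_fun_mult) auto
 have sum: "(SUM i:I. phi i x) = f x" for x unfolding phi_def by (simp add: sum_distrib_right[symmetric] one)
 have Gamsum: "(SUM i:I. Gam (phi i) u x) = Gam f u x" for x
 proof -
  let ?c = "chart_at M x" let ?y = "coords ?c x"
  have y: "?y : U ?c" using chart_at(2) by auto
  have "(SUM i:I. dv ?c (phi i) ?y) = dv ?c f ?y"
  proof -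
   have "partial j (f o param ?c) ?y = (SUM i:I. partial j (phi i o param ?c) ?y)" for j
   proof -
    have "((%z. SUM i:I. (phi i o param ?c) z) has_derivative (%v. SUM i:I. frechet_derivative (phi i o param ?c) (at ?y) v)) (at ?y)"
     by (intro has_derivative_sum Ck_on_has_derivative[OF C_funD[OF phi chart_at(1)] open_U[OF chart_at(1)] y])
    moreover have "(%z. SUM i:I. (phi i o param ?c) z) = f o param ?c" using sum by (auto simp: fun_eq_iff)
    ultimately have "(f o param ?c has_derivative (%v. SUM i:I. frechet_derivative (phi i o param ?c) (at ?y) v)) (at ?y)" by simp
    from partial_eq[OF this] show ?thesis by (simp add: partial_def)
   qed
   thus ?thesis by (simp add: dv_def vec_eq_iff)
  qed
  thus ?thesis unfolding Gam_def ginner_def by (simp add: inner_sum_left[symmetric])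
 qed
 have "(LINT x|vol. f x * laplacian M u x) = (LINT x|vol. (SUM i:I. phi i x * laplacian M u x))"
  by (simp add: sum_distrib_right[symmetric] sum)
 also have "... = (SUM i:I. \<integral>x. phi i x * laplacian M u x \<partial>vol)"
  by (intro Bochner_Integration.integral_sum integrable_cont continuous_on_mult laplacian_cont u C_fun_cont[OF phi])
 also have "... = (SUM i:I. \<integral>x. Gam (phi i) u x \<partial>vol)"
 proof (rule sum.cong[OF refl])
  fix i assume i: "i : I"
  show "(LINT x|vol. phi i x * laplacian M u x) = (LINT x|vol. Gam (phi i) u x)"
   by (rule green_local[of "c i" "phi i" u "K i"]) (use P i phi[OF i] u in "auto simp: phi_def")
 qed
 also have "... = (LINT x|vol. (SUM i:I. Gam (phi i) u x))"
  by (intro Bochner_Integration.integral_sum[symmetric] integrable_cont Gam_cont phi u)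
 finally show ?thesis unfolding Gamsum .
qed

corollary green_sym:
 assumes f: "C_fun (Suc (Suc 0)) f" and u: "C_fun (Suc (Suc 0)) u"
 shows "(LINT x|vol. f x * laplacian M u x) = (LINT x|vol. u x * laplacian M f x)"
proof -
 have "Gam f u x = Gam u f x" for x
  unfolding Gam_def by (rule ginner_commute[OF chart_at(1)]) (use chart_at(2) in auto)
 thus ?thesis using green[OF C_fun_Suc[OF f] u] green[OF C_fun_Suc[OF u] f] by simp
qed

lemma grad_norm_sq_Gam: "grad_norm_sq M f x = Gam f f x"
proof -
 let ?c = "chart_at M x"
 have y: "coords ?c x : U ?c" using chart_at(2) by auto
 have "metric M ?c x = g ?c (coords ?c x)" using chart_at by (simp add: metric_coords)
 thus ?thesis
  using g_gradient[OF chart_at(1) y, of f]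
  by (simp add: grad_norm_sq_def Let_def Gam_def ginner_def inner_commute)
qed

end

context compact_isometry begin

lemma laplacian_h: "C_fun (Suc (Suc 0)) f ==> laplacian M (f o h) x = laplacian M f (h x)"
 using lap_isometry[OF _ chart_at(1) chart_at(1) chart_at(2) chart_at(2), of f x]
 by (simp add: laplacian_lap)

lemma eigenfunction_h:
 assumes "eigenfunction M l f" shows "eigenfunction M l (f o h)"
proof -
 have f: "C_fun k f" for k using assms by (simp add: eigenfunction_def smooth_fun_iff)
 obtain x where "f x ~= 0" using assms by (auto simp: eigenfunction_def)
 hence "(f o h) (inv h x) ~= 0" by simp
 moreover have "smooth_fun M (f o h)" unfolding smooth_fun_iff using C_fun_h(1)[OF f] by blast
 moreover have "laplacian M (f o h) x = l * (f o h) x" for x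
  using laplacian_h[OF f] assms by (simp add: eigenfunction_def)
 ultimately show ?thesis unfolding eigenfunction_def by blast
qed

end

lemma has_derivative_compose_Icc:
 fixes f :: "'e::real_normed_vector => real" and psi :: "real => real"
 assumes U: "open U" "x : U" and im: "f ` U <= {a..b}" and f: "(f has_derivative D) (at x)"
  and psi: "(psi has_real_derivative d) (at (f x) within {a..b})"
 shows "((%x. psi (f x)) has_derivative (%v. d * D v)) (at x)"
proof -
 have 1: "(f has_derivative D) (at x within U)" by (rule has_derivative_at_withinI[OF f])
 have 2: "(psi has_derivative (*) d) (at (f x) within f ` U)"
  by (rule has_derivative_subset[OF _ im]) (use psi in "simp add: has_field_derivative_def")
 show ?thesis using has_derivative_in_compose[OF 1 2] at_within_open[OF U(2,1)] by simp
qed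

context compact_riemannian begin

lemma C_fun_C_seg:
 assumes "C_seg k a b psi" "C_fun k F" "range F <= {a..b}" shows "C_fun k (%x. psi (F x))"
 unfolding C_fun_def
proof
 fix c assume c: "c : atlas M"
 show "Ck_on k (U c) ((%x. psi (F x)) o param c)"
  using Ck_on_C_seg_compose[OF open_U[OF c] _ assms(1) C_funD[OF assms(2) c]] assms(3) by (auto simp: o_def)
qed

lemma dv_compose:
 assumes F: "C_fun (Suc 0) F" and im: "range F <= {a..b}" and c: "c : atlas M" and y: "y : U c"
  and eta: "(eta has_real_derivative d) (at (F (param c y)) within {a..b})"
 shows "dv c (%x. eta (F x)) y = d *\<^sub>R dv c F y"
proof -
 have "((%z. eta ((F o param c) z)) has_derivative (%v. d * frechet_derivative (F o param c) (at y) v)) (at y)"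
  by (rule has_derivative_compose_Icc[OF open_U[OF c] y _ Ck_on_has_derivative[OF C_funD[OF F c] open_U[OF c] y]])
    (use im eta in auto)
 hence "partial i ((%x. eta (F x)) o param c) y = d * partial i (F o param c) y" for i
  using partial_eq by (force simp: o_def partial_def)
 thus ?thesis by (simp add: dv_def vec_eq_iff)
qed

lemma Gam_compose:
 assumes F: "C_fun (Suc 0) F" and im: "range F <= {a..b}"
  and eta: "(eta has_real_derivative d) (at (F x) within {a..b})"
 shows "Gam (%x. eta (F x)) u x = d * Gam F u x"
 unfolding Gam_def ginner_def
 using dv_compose[OF F im chart_at(1), of "coords (chart_at M x) x" x eta d] chart_at eta by simp

theorem laplacian_compose:
 assumes F: "C_fun (Suc (Suc 0)) F" and im: "range F <= {a..b}"
  and 1: "!!s. s : {a..b} ==> (eta has_real_derivative eta1 s) (at s within {a..b})"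
  and 2: "!!s. s : {a..b} ==> (eta1 has_real_derivative eta2 s) (at s within {a..b})"
 shows "laplacian M (%x. eta (F x)) x = eta1 (F x) * laplacian M F x - eta2 (F x) * grad_norm_sq M F x"
proof -
 define c where "c = chart_at M x"
 define y where "y = coords c x"
 have c: "c : atlas M" and x: "x : domain c" using chart_at by (auto simp: c_def)
 have y: "y : U c" and py: "param c y = x" using x c by (auto simp: y_def)
 have Fin: "F z : {a..b}" for z using subsetD[OF im rangeI] .
 have grad: "gradient_in M c (%x. eta (F x)) z = eta1 (F (param c z)) *\<^sub>R gradient_in M c F z" if "z : U c" for z
  unfolding gradient_in_eq dv_compose[OF C_fun_Suc[OF F] im c that 1[OF Fin]]
  by (simp add: matrix_vector_mult_scaleR)
 have p: "partial i (%z. w c z * gradient_in M c (%x. eta (F x)) z $ i) y =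
   eta2 (F x) * partial i (F o param c) y * (w c y * gradient_in M c F y $ i) +
   eta1 (F x) * partial i (%z. w c z * gradient_in M c F z $ i) y" for i
 proof -
  have "partial i (%z. w c z * gradient_in M c (%x. eta (F x)) z $ i) y =
    partial i (%z. eta1 ((F o param c) z) * (w c z * gradient_in M c F z $ i)) y"
   by (rule partial_cong[OF open_U[OF c] y]) (simp add: grad)
  also have "... = eta1 ((F o param c) y) * frechet_derivative (%z. w c z * gradient_in M c F z $ i) (at y) (axis i 1) +
    eta2 (F x) * frechet_derivative (F o param c) (at y) (axis i 1) * (w c y * gradient_in M c F y $ i)"
  proof (rule partial_eq[OF has_derivative_mult])
   show "((%z. eta1 ((F o param c) z)) has_derivative (%v. eta2 (F x) * frechet_derivative (F o param c) (at y) v)) (at y)"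
    by (rule has_derivative_compose_Icc[OF open_U[OF c] y _ Ck_on_has_derivative[OF C_funD[OF F c] open_U[OF c] y]])
      (use im py 2[OF Fin] in auto)
   show "((%z. w c z * gradient_in M c F z $ i) has_derivative frechet_derivative (%z. w c z * gradient_in M c F z $ i) (at y)) (at y)"
    by (rule Ck_on_has_derivative[OF w_gradient_C1[OF F c] open_U[OF c] y])
  qed
  finally show ?thesis by (simp add: partial_def py)
 qed
 have w: "0 < w c y" by (rule w_pos[OF c y])
 have "(SUM i:UNIV. partial i (%z. w c z * gradient_in M c (%x. eta (F x)) z $ i) y) =
   eta2 (F x) * w c y * ginner c F F y + eta1 (F x) * (SUM i:UNIV. partial i (%z. w c z * gradient_in M c F z $ i) y)"
  unfolding p sum.distrib by (simp add: ginner_def dv_def inner_vec_def sum_distrib_left mult_ac)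
 hence "lap c (%x. eta (F x)) y = eta1 (F x) * lap c F y - eta2 (F x) * ginner c F F y"
  using w by (simp add: lap_eq field_simps)
 thus ?thesis unfolding laplacian_lap grad_norm_sq_Gam Gam_def c_def y_def .
qed

end

section \<open>Isoparametric functions\<close>

lemma C_seg_all_deriv:
 assumes ab: "a < b" and f: "!!k. C_seg k a b f"
 shows "EX f'. (ALL x:{a..b}. (f has_real_derivative f' x) (at x within {a..b})) & (ALL k. C_seg k a b f')"
proof -
 obtain f' where f': "ALL x:{a..b}. (f has_real_derivative f' x) (at x within {a..b})"
  using f[of "Suc 0"] unfolding C_seg.simps by blast
 have "C_seg k a b f'" for k
 proof -
  obtain h where h: "ALL x:{a..b}. (f has_real_derivative h x) (at x within {a..b})" "C_seg k a b h"
   using f[of "Suc k"] unfolding C_seg.simps by blast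
  have "h x = f' x" if "x : {a..b}" for x
   using vector_derivative_unique_within_closed_interval[OF ab, of x f "h x" "f' x"] h(1) f' that
   by (simp add: has_real_derivative_iff_has_vector_derivative)
  thus ?thesis by (rule C_seg_cong[OF h(2)])
 qed
 thus ?thesis using f' by (intro exI[of _ f']) simp
qed

lemma C_seg_reflect: "C_seg k a b f ==> C_seg k (- b) (- a) (%s. f (- s))"
proof (induction k arbitrary: f)
 case 0
 hence "continuous_on {a..b} f" by simp
 thus ?case unfolding C_seg.simps by (rule continuous_on_compose2) (auto intro!: continuous_intros)
next
 case (Suc k)
 then obtain f' where f': "ALL x:{a..b}. (f has_real_derivative f' x) (at x within {a..b})" "C_seg k a b f'"
  unfolding C_seg.simps by blast
 have "ALL x:{- b..- a}. ((%s. f (- s)) has_real_derivative (- 1) * f' (- x)) (at x within {- b..- a})"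
 proof
  fix x assume x: "x : {- b..- a}"
  have "(f has_real_derivative f' (- x)) (at (- x) within uminus ` {- b..- a})"
   using f'(1) x by simp
  moreover have "(uminus has_real_derivative - 1) (at x within {- b..- a})"
   by (auto intro!: derivative_eq_intros)
  ultimately have "(f o uminus has_real_derivative f' (- x) * - 1) (at x within {- b..- a})"
   by (rule DERIV_image_chain)
  thus "((%s. f (- s)) has_real_derivative (- 1) * f' (- x)) (at x within {- b..- a})"
   by (simp add: o_def)
 qed
 moreover have "C_seg k (- b) (- a) (%x. (- 1) * f' (- x))" by (rule C_seg_cmult[OF Suc.IH[OF f'(2)]])
 ultimately show ?case unfolding C_seg.simps by (intro exI[of _ "%x. (- 1) * f' (- x)"] conjI)
qed

context riemannian_mfd begin

lemma metric_CS:
 assumes "c : atlas M" "y : U c"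
 shows "(u \<bullet> (g c y *v v))^2 <= (u \<bullet> (g c y *v u)) * (v \<bullet> (g c y *v v))"
proof (cases "v = 0")
 case False
 define Q where "Q = (%a b. a \<bullet> (g c y *v b))"
 have sym: "Q a b = Q b a" for a b
  unfolding Q_def using g_symm_inner[OF assms, of a b] by (metis inner_commute)
 have pos: "0 < Q v v" using g_pos[OF assms False] by (simp add: Q_def)
 define t where "t = - Q u v / Q v v"
 have "0 <= Q (u + t *\<^sub>R v) (u + t *\<^sub>R v)" unfolding Q_def by (rule g_nonneg[OF assms])
 also have "... = Q u u + 2 * t * Q u v + t^2 * Q v v"
  using sym[of u v] unfolding Q_def
  by (simp add: matrix_vector_right_distrib inner_add_left inner_add_right matrix_vector_mult_scaleR algebra_simps power2_eq_square)
 also have "... = Q u u - (Q u v)^2 / Q v v" using pos by (simp add: t_def field_simps power2_eq_square)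
 finally show ?thesis using pos unfolding Q_def by (simp add: field_simps)
qed simp

lemma has_derivative_dv:
 assumes "C_fun (Suc 0) f" "c : atlas M" "y : U c"
 shows "(f o param c has_derivative (%v. dv c f y \<bullet> v)) (at y)"
proof -
 have d: "(f o param c) differentiable (at y)" by (rule C_fun_differentiable[OF assms])
 have "frechet_derivative (f o param c) (at y) = (%v. dv c f y \<bullet> v)"
  using frechet_eq_partial[OF d] by (auto simp: dv_def inner_vec_def mult.commute)
 thus ?thesis using d unfolding frechet_derivative_works by simp
qed

lemma dv_bound:
 assumes "c : atlas M" "y : U c"
 shows "(dv c f y \<bullet> v)^2 <= ginner c f f y * (v \<bullet> (g c y *v v))"
proof -
 have "dv c f y \<bullet> v = v \<bullet> (g c y *v gradient_in M c f y)"
  unfolding g_gradient[OF assms] by (rule inner_commute)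
 also have "...\<^sup>2 <= (v \<bullet> (g c y *v v)) * (gradient_in M c f y \<bullet> (g c y *v gradient_in M c f y))"
  by (rule metric_CS[OF assms])
 finally show ?thesis unfolding g_gradient[OF assms] ginner_def by (simp add: inner_commute mult.commute)
qed

lemma g_form_cont:
 assumes "c : atlas M" shows "continuous_on (U c) (%y. v \<bullet> (g c y *v v))"
proof -
 have "continuous_on (U c) (%y. g c y $ i $ j)" for i j using g_smooth[OF assms, of 0] by simp
 thus ?thesis unfolding inner_vec_def inner_real_def matrix_vector_mult_def
  by (simp, intro continuous_on_sum continuous_on_mult continuous_on_const)
qed

end

text \<open>The isoparametric condition, with one-sided differentiability of all orders of \<open>A\<close> and \<open>B\<close> on \<open>[a, b]\<close>.\<close>
locale isoparametric_mfd = compact_riemannian M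
 for M :: "('a::{t2_space,second_countable_topology}, 'n::finite) riemannian" +
 fixes F :: "'a => real" and a b :: real and A B :: "real => real"
 assumes ab: "a < b" and F_smooth: "smooth_fun M F" and rangeF: "range F = {a..b}"
  and A: "!!k. C_seg k a b A" and B: "!!k. C_seg k a b B"
  and gradF: "!!x. grad_norm_sq M F x = A (F x)" and lapF: "!!x. laplacian M F x = B (F x)"
  and conn: "connected (UNIV :: 'a set)"
begin

lemma F: "C_fun k F" using F_smooth by (simp add: smooth_fun_iff)

lemma F_range: "F x : {a..b}" "a <= F x" "F x <= b"
 using rangeI[of F x] unfolding rangeF by auto

lemma F_sub: "range F <= {a..b}" using rangeF by simp

lemma F_surj: "s : {a..b} ==> EX x. F x = s"
 unfolding rangeF[symmetric] by auto

lemma F_cont: "continuous_on UNIV F" by (rule C_fun_cont[OF F])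

lemma Gam_FF: "Gam F F x = A (F x)" using gradF grad_norm_sq_Gam by metis

lemma A_nonneg: assumes "s : {a..b}" shows "0 <= A s"
proof -
 obtain x where x: "F x = s" using F_surj[OF assms] by blast
 let ?c = "chart_at M x"
 have y: "coords ?c x : U ?c" using chart_at(2) by auto
 have "Gam F F x = (g ?c (coords ?c x) *v gradient_in M ?c F (coords ?c x)) \<bullet> gradient_in M ?c F (coords ?c x)"
  unfolding Gam_def ginner_def g_gradient[OF chart_at(1) y] ..
 also have "... >= 0" using g_nonneg[OF chart_at(1) y] by (simp add: inner_commute)
 finally show ?thesis using Gam_FF[of x] x by simp
qed

lemma A_extremum:
 assumes "F x = a | F x = b" shows "A (F x) = 0"
proof -
 let ?c = "chart_at M x" let ?y = "coords ?c x"
 have y: "?y : U ?c" using chart_at(2) by auto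
 have px: "param ?c ?y = x" using chart_at by simp
 have "(ALL z:U ?c. (F o param ?c) z <= (F o param ?c) ?y) | (ALL z:U ?c. (F o param ?c) ?y <= (F o param ?c) z)"
  using assms F_range px by auto
 from differential_zero_maxmin[OF y open_U[OF chart_at(1)] has_derivative_dv[OF F chart_at(1) y] this]
 have "dv ?c F ?y \<bullet> v = 0" for v by metis
 hence "Gam F F x = 0" by (simp add: Gam_def ginner_def)
 thus ?thesis using Gam_FF by simp
qed

lemma A_ends: "A a = 0" "A b = 0"
 using A_extremum F_surj[of a] F_surj[of b] ab by auto

definition A1 where "A1 = (SOME f'. (ALL x:{a..b}. (A has_real_derivative f' x) (at x within {a..b})) & (ALL k. C_seg k a b f'))"

lemma A1: "x : {a..b} ==> (A has_real_derivative A1 x) (at x within {a..b})" "C_seg k a b A1"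
proof -
 from someI_ex[OF C_seg_all_deriv[OF ab A]] have "(ALL x:{a..b}. (A has_real_derivative A1 x) (at x within {a..b})) & (ALL k. C_seg k a b A1)"
  unfolding A1_def .
 thus "x : {a..b} ==> (A has_real_derivative A1 x) (at x within {a..b})" "C_seg k a b A1" by auto
qed

lemma A_cont: "continuous_on {a..b} A" and B_cont: "continuous_on {a..b} B" and A1_cont: "continuous_on {a..b} A1"
 using A[of 0] B[of 0] A1(2)[of 0] by auto

text \<open>If \<open>A\<close> vanished to second order at \<open>t\<close>, then \<open>|grad F| \<le> C |F - t|\<close>, and by Gronwall's inequality along segments the level \<open>F = t\<close> would be open. Being closed, it would be all of the connected manifold.\<close>
lemma level_not_degenerate:
 assumes t: "t : {a..b}" and K: "!!s. s : {a..b} ==> A s <= K * (s - t)^2"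
 shows False
proof -
 have K0: "0 <= K"
 proof -
  obtain s where s: "s : {a..b}" "s ~= t" using ab t by (metis atLeastAtMost_iff less_imp_le less_irrefl order_refl)
  hence "0 <= K * (s - t)^2" using K[OF s(1)] A_nonneg[OF s(1)] by linarith
  thus ?thesis using s(2) by (simp add: zero_le_mult_iff)
 qed
 define S where "S = F -` {t}"
 have closed: "closed S" unfolding S_def using F_cont by (intro closed_vimage) auto
 have "open S" unfolding open_subopen[of S]
 proof
  fix p assume p: "p : S"
  obtain c where c: "c : atlas M" "p : domain c" using chart_cover by blast
  obtain r where r: "r > 0" "cball (coords c p) r <= U c"
   using open_contains_cball[of "U c"] open_U[OF c(1)] c(2) by blast
  have sub: "ball (coords c p) r <= U c" using r(2) by auto
  define V where "V = param c ` ball (coords c p) r"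
  have "V <= S"
  proof
   fix z assume "z : V"
   then obtain y where y: "y : ball (coords c p) r" "z = param c y" by (auto simp: V_def)
   define v where "v = y - coords c p"
   define f where "f = (%s. F (param c (coords c p + s *\<^sub>R v)))"
   have seg: "coords c p + s *\<^sub>R v : cball (coords c p) r" if s: "0 <= s" "s <= 1" for s
   proof -
    have "norm (s *\<^sub>R v) <= 1 * norm v" using mult_right_mono[of s 1 "norm v"] s by simp
    also have "... <= r" using y(1) by (simp add: v_def dist_norm norm_minus_commute)
    finally show ?thesis by (simp add: dist_norm)
   qed
   have segU: "coords c p + s *\<^sub>R v : U c" if "0 <= s" "s <= 1" for s using seg[OF that] r(2) by blast
   have "continuous_on {0..1} (%s. v \<bullet> (g c (coords c p + s *\<^sub>R v) *v v))"
    by (rule continuous_on_compose2[OF g_form_cont[OF c(1)]]) (use segU in "auto intro!: continuous_intros")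
   then obtain C where C: "!!s. s : {0..1} ==> abs (v \<bullet> (g c (coords c p + s *\<^sub>R v) *v v)) <= C" using bounded_by by meson
   have C0: "0 <= C" using C[of 0] by simp
   define D where "D = (%s. dv c F (coords c p + s *\<^sub>R v) \<bullet> v)"
   have der: "DERIV f s :> D s" if s: "0 <= s" "s <= 1" for s
   proof -
    have "((%s. coords c p + s *\<^sub>R v) has_derivative (%h. h *\<^sub>R v)) (at s)"
     by (auto intro!: derivative_eq_intros)
    from diff_chain_at[OF this has_derivative_dv[OF F c(1) segU[OF s]]]
    show ?thesis by (simp add: f_def D_def o_def has_field_derivative_def mult.commute[of _ "dv c F _ \<bullet> v"])
   qed
   have Dbd: "(D s)^2 <= K * C * (f s - t)^2" if s: "0 <= s" "s <= 1" for s
   proof -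
    have "(D s)^2 <= ginner c F F (coords c p + s *\<^sub>R v) * (v \<bullet> (g c (coords c p + s *\<^sub>R v) *v v))"
     unfolding D_def by (rule dv_bound[OF c(1) segU[OF s]])
    also have "ginner c F F (coords c p + s *\<^sub>R v) = A (f s)"
     using Gam_chart[OF F F c(1), of "param c (coords c p + s *\<^sub>R v)"] segU[OF s] Gam_FF
     by (simp add: f_def)
    also have "A (f s) * (v \<bullet> (g c (coords c p + s *\<^sub>R v) *v v)) <= (K * (f s - t)^2) * C"
     using K[of "f s"] A_nonneg[of "f s"] F_range C[of s] s g_nonneg[OF c(1) segU[OF s], of v] K0
     by (intro mult_mono) (auto simp: f_def)
    finally show ?thesis by (simp add: mult_ac)
   qed
   define E where "E = (%s. (f s - t)^2)"
   have E': "DERIV E s :> 2 * (f s - t) * D s" if s: "0 <= s" "s <= 1" for s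
    unfolding E_def using der[OF s] by (auto intro!: derivative_eq_intros)
   have "E 1 <= 0"
   proof (rule gronwall_zero_right[where E = E and c = 0 and d = 1 and k = "1 + K * C" and E' = "%s. 2 * (f s - t) * D s"])
    show "(E has_real_derivative 2 * (f s - t) * D s) (at s within {0..1})" if "0 <= s" "s <= 1" for s
     using E'[OF that] by (rule has_field_derivative_at_within)
    show "2 * (f s - t) * D s <= (1 + K * C) * E s" if s: "0 <= s" "s <= 1" for s
    proof -
     have "2 * (f s - t) * D s <= (f s - t)^2 + (D s)^2"
      using zero_le_power2[of "(f s - t) - D s"] by (simp add: power2_diff)
     also have "... <= (1 + K * C) * E s" using Dbd[OF s] by (simp add: E_def algebra_simps)
     finally show ?thesis .
    qed
    show "E 0 <= 0" using p c by (simp add: E_def f_def S_def)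
   qed simp
   hence "f 1 = t" by (simp add: E_def)
   thus "z : S" using y(2) by (simp add: S_def f_def v_def)
  qed
  moreover have "open V" unfolding V_def by (rule open_param_image[OF c(1) open_ball sub])
  moreover have "p : V" unfolding V_def using c r(1) by (intro image_eqI[of _ _ "coords c p"]) auto
  ultimately show "EX T. open T & p : T & T <= S" by blast
 qed
 moreover have "S ~= {}" using F_surj[OF t] by (auto simp: S_def)
 ultimately have "S = UNIV" using conn closed
  using connected_clopen[of "UNIV :: 'a set"] by (simp flip: open_openin closed_closedin) blast
 hence "F x = t" for x by (auto simp: S_def)
 thus False using F_surj[of a] F_surj[of b] ab by auto
qed

lemma A_quadratic:
 assumes t: "t : {a..b}" and z: "A t = 0" "A1 t = 0"
 shows "EX K. ALL s:{a..b}. A s <= K * (s - t)^2"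
proof -
 obtain A2 where A2: "ALL x:{a..b}. (A1 has_real_derivative A2 x) (at x within {a..b})" "ALL k. C_seg k a b A2"
  using C_seg_all_deriv[OF ab A1(2)] by (elim exE conjE)
 have "continuous_on {a..b} A2" using A2(2) C_seg.simps(1) by blast
 then obtain K where K: "!!s. s : {a..b} ==> abs (A2 s) <= K" using bounded_by by meson
 have K0: "0 <= K" using K[OF t] by linarith
 have 1: "abs (A1 s) <= K * abs (s - t)" if "s : {a..b}" for s
  using field_differentiable_bound[OF convex_real_interval(5)[of a b] A2(1)[rule_format], of K s t] K that t z by simp
 have "A s <= K * (s - t)^2" if s: "s : {a..b}" for s
 proof -
  have sub: "closed_segment s t <= {a..b}" using s t by (simp add: closed_segment_subset)
  have "norm (A s - A t) <= (K * abs (s - t)) * norm (s - t)"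
  proof (rule field_differentiable_bound[of "closed_segment s t" A A1])
   show "(A has_field_derivative A1 x) (at x within closed_segment s t)" if "x : closed_segment s t" for x
    using A1(1)[of x] sub that has_field_derivative_subset by blast
   show "norm (A1 x) <= K * abs (s - t)" if x: "x : closed_segment s t" for x
   proof -
    have "abs (x - t) <= abs (s - t)" using x by (auto simp: closed_segment_eq_real_ivl split: if_splits)
    thus ?thesis using 1[of x] x sub K0 mult_left_mono[of "abs (x - t)" "abs (s - t)" K] by auto
   qed
  qed auto
  thus ?thesis using z by (simp add: power2_eq_square mult.assoc abs_mult_self_eq)
 qed
 thus ?thesis by blast
qed

text \<open>An interior zero of the nonnegative function \<open>A\<close> is a minimum, hence degenerate.\<close>
lemma A_pos: assumes s: "a < s" "s < b" shows "0 < A s"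
proof (rule ccontr)
 assume "~ 0 < A s"
 hence z: "A s = 0" using A_nonneg[of s] s by auto
 have d: "DERIV A s :> A1 s"
  using A1(1)[of s] s at_within_interior[of s "{a..b}"] by auto
 have "A1 s = 0"
  by (rule DERIV_local_min[OF d, of "min (s - a) (b - s)"]) (use s z A_nonneg in "auto simp: abs_less_iff")
 then obtain K where "ALL x:{a..b}. A x <= K * (x - s)^2" using A_quadratic[of s] z s by auto
 thus False using level_not_degenerate[of s K] s by auto
qed

lemma A1_a: "0 < A1 a"
proof -
 have aa: "a : {a..b}" using ab by simp
 have "~ A1 a < 0"
 proof
  assume neg: "A1 a < 0"
  obtain d where d: "d > 0" "!!h. 0 < h ==> a + h : {a..b} ==> h < d ==> A (a + h) < A a"
   using has_real_derivative_neg_dec_right[OF A1(1)[OF aa] neg] by blast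
  define h where "h = min (d / 2) (b - a)"
  have "A (a + h) < A a" by (rule d(2)) (use d(1) ab in "auto simp: h_def min_def")
  moreover have "0 <= A (a + h)" by (rule A_nonneg) (use d(1) ab in "auto simp: h_def min_def")
  ultimately show False using A_ends by simp
 qed
 moreover have "A1 a ~= 0"
  using A_quadratic[OF aa A_ends(1)] level_not_degenerate[OF aa] by blast
 ultimately show ?thesis by simp
qed

text \<open>Exchanges the two ends, so that claims about \<open>b\<close> follow from those about \<open>a\<close>.\<close>
lemma isoparametric_neg: "isoparametric_mfd M (%x. - F x) (- b) (- a) (%s. A (- s)) (%s. (- 1) * B (- s))"
proof unfold_locales
 have um: "C_seg k a b uminus" for k
  using C_seg_cmult[of k a b "%x. x" "- 1"]
 proof -
  have "C_seg k a b (%x. x)" for k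
   by (cases k) (auto intro!: exI[of _ "%x. 1"] C_seg_const)
  from C_seg_cmult[OF this, of k "- 1"] show ?thesis by simp
 qed
 show "- b < - a" using ab by simp
 show "smooth_fun M (%x. - F x)" unfolding smooth_fun_iff using C_fun_C_seg[OF um F F_sub] by blast
 have "range (%x. - F x) = uminus ` range F" by auto
 thus "range (%x. - F x) = {- b..- a}" unfolding rangeF by simp
 show "C_seg k (- b) (- a) (%s. A (- s))" for k by (rule C_seg_reflect[OF A])
 show "C_seg k (- b) (- a) (%s. (- 1) * B (- s))" for k by (rule C_seg_cmult[OF C_seg_reflect[OF B]])
 have d: "(uminus has_real_derivative (%_. - 1) s) (at s within {a..b})" for s :: real
  by (auto intro!: derivative_eq_intros)
 have Gam1: "Gam (%x. - F x) u x = - Gam F u x" for u x using Gam_compose[OF F F_sub d] by simp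
 have sym: "Gam u v x = Gam v u x" for u v x
  unfolding Gam_def by (rule ginner_commute[OF chart_at(1)]) (use chart_at(2) in auto)
 show "grad_norm_sq M (%x. - F x) x = A (- (- F x))" for x
  unfolding grad_norm_sq_Gam Gam1 sym[of F "%x. - F x"] Gam1 by (simp add: Gam_FF)
 have "((%_::real. - 1 :: real) has_real_derivative (%_. 0) s) (at s within {a..b})" for s by simp
 from laplacian_compose[OF F F_sub d this]
 show "laplacian M (%x. - F x) x = (- 1) * B (- (- F x))" for x by (simp add: lapF)
 show "connected (UNIV :: 'a set)" by (rule conn)
qed

lemma A1_b: "A1 b < 0"
proof -
 interpret neg: isoparametric_mfd M "%x. - F x" "- b" "- a" "%s. A (- s)" "%s. (- 1) * B (- s)"
  by (rule isoparametric_neg)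
 have mem: "- b : {- b..- a}" "b : {a..b}" using ab by auto
 have "(A has_real_derivative A1 (- (- b))) (at (- (- b)) within uminus ` {- b..- a})"
  using A1(1)[OF mem(2)] by simp
 moreover have "(uminus has_real_derivative - 1) (at (- b) within {- b..- a})"
  by (auto intro!: derivative_eq_intros)
 ultimately have "(A o uminus has_real_derivative A1 (- (- b)) * - 1) (at (- b) within {- b..- a})"
  by (rule DERIV_image_chain)
 hence "neg.A1 (- b) = A1 (- (- b)) * - 1"
  using vector_derivative_unique_within_closed_interval[OF neg.ab, of "- b" "%s. A (- s)" "neg.A1 (- b)" "A1 (- (- b)) * - 1"]
   neg.A1(1)[OF mem(1)] mem(1)
  by (simp add: has_real_derivative_iff_has_vector_derivative o_def)
 thus ?thesis using neg.A1_a by simp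
qed

lemma A_lipschitz: "EX L>0. ALL s:{a..b}. A s <= L * (s - a) & A s <= L * (b - s)"
proof -
 obtain L where L: "!!s. s : {a..b} ==> abs (A1 s) <= L" using bounded_by[OF A1_cont] by meson
 have "A s <= (L + 1) * (s - a) & A s <= (L + 1) * (b - s)" if s: "s : {a..b}" for s
 proof -
  have "norm (A s - A a) <= L * norm (s - a)" "norm (A s - A b) <= L * norm (s - b)"
   by (rule field_differentiable_bound[OF convex_real_interval(5)[of a b] A1(1)]; use L s ab in auto)+
  hence "A s <= L * (s - a)" "A s <= L * (b - s)" using A_ends s by auto
  moreover have "L * (s - a) <= (L + 1) * (s - a)" "L * (b - s) <= (L + 1) * (b - s)"
   using s by (auto intro!: mult_right_mono)
  ultimately show ?thesis by linarith
 qed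
 moreover have "0 < L + 1" using L[of a] ab by auto
 ultimately show ?thesis by blast
qed

text \<open>The zeros of \<open>A\<close> at the ends are simple, so the quotient by \<open>(s - a) * (b - s)\<close> extends to a positive continuous function.\<close>
lemma A_lower: "EX c>0. ALL s:{a..b}. c * ((s - a) * (b - s)) <= A s"
proof -
 define r where "r = (%s. if s = a then A1 a / (b - a) else if s = b then - A1 b / (b - a) else A s / ((s - a) * (b - s)))"
 have lima: "tendsto (%s. A s / (s - a)) (A1 a) (at_right a)"
 proof -
  have "tendsto (%s. (A s - A a) / (s - a)) (A1 a) (at a within {a..b})"
   using A1(1)[of a] ab by (simp add: has_field_derivative_iff)
  thus ?thesis using ab A_ends by (simp add: at_within_Icc_at_right)
 qed
 have limb: "tendsto (%s. A s / (s - b)) (A1 b) (at_left b)"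
 proof -
  have "tendsto (%s. (A s - A b) / (s - b)) (A1 b) (at b within {a..b})"
   using A1(1)[of b] ab by (simp add: has_field_derivative_iff)
  thus ?thesis using ab A_ends by (simp add: at_within_Icc_at_left)
 qed
 have "continuous_on {a..b} r"
 proof (rule continuous_on_IccI[OF _ _ _ ab])
  have "tendsto (%s. A s / (s - a) / (b - s)) (A1 a / (b - a)) (at_right a)"
   using ab by (intro tendsto_divide lima tendsto_diff tendsto_const tendsto_ident_at) auto
  moreover have "eventually (%s. A s / (s - a) / (b - s) = r s) (at_right a)"
   using eventually_inside_right[OF ab] by eventually_elim (auto simp: r_def)
  ultimately show "tendsto r (r a) (at_right a)"
   unfolding r_def[THEN fun_cong, of a] by (auto intro: Lim_transform_eventually)
  have "tendsto (%s. - (A s / (s - b)) / (s - a)) (- A1 b / (b - a)) (at_left b)"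
   using ab by (intro tendsto_divide tendsto_minus limb tendsto_diff tendsto_const tendsto_ident_at) auto
  moreover have "eventually (%s. - (A s / (s - b)) / (s - a) = r s) (at_left b)"
   using eventually_inside_left[OF ab]
  proof eventually_elim
   case (elim s)
   thus ?case by (simp add: r_def divide_simps) (simp add: algebra_simps)
  qed
  moreover have "r b = - A1 b / (b - a)" using ab by (simp add: r_def)
  ultimately show "tendsto r (r b) (at_left b)" by (auto intro: Lim_transform_eventually)
 next
  fix x assume x: "a < x" "x < b"
  have "isCont A x" using A_cont x by (intro continuous_on_interior[of "{a..b}"]) auto
  hence "isCont (%s. A s / ((s - a) * (b - s))) x" using x by (intro continuous_intros) auto
  hence "tendsto (%s. A s / ((s - a) * (b - s))) (r x) (at x)" using x by (simp add: isCont_def r_def)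
  moreover have "eventually (%s. A s / ((s - a) * (b - s)) = r s) (at x)"
   by (rule eventually_mono[OF eventually_at_in_open'[of "{a<..<b}" x]]) (use x in "auto simp: r_def")
  ultimately show "tendsto r (r x) (at x)" by (rule Lim_transform_eventually)
 qed
 from continuous_attains_inf[OF compact_Icc _ this] ab
 obtain x0 where x0: "x0 : {a..b}" "!!s. s : {a..b} ==> r x0 <= r s" by auto
 have rpos: "0 < r s" if "s : {a..b}" for s
  using that A_pos[of s] A1_a A1_b ab by (auto simp: r_def divide_neg_pos)
 have "r x0 * ((s - a) * (b - s)) <= A s" if s: "s : {a..b}" for s
 proof (cases "s = a | s = b")
  case False
  hence s': "a < s" "s < b" using s by auto
  hence "r s = A s / ((s - a) * (b - s))" by (simp add: r_def)
  hence "r x0 <= A s / ((s - a) * (b - s))" using x0(2)[OF s] by simp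
  thus ?thesis using s' by (simp add: pos_le_divide_eq)
 qed (use A_ends in auto)
 thus ?thesis using rpos[OF x0(1)] by blast
qed

end

section \<open>The image of the Riemannian measure\<close>

text \<open>A bounded function cannot have a derivative larger than a multiple of \<open>1 / (s - a)\<close>, whose integral diverges.\<close>
lemma log_blowup:
 fixes h h' :: "real => real"
 assumes am: "a < m" and der: "!!s. a < s ==> s < m ==> DERIV h s :> h' s"
  and ge: "!!s. a < s ==> s < m ==> c / (s - a) <= h' s" and c: "0 < c"
  and bd: "!!s. a < s ==> s < m ==> abs (h s) <= K"
 shows False
proof -
 define n where "n = (a + m) / 2"
 have n: "a < n" "n < m" using am by (auto simp: n_def)
 have K: "0 <= K" using bd[OF n] by linarith
 define e where "e = exp (- ((2 * K + 1) / c))"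
 define s where "s = a + (n - a) * e"
 have e: "0 < e" "e < 1" "ln e = - ((2 * K + 1) / c)" using K c by (auto simp: e_def)
 have "(n - a) * e < (n - a) * 1" by (rule mult_strict_left_mono[OF e(2)]) (use n in simp)
 hence s: "a < s" "s < n" using n e(1) mult_pos_pos[of "n - a" e] unfolding s_def mult_1_right by linarith+
 have "h s - c * ln (s - a) <= h n - c * ln (n - a)"
 proof (rule DERIV_nonneg_imp_nondecreasing[of s n "%s. h s - c * ln (s - a)"])
  fix x assume x: "s <= x" "x <= n"
  have "DERIV (%s. h s - c * ln (s - a)) x :> h' x - c / (x - a)"
   using x s n by (auto intro!: derivative_eq_intros der)
  moreover have "0 <= h' x - c / (x - a)" using ge[of x] x s n by auto
  ultimately show "EX y. DERIV (%s. h s - c * ln (s - a)) x :> y & 0 <= y" by blast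
 qed (use s in simp)
 moreover have "ln (s - a) = ln (n - a) - (2 * K + 1) / c"
  using n e by (simp add: s_def ln_mult)
 moreover have "c * ((2 * K + 1) / c) = 2 * K + 1" using c by simp
 ultimately have "h s + (2 * K + 1) <= h n" by (simp add: right_diff_distrib)
 thus False using bd[of s] bd[of n] s n by (simp add: abs_le_iff)
qed

lemma no_decay_to_zero:
 fixes p p' :: "real => real"
 assumes am: "a < m" and der: "!!s. a < s ==> s < m ==> DERIV p s :> p' s"
  and le: "!!s. a < s ==> s < m ==> p' s <= C * p s" and pos: "!!s. a < s ==> s < m ==> 0 < p s"
  and lim: "tendsto p 0 (at_right a)"
 shows False
proof -
 define n where "n = (a + m) / 2"
 have n: "a < n" "n < m" using am by (auto simp: n_def)
 define h where "h = (%s. p s * exp (- (C * s)))"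
 have mono: "h n <= h s" if s: "a < s" "s < n" for s
 proof (rule DERIV_nonpos_imp_nonincreasing[where f = h])
  fix x assume x: "s <= x" "x <= n"
  have "DERIV h x :> (p' x - C * p x) * exp (- (C * x))"
   unfolding h_def using x s n by (auto intro!: derivative_eq_intros der simp: algebra_simps)
  moreover have "(p' x - C * p x) * exp (- (C * x)) <= 0"
   using le[of x] x s n by (intro mult_nonpos_nonneg) auto
  ultimately show "EX y. DERIV h x :> y & y <= 0" by blast
 qed (use s in simp)
 have "tendsto h (0 * exp (- (C * a))) (at_right a)"
  unfolding h_def by (intro tendsto_intros lim)
 hence "tendsto h 0 (at_right a)" by simp
 hence "h n <= 0"
 proof (rule tendsto_lowerbound)
  show "eventually (%s. h n <= h s) (at_right a)"
   using eventually_inside_right[OF n(1)] by eventually_elim (rule mono; simp)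
 qed simp
 thus False using pos[OF n] by (simp add: h_def mult_le_0_iff not_le)
qed

lemma antiderivative_Ioo:
 fixes f :: "real => real"
 assumes "a < b" "continuous_on {a<..<b} f"
 shows "EX H. ALL s. a < s --> s < b --> DERIV H s :> f s"
proof -
 have "isCont f s" if "ereal a < ereal s" "ereal s < ereal b" for s
  using assms(2) that by (simp add: continuous_on_eq_continuous_at)
 from einterval_antiderivative[of "ereal a" "ereal b" f, OF _ this] assms(1)
 show ?thesis by (simp add: has_real_derivative_iff_has_vector_derivative)
qed

lemma antiderivative_UNIV:
 fixes f :: "real => real"
 assumes "continuous_on UNIV f"
 shows "EX H. ALL s. DERIV H s :> f s"
proof -
 have "isCont f s" for s using assms by (simp add: continuous_on_eq_continuous_at)
 from einterval_antiderivative[of "-\<infinity>" "\<infinity>" f, OF _ this]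
 show ?thesis by (simp add: has_real_derivative_iff_has_vector_derivative)
qed

lemma continuous_zero_outside:
 fixes g :: "real => real"
 assumes "continuous_on {a<..<b} g" "a < alpha" "beta < b" "!!s. s ~: {alpha..beta} ==> g s = 0"
 shows "continuous_on UNIV g"
proof -
 have "continuous_on (- {alpha..beta}) g"
  using assms(4) by (subst continuous_on_cong[OF refl, of _ _ "%_. 0"]) auto
 moreover have "{a<..<b} Un - {alpha..beta} = UNIV" using assms(2,3) by auto
 ultimately show ?thesis
  using continuous_on_open_Un[of "{a<..<b}" "- {alpha..beta}" g] assms(1) by auto
qed

lemma integrable_zero_outside:
 fixes g :: "real => real"
 assumes "continuous_on UNIV g" "!!s. s ~: {alpha..beta} ==> g s = 0"
 shows "integrable lborel g"
proof -
 have "integrable lborel (%x. indicator {alpha..beta} x *\<^sub>R g x)"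
  by (rule borel_integrable_compact[OF compact_Icc continuous_on_subset[OF assms(1)]]) simp
 moreover have "(%x. indicator {alpha..beta} x *\<^sub>R g x) = g" using assms(2) by (fastforce simp: indicator_def)
 ultimately show ?thesis by simp
qed

lemma integral_derivative_Icc:
 fixes g :: "real => real"
 assumes der: "!!s. DERIV G s :> g s" and g: "continuous_on UNIV g" and "c <= d"
 shows "(LINT s|lborel. (if c <= s & s <= d then g s else 0)) = G d - G c"
proof -
 have "(LINT s|lborel. g s * indicator {c..d} s) = G d - G c"
  using der g assms(3) by (intro integral_FTC_Icc_real) (auto simp: continuous_on_eq_continuous_at)
 moreover have "(%s. g s * indicator {c..d} s) = (%s. if c <= s & s <= d then g s else 0)"
  by (auto simp: indicator_def)
 ultimately show ?thesis by simp
qed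

lemma integral_derivative_zero_outside:
 fixes g :: "real => real"
 assumes der: "!!s. DERIV G s :> g s" and g: "continuous_on UNIV g"
  and z: "!!s. s ~: {alpha..beta} ==> g s = 0" and cd: "c <= d" "c <= alpha" "beta <= d"
 shows "(LINT s|lborel. g s) = G d - G c"
proof -
 have "g s = (if c <= s & s <= d then g s else 0)" for s using z[of s] cd by auto
 hence "(LINT s|lborel. g s) = (LINT s|lborel. (if c <= s & s <= d then g s else 0))"
  by (intro lebesgue_integral_cong) auto
 thus ?thesis using integral_derivative_Icc[OF der g cd(1)] by simp
qed

text \<open>Continuous piecewise linear functions which increase to the indicator function of \<open>{x<..}\<close>.\<close>
definition ramp :: "real => real => nat => real => real" where
 "ramp x d n s = min 1 (max 0 (real (Suc n) * (s - x) / d))"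

lemma ramp_cont: "d > 0 ==> continuous_on S (ramp x d n)"
 unfolding ramp_def by (intro continuous_intros) auto

lemma ramp_bounds: "0 <= ramp x d n s" "ramp x d n s <= 1" by (auto simp: ramp_def)

lemma ramp_zero: assumes "0 < d" "s <= x" shows "ramp x d n s = 0"
proof -
 have "real (Suc n) * (s - x) / d <= 0"
  using assms by (intro divide_nonpos_pos mult_nonneg_nonpos) auto
 thus ?thesis unfolding ramp_def by linarith
qed

lemma ramp_one: "0 < d ==> x + d <= s ==> ramp x d n s = 1"
proof -
 assume a: "0 < d" "x + d <= s"
 have "1 * d <= real (Suc n) * (s - x)" using a by (intro mult_mono) auto
 hence "1 <= real (Suc n) * (s - x) / d" using a(1) by (simp add: pos_le_divide_eq)
 thus ?thesis unfolding ramp_def by linarith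
qed

lemma ramp_lim:
 assumes "0 < d" shows "(%n. ramp x d n s) \<longlonglongrightarrow> (if x < s then 1 else 0)"
proof (cases "x < s")
 case True
 obtain N :: nat where N: "d / (s - x) < real N" using reals_Archimedean2 by blast
 have "ramp x d n s = 1" if "N <= n" for n
 proof -
  have "d / (s - x) <= real (Suc n)" using N that by simp
  hence "1 <= real (Suc n) * (s - x) / d" using True assms by (simp add: field_simps)
  thus ?thesis unfolding ramp_def by linarith
 qed
 hence "eventually (%n. ramp x d n s = 1) sequentially" using eventually_sequentially by blast
 thus ?thesis using True by (simp add: tendsto_eventually)
qed (use ramp_zero[OF assms] in "simp add: not_less")

lemma ramp_mono: "0 < d ==> x <= y ==> ramp y d n s <= ramp x d n s"
proof -
 assume "0 < d" "x <= y"
 hence "real (Suc n) * (s - y) / d <= real (Suc n) * (s - x) / d"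
  by (intro divide_right_mono mult_left_mono) auto
 thus ?thesis unfolding ramp_def by linarith
qed

context isoparametric_mfd begin

text \<open>An integrating factor: for \<open>theta = q * zeta\<close> one has \<open>A theta' - B theta = A q zeta'\<close>.\<close>
definition "q = (SOME q. ALL s. a < s --> s < b --> 0 < q s & DERIV q s :> q s * B s / A s)"

lemma A_cont_Ioo: "continuous_on {a<..<b} A" and B_cont_Ioo: "continuous_on {a<..<b} B"
 by (rule continuous_on_subset[OF A_cont], force) (rule continuous_on_subset[OF B_cont], force)

lemma q: assumes "a < s" "s < b" shows "0 < q s" "DERIV q s :> q s * B s / A s"
proof -
 have "continuous_on {a<..<b} (%s. B s / A s)"
  by (intro continuous_on_divide A_cont_Ioo B_cont_Ioo) (use A_pos in fastforce)
 from antiderivative_Ioo[OF ab this] obtain Q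
  where Q: "!!s. a < s ==> s < b ==> DERIV Q s :> B s / A s" by blast
 have "ALL s. a < s --> s < b --> 0 < exp (Q s) & DERIV (%s. exp (Q s)) s :> exp (Q s) * B s / A s"
  using DERIV_fun_exp[OF Q] by simp
 hence "EX q. ALL s. a < s --> s < b --> 0 < q s & DERIV q s :> q s * B s / A s"
  by (rule exI[of _ "%s. exp (Q s)"])
 from someI_ex[OF this] assms show "0 < q s" "DERIV q s :> q s * B s / A s"
  unfolding q_def[symmetric] by auto
qed

lemma q_cont: "continuous_on {a<..<b} q"
 using DERIV_isCont[OF q(2)] by (auto intro!: continuous_at_imp_continuous_on)

text \<open>Green's identity for \<open>f\<close> and \<open>eta o F\<close>, where \<open>theta = eta'\<close>.\<close>
lemma weak_test:
 assumes f: "C_fun (Suc (Suc 0)) f" "!!x. laplacian M f x = l * f x"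
  and 1: "!!s. s : {a..b} ==> (eta has_real_derivative theta s) (at s within {a..b})"
  and 2: "!!s. s : {a..b} ==> (theta has_real_derivative theta' s) (at s within {a..b})"
  and c: "continuous_on {a..b} theta'"
 shows "(LINT x|vol. f x * (A (F x) * theta' (F x) - B (F x) * theta (F x))) = - l * (LINT x|vol. f x * eta (F x))"
proof -
 have "C_seg (Suc (Suc 0)) a b eta"
  unfolding C_seg.simps using 1 2 c by (intro exI[of _ theta] conjI exI[of _ theta'] ballI) auto
 from C_fun_C_seg[OF this F F_sub] have u: "C_fun (Suc (Suc 0)) (%x. eta (F x))" .
 have "(LINT x|vol. f x * (A (F x) * theta' (F x) - B (F x) * theta (F x))) = (LINT x|vol. - (f x * laplacian M (%x. eta (F x)) x))"
 proof (intro lebesgue_integral_cong refl)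
  fix x
  have "laplacian M (%x. eta (F x)) x = theta (F x) * B (F x) - theta' (F x) * A (F x)"
   unfolding gradF[symmetric] lapF[symmetric] by (rule laplacian_compose[OF F F_sub]) (use 1 2 in auto)
  thus "f x * (A (F x) * theta' (F x) - B (F x) * theta (F x)) = - (f x * laplacian M (%x. eta (F x)) x)"
   by simp (simp add: algebra_simps)
 qed
 also have "... = - (LINT x|vol. eta (F x) * laplacian M f x)" by (simp add: green_sym[OF f(1) u])
 also have "... = - l * (LINT x|vol. f x * eta (F x))"
  unfolding f(2) by (simp add: mult_ac)
 finally show ?thesis .
qed

lemma laplacian_const: "laplacian M (%_. c) x = 0"
proof -
 have "((%_. c) has_real_derivative (%_. 0) s) (at s within {a..b})"
  "((%_. 0) has_real_derivative (%_. 0) s) (at s within {a..b})" for s :: real by auto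
 from laplacian_compose[OF F F_sub this] show ?thesis by simp
qed

lemma F_comp_cont: "continuous_on {a..b} u ==> continuous_on UNIV (%x. u (F x) :: real)"
 using F_range by (intro continuous_on_compose2[OF _ F_cont]) auto

lemma F_comp_cont': "continuous_on UNIV u ==> continuous_on UNIV (%x. u (F x) :: real)"
 by (rule F_comp_cont[OF continuous_on_subset]) auto

lemma F_meas [measurable]: "F : borel_measurable borel"
 using F_cont by (rule borel_measurable_continuous_onI)

text \<open>A weak form of the statement that \<open>A q\<close> times the image of \<open>f dvol\<close> has derivative \<open>- K'\<close>: testing with derivatives \<open>k\<close> of compactly supported functions determines the measure up to a constant multiple of Lebesgue measure. The constant is found from one fixed \<open>k0\<close>, and ramps pass from test functions to intervals.\<close>
lemma density_of_test:
 assumes f: "continuous_on UNIV f" and K: "continuous_on {a<..<b} K"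
  and test: "!!zeta k alpha beta. [|a < alpha; beta < b; !!s. DERIV zeta s :> k s; continuous_on UNIV k;
    !!s. s ~: {alpha..beta} ==> zeta s = 0; !!s. s ~: {alpha..beta} ==> k s = 0|] ==>
   (LINT x|vol. f x * (A (F x) * q (F x) * k (F x))) = - (LINT s|lborel. K s * k s)"
 shows "EX C. ALL g x y. continuous_on {a..b} g --> a < x --> x <= y --> y < b -->
  (LINT z|vol. (if x < F z & F z <= y then f z * g (F z) else 0)) = integral {x..y} (%s. g s * ((C - K s) / (A s * q s)))"
proof -
 define L where "L = (%k. (LINT x|vol. f x * (A (F x) * q (F x) * k (F x))) + (LINT s|lborel. K s * k s))"
 have Aqk: "continuous_on UNIV (%s. A s * q s * k s)" and Kk: "continuous_on UNIV (%s. K s * k s)"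
  if "continuous_on UNIV k" "a < alpha" "beta < b" "!!s. s ~: {alpha..beta} ==> k s = 0" for k alpha beta
  by (rule continuous_zero_outside[OF _ that(2,3)], (intro continuous_on_mult A_cont_Ioo q_cont K continuous_on_subset[OF that(1)], simp), simp add: that(4))+
 have int: "integrable vol (%x. f x * (A (F x) * q (F x) * k (F x)))" "integrable lborel (%s. K s * k s)" "integrable lborel k"
  if k: "continuous_on UNIV k" "a < alpha" "beta < b" "!!s. s ~: {alpha..beta} ==> k s = 0" for k alpha beta
  using integrable_cont[OF continuous_on_mult[OF f F_comp_cont'[OF Aqk[OF k]]]]
   integrable_zero_outside[OF Kk[OF k], of alpha beta] integrable_zero_outside[OF k(1,4)] k(4) by auto
 define m w where "m = (a + b) / 2" and "w = (b - a) / 4"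
 have w: "0 < w" "a < m - w" "m + w < b" using ab by (auto simp: m_def w_def field_simps)
 \<comment> \<open>A reference function of positive integral; subtracting a multiple of it makes a test function the derivative of another one with compact support.\<close>
 define k0 where "k0 = (%s. max 0 (w - abs (s - m)))"
 have k0: "continuous_on UNIV k0" "!!s. s ~: {m - w..m + w} ==> k0 s = 0"
  unfolding k0_def by (intro continuous_intros) auto
 have "(LINT s|lborel. k0 s) > 0"
 proof -
  obtain Z where Z: "!!s. DERIV Z s :> k0 s" using antiderivative_UNIV[OF k0(1)] by blast
  have "(LINT s|lborel. k0 s) = Z (m + w) - Z (m - w)"
   by (rule integral_derivative_zero_outside[OF Z k0]) (use w in auto)
  moreover have "Z (m - w) < Z (m + w)"
  proof (rule DERIV_pos_imp_increasing_open[where f = Z])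
   show "EX y. DERIV Z x :> y & 0 < y" if "m - w < x" "x < m + w" for x
    using Z[of x] that by (intro exI[of _ "k0 x"]) (auto simp: k0_def)
   show "continuous_on {m - w..m + w} Z" by (intro continuous_at_imp_continuous_on ballI DERIV_isCont[OF Z])
  qed (use w in simp)
  ultimately show ?thesis by simp
 qed
 note I0 = this
 define C where "C = L k0 / (LINT s|lborel. k0 s)"
 have claim: "L k = C * (LINT s|lborel. k s)"
  if k: "continuous_on UNIV k" "a < alpha" "beta < b" "!!s. s ~: {alpha..beta} ==> k s = 0" for k alpha beta
 proof -
  define c where "c = (LINT s|lborel. k s) / (LINT s|lborel. k0 s)"
  define alpha' beta' where "alpha' = min alpha (m - w)" and "beta' = max beta (m + w)"
  define k' where "k' = (%s. k s - c * k0 s)"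
  have k': "continuous_on UNIV k'" "a < alpha'" "beta' < b" "alpha' <= beta'" unfolding k'_def
   using k w by (auto simp: alpha'_def beta'_def intro!: continuous_intros k0(1))
  have z': "k' s = 0" if "s ~: {alpha'..beta'}" for s
   using that k(4)[of s] k0(2)[of s] by (auto simp: k'_def alpha'_def beta'_def min_def max_def split: if_splits)
  obtain Z where Z: "!!s. DERIV Z s :> k' s" using antiderivative_UNIV[OF k'(1)] by blast
  have Zc: "continuous_on S Z" for S by (intro continuous_at_imp_continuous_on ballI DERIV_isCont[OF Z])
  have "(LINT s|lborel. k' s) = 0"
   unfolding k'_def using I0 int(3)[OF k] int(3)[OF k0(1) w(2,3) k0(2)] by (simp add: c_def)
  hence Zint: "Z beta' = Z alpha'"
   using integral_derivative_zero_outside[OF Z k'(1) z', of alpha' beta'] k'(4) by simp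
  have zero: "Z s - Z alpha' = 0" if s: "s ~: {alpha'..beta'}" for s
  proof (cases "s < alpha'")
   case True
   have "DERIV Z x :> 0" if "s < x" "x < alpha'" for x using Z[of x] z'[of x] that by simp
   from DERIV_isconst2[OF True _ this, of alpha'] show ?thesis
    using True Zc by simp
  next
   case False
   hence gt: "beta' < s" using s by simp
   have "DERIV Z x :> 0" if "beta' < x" "x < s" for x using Z[of x] z'[of x] that by simp
   from DERIV_isconst2[OF gt _ this, of s] show ?thesis
    using gt Zint Zc by simp
  qed
  have dZ: "DERIV (%s. Z s - Z alpha') s :> k' s" for s
   using DERIV_diff[OF Z DERIV_const] by simp
  have "L k' = 0" using test[OF k'(2,3) dZ k'(1) zero z'] by (simp add: L_def)
  moreover have "L k' = L k - c * L k0"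
  proof -
   have "(LINT x|vol. f x * (A (F x) * q (F x) * k' (F x))) =
     (LINT x|vol. f x * (A (F x) * q (F x) * k (F x)) - c * (f x * (A (F x) * q (F x) * k0 (F x))))"
    by (intro lebesgue_integral_cong refl) (simp add: k'_def algebra_simps)
   moreover have "(LINT s|lborel. K s * k' s) = (LINT s|lborel. K s * k s - c * (K s * k0 s))"
    by (intro lebesgue_integral_cong refl) (simp add: k'_def algebra_simps)
   ultimately show ?thesis unfolding L_def
    using int[OF k] int[OF k0(1) w(2,3) k0(2)] by (simp add: algebra_simps)
  qed
  ultimately show ?thesis by (simp add: C_def c_def)
 qed
 show ?thesis
 proof (intro exI[of _ C] allI impI)
  fix g :: "real => real" and x y assume g: "continuous_on {a..b} g" and x: "a < x" and xy: "x <= y" and y: "y < b"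
  define d where "d = (b - y) / 2"
  have d: "0 < d" "y + d < b" using y by (auto simp: d_def field_simps)
  define rh where "rh = (%n s. ramp x d n s - ramp y d n s)"
  have rhz: "rh n s = 0" if "s ~: {x..y + d}" for n s
   using that ramp_zero[OF d(1), of s] ramp_one[OF d(1), of _ s] xy d(1) by (auto simp: rh_def)
  have rhb: "0 <= rh n s" "rh n s <= 1" for n s
   using ramp_mono[OF d(1) xy, of n s] ramp_bounds(2)[of x d n s] ramp_bounds(1)[of y d n s] by (auto simp: rh_def)
  have rhc: "continuous_on S (rh n)" for n S unfolding rh_def by (intro continuous_intros ramp_cont d(1))
  have rhl: "(%n. rh n s) \<longlonglongrightarrow> (if x < s & s <= y then 1 else 0)" for s
  proof -
   have "(%n. rh n s) \<longlonglongrightarrow> (if x < s then 1 else 0) - (if y < s then 1 else 0)"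
    unfolding rh_def by (intro tendsto_diff ramp_lim d(1))
   thus ?thesis using xy by (cases "x < s"; cases "y < s") auto
  qed
  define D where "D = (%s. g s * ((C - K s) / (A s * q s)))"
  define k where "k = (%n s. g s * rh n s / (A s * q s))"
  have gI: "continuous_on {a<..<b} g" by (rule continuous_on_subset[OF g]) auto
  have AqI: "ALL s:{a<..<b}. A s * q s ~= 0" using A_pos q(1) by fastforce
  have kc: "continuous_on UNIV (k n)" for n
  proof (rule continuous_zero_outside[OF _ x d(2)])
   show "continuous_on {a<..<b} (k n)" unfolding k_def
    by (intro continuous_on_divide continuous_on_mult gI rhc A_cont_Ioo q_cont AqI)
  qed (simp add: k_def rhz)
  have kz: "k n s = 0" if "s ~: {x..y + d}" for n s using rhz[OF that] by (simp add: k_def)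
  have L: "L (k n) = C * (LINT s|lborel. k n s)" for n by (rule claim[OF kc x d(2) kz])
  have e1: "A (F z) * q (F z) * k n (F z) = g (F z) * rh n (F z)" for n z
  proof (cases "F z : {x..y + d}")
   case True
   hence "A (F z) * q (F z) ~= 0" using AqI x d by auto
   thus ?thesis by (simp add: k_def)
  next
   case False thus ?thesis using kz rhz by simp
  qed
  have e2: "C * k n s - K s * k n s = D s * rh n s" for n s
  proof -
   have "C * k n s - K s * k n s = (C - K s) * k n s" by (simp add: left_diff_distrib)
   also have "... = D s * rh n s" unfolding k_def D_def times_divide_eq_left times_divide_eq_right by (simp only: mult_ac)
   finally show ?thesis .
  qed
  have eq: "(LINT z|vol. f z * (g (F z) * rh n (F z))) = (LINT s|lborel. D s * rh n s)" for n
  proof -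
   note i = int[OF kc x d(2) kz, of n]
   have "(LINT s|lborel. D s * rh n s) = C * (LINT s|lborel. k n s) - (LINT s|lborel. K s * k n s)"
    unfolding e2[symmetric] using i(2,3) by simp
   thus ?thesis using L[of n] unfolding L_def e1 by simp
  qed
  have gF: "continuous_on UNIV (%z. f z * g (F z))" by (intro continuous_on_mult f F_comp_cont[OF g])
  obtain M' where M': "!!z. abs (f z * g (F z)) <= M'" using cont_bounded[OF gF] by blast
  have [measurable]: "(%z. f z * g (F z)) : borel_measurable vol"
   unfolding measurable_vol by (rule borel_measurable_continuous_onI[OF gF])
  have Fv[measurable]: "F : borel_measurable vol" unfolding measurable_vol by simp
  have rhm[measurable]: "rh n : borel_measurable borel" for n by (rule borel_measurable_continuous_onI[OF rhc])
  have "(%n. \<integral>z. f z * g (F z) * rh n (F z) \<partial>vol) \<longlonglongrightarrow> (LINT z|vol. f z * g (F z) * (if x < F z & F z <= y then 1 else 0))"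
  proof (rule integral_dominated_convergence[where w = "%_. M'"])
   show "integrable vol (%_. M')" using finite_measure.integrable_const[OF finite_vol] .
   show "AE z in vol. (%n. f z * g (F z) * rh n (F z)) \<longlonglongrightarrow> f z * g (F z) * (if x < F z & F z <= y then 1 else 0)"
    by (intro AE_I2 tendsto_mult tendsto_const rhl)
   show "AE z in vol. norm (f z * g (F z) * rh n (F z)) <= M'" for n
   proof (rule AE_I2)
    fix z
    have "abs (f z * g (F z)) * abs (rh n (F z)) <= M' * 1" using M'[of z] rhb[of n "F z"] by (intro mult_mono) auto
    thus "norm (f z * g (F z) * rh n (F z)) <= M'" by (simp add: abs_mult)
   qed
  qed measurable
  hence lim1: "(%n. \<integral>z. f z * (g (F z) * rh n (F z)) \<partial>vol) \<longlonglongrightarrow> (LINT z|vol. (if x < F z & F z <= y then f z * g (F z) else 0))"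
   by (simp add: mult.assoc if_distrib[of "%t. _ * t"] cong: if_cong)
  have Dc: "continuous_on {x..y + d} D" unfolding D_def
   by (intro continuous_on_mult continuous_on_divide continuous_on_diff continuous_on_const)
     (use x d AqI in "auto intro: continuous_on_subset[OF gI] continuous_on_subset[OF K] continuous_on_subset[OF A_cont_Ioo] continuous_on_subset[OF q_cont]")
  define D' where "D' = (%s. indicator {x..y + d} s *\<^sub>R D s)"
  have iD': "integrable lborel D'" unfolding D'_def by (rule borel_integrable_compact[OF compact_Icc Dc])
  hence [measurable]: "D' : borel_measurable lborel" by (rule borel_measurable_integrable)
  have DD: "D s * rh n s = D' s * rh n s" for n s using rhz[of s n] by (auto simp: D'_def indicator_def)
  have "(%n. \<integral>s. D' s * rh n s \<partial>lborel) \<longlonglongrightarrow> (LINT s|lborel. D' s * (if x < s & s <= y then 1 else 0))"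
  proof (rule integral_dominated_convergence[where w = "%s. abs (D' s)"])
   show "integrable lborel (%s. abs (D' s))" using iD' by simp
   show "AE s in lborel. (%n. D' s * rh n s) \<longlonglongrightarrow> D' s * (if x < s & s <= y then 1 else 0)"
    by (intro AE_I2 tendsto_mult tendsto_const rhl)
   show "AE s in lborel. norm (D' s * rh n s) <= abs (D' s)" for n
    using rhb[of n] by (auto simp: abs_mult mult_left_le)
  qed measurable
  moreover have "(LINT s|lborel. D' s * (if x < s & s <= y then 1 else 0)) = (LINT s:{x..y}|lborel. D s)"
   unfolding set_lebesgue_integral_def
  proof (rule integral_cong_AE)
   show "(%s. indicator {x..y} s *\<^sub>R D s) : borel_measurable lborel"
    using d by (intro borel_measurable_integrable borel_integrable_compact[OF compact_Icc] continuous_on_subset[OF Dc]) auto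
   show "AE s in lborel. D' s * (if x < s & s <= y then 1 else 0) = indicator {x..y} s *\<^sub>R D s"
    by (rule eventually_mono[OF AE_lborel_singleton[of x]]) (use d(1) in "auto simp: D'_def indicator_def")
  qed measurable
  moreover have "(LINT s:{x..y}|lborel. D s) = integral {x..y} D"
   by (rule set_borel_integral_eq_integral(2))
     (unfold set_integrable_def, use d in "intro borel_integrable_compact[OF compact_Icc] continuous_on_subset[OF Dc]", auto)
  ultimately have "(%n. \<integral>s. D s * rh n s \<partial>lborel) \<longlonglongrightarrow> integral {x..y} D" unfolding DD by simp
  thus "(LINT z|vol. (if x < F z & F z <= y then f z * g (F z) else 0)) = integral {x..y} (%s. g s * ((C - K s) / (A s * q s)))"
   unfolding eq[symmetric] D_def[symmetric] by (rule LIMSEQ_unique[OF lim1])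
 qed
qed

text \<open>The function \<open>G\<close> of the introduction.\<close>
definition cum :: "('a => real) => real => real" where
 "cum f s = (LINT x|vol. (if F x <= s then f x else 0))"

lemma F_vol [measurable]: "F : borel_measurable vol"
 unfolding measurable_vol by (rule F_meas)

lemma cont_vol: "continuous_on UNIV (f :: 'a => real) ==> f : borel_measurable vol"
 unfolding measurable_vol by (rule borel_measurable_continuous_onI)

lemma integrable_cut:
 assumes f: "continuous_on UNIV (f :: 'a => real)" and P: "Measurable.pred borel P"
 shows "integrable vol (%x. if P (F x) then f x else 0)"
proof -
 obtain C where C: "!!x. abs (f x) <= C" using cont_bounded[OF f] by blast
 have [measurable]: "f : borel_measurable borel" by (rule borel_measurable_continuous_onI[OF f])
 note P [measurable]
 show ?thesis
  by (rule integrable_bounded_vol[of _ "max C 0"]) (measurable, use C in "auto simp: le_max_iff_disj")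
qed

lemma cum_diff:
 assumes f: "continuous_on UNIV f" and "s <= t"
 shows "cum f t - cum f s = (LINT x|vol. (if s < F x & F x <= t then f x else 0))"
proof -
 have "cum f t - cum f s = (LINT x|vol. (if F x <= t then f x else 0) - (if F x <= s then f x else 0))"
  unfolding cum_def by (intro Bochner_Integration.integral_diff[symmetric] integrable_cut f) auto
 also have "... = (LINT x|vol. (if s < F x & F x <= t then f x else 0))"
  using assms(2) by (intro lebesgue_integral_cong refl) auto
 finally show ?thesis .
qed

definition tot :: "('a => real) => real" where "tot f = (LINT x|vol. f x)"

lemma cum_b: "cum f b = tot f" using F_range by (simp add: cum_def tot_def)

lemma integral_cut_bound:
 assumes f: "continuous_on UNIV (f :: 'a => real)" "!!x. abs (f x) <= C" and P: "Measurable.pred borel P"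
 shows "abs (LINT x|vol. (if P (F x) then f x else 0)) <= C * (LINT x|vol. (if P (F x) then 1 else 0))"
proof -
 have "abs (LINT x|vol. (if P (F x) then f x else 0)) <= (LINT x|vol. abs (if P (F x) then f x else 0))"
  by (rule integral_abs_bound)
 also have "... <= (LINT x|vol. C * (if P (F x) then 1 else 0))"
  by (rule integral_mono) (use f(2) integrable_cut[OF f(1) P] integrable_cut[OF continuous_on_const P, of 1] in auto)
 finally show ?thesis by simp
qed

lemma cum_bound:
 assumes f: "continuous_on UNIV f" "!!x. abs (f x) <= C" and st: "s <= t"
 shows "abs (cum f t - cum f s) <= C * (cum (%_. 1) t - cum (%_. 1) s)"
 unfolding cum_diff[OF f(1) st] cum_diff[OF continuous_on_const st]
 by (rule integral_cut_bound[OF f]) measurable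

lemma cum_lim:
 assumes f: "continuous_on UNIV f"
 shows "tendsto (cum f) (cum f a) (at_right a)"
  and "tendsto (cum f) (LINT x|vol. (if F x < b then f x else 0)) (at_left b)"
proof -
 obtain C where C: "!!x. abs (f x) <= C" using cont_bounded[OF f] by blast
 note [measurable] = cont_vol[OF f]
 have C0: "0 <= C" using C[of undefined] by linarith
 have dom: "(%n. cum f (S n)) \<longlonglongrightarrow> (LINT x|vol. (if P (F x) then f x else 0))"
  if P: "!!x. \<forall>\<^sub>F n in sequentially. (F x <= S n) = P (F x)" and Pm[measurable]: "Measurable.pred borel P" for S :: "nat => real" and P
  unfolding cum_def
 proof (rule integral_dominated_convergence[where w = "%_. C"])
  show "integrable vol (%_. C)" using finite_measure.integrable_const[OF finite_vol] .
  show "AE x in vol. (%n. if F x <= S n then f x else 0) \<longlonglongrightarrow> (if P (F x) then f x else 0)"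
   by (intro AE_I2 tendsto_eventually eventually_mono[OF P]) auto
  show "AE x in vol. norm (if F x <= S n then f x else 0) <= C" for n using C C0 by auto
 qed measurable
 show "tendsto (cum f) (cum f a) (at_right a)"
 proof (rule tendsto_at_right_sequentially[OF ab])
  fix S assume S: "!!n. a < S n" "S \<longlonglongrightarrow> a"
  show "(%n. cum f (S n)) \<longlonglongrightarrow> cum f a"
   unfolding cum_def[of f a]
  proof (rule dom)
   show "eventually (%n. (F x <= S n) = (F x <= a)) sequentially" for x
   proof (cases "F x <= a")
    case True
    hence "F x <= S n" for n using S(1)[of n] by linarith
    thus ?thesis using True by simp
   next
    case False
    hence "eventually (%n. S n < F x) sequentially" using order_tendstoD(2)[OF S(2)] by simp
    thus ?thesis by eventually_elim (use False in auto)
   qed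
  qed measurable
 qed
 show "tendsto (cum f) (LINT x|vol. (if F x < b then f x else 0)) (at_left b)"
 proof (rule tendsto_at_left_sequentially[OF ab])
  fix S assume S: "!!n. S n < b" "S \<longlonglongrightarrow> b"
  show "(%n. cum f (S n)) \<longlonglongrightarrow> (LINT x|vol. (if F x < b then f x else 0))"
  proof (rule dom)
   show "eventually (%n. (F x <= S n) = (F x < b)) sequentially" for x
   proof (cases "F x < b")
    case True
    hence "eventually (%n. F x < S n) sequentially" using order_tendstoD(1)[OF S(2)] by simp
    thus ?thesis by eventually_elim (use True in auto)
   next
    case False
    hence "~ F x <= S n" for n using S(1)[of n] by linarith
    thus ?thesis using False by simp
   qed
  qed measurable
 qed
qed

lemma cum_has_derivative:
 assumes f: "continuous_on UNIV f" and h: "continuous_on {a<..<b} h"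
  and eq: "!!x y. a < x ==> x <= y ==> y < b ==> (LINT z|vol. (if x < F z & F z <= y then f z else 0)) = integral {x..y} h"
  and s: "a < s" "s < b"
 shows "DERIV (cum f) s :> h s"
proof -
 define c d where "c = (a + s) / 2" and "d = (s + b) / 2"
 have cd: "a < c" "c < s" "s < d" "d < b" using s by (auto simp: c_def d_def)
 have "continuous_on {c..d} h" by (rule continuous_on_subset[OF h]) (use cd in auto)
 from integral_has_real_derivative[OF this, of s] cd
 have "((%y. cum f c + integral {c..y} h) has_real_derivative h s) (at s within {c..d})"
  by (auto intro!: derivative_eq_intros)
 hence "(cum f has_real_derivative h s) (at s within {c..d})"
 proof (rule has_field_derivative_transform_within[of _ _ _ _ 1])
  show "cum f c + integral {c..y} h = cum f y" if "y : {c..d}" for y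
   using cum_diff[OF f, of c y] eq[of c y] that cd by auto
 qed (use cd in auto)
 thus ?thesis using cd at_within_interior[of s "{c..d}"] by auto
qed

lemma weak_one:
 assumes "!!s. s : {a..b} ==> (eta has_real_derivative theta s) (at s within {a..b})"
  and "!!s. s : {a..b} ==> (theta has_real_derivative theta' s) (at s within {a..b})"
  and "continuous_on {a..b} theta'"
 shows "(LINT x|vol. (A (F x) * theta' (F x) - B (F x) * theta (F x))) = 0"
 using weak_test[of "%_. 1" 0 eta theta theta', OF C_fun_const _ assms] laplacian_const by simp

lemma test_function:
 assumes alpha: "a < alpha" "beta < b" and d: "!!s. DERIV zeta s :> k s" and k: "continuous_on UNIV k"
  and z: "!!s. s ~: {alpha..beta} ==> zeta s = 0" "!!s. s ~: {alpha..beta} ==> k s = 0"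
 shows "DERIV (%s. q s * zeta s) s :> q s * B s / A s * zeta s + q s * k s" (is ?d)
  and "continuous_on UNIV (%s. q s * zeta s)" (is ?c1)
  and "continuous_on UNIV (%s. q s * B s / A s * zeta s + q s * k s)" (is ?c2)
proof -
 show ?d
 proof (cases "s : {alpha..beta}")
  case True
  thus ?thesis using alpha by (auto intro!: derivative_eq_intros q d)
 next
  case False
  have "DERIV (%s. q s * zeta s) s :> 0"
  proof (rule DERIV_local[of "%_. 0" _ _ "- {alpha..beta}"])
   show "0 = q x * zeta x" if "x : - {alpha..beta}" for x using z(1)[of x] that by simp
  qed (use False in auto)
  thus ?thesis using z[OF False] by simp
 qed
 have zeta: "continuous_on S zeta" for S by (intro continuous_at_imp_continuous_on ballI DERIV_isCont[OF d])
 have k': "continuous_on S k" for S by (rule continuous_on_subset[OF k]) simp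
 have An: "ALL s:{a<..<b}. A s ~= 0" using A_pos by fastforce
 show ?c1 by (rule continuous_zero_outside[OF _ alpha]) (auto intro: continuous_on_mult q_cont zeta simp: z)
 show ?c2
  by (rule continuous_zero_outside[OF _ alpha])
    (auto intro!: continuous_on_add continuous_on_mult continuous_on_divide q_cont zeta k' A_cont_Ioo B_cont_Ioo An simp: z)
qed

lemma test_identity:
 assumes f: "C_fun (Suc (Suc 0)) f" "!!x. laplacian M f x = l * f x"
  and alpha: "a < alpha" "beta < b" and d: "!!s. DERIV zeta s :> k s" and k: "continuous_on UNIV k"
  and z: "!!s. s ~: {alpha..beta} ==> zeta s = 0" "!!s. s ~: {alpha..beta} ==> k s = 0"
  and eta: "!!s. DERIV eta s :> q s * zeta s"
 shows "(LINT x|vol. f x * (A (F x) * q (F x) * k (F x))) = - l * (LINT x|vol. f x * eta (F x))"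
proof -
 note t = test_function[OF alpha d k z]
 have "(LINT x|vol. f x * (A (F x) * q (F x) * k (F x))) =
   (LINT x|vol. f x * (A (F x) * (q (F x) * B (F x) / A (F x) * zeta (F x) + q (F x) * k (F x)) - B (F x) * (q (F x) * zeta (F x))))"
 proof (intro lebesgue_integral_cong refl arg_cong2[where f = "(*)"])
  fix x
  show "A (F x) * q (F x) * k (F x) = A (F x) * (q (F x) * B (F x) / A (F x) * zeta (F x) + q (F x) * k (F x)) - B (F x) * (q (F x) * zeta (F x))"
  proof (cases "F x : {alpha..beta}")
   case True
   hence "A (F x) ~= 0" using A_pos[of "F x"] alpha by auto
   thus ?thesis by (simp add: field_simps)
  next
   case False thus ?thesis using z by simp
  qed
 qed
 also have "... = - l * (LINT x|vol. f x * eta (F x))"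
  by (rule weak_test[OF f has_field_derivative_at_within[OF eta] has_field_derivative_at_within[OF t(1)]
     continuous_on_subset[OF t(3)]]) simp_all
 finally show ?thesis .
qed

text \<open>For \<open>f = 1\<close> the term \<open>K\<close> is zero, so the density of the image measure is a multiple of \<open>1 / (A q)\<close>.\<close>
definition "C1 = (SOME C. ALL g x y. continuous_on {a..b} g --> a < x --> x <= y --> y < b -->
  (LINT z|vol. (if x < F z & F z <= y then g (F z) else 0)) = integral {x..y} (%s. g s * (C / (A s * q s))))"

definition v where "v s = C1 / (A s * q s)"

lemma density:
 assumes "continuous_on {a..b} u" "a < x" "x <= y" "y < b"
 shows "(LINT z|vol. (if x < F z & F z <= y then u (F z) else 0)) = integral {x..y} (%s. u s * v s)"
proof -
 have tt: "(LINT x|vol. 1 * (A (F x) * q (F x) * k (F x))) = - (LINT s|lborel. 0 * k s)"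
  if t: "a < alpha" "beta < b" "!!s. DERIV zeta s :> k s" "continuous_on UNIV k"
   "!!s. s ~: {alpha..beta} ==> zeta s = 0" "!!s. s ~: {alpha..beta} ==> k s = 0" for zeta k alpha beta
 proof -
  obtain eta where "!!s. DERIV eta s :> q s * zeta s"
   using antiderivative_UNIV[OF test_function(2)[OF t]] by blast
  from test_identity[OF C_fun_const[of _ 1] _ t this, of 0] laplacian_const show ?thesis by simp
 qed
 have "EX C. ALL g x y. continuous_on {a..b} g --> a < x --> x <= y --> y < b -->
  (LINT z|vol. (if x < F z & F z <= y then 1 * g (F z) else 0)) = integral {x..y} (%s. g s * ((C - 0) / (A s * q s)))"
  by (rule density_of_test[of "%_. 1" "%_. 0"], simp, simp, rule tt; assumption)
 hence "EX C. ALL g x y. continuous_on {a..b} g --> a < x --> x <= y --> y < b -->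
  (LINT z|vol. (if x < F z & F z <= y then g (F z) else 0)) = integral {x..y} (%s. g s * (C / (A s * q s)))"
  by (simp cong: if_cong)
 from someI_ex[OF this] assms show ?thesis unfolding C1_def[symmetric] v_def by blast
qed

lemma v_cont: "continuous_on {a<..<b} v"
 unfolding v_def by (intro continuous_on_divide continuous_on_mult continuous_on_const A_cont_Ioo q_cont) (use A_pos q(1) in fastforce)

lemma cum_F_deriv:
 assumes u: "continuous_on {a..b} u" and s: "a < s" "s < b"
 shows "DERIV (cum (%x. u (F x))) s :> u s * v s"
 by (rule cum_has_derivative[OF F_comp_cont[OF u] continuous_on_mult[OF continuous_on_subset[OF u] v_cont] density[OF u] s]) auto

definition "V = cum (%_. 1)"

lemma V_deriv: "a < s ==> s < b ==> DERIV V s :> v s"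
 using cum_F_deriv[of "%_. 1" s] by (simp add: V_def)

lemma V_strict_Ioo: assumes "a < s" "s < t" "t < b" shows "V s < V t"
proof -
 have "open (F -` {s<..<t})" using F_cont by (simp add: open_vimage)
 moreover obtain x where "F x = (s + t) / 2" using F_surj[of "(s + t) / 2"] assms by auto
 hence "x : F -` {s<..<t}" using assms by auto
 ultimately have "emeasure vol (F -` {s<..<t}) > 0" by (rule open_vol_pos)
 moreover have m: "F -` {s<..<t} : sets vol" using \<open>open (F -` {s<..<t})\<close> by simp
 ultimately have "measure vol (F -` {s<..<t}) > 0"
  using finite_measure.emeasure_eq_measure[OF finite_vol] by simp
 also have "measure vol (F -` {s<..<t}) <= (LINT x|vol. (if s < F x & F x <= t then 1 else 0))"
 proof -
  have "measure vol (F -` {s<..<t}) = (LINT x|vol. indicator (F -` {s<..<t}) x)" by simp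
  also have "... <= (LINT x|vol. (if s < F x & F x <= t then 1 else 0))"
   by (rule integral_mono)
     (use integrable_cut[OF continuous_on_const, of "%r. s < r & r <= t" 1]
      integrable_cut[OF continuous_on_const, of "%r. s < r & r < t" 1] in
      "auto simp: indicator_def of_bool_def")
  finally show ?thesis .
 qed
 also have "... = V t - V s" unfolding V_def using cum_diff[of "%_. 1" s t] assms by simp
 finally show ?thesis by simp
qed

lemma C1_pos: "0 < C1"
proof (rule ccontr)
 assume "~ 0 < C1"
 hence le: "v x <= 0" if "a < x" "x < b" for x
  using A_pos[OF that] q(1)[OF that] by (simp add: v_def divide_nonpos_pos)
 define s t where "s = (2 * a + b) / 3" and "t = (a + 2 * b) / 3"
 have st: "a < s" "s < t" "t < b" using ab by (auto simp: s_def t_def field_simps)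
 have "V t <= V s"
 proof (rule DERIV_nonpos_imp_nonincreasing[where f = V])
  show "EX y. DERIV V x :> y & y <= 0" if "s <= x" "x <= t" for x
   using V_deriv[of x] le[of x] that st by (intro exI[of _ "v x"]) auto
 qed (use st in simp)
 thus False using V_strict_Ioo[OF st] by simp
qed

definition p where "p s = C1 / q s"

lemma p_eq: "a < s ==> s < b ==> p s = A s * v s"
 using A_pos[of s] by (simp add: p_def v_def)

lemma v_pos: "a < s ==> s < b ==> 0 < v s" and p_pos: "a < s ==> s < b ==> 0 < p s"
 using A_pos[of s] q(1)[of s] C1_pos by (auto simp: v_def p_def)

lemma p_deriv: assumes s: "a < s" "s < b" shows "DERIV p s :> - B s * v s"
proof -
 have "DERIV (%s. C1 / q s) s :> - B s * v s"
  using A_pos[OF s] q(1)[OF s]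
  by (auto intro!: derivative_eq_intros q(2)[OF s] simp: v_def field_simps power2_eq_square)
 thus ?thesis unfolding p_def .
qed

lemma constant_Ioo:
 assumes "!!s. a < s ==> s < b ==> DERIV h s :> 0"
 shows "EX c. ALL s. a < s --> s < b --> h s = (c :: real)"
proof -
 have "h constant_on {a<..<b}"
  by (rule has_field_derivative_0_imp_constant_on[OF _ convex_connected]) (use assms in auto)
 thus ?thesis by (auto simp: constant_on_def)
qed

lemma tendsto_Ioo_right: "tendsto h c (at_right a) ==> (!!s. a < s ==> s < b ==> h s = h' s) ==> tendsto h' c (at_right a)"
 by (erule Lim_transform_eventually, rule eventually_mono[OF eventually_inside_right[OF ab]]) auto

lemma tendsto_Ioo_left: "tendsto h c (at_left b) ==> (!!s. a < s ==> s < b ==> h s = h' s) ==> tendsto h' c (at_left b)"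
 by (erule Lim_transform_eventually, rule eventually_mono[OF eventually_inside_left[OF ab]]) auto

lemma V_abs: "abs (V s) <= tot (%_. 1)"
proof -
 have "V s <= tot (%_. 1)" unfolding V_def cum_def tot_def
  by (rule integral_mono) (use integrable_cut[OF continuous_on_const, of "%r. r <= s" 1] integrable_cont[OF continuous_on_const, of 1] in auto)
 moreover have "0 <= V s" unfolding V_def cum_def by (rule integral_nonneg_AE) simp
 ultimately show ?thesis by simp
qed

text \<open>The derivative \<open>- B v\<close> of \<open>p\<close> is integrable, so \<open>p\<close> has limits at the ends. A positive limit would make \<open>v = p / A\<close> at least a multiple of \<open>1 / (s - a)\<close>, contrary to finite volume.\<close>
lemma p_lim: "tendsto p 0 (at_right a)" "tendsto p 0 (at_left b)"
proof -
 have "DERIV (%s. p s + cum (%x. B (F x)) s) s :> 0" if "a < s" "s < b" for s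
  using DERIV_add[OF p_deriv[OF that] cum_F_deriv[OF B_cont that]] by simp
 from constant_Ioo[OF this] obtain c where c: "!!s. a < s ==> s < b ==> c - cum (%x. B (F x)) s = p s"
  by (auto simp: algebra_simps)
 note BF = F_comp_cont[OF B_cont]
 define ca where "ca = c - cum (%x. B (F x)) a"
 define cb where "cb = c - (LINT x|vol. (if F x < b then B (F x) else 0))"
 have la: "tendsto p ca (at_right a)" unfolding ca_def
  by (rule tendsto_Ioo_right[OF _ c]) (auto intro!: tendsto_intros cum_lim BF)
 have lb: "tendsto p cb (at_left b)" unfolding cb_def
  by (rule tendsto_Ioo_left[OF _ c]) (auto intro!: tendsto_intros cum_lim BF)
 have ca: "0 <= ca"
  by (rule tendsto_lowerbound[OF la eventually_mono[OF eventually_inside_right[OF ab]]]) (use p_pos in "auto intro: less_imp_le")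
 have cb: "0 <= cb"
  by (rule tendsto_lowerbound[OF lb eventually_mono[OF eventually_inside_left[OF ab]]]) (use p_pos in "auto intro: less_imp_le")
 obtain L where L: "L > 0" "ALL s:{a..b}. A s <= L * (s - a) & A s <= L * (b - s)" using A_lipschitz by blast
 have blow: "~ 0 < c" if lim: "tendsto P c (at_right l)" and lr: "l < r"
  and W: "!!s. l < s ==> s < r ==> DERIV W s :> P s / R s & 0 < R s & R s <= L * (s - l) & abs (W s) <= tot (%_. 1)"
  for c l r and P R W :: "real => real"
 proof
  assume c: "0 < c"
  hence "eventually (%s. c / 2 < P s) (at_right l)" using order_tendstoD(1)[OF lim, of "c / 2"] by simp
  then obtain m where m: "l < m" "!!s. l < s ==> s < m ==> c / 2 < P s"
   unfolding eventually_at_right[OF lr] by blast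
  show False
  proof (rule log_blowup[of l "min m r" W "%s. P s / R s" "c / (2 * L)"])
   fix s assume s: "l < s" "s < min m r"
   have "c / 2 / (L * (s - l)) <= P s / R s" using m(2)[of s] W[of s] s c by (intro frac_le) auto
   thus "c / (2 * L) / (s - l) <= P s / R s" by (simp add: mult_ac)
  qed (use m lr W c L in auto)
 qed
 have "~ 0 < ca" by (rule blow[of p ca a b V A, OF la ab]) (use V_deriv p_eq A_pos L V_abs in force)
 moreover have "~ 0 < cb"
 proof (rule blow[of "%s. p (- s)" cb "- b" "- a" "%s. - V (- s)" "%s. A (- s)"])
  fix s assume "- b < s" "s < - a"
  hence r: "a < - s" "- s < b" by auto
  have "DERIV (%s. - V (- s)) s :> v (- s)"
   using V_deriv[OF r] by (auto intro!: derivative_eq_intros DERIV_chain2[where g = uminus])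
  thus "DERIV (%s. - V (- s)) s :> p (- s) / A (- s) & 0 < A (- s) & A (- s) <= L * (s - - b) & abs (- V (- s)) <= tot (%_. 1)"
   using p_eq[OF r] A_pos[OF r] bspec[OF L(2), of "- s"] r V_abs[of "- s"] by (simp add: add.commute)
 qed (use lb ab in "auto simp: filterlim_at_left_to_right")
 ultimately have "ca = 0" "cb = 0" using ca cb by auto
 thus "tendsto p 0 (at_right a)" "tendsto p 0 (at_left b)" using la lb by auto
qed

end

section \<open>The equation for integrals over sublevel sets\<close>

lemma C_seg_lipschitz:
 assumes "C_seg (Suc 0) a b h"
 shows "EX L>=0. ALL s:{a..b}. ALL t:{a..b}. abs (h s - h t) <= L * abs (s - t)"
proof -
 obtain h' where h': "!!x. x : {a..b} ==> (h has_real_derivative h' x) (at x within {a..b})" "continuous_on {a..b} h'"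
  using assms unfolding C_seg.simps by blast
 obtain L where L: "!!s. s : {a..b} ==> abs (h' s) <= L" using bounded_by[OF h'(2)] by meson
 have "abs (h s - h t) <= max L 0 * abs (s - t)" if "s : {a..b}" "t : {a..b}" for s t
  using field_differentiable_bound[OF convex_real_interval(5)[of a b] h'(1), of "max L 0" s t] L that
  by (force simp: le_max_iff_disj)
 thus ?thesis by (intro exI[of _ "max L 0"]) auto
qed

context isoparametric_mfd begin

text \<open>If \<open>B a \<ge> 0\<close>, then \<open>- B \<le> C A\<close>, so \<open>p' = - B v \<le> C p\<close> and \<open>p\<close> could not tend to \<open>0\<close> at \<open>a\<close> while being positive.\<close>
lemma B_a: "B a < 0"
proof (rule ccontr)
 assume n: "~ B a < 0"
 obtain L where L: "L >= 0" "!!s. s : {a..b} ==> abs (B s - B a) <= L * abs (s - a)"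
  using C_seg_lipschitz[OF B] ab by force
 obtain c where c: "c > 0" "!!s. s : {a..b} ==> c * ((s - a) * (b - s)) <= A s" using A_lower by blast
 define m where "m = (a + b) / 2"
 have m: "a < m" "m < b" using ab by (auto simp: m_def)
 show False
 proof (rule no_decay_to_zero[OF m(1) p_deriv _ p_pos p_lim(1)])
  fix s assume s: "a < s" "s < m"
  have sb: "s < b" "s : {a..b}" using s m by auto
  have "- B s <= L * (s - a)" using L(2)[OF sb(2)] n s by auto
  also have "... <= L / (c * (b - m)) * A s"
  proof -
   have "c * ((s - a) * (b - m)) <= c * ((s - a) * (b - s))" using s m c by (intro mult_left_mono) auto
   hence "c * (b - m) * (s - a) <= A s" using c(2)[OF sb(2)] by (simp add: mult_ac)
   hence "L * (c * (b - m) * (s - a)) <= L * A s" using L(1) by (rule mult_left_mono)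
   thus ?thesis using c(1) m by (simp add: field_simps)
  qed
  finally have "- B s * v s <= L / (c * (b - m)) * A s * v s"
   using v_pos[OF s(1) sb(1)] by (intro mult_right_mono) auto
  thus "- B s * v s <= L / (c * (b - m)) * p s" using p_eq[OF s(1) sb(1)] by (simp add: mult.assoc)
 qed (use m in auto)
qed

lemma B_b: "0 < B b"
proof -
 interpret neg: isoparametric_mfd M "%x. - F x" "- b" "- a" "%s. A (- s)" "%s. (- 1) * B (- s)"
  by (rule isoparametric_neg)
 show ?thesis using neg.B_a by simp
qed

text \<open>The Laplacian of \<open>(F - e)\<^sup>2 / 2\<close> is \<open>- u o F\<close>. Its integral over \<open>M\<close> is zero, and over the complement of the two extremal levels too, because \<open>cum (u o F) - p * (s - e)\<close> is constant.\<close>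
lemma moment:
 fixes e :: real
 defines "u == %s. A s - B s * (s - e)"
 shows "cum (%x. u (F x)) a = (LINT x|vol. (if F x < b then u (F x) else 0))" "tot (%x. u (F x)) = 0"
proof -
 have u: "continuous_on {a..b} u" unfolding u_def by (intro continuous_intros A_cont B_cont)
 note uF = F_comp_cont[OF u]
 have "DERIV (%s. cum (%x. u (F x)) s - p s * (s - e)) s :> 0" if s: "a < s" "s < b" for s
 proof -
  have "DERIV (%s. cum (%x. u (F x)) s - p s * (s - e)) s :> u s * v s - (p s * 1 + - B s * v s * (s - e))"
   by (auto intro!: derivative_eq_intros cum_F_deriv[OF u s] p_deriv[OF s])
  moreover have "u s * v s - (p s * 1 + - B s * v s * (s - e)) = 0"
   using p_eq[OF s] by (simp add: u_def algebra_simps)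
  ultimately show ?thesis by simp
 qed
 from constant_Ioo[OF this] obtain c where c: "!!s. a < s ==> s < b ==> cum (%x. u (F x)) s - p s * (s - e) = c" by blast
 have "tendsto (%s. cum (%x. u (F x)) s - p s * (s - e)) (cum (%x. u (F x)) a - 0 * (a - e)) (at_right a)"
  by (intro tendsto_intros cum_lim uF p_lim)
 from tendsto_Ioo_right[OF this c] have 1: "cum (%x. u (F x)) a = c" by (simp add: tendsto_const_iff)
 have "tendsto (%s. cum (%x. u (F x)) s - p s * (s - e)) ((LINT x|vol. (if F x < b then u (F x) else 0)) - 0 * (b - e)) (at_left b)"
  by (intro tendsto_intros cum_lim uF p_lim)
 from tendsto_Ioo_left[OF this c] have 2: "(LINT x|vol. (if F x < b then u (F x) else 0)) = c" by (simp add: tendsto_const_iff)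
 show "cum (%x. u (F x)) a = (LINT x|vol. (if F x < b then u (F x) else 0))" using 1 2 by simp
 show "tot (%x. u (F x)) = 0"
 proof -
  have "(LINT x|vol. (A (F x) * 1 - B (F x) * (F x - e))) = 0"
   by (rule weak_one[of "%s. (s - e)^2 / 2" "%s. s - e" "%_. 1"]) (auto intro!: derivative_eq_intros)
  thus ?thesis by (simp add: tot_def u_def)
 qed
qed

lemma cum_F_a: "cum (%x. u (F x)) a = u a * V a"
proof -
 have "(if F x <= a then u (F x) else 0) = u a * (if F x <= a then 1 else 0)" for x
  using F_range(2)[of x] by (cases "F x = a") auto
 thus ?thesis by (simp add: cum_def V_def)
qed

definition "V_left = (LINT x|vol. (if F x < b then 1 else 0))"

lemma integral_left:
 assumes u: "continuous_on {a..b} u"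
 shows "(LINT x|vol. (if F x < b then u (F x) else 0)) = tot (%x. u (F x)) - u b * (V b - V_left)"
proof -
 have i: "integrable vol (%x. if F x < b then 1 else 0 :: real)"
  using integrable_cut[OF continuous_on_const, of "%r. r < b" 1] by simp
 have j: "integrable vol (%x. u (F x))" by (rule integrable_cont[OF F_comp_cont[OF u]])
 have k: "integrable vol (%x. 1 :: real)" using finite_measure.integrable_const[OF finite_vol] .
 have "(if F x < b then u (F x) else 0) = u (F x) - u b * (1 - (if F x < b then 1 else 0))" for x
  using F_range(3)[of x] by (cases "F x = b") auto
 hence "(LINT x|vol. (if F x < b then u (F x) else 0)) = (LINT x|vol. u (F x) - u b * (1 - (if F x < b then 1 else 0)))"
  by simp
 also have "... = tot (%x. u (F x)) - u b * (V b - V_left)"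
  unfolding V_def cum_b tot_def V_left_def
  using i j k by (simp del: lebesgue_integral_const integral_const)
 finally show ?thesis .
qed

text \<open>Taking for \<open>e\<close> one end in \<open>moment\<close> isolates the mass of the other end, with the nonzero coefficient \<open>B a\<close> or \<open>B b\<close>.\<close>
lemma no_mass: "V a = 0" "V_left = V b"
proof -
 have u: "continuous_on {a..b} (%s. A s - B s * (s - e))" for e by (intro continuous_intros A_cont B_cont)
 have m: "(A a - B a * (a - e)) * V a = - ((A b - B b * (b - e)) * (V b - V_left))" for e
  using moment[of e] integral_left[OF u, of e] cum_F_a[of "%s. A s - B s * (s - e)"] by simp
 show "V a = 0" using m[of b] A_ends B_a ab by simp
 show "V_left = V b" using m[of a] A_ends B_b ab by simp
qed

lemma V_cont: "continuous_on {a..b} V"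
proof (rule continuous_on_IccI[OF _ _ _ ab])
 show "tendsto V (V a) (at_right a)" unfolding V_def by (rule cum_lim) simp
 have "tendsto V V_left (at_left b)" unfolding V_left_def V_def by (rule cum_lim) simp
 thus "tendsto V (V b) (at_left b)" by (simp add: no_mass)
 show "tendsto V (V x) (at x)" if "a < x" "x < b" for x
  using DERIV_isCont[OF V_deriv[OF that]] by (simp add: isCont_def)
qed

sublocale sl: sturm_liouville a b B p v V
 by unfold_locales (use ab no_mass V_cont V_deriv v_cont v_pos p_pos p_deriv B_cont B_a B_b p_lim in auto)

lemma cum_a: assumes f: "continuous_on UNIV f" shows "cum f a = 0"
proof -
 obtain C where C: "!!x. abs (f x) <= C" using cont_bounded[OF f] by blast
 have "abs (cum f a) <= C * V a" unfolding cum_def V_def by (rule integral_cut_bound[OF f C]) measurable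
 thus ?thesis using no_mass(1) by simp
qed

lemma cum_cont: assumes f: "continuous_on UNIV f" shows "continuous_on {a..b} (cum f)"
 unfolding continuous_on
proof
 fix x assume x: "x : {a..b}"
 obtain C where C: "!!x. abs (f x) <= C" using cont_bounded[OF f] by blast
 have le: "norm (cum f t - cum f x) <= C * abs (V t - V x)" for t
 proof (cases "x <= t")
  case True
  hence "V x <= V t" "abs (cum f t - cum f x) <= C * (V t - V x)"
   using cum_bound[OF f C True] cum_bound[OF continuous_on_const[of UNIV "1::real"] _ True, of 1] by (auto simp: V_def)
  thus ?thesis by simp
 next
  case False
  hence "V t <= V x" "abs (cum f x - cum f t) <= C * (V x - V t)"
   using cum_bound[OF f C, of t x] cum_bound[OF continuous_on_const[of UNIV "1::real"], of 1 t x] by (auto simp: V_def)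
  thus ?thesis by (simp add: abs_minus_commute)
 qed
 have "tendsto (%t. C * abs (V t - V x)) (C * abs (V x - V x)) (at x within {a..b})"
  using V_cont x by (intro tendsto_intros) (auto simp: continuous_on)
 hence "tendsto (%t. cum f t - cum f x) 0 (at x within {a..b})"
  by (intro Lim_null_comparison[OF always_eventually[OF allI[OF le]]]) simp
 thus "tendsto (cum f) (cum f x) (at x within {a..b})" by (rule LIM_zero_cancel)
qed

text \<open>Integration by parts for the image measure, by Fubini's theorem on the region \<open>s \<le> F x\<close>.\<close>
lemma cum_fubini:
 assumes f: "continuous_on UNIV f" and theta: "continuous_on UNIV theta" and z: "!!s. s ~: {alpha..beta} ==> theta s = 0" and alpha: "a < alpha"
  and eta: "!!s. DERIV eta s :> theta s"
 shows "(LINT x|vol. f x * (eta (F x) - eta a)) = (LINT s|lborel. theta s * (tot f - cum f s))"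
proof -
 interpret vol: finite_measure vol by (rule finite_vol)
 interpret pair_sigma_finite lborel vol ..
 define phi where "phi = (%s x. if a <= s & s < F x then theta s * f x else 0)"
 have [measurable]: "f : borel_measurable vol" by (rule cont_vol[OF f])
 have [measurable]: "theta : borel_measurable borel" by (rule borel_measurable_continuous_onI[OF theta])
 obtain C where C: "!!x. abs (f x) <= C" using cont_bounded[OF f] by blast
 obtain T where T: "!!s. s : {alpha..beta} ==> abs (theta s) <= T"
  using bounded_by[OF continuous_on_subset[OF theta subset_UNIV]] by meson
 have "integrable (lborel \<Otimes>\<^sub>M vol) (case_prod phi)"
 proof (rule integrableI_bounded_set[of "{alpha..beta} \<times> UNIV" _ _ "T * C"])
  show "{alpha..beta} \<times> UNIV : sets (lborel \<Otimes>\<^sub>M vol)"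
   using pair_measureI[of "{alpha..beta}" lborel UNIV vol] by simp
  show "case_prod phi : borel_measurable (lborel \<Otimes>\<^sub>M vol)" unfolding phi_def by measurable
  have "emeasure (lborel \<Otimes>\<^sub>M vol) ({alpha..beta} \<times> UNIV) = emeasure lborel {alpha..beta} * emeasure vol UNIV"
   by (rule vol.emeasure_pair_measure_Times) auto
  also have "... < \<infinity>"
  proof -
   have "emeasure vol UNIV < \<infinity>" "emeasure lborel {alpha..beta} < \<infinity>"
    using vol.emeasure_finite[of UNIV] by (auto simp: less_top[symmetric] emeasure_lborel_Icc_eq)
   thus ?thesis by (simp add: ennreal_mult_less_top)
  qed
  finally show "emeasure (lborel \<Otimes>\<^sub>M vol) ({alpha..beta} \<times> UNIV) < \<infinity>" .
  have "norm (phi s x) <= T * C" if "s : {alpha..beta}" for s x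
  proof -
   have "abs (theta s) * abs (f x) <= T * C" using T[OF that] C[of x] by (intro mult_mono) auto
   moreover from this have "0 <= T * C" by (rule order_trans[rotated]) simp
   ultimately show ?thesis unfolding phi_def by (auto simp: abs_mult)
  qed
  thus "AE x in lborel \<Otimes>\<^sub>M vol. x : {alpha..beta} \<times> UNIV --> norm (case_prod phi x) <= T * C" by auto
  show "AE x in lborel \<Otimes>\<^sub>M vol. x ~: {alpha..beta} \<times> UNIV --> case_prod phi x = 0"
  proof (rule AE_I2)
   fix y :: "real \<times> 'a"
   have "phi (fst y) (snd y) = 0" if "fst y ~: {alpha..beta}" using z[OF that] by (simp add: phi_def)
   thus "y ~: {alpha..beta} \<times> UNIV --> case_prod phi y = 0" by (cases y) simp
  qed
 qed
 from Fubini_integral[OF this] have eq: "(LINT x|vol. (LINT s|lborel. phi s x)) = (LINT s|lborel. (LINT x|vol. phi s x))" .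
 have 1: "(LINT s|lborel. phi s x) = f x * (eta (F x) - eta a)" for x
 proof -
  have "(LINT s|lborel. phi s x) = (LINT s|lborel. (if a <= s & s <= F x then theta s else 0) * f x)"
  proof (rule integral_cong_AE)
   show "AE s in lborel. phi s x = (if a <= s & s <= F x then theta s else 0) * f x"
    by (rule eventually_mono[OF AE_lborel_singleton[of "F x"]]) (auto simp: phi_def)
  qed (unfold phi_def, measurable)
  also have "... = (eta (F x) - eta a) * f x"
   unfolding integral_mult_left_zero integral_derivative_Icc[OF eta theta F_range(2)] ..
  finally show ?thesis by (simp add: mult.commute)
 qed
 have 2: "(LINT x|vol. phi s x) = theta s * (tot f - cum f s)" for s
 proof (cases "a <= s")
  case True
  have "(LINT x|vol. phi s x) = (LINT x|vol. theta s * (f x - (if F x <= s then f x else 0)))"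
   using True by (intro lebesgue_integral_cong refl) (auto simp: phi_def)
  also have "... = theta s * (tot f - cum f s)"
   using integrable_cont[OF f] integrable_cut[OF f, of "%r. r <= s"] by (simp add: tot_def cum_def)
  finally show ?thesis .
 next
  case False
  hence "theta s = 0" using z[of s] alpha by simp
  thus ?thesis by (simp add: phi_def cong: if_cong)
 qed
 show ?thesis using eq unfolding 1 2 .
qed

text \<open>With \<open>K' = q * cum f\<close>, the test identity for \<open>f\<close> becomes the hypothesis of \<open>density_of_test\<close> for \<open>l * K\<close>. The resulting density is \<open>phi * v\<close> with \<open>phi = (C - l K) / C1\<close>, and \<open>phi' = - l * cum f * q / C1\<close> is the second equation.\<close>
theorem eigen_system:
 assumes f: "C_fun (Suc (Suc 0)) f" "!!x. laplacian M f x = l * f x"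
 shows "EX phi. sl.sol l phi (cum f)"
proof -
 have fc: "continuous_on UNIV f" by (rule C_fun_cont[OF f(1)])
 have ltot: "l * tot f = 0"
  using green_sym[OF C_fun_const[of _ 1] f(1)] f(2) laplacian_const by (simp add: tot_def)
 have cumI: "continuous_on {a<..<b} (cum f)" by (rule continuous_on_subset[OF cum_cont[OF fc]]) auto
 obtain K where K: "!!s. a < s ==> s < b ==> DERIV K s :> q s * cum f s"
  using antiderivative_Ioo[OF ab continuous_on_mult[OF q_cont cumI]] by blast
 have Kc: "continuous_on {a<..<b} K"
  using DERIV_isCont[OF K] by (auto intro!: continuous_at_imp_continuous_on)
 have test: "(LINT x|vol. f x * (A (F x) * q (F x) * k (F x))) = - (LINT s|lborel. (l * K s) * k s)"
  if t: "a < alpha" "beta < b" "!!s. DERIV zeta s :> k s" "continuous_on UNIV k"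
   "!!s. s ~: {alpha..beta} ==> zeta s = 0" "!!s. s ~: {alpha..beta} ==> k s = 0" for zeta k alpha beta
 proof -
  define theta where "theta = (%s. q s * zeta s)"
  have thetac: "continuous_on UNIV theta" and thetaz: "!!s. s ~: {alpha..beta} ==> theta s = 0"
   using test_function(2)[OF t] t(5) by (auto simp: theta_def)
  obtain eta where eta: "!!s. DERIV eta s :> theta s" using antiderivative_UNIV[OF thetac] by blast
  have etac: "continuous_on {a..b} eta" by (intro continuous_at_imp_continuous_on ballI DERIV_isCont[OF eta])
  have thetacum: "continuous_on UNIV (%s. theta s * cum f s)"
   by (rule continuous_zero_outside[OF continuous_on_mult[OF continuous_on_subset[OF thetac] cumI] t(1,2)]) (auto simp: thetaz)
  have i1: "integrable lborel theta" by (rule integrable_zero_outside[OF thetac thetaz])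
  have i2: "integrable lborel (%s. theta s * cum f s)" by (rule integrable_zero_outside[OF thetacum, of alpha beta]) (simp add: thetaz)
  have Kk: "continuous_on UNIV (%s. K s * k s)"
   by (rule continuous_zero_outside[OF continuous_on_mult[OF Kc continuous_on_subset[OF t(4)]] t(1,2)]) (auto simp: t(6))
  have i3: "integrable lborel (%s. K s * k s)" by (rule integrable_zero_outside[OF Kk, of alpha beta]) (simp add: t(6))
  have dK: "DERIV (%s. K s * zeta s) s :> theta s * cum f s + K s * k s" for s
  proof (cases "s : {alpha..beta}")
   case True
   thus ?thesis using t(1,2) unfolding theta_def by (auto intro!: derivative_eq_intros K t(3) simp: mult_ac)
  next
   case False
   have "DERIV (%s. K s * zeta s) s :> 0"
   proof (rule DERIV_local[of "%_. 0" _ _ "- {alpha..beta}"])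
    show "0 = K x * zeta x" if "x : - {alpha..beta}" for x using t(5)[of x] that by simp
   qed (use False in auto)
   thus ?thesis using thetaz[OF False] t(6)[OF False] by simp
  qed
  have "(LINT s|lborel. theta s * cum f s + K s * k s) = K (max b (beta + 1)) * zeta (max b (beta + 1)) - K (min a (alpha - 1)) * zeta (min a (alpha - 1))"
   by (rule integral_derivative_zero_outside[OF dK continuous_on_add[OF thetacum Kk], of alpha beta]) (use ab in "auto simp: thetaz t(6)")
  also have "... = 0" using t(5)[of "max b (beta + 1)"] t(5)[of "min a (alpha - 1)"] by auto
  finally have ibp: "(LINT s|lborel. theta s * cum f s) = - (LINT s|lborel. K s * k s)" using i2 i3 by simp
  have fub: "(LINT x|vol. f x * (eta (F x) - eta a)) = tot f * (LINT s|lborel. theta s) - (LINT s|lborel. theta s * cum f s)"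
  proof -
   have "(LINT s|lborel. theta s * (tot f - cum f s)) = (LINT s|lborel. tot f * theta s - theta s * cum f s)"
    by (intro lebesgue_integral_cong refl) (simp add: algebra_simps)
   moreover have "(LINT x|vol. f x * (eta (F x) - eta a)) = (LINT s|lborel. theta s * (tot f - cum f s))"
    by (rule cum_fubini[OF fc thetac thetaz t(1) eta])
   ultimately show ?thesis using i1 i2 by simp
  qed
  have sp: "(LINT x|vol. f x * (eta (F x) - eta a)) = (LINT x|vol. f x * eta (F x)) - tot f * eta a"
   using integrable_cont[OF fc] integrable_cont[OF continuous_on_mult[OF fc F_comp_cont[OF etac]]]
   by (simp add: right_diff_distrib tot_def)
  have "(LINT x|vol. f x * (A (F x) * q (F x) * k (F x))) = - l * (LINT x|vol. f x * eta (F x))"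
   by (rule test_identity[OF f t eta[unfolded theta_def]])
  also have "... = - ((l * tot f) * (eta a + (LINT s|lborel. theta s))) + l * (LINT s|lborel. theta s * cum f s)"
  proof -
   have X: "(LINT x|vol. f x * eta (F x)) = tot f * eta a + tot f * (LINT s|lborel. theta s) - (LINT s|lborel. theta s * cum f s)"
    using fub sp by linarith
   show ?thesis unfolding X by (simp add: algebra_simps)
  qed
  also have "... = - (LINT s|lborel. (l * K s) * k s)" unfolding ltot ibp by (simp add: mult.assoc)
  finally show ?thesis .
 qed
 have "EX C. ALL g x y. continuous_on {a..b} g --> a < x --> x <= y --> y < b -->
  (LINT z|vol. (if x < F z & F z <= y then f z * g (F z) else 0)) = integral {x..y} (%s. g s * ((C - l * K s) / (A s * q s)))"
  by (rule density_of_test[OF fc continuous_on_mult[OF continuous_on_const Kc]], rule test; assumption)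
 then obtain C where C: "!!x y. a < x ==> x <= y ==> y < b ==>
  (LINT z|vol. (if x < F z & F z <= y then f z * 1 else 0)) = integral {x..y} (%s. 1 * ((C - l * K s) / (A s * q s)))"
  using continuous_on_const[of "{a..b}" "1::real"] by meson
 define phi where "phi s = (C - l * K s) / C1" for s
 have dens_eq: "(C - l * K s) / (A s * q s) = phi s * v s" for s
  using C1_pos by (simp add: phi_def v_def)
 have phic: "continuous_on {a<..<b} phi" unfolding phi_def using C1_pos by (intro continuous_intros Kc) auto
 have G: "DERIV (cum f) s :> phi s * v s" if s: "a < s" "s < b" for s
  by (rule cum_has_derivative[OF fc continuous_on_mult[OF phic v_cont] _ s])
    (use C in "simp add: dens_eq cong: if_cong")
 have phi': "DERIV phi s :> - (l * cum f s / p s)" if s: "a < s" "s < b" for s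
 proof -
  have "DERIV phi s :> (0 - l * (q s * cum f s)) / C1"
   unfolding phi_def by (intro DERIV_cdivide DERIV_diff DERIV_const DERIV_cmult K s)
  moreover have "(0 - l * (q s * cum f s)) / C1 = - (l * cum f s / p s)" by (simp add: p_def mult_ac)
  ultimately show ?thesis by simp
 qed
 obtain N where N: "!!x. abs (f x) <= N" using cont_bounded[OF fc] by blast
 have bd: "abs (phi s) <= N" if s: "a < s" "s < b" for s
 proof -
  have "0 <= N * v s + c * (phi s * v s)" if c: "abs c = 1" for c
  proof (rule mono_on_imp_deriv_nonneg[of "{a<..<b}" "%s. N * V s + c * cum f s"])
   show "mono_on {a<..<b} (%s. N * V s + c * cum f s)"
   proof (rule mono_onI)
    fix x y :: real assume "x <= y"
    from cum_bound[OF fc N this] have "abs (c * (cum f y - cum f x)) <= N * (V y - V x)"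
     using c by (simp add: abs_mult V_def)
    thus "N * V x + c * cum f x <= N * V y + c * cum f y" by (simp add: abs_le_iff algebra_simps)
   qed
   show "DERIV (%s. N * V s + c * cum f s) s :> N * v s + c * (phi s * v s)"
    by (auto intro!: derivative_eq_intros V_deriv G s)
  qed (use s in auto)
  from this[of 1] this[of "- 1"] have "0 <= (N + phi s) * v s" "0 <= (N - phi s) * v s"
   by (auto simp: algebra_simps)
  thus ?thesis using v_pos[OF s] by (simp add: zero_le_mult_iff abs_le_iff)
 qed
 have la: "tendsto (cum f) 0 (at_right a)" using cum_lim(1)[OF fc] cum_a[OF fc] by simp
 have "tendsto (cum f) (cum f b) (at b within {a..b})" using cum_cont[OF fc] ab by (auto simp: continuous_on)
 hence "tendsto (cum f) (cum f b) (at_left b)" by (simp add: at_within_Icc_at_left[OF ab])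
 hence lb: "tendsto (%s. l * cum f s) (l * tot f) (at_left b)" unfolding cum_b by (intro tendsto_intros)
 have "sl.sol l phi (cum f)"
  unfolding sl.sol_def using phi' G bd la lb ltot by auto
 thus ?thesis by (rule exI[of _ phi])
qed

section \<open>Radial eigenfunctions\<close>

lemma profile_cont:
 fixes h :: "real => real"
 assumes "continuous_on UNIV (%x. h (F x))" shows "continuous_on {a..b} h"
proof -
 have "closed (h -` C Int {a..b})" if "closed C" for C
 proof -
  have "closed ((%x. h (F x)) -` C)" by (rule closed_vimage[OF that assms])
  hence "compact ((%x. h (F x)) -` C)" using compact_Int_closed[OF compact_M] by simp
  hence "compact (F ` ((%x. h (F x)) -` C))"
   by (rule compact_continuous_image[OF continuous_on_subset[OF F_cont subset_UNIV]])
  moreover have "F ` ((%x. h (F x)) -` C) = h -` C Int {a..b}"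
  proof
   show "h -` C Int {a..b} <= F ` ((%x. h (F x)) -` C)"
   proof
    fix s assume s: "s : h -` C Int {a..b}"
    then obtain x where "F x = s" using F_surj by blast
    thus "s : F ` ((%x. h (F x)) -` C)" using s by (intro image_eqI[of _ _ x]) auto
   qed
  qed (use F_range in auto)
  ultimately show ?thesis by (simp add: compact_imp_closed)
 qed
 thus ?thesis by (simp add: continuous_on_closed_vimage)
qed

theorem radial_profile:
 assumes f: "C_fun (Suc (Suc 0)) f" "!!x. laplacian M f x = l * f x" and h: "!!x. f x = h (F x)"
 shows "continuous_on {a..b} h" "sl.sol l h (sl.I h)" "s : {a..b} ==> cum f s = sl.I h s"
proof -
 have fc: "continuous_on UNIV f" by (rule C_fun_cont[OF f(1)])
 have feq: "f = (%x. h (F x))" using h by auto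
 show c: "continuous_on {a..b} h" using fc unfolding feq by (rule profile_cont)
 obtain phi where phi: "sl.sol l phi (cum f)" using eigen_system[OF f] by blast
 have G: "DERIV (cum f) s :> h s * v s" if "a < s" "s < b" for s
  unfolding feq by (rule cum_F_deriv[OF c that])
 have eq: "phi s = h s" if s: "a < s" "s < b" for s
  using DERIV_unique[OF sl.sol_deriv(2)[OF phi s] G[OF s]] v_pos[OF s] by simp
 have I: "cum f s = sl.I h s" if "s : {a..b}" for s
  using sl.I_unique[OF c cum_cont[OF fc] G that] cum_a[OF fc] by simp
 thus "s : {a..b} ==> cum f s = sl.I h s" .
 have "DERIV h s :> - (l * sl.I h s / p s)" if s: "a < s" "s < b" for s
 proof -
  have "DERIV h s :> - (l * cum f s / p s)"
   by (rule DERIV_local[OF sl.sol_deriv(1)[OF phi s], of "{a<..<b}"]) (use eq s in auto)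
  thus ?thesis using I[of s] s by simp
 qed
 moreover have "l * sl.I h b = 0"
 proof -
  have "l * tot f = 0"
   using green_sym[OF C_fun_const[of _ 1] f(1)] f(2) laplacian_const by (simp add: tot_def)
  thus ?thesis using I[of b] cum_b ab by simp
 qed
 ultimately show "sl.sol l h (sl.I h)" by (rule sl.solI[OF c])
qed

text \<open>A solution on \<open>[a, b]\<close> is smooth up to the ends and solves \<open>A phi'' - B phi' + l phi = 0\<close>, which is the eigenvalue equation for \<open>phi o F\<close>.\<close>
theorem eigenfunction_of_profile:
 assumes c: "continuous_on {a..b} phi" and nz: "EX s:{a..b}. phi s ~= 0" and sol: "sl.sol l phi (sl.I phi)"
 shows "eigenfunction M l (%x. phi (F x))"
proof -
 have C: "C_seg k a b phi" for k
  by (rule sl.sol_smooth[OF A1(1) A1(2) A_pos _ _ B p_eq c sol]) (use A1_a A1_b in auto)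
 obtain phi1 where 1: "ALL x:{a..b}. (phi has_real_derivative phi1 x) (at x within {a..b})" "ALL k. C_seg k a b phi1"
  using C_seg_all_deriv[OF ab C] by (elim exE conjE)
 obtain phi2 where 2: "ALL x:{a..b}. (phi1 has_real_derivative phi2 x) (at x within {a..b})" "ALL k. C_seg k a b phi2"
  using C_seg_all_deriv[OF ab 1(2)[rule_format]] by (elim exE conjE)
 have c2: "continuous_on {a..b} phi2" using 2(2) C_seg.simps(1) by blast
 have "laplacian M (%x. phi (F x)) x = l * phi (F x)" for x
 proof -
  have "laplacian M (%x. phi (F x)) x = phi1 (F x) * laplacian M F x - phi2 (F x) * grad_norm_sq M F x"
   by (rule laplacian_compose[OF F F_sub]) (use 1 2 in auto)
  also have "... = l * phi (F x)"
   using sl.sol_equation[OF A1(1) p_eq c sol 1(1)[rule_format] 2(1)[rule_format] c2, of "F x"] F_range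
   by (simp add: gradF lapF algebra_simps)
  finally show ?thesis .
 qed
 moreover have "smooth_fun M (%x. phi (F x))" unfolding smooth_fun_iff using C_fun_C_seg[OF C F F_sub] by blast
 moreover have "EX x. phi (F x) ~= 0" using nz F_surj by blast
 ultimately show ?thesis unfolding eigenfunction_def by blast
qed

corollary level_eigenvalues:
 "{l. EX f. eigenfunction M l f & (EX h. f = (%x. h (F x)))} = sl.eigenvalues"
proof
 show "{l. EX f. eigenfunction M l f & (EX h. f = (%x. h (F x)))} <= sl.eigenvalues"
 proof
  fix l assume "l : {l. EX f. eigenfunction M l f & (EX h. f = (%x. h (F x)))}"
  then obtain f h where f: "eigenfunction M l f" "f = (%x. h (F x))" by blast
  hence C: "C_fun (Suc (Suc 0)) f" "!!x. laplacian M f x = l * f x" and nz: "EX x. f x ~= 0"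
   by (auto simp: eigenfunction_def smooth_fun_iff)
  note r = radial_profile[OF C, of h]
  have "EX s:{a..b}. h s ~= 0" using nz f(2) F_range by auto
  thus "l : sl.eigenvalues" unfolding sl.eigenvalues_def using r f(2) by blast
 qed
 show "sl.eigenvalues <= {l. EX f. eigenfunction M l f & (EX h. f = (%x. h (F x)))}"
  unfolding sl.eigenvalues_def using eigenfunction_of_profile by blast
qed

end

section \<open>Curves of controlled length\<close>

text \<open>The derivative is measurable as a pointwise limit of difference quotients, and the fundamental theorem of calculus admits finitely many exceptions.\<close>
lemma variation_bound:
 fixes h d :: "real => real"
 assumes uv: "u <= v" and c: "continuous_on {u..v} h" and E: "finite E"
  and der: "!!s. u < s ==> s < v ==> s ~: E ==> DERIV h s :> d s"
  and le: "!!s. u < s ==> s < v ==> s ~: E ==> abs (d s) <= sp s"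
 shows "ennreal (abs (h v - h u)) <= (\<integral>\<^sup>+s\<in>{u..v}. ennreal (sp s) \<partial>lborel)"
proof -
 define N where "N = {u<..<v} - E"
 have N: "open N" unfolding N_def using E finite_imp_closed by (auto intro!: open_Diff)
 define hh where "hh = (%s. h (max u (min v s)))"
 have hhc: "continuous_on UNIV hh" unfolding hh_def
  by (rule continuous_on_compose2[OF c]) (use uv in "auto intro!: continuous_intros")
 define d' where "d' = (%s. if s : N then d s else 0)"
 have [measurable]: "hh : borel_measurable borel" by (rule borel_measurable_continuous_onI[OF hhc])
 note borel_open[OF N, measurable]
 have d'm [measurable]: "d' : borel_measurable borel"
 proof (rule borel_measurable_LIMSEQ_real)
  fix s
  show "(%n. if s : N then (hh (s + inverse (real (Suc n))) - hh s) / inverse (real (Suc n)) else 0) \<longlonglongrightarrow> d' s"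
  proof (cases "s : N")
   case True
   have "DERIV hh s :> d s"
    by (rule DERIV_local[OF der N True])
      (use True in "auto simp: N_def hh_def max_def min_def")
   hence 1: "tendsto (%t. (hh (s + t) - hh s) / t) (d s) (at 0)" by (simp add: DERIV_def)
   have "filterlim (%n. inverse (real (Suc n))) (at 0) sequentially"
    using LIMSEQ_inverse_real_of_nat by (simp add: filterlim_at)
   from filterlim_compose[OF 1 this] show ?thesis using True by (simp add: d'_def)
  qed (simp add: d'_def)
 qed measurable
 have "(d' has_integral (h v - h u)) {u..v}"
  by (rule fundamental_theorem_of_calculus_interior_strong[OF E uv _ c])
    (use der in "auto simp: d'_def N_def has_real_derivative_iff_has_vector_derivative")
 hence hi: "(d' has_integral (h v - h u)) UNIV"
 proof (rule has_integral_on_superset)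
  show "d' x = 0" if "x ~: {u..v}" for x using that by (auto simp: d'_def N_def)
 qed simp
 have le': "(nn_integral lborel (%s. ennreal (abs (d' s)))) <= (\<integral>\<^sup>+s\<in>{u..v}. ennreal (sp s) \<partial>lborel)"
  by (rule nn_integral_mono) (use le in "auto simp: d'_def N_def indicator_def intro!: ennreal_leI")
 show ?thesis
 proof (cases "(\<integral>\<^sup>+s\<in>{u..v}. ennreal (sp s) \<partial>lborel) = \<infinity>")
  case False
  hence "(nn_integral lborel (%s. ennreal (abs (d' s)))) < \<infinity>" using le' by (auto simp: less_top[symmetric] top_unique)
  hence i: "integrable lborel d'" by (intro integrableI_bounded) auto
  have "h v - h u = (LINT s|lborel. d' s)"
   by (rule has_integral_unique[OF hi has_integral_integral_lborel[OF i]])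
  hence "ennreal (abs (h v - h u)) <= ennreal (LINT s|lborel. abs (d' s))"
   by (intro ennreal_leI) (simp add: integral_abs_bound)
  also have "... = (nn_integral lborel (%s. ennreal (abs (d' s))))"
   by (rule nn_integral_eq_integral[symmetric]) (use i in auto)
  finally show ?thesis using le' by (rule order_trans)
 qed simp
qed

text \<open>Take for \<open>d\<close> the first time at or below the final value and for \<open>c\<close> the last time before it at or above the initial value. Strictly between these values a curve avoids the focal sets.\<close>
lemma descending_interval:
 fixes f :: "real => real"
 assumes f: "continuous_on {0..1} f"
 obtains c d where "0 <= c" "c <= d" "d <= 1" "f 0 <= f c" "f d <= f 1" "!!t. c < t ==> t < d ==> f 1 < f t & f t < f 0"
proof -
 define D where "D = {0..1} Int f -` {..f 1}"
 have "closed D" unfolding D_def by (rule continuous_closed_preimage[OF f]) auto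
 hence "compact D" unfolding compact_eq_bounded_closed by (auto simp: D_def intro: bounded_subset[OF bounded_closed_interval[of 0 1]])
 moreover have "1 : D" by (simp add: D_def)
 ultimately obtain d where d: "d : D" "!!t. t : D ==> d <= t" using compact_attains_inf[of D] by blast
 define C where "C = {0..d} Int f -` {f 0..}"
 have "continuous_on {0..d} f" by (rule continuous_on_subset[OF f]) (use d in "auto simp: D_def")
 hence "closed C" unfolding C_def by (rule continuous_closed_preimage) auto
 hence "compact C" unfolding compact_eq_bounded_closed by (auto simp: C_def intro: bounded_subset[OF bounded_closed_interval[of 0 d]])
 moreover have "0 : C" using d by (simp add: C_def D_def)
 ultimately obtain c where c: "c : C" "!!t. t : C ==> t <= c" using compact_attains_sup[of C] by blast
 show thesis
 proof (rule that[of c d])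
  fix t assume t: "c < t" "t < d"
  hence "t ~: D" "t ~: C" using c(2)[of t] d(2)[of t] by auto
  thus "f 1 < f t & f t < f 0" using t c(1) d(1) by (auto simp: C_def D_def)
 qed (use c d in "auto simp: C_def D_def")
qed

lemma (in riemannian_isometry) J_cont:
 assumes c: "c : atlas M" "c' : atlas M" shows "continuous_on (W c c') (%y. J c c' y *v u)"
proof -
 have "continuous_on (W c c') (%y. J c c' y $ i $ j)" for i j
 proof -
  have "Ck_on 0 (W c c') (%y. frechet_derivative (tau c c') (at y) (axis j 1))"
   using tau_smooth[OF c, of "Suc 0"] axis_Basis unfolding Ck_on.simps(2) by blast
  from Ck_on_bounded_linear[OF bounded_linear_vec_nth[of i] open_W[OF c] this]
  show ?thesis by (simp add: J_def jacobian_def matrix_def)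
 qed
 thus ?thesis unfolding matrix_vector_mult_def
  by (intro continuous_on_vec_lambda continuous_on_sum continuous_on_mult continuous_on_const)
qed

context riemannian_mfd begin

lemma speed_eq:
 assumes "c = chart_at M (gamma s)" "(coords c o gamma has_vector_derivative u) (at s)"
 shows "speed M gamma s = sqrt (u \<bullet> (g c (coords c (gamma s)) *v u))"
 using assms chart_at[of "gamma s"] by (simp add: speed_def Let_def vector_derivative_at metric_coords)

lemma speed_reparam:
 assumes S: "open S" "s : S" and eq: "!!t. t : S ==> gamma t = gamma1 (2 * t - i)"
 shows "(coords c o gamma1 has_vector_derivative D) (at (2 * s - i)) ==> (coords c o gamma has_vector_derivative 2 *\<^sub>R D) (at s)"
  and "(coords (chart_at M (gamma s)) o gamma1 has_vector_derivative D) (at (2 * s - i)) ==>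
   ennreal (speed M gamma s) = 2 * ennreal (speed M gamma1 (2 * s - i))"
proof -
 have d: "(coords c o gamma has_vector_derivative 2 *\<^sub>R D) (at s)"
  if D: "(coords c o gamma1 has_vector_derivative D) (at (2 * s - i))" for c
 proof -
  have "((%s. 2 * s - i) has_vector_derivative 2) (at s)" by (auto intro!: derivative_eq_intros)
  from vector_diff_chain_at[OF this D] show ?thesis
   by (rule has_vector_derivative_transform_within_open[OF _ S]) (simp add: eq)
 qed
 thus "(coords c o gamma1 has_vector_derivative D) (at (2 * s - i)) ==> (coords c o gamma has_vector_derivative 2 *\<^sub>R D) (at s)" .
 let ?c = "chart_at M (gamma s)"
 assume D: "(coords ?c o gamma1 has_vector_derivative D) (at (2 * s - i))"
 have "speed M gamma s = sqrt (2^2 * (D \<bullet> (g ?c (coords ?c (gamma s)) *v D)))"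
  using speed_eq[OF refl d[OF D]] by (simp add: matrix_vector_mult_scaleR)
 also have "... = 2 * speed M gamma1 (2 * s - i)"
  unfolding real_sqrt_mult using speed_eq[of ?c gamma1 "2 * s - i" D] D eq[OF S(2)] by simp
 finally show "ennreal (speed M gamma s) = 2 * ennreal (speed M gamma1 (2 * s - i))" by (simp add: ennreal_mult')
qed

text \<open>Length is measured by a Borel majorant \<open>e\<close> of the speed outside a finite set. This makes concatenation and estimates straightforward, without measurability of the speed or values at corners.\<close>
definition reach :: "'a => 'a => real => bool" where
 "reach x y r \<longleftrightarrow> 0 <= r & (EX gamma e E. piecewise_C1_curve M gamma & gamma 0 = x & gamma 1 = y & e : borel_measurable borel & finite E &
   (ALL s:{0<..<1} - E. ennreal (speed M gamma s) <= e s) & (nn_integral lborel (%s. e s)) <= ennreal r)"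

lemma reach_nonneg: "reach x y r ==> 0 <= r" by (simp add: reach_def)

lemma reach_length:
 assumes "reach x y r"
 shows "(INF gamma \<in> {gamma. piecewise_C1_curve M gamma & gamma 0 = x & gamma 1 = y}. curve_length M gamma) <= ennreal r"
proof -
 obtain gamma e E where gamma: "piecewise_C1_curve M gamma" "gamma 0 = x" "gamma 1 = y" and fin: "finite E"
  and le: "ALL s:{0<..<1} - E. ennreal (speed M gamma s) <= e s" and int: "(nn_integral lborel (%s. e s)) <= ennreal r"
  using assms unfolding reach_def by blast
 have "AE s in lborel. s ~: insert 0 (insert 1 E)"
  by (rule AE_not_in) (use fin in "auto intro: countable_imp_null_set_lborel countable_finite")
 hence "curve_length M gamma <= (nn_integral lborel (%s. e s))" unfolding curve_length_def
  by (intro nn_integral_mono_AE, elim eventually_mono) (use le in "auto simp: indicator_def")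
 thus ?thesis using int gamma by (intro INF_lower2[of gamma]) auto
qed

lemma reach_rdist: "reach x y r ==> rdist M x y <= r"
 unfolding rdist_def by (rule enn2real_leI[OF reach_nonneg reach_length])

lemma reach_segment:
 assumes c: "c : atlas M" and seg: "!!s. 0 <= s ==> s <= 1 ==> y + s *\<^sub>R u : U c"
  and C: "0 <= C" "!!s. 0 <= s ==> s <= 1 ==> u \<bullet> (g c (y + s *\<^sub>R u) *v u) <= C^2"
 shows "reach (param c y) (param c (y + u)) C"
proof -
 define gamma where "gamma = (%s. param c (y + s *\<^sub>R u))"
 have der: "(coords c' o gamma has_vector_derivative ident.J c c' (y + s *\<^sub>R u) *v u) (at s)"
  if s: "0 < s" "s < 1" "gamma s : domain c'" "c' : atlas M" for s c'
 proof -
  have W: "y + s *\<^sub>R u : ident.W c c'" using s seg[of s] c by (simp add: ident.W_iff gamma_def)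
  have "((%s. y + s *\<^sub>R u) has_derivative (%t. t *\<^sub>R u)) (at s)" by (auto intro!: derivative_eq_intros)
  from diff_chain_at[OF this ident.tau_deriv[OF c s(4) W]]
  have "((local_rep c c' id o (%s. y + s *\<^sub>R u)) has_derivative (%t. t *\<^sub>R (ident.J c c' (y + s *\<^sub>R u) *v u))) (at s)"
   by (simp add: o_def matrix_vector_mult_scaleR)
  moreover have "local_rep c c' id o (%s. y + s *\<^sub>R u) = coords c' o gamma" by (auto simp: local_rep_def gamma_def)
  ultimately show ?thesis by (simp add: has_vector_derivative_def)
 qed
 have "piecewise_C1_curve M gamma" unfolding piecewise_C1_curve_def
 proof (intro conjI exI[of _ "{0, 1}"] ballI)
  show "continuous_on {0..1} gamma" unfolding gamma_def
   by (rule continuous_on_compose2[OF cont_param[OF c]]) (use seg in "auto intro!: continuous_intros")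
  fix c' assume c': "c' : atlas M"
  let ?S = "({0..1} - {0, 1}) Int gamma -` domain c'"
  have "continuous_on ?S (%s. ident.J c c' (y + s *\<^sub>R u) *v u)"
   by (rule continuous_on_compose2[OF ident.J_cont[OF c c'], of _ "%s. y + s *\<^sub>R u"])
     (use seg c in "auto intro!: continuous_intros simp: ident.W_iff gamma_def")
  thus "(coords c' o gamma) C1_differentiable_on ?S"
   unfolding C1_differentiable_on_def using der[OF _ _ _ c'] by (intro exI[of _ "%s. ident.J c c' (y + s *\<^sub>R u) *v u"]) auto
 qed simp
 moreover have "speed M gamma s <= C" if s: "0 < s" "s < 1" for s
 proof -
  let ?c = "chart_at M (gamma s)" let ?y = "y + s *\<^sub>R u" let ?J = "ident.J c (chart_at M (gamma s)) (y + s *\<^sub>R u)"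
  note ca = chart_at[of "gamma s"]
  have W: "?y : ident.W c ?c" using s seg[of s] c ca by (simp add: ident.W_iff gamma_def)
  have co: "coords ?c (gamma s) = local_rep c ?c id ?y" by (simp add: local_rep_def gamma_def)
  have "speed M gamma s = sqrt ((?J *v u) \<bullet> (g ?c (local_rep c ?c id ?y) *v (?J *v u)))"
   using speed_eq[OF refl der[OF s ca(2,1)]] unfolding co .
  also have "(?J *v u) \<bullet> (g ?c (local_rep c ?c id ?y) *v (?J *v u)) = u \<bullet> (g c ?y *v u)"
  proof -
   have "u \<bullet> (w v* ?J) = (?J *v u) \<bullet> w" for w by (metis inner_commute dot_lmul_matrix)
   thus ?thesis unfolding ident.g_pullback[OF c ca(1) W] matrix_vector_mul_assoc[symmetric] transpose_matrix_vector
    by simp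
  qed
  also have "sqrt ... <= C" using C s by (intro real_le_lsqrt) auto
  finally show ?thesis .
 qed
 moreover have "(nn_integral lborel (%s. ennreal C * indicator {0..1::real} s)) <= ennreal C"
  by (subst nn_integral_cmult_indicator) auto
 ultimately show ?thesis unfolding reach_def
  using C(1) by (intro conjI exI[of _ gamma] exI[of _ "%s. ennreal C * indicator {0..1} s"] exI[of _ "{}"])
   (auto simp: gamma_def intro!: ennreal_leI)
qed

text \<open>Concatenation with doubled speed on each half; the finite exceptional sets absorb the corner.\<close>
lemma reach_trans:
 assumes "reach x y r" "reach y z r'" shows "reach x z (r + r')"
proof -
 obtain gamma1 e1 E1 where 1: "piecewise_C1_curve M gamma1" "gamma1 0 = x" "gamma1 1 = y" and E1: "finite E1"
  and le1: "ALL s:{0<..<1} - E1. ennreal (speed M gamma1 s) <= e1 s" and int1: "(nn_integral lborel (%s. e1 s)) <= ennreal r"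
  and [measurable]: "e1 : borel_measurable borel"
  using assms(1) unfolding reach_def by blast
 obtain gamma2 e2 E2 where 2: "piecewise_C1_curve M gamma2" "gamma2 0 = y" "gamma2 1 = z" and E2: "finite E2"
  and le2: "ALL s:{0<..<1} - E2. ennreal (speed M gamma2 s) <= e2 s" and int2: "(nn_integral lborel (%s. e2 s)) <= ennreal r'"
  and [measurable]: "e2 : borel_measurable borel"
  using assms(2) unfolding reach_def by blast
 obtain G1 where G1: "finite G1" "!!c. c : atlas M ==> (coords c o gamma1) C1_differentiable_on (({0..1} - G1) Int gamma1 -` domain c)"
  using 1(1) unfolding piecewise_C1_curve_def by blast
 obtain G2 where G2: "finite G2" "!!c. c : atlas M ==> (coords c o gamma2) C1_differentiable_on (({0..1} - G2) Int gamma2 -` domain c)"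
  using 2(1) unfolding piecewise_C1_curve_def by blast
 define gamma where "gamma = (gamma1 +++ gamma2)"
 define H1 where "H1 = G1 Un E1" define H2 where "H2 = G2 Un E2"
 define E where "E = insert 0 (insert 1 (insert (1 / 2) ((%t. t / 2) ` H1 Un (%t. (t + 1) / 2) ` H2)))"
 have E: "finite E" using E1 E2 G1 G2 by (simp add: E_def H1_def H2_def)
 have low: "2 * s : {0<..<1} - H1" "gamma s = gamma1 (2 * s)" if "s : {0..1} - E" "s < 1 / 2" for s
 proof -
  have "2 * s ~: H1"
  proof
   assume "2 * s : H1"
   from imageI[OF this, of "%t. t / 2"] show False using that by (auto simp: E_def)
  qed
  thus "2 * s : {0<..<1} - H1" using that by (auto simp: E_def)
  show "gamma s = gamma1 (2 * s)" using that by (simp add: gamma_def joinpaths_def)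
 qed
 have high: "2 * s - 1 : {0<..<1} - H2" "gamma s = gamma2 (2 * s - 1)" if "s : {0..1} - E" "~ s < 1 / 2" for s
 proof -
  have "2 * s - 1 ~: H2"
  proof
   assume "2 * s - 1 : H2"
   from imageI[OF this, of "%t. (t + 1) / 2"] show False using that by (auto simp: E_def)
  qed
  thus "2 * s - 1 : {0<..<1} - H2" using that by (auto simp: E_def)
  show "gamma s = gamma2 (2 * s - 1)" using that by (auto simp: E_def gamma_def joinpaths_def)
 qed
 have low': "gamma t = gamma1 (2 * t - 0)" if "t : {..<1 / 2}" for t using that by (simp add: gamma_def joinpaths_def)
 have high': "gamma t = gamma2 (2 * t - 1)" if "t : {1 / 2<..}" for t using that by (simp add: gamma_def joinpaths_def)
 have d1: "(coords c o gamma has_vector_derivative 2 *\<^sub>R D) (at s)"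
  if "s < 1 / 2" "(coords c o gamma1 has_vector_derivative D) (at (2 * s))" for c s and D :: "real^'n"
  by (rule speed_reparam(1)[of "{..<1 / 2}" s gamma gamma1 0]) (use that in "auto simp: low'")
 have d2: "(coords c o gamma has_vector_derivative 2 *\<^sub>R D) (at s)"
  if "1 / 2 < s" "(coords c o gamma2 has_vector_derivative D) (at (2 * s - 1))" for c s and D :: "real^'n"
  by (rule speed_reparam(1)[of "{1 / 2<..}" s gamma gamma2 1]) (use that in "auto simp: high'")
 have "piecewise_C1_curve M gamma" unfolding piecewise_C1_curve_def
 proof (intro conjI exI[of _ E] ballI E)
  have "path (gamma1 +++ gamma2)"
   using 1 2 by (intro path_join_imp) (auto simp: path_def piecewise_C1_curve_def pathfinish_def pathstart_def)
  thus "continuous_on {0..1} gamma" by (simp add: path_def gamma_def)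
  fix c assume c: "c : atlas M"
  obtain D1 where D1: "!!s. s : ({0..1} - G1) Int gamma1 -` domain c ==> (coords c o gamma1 has_vector_derivative D1 s) (at s)"
   "continuous_on (({0..1} - G1) Int gamma1 -` domain c) D1" using G1(2)[OF c] unfolding C1_differentiable_on_def by blast
  obtain D2 where D2: "!!s. s : ({0..1} - G2) Int gamma2 -` domain c ==> (coords c o gamma2 has_vector_derivative D2 s) (at s)"
   "continuous_on (({0..1} - G2) Int gamma2 -` domain c) D2" using G2(2)[OF c] unfolding C1_differentiable_on_def by blast
  let ?S = "({0..1} - E) Int gamma -` domain c"
  define D where "D = (%s. if s < 1 / 2 then 2 *\<^sub>R D1 (2 * s) else 2 *\<^sub>R D2 (2 * s - 1))"
  have half: "s ~= 1 / 2" if "s : ?S" for s using that by (auto simp: E_def)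
  have m1: "2 * s : ({0..1} - G1) Int gamma1 -` domain c" if "s : ?S" "s < 1 / 2" for s
   using low[of s] that by (auto simp: H1_def)
  have m2: "2 * s - 1 : ({0..1} - G2) Int gamma2 -` domain c" if "s : ?S" "~ s < 1 / 2" for s
   using high[of s] that by (auto simp: H2_def)
  have "(coords c o gamma has_vector_derivative D s) (at s)" if s: "s : ?S" for s
  proof (cases "s < 1 / 2")
   case True
   thus ?thesis unfolding D_def using d1[OF True D1(1)[OF m1[OF s True]]] by simp
  next
   case False
   thus ?thesis unfolding D_def using d2[OF _ D2(1)[OF m2[OF s False]]] half[OF s] by simp
  qed
  moreover have "continuous_on ?S D"
  proof -
   have "s < 1 / 2 | 1 / 2 < s" if "s : ?S" for s using half[OF that] by linarith
   hence S: "?S = ?S Int {..<1 / 2} Un ?S Int {1 / 2<..}" by blast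
   have "continuous_on (?S Int {..<1 / 2} Un ?S Int {1 / 2<..}) D"
   proof (rule continuous_on_Un_local_open)
    show "openin (top_of_set (?S Int {..<1 / 2} Un ?S Int {1 / 2<..})) (?S Int {..<1 / 2})"
     unfolding S[symmetric] by (intro openin_open_Int) simp
    show "openin (top_of_set (?S Int {..<1 / 2} Un ?S Int {1 / 2<..})) (?S Int {1 / 2<..})"
     unfolding S[symmetric] by (intro openin_open_Int) simp
    have "continuous_on (?S Int {..<1 / 2}) (%s. 2 *\<^sub>R D1 (2 * s))"
     by (intro continuous_on_scaleR continuous_on_const continuous_on_compose2[OF D1(2)]) (use m1 in "auto intro!: continuous_intros")
    thus "continuous_on (?S Int {..<1 / 2}) D"
     by (rule continuous_on_eq) (simp add: D_def)
    have "continuous_on (?S Int {1 / 2<..}) (%s. 2 *\<^sub>R D2 (2 * s - 1))"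
     by (intro continuous_on_scaleR continuous_on_const continuous_on_compose2[OF D2(2)]) (use m2 in "auto intro!: continuous_intros")
    thus "continuous_on (?S Int {1 / 2<..}) D"
     by (rule continuous_on_eq) (simp add: D_def)
   qed
   thus ?thesis unfolding S[symmetric] .
  qed
  ultimately show "(coords c o gamma) C1_differentiable_on ?S" unfolding C1_differentiable_on_def by blast
 qed
 moreover have "ennreal (speed M gamma s) <= 2 * e1 (2 * s) + 2 * e2 (2 * s - 1)" if s: "s : {0<..<1} - E" for s
 proof -
  let ?c = "chart_at M (gamma s)"
  have sE: "s : {0..1} - E" using s by auto
  show ?thesis
  proof (cases "s < 1 / 2")
   case True
   note l = low[OF sE True]
   obtain u where u: "(coords ?c o gamma1 has_vector_derivative u) (at (2 * s))"
    using G1(2)[OF chart_at(1)[of "gamma s"]] chart_at(2)[of "gamma s"] l unfolding C1_differentiable_on_def H1_def by force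
   have "ennreal (speed M gamma s) = 2 * ennreal (speed M gamma1 (2 * s))"
    by (subst speed_reparam(2)[of "{..<1 / 2}" s gamma gamma1 0 u]) (use True u in "auto simp: low'")
   also have "... <= 2 * e1 (2 * s)" using le1 l(1) by (intro mult_left_mono) (auto simp: H1_def)
   finally show ?thesis by (rule order_trans) simp
  next
   case False
   hence gt: "s > 1 / 2" using sE by (auto simp: E_def)
   note l = high[OF sE False]
   obtain u where u: "(coords ?c o gamma2 has_vector_derivative u) (at (2 * s - 1))"
    using G2(2)[OF chart_at(1)[of "gamma s"]] chart_at(2)[of "gamma s"] l unfolding C1_differentiable_on_def H2_def by force
   have "ennreal (speed M gamma s) = 2 * ennreal (speed M gamma2 (2 * s - 1))"
    by (subst speed_reparam(2)[of "{1 / 2<..}" s gamma gamma2 1 u]) (use gt u in "auto simp: high'")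
   also have "... <= 2 * e2 (2 * s - 1)" using le2 l(1) by (intro mult_left_mono) (auto simp: H2_def)
   finally show ?thesis by (rule order_trans) simp
  qed
 qed
 moreover have "(nn_integral lborel (%s. 2 * e1 (2 * s) + 2 * e2 (2 * s - 1))) <= ennreal (r + r')"
 proof -
  have "(nn_integral lborel (%s. 2 * e1 (2 * s) + 2 * e2 (2 * s - 1))) = 2 * (nn_integral lborel (%s. e1 (0 + 2 * s))) + 2 * (nn_integral lborel (%s. e2 (- 1 + 2 * s)))"
   by (simp add: nn_integral_add nn_integral_cmult)
  also have "... = (nn_integral lborel (%s. e1 s)) + (nn_integral lborel (%s. e2 s))"
   using nn_integral_real_affine[of e1 2 0] nn_integral_real_affine[of e2 2 "- 1"] by simp
  also have "... <= ennreal (r + r')"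
   using int1 int2 reach_nonneg[OF assms(1)] reach_nonneg[OF assms(2)] by (auto intro!: add_mono simp: ennreal_plus)
  finally show ?thesis .
 qed
 moreover have "gamma 0 = x" "gamma 1 = z" using 1 2 by (auto simp: gamma_def joinpaths_def)
 moreover have "(%s. 2 * e1 (2 * s) + 2 * e2 (2 * s - 1)) : borel_measurable borel" by measurable
 ultimately show ?thesis unfolding reach_def
  using reach_nonneg[OF assms(1)] reach_nonneg[OF assms(2)] E
  by (intro conjI exI[of _ gamma] exI[of _ "%s. 2 * e1 (2 * s) + 2 * e2 (2 * s - 1)"] exI[of _ E]) auto
qed

lemma reach_refl: "reach x x 0"
proof -
 let ?c = "chart_at M x"
 have "reach (param ?c (coords ?c x)) (param ?c (coords ?c x + 0)) 0"
  by (rule reach_segment[OF chart_at(1)]) (use chart_at(2) in auto)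
 thus ?thesis using chart_at by simp
qed

lemma reach_local:
 assumes eta: "0 < eta"
 shows "EX V. open V & x : V & (ALL z:V. reach x z eta & reach z x eta)"
proof -
 obtain c where c: "c : atlas M" "x : domain c" using chart_cover by blast
 define y where "y = coords c x"
 obtain r where r: "r > 0" "cball y r <= U c"
  using open_contains_cball[of "U c"] open_U[OF c(1)] c(2) by (auto simp: y_def)
 have "continuous_on (cball y r) (%z. SUM i:UNIV. SUM j:UNIV. abs (g c z $ i $ j))"
 proof (intro continuous_on_sum continuous_on_rabs)
  show "continuous_on (cball y r) (%z. g c z $ i $ j)" for i j
   using g_smooth[OF c(1), of 0 i j] r(2) by (auto intro: continuous_on_subset)
 qed
 hence "bounded ((%z. SUM i:UNIV. SUM j:UNIV. abs (g c z $ i $ j)) ` cball y r)"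
  using compact_continuous_image compact_cball compact_imp_bounded by blast
 then obtain K where K0: "ALL t:(%z. SUM i:UNIV. SUM j:UNIV. abs (g c z $ i $ j)) ` cball y r. norm t <= K"
  unfolding bounded_iff by blast
 have K: "(SUM i:UNIV. SUM j:UNIV. abs (g c z $ i $ j)) <= K" if "z : cball y r" for z
  using bspec[OF K0 imageI[OF that]] by (simp add: abs_le_iff)
 define L where "L = max 1 (real CARD('n) * real CARD('n) * K)"
 have quad: "u \<bullet> (g c z *v u) <= L * (norm u)^2" if z: "z : cball y r" for z u
 proof -
  have "abs (g c z $ i $ j) <= K" for i j
  proof -
   have "abs (g c z $ i $ j) <= (SUM j:UNIV. abs (g c z $ i $ j))" by (rule member_le_sum) auto
   also have "... <= (SUM i:UNIV. SUM j:UNIV. abs (g c z $ i $ j))"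
    by (rule member_le_sum[of i UNIV "%i. SUM j:UNIV. abs (g c z $ i $ j)"]) (auto intro: sum_nonneg)
   finally show ?thesis using K[OF z] by linarith
  qed
  hence "onorm ((*v) (g c z)) <= L" using onorm_le_matrix_component[of "g c z" K] by (simp add: L_def)
  hence "norm (g c z *v u) <= L * norm u"
   using onorm[OF matrix_vector_mul_bounded_linear[of "g c z"], of u] by (meson mult_right_mono norm_ge_zero order_trans)
  hence "norm u * norm (g c z *v u) <= norm u * (L * norm u)" by (rule mult_left_mono) simp
  thus ?thesis using norm_cauchy_schwarz[of u "g c z *v u"] by (simp add: power2_eq_square mult_ac)
 qed
 have L: "1 <= L" "0 < sqrt L" by (auto simp: L_def)
 define delta where "delta = min r (eta / sqrt L)"
 have delta: "0 < delta" "delta <= r" "sqrt L * delta <= eta" using r(1) eta L by (auto simp: delta_def min_def field_simps)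
 have bd: "u \<bullet> (g c z *v u) <= eta^2" if "z : cball y r" "norm u <= delta" for z u
 proof -
  have "u \<bullet> (g c z *v u) <= L * (norm u)^2" by (rule quad[OF that(1)])
  also have "... = (sqrt L * norm u)^2" using L by (simp add: power_mult_distrib)
  also have "... <= eta^2"
  proof (rule power_mono)
   have "sqrt L * norm u <= sqrt L * delta" using that(2) L by (intro mult_left_mono) auto
   thus "sqrt L * norm u <= eta" using delta(3) by linarith
  qed (use L in auto)
  finally show ?thesis .
 qed
 have px: "param c y = x" using c by (simp add: y_def)
 define V where "V = param c ` ball y delta"
 have "open V" unfolding V_def by (rule open_param_image[OF c(1) open_ball]) (use r(2) delta(2) in auto)
 moreover have "x : V" unfolding V_def using px delta(1) by (intro image_eqI[of _ _ y]) auto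
 moreover have "reach x z eta & reach z x eta" if z: "z : V" for z
 proof -
  obtain t where "t : ball y delta" and zt: "z = param c t" using z unfolding V_def by blast
  hence t: "norm (t - y) < delta" "z = param c t" by (auto simp: dist_norm norm_minus_commute)
  have small: "y + s *\<^sub>R (t - y) : cball y r" if "0 <= s" "s <= 1" for s
  proof -
   have "s * norm (t - y) <= 1 * norm (t - y)" using that by (intro mult_right_mono) auto
   thus ?thesis using that t(1) delta(2) by (simp add: dist_norm)
  qed
  have "reach (param c y) (param c (y + (t - y))) eta"
   by (rule reach_segment[OF c(1)]) (use small r(2) bd[OF small, of _ "t - y"] t(1) eta in auto)
  moreover have rev: "t + s *\<^sub>R (y - t) = y + (1 - s) *\<^sub>R (t - y)" for s by (simp add: algebra_simps)
  have "reach (param c t) (param c (t + (y - t))) eta"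
  proof (rule reach_segment[OF c(1)])
   fix s :: real assume s: "0 <= s" "s <= 1"
   hence m: "t + s *\<^sub>R (y - t) : cball y r" unfolding rev by (intro small) auto
   thus "t + s *\<^sub>R (y - t) : U c" using r(2) by blast
   show "(y - t) \<bullet> (g c (t + s *\<^sub>R (y - t)) *v (y - t)) <= eta^2"
    by (rule bd[OF m]) (use t(1) in "simp add: norm_minus_commute")
  qed (use eta in simp)
  ultimately show ?thesis using t(2) px by simp
 qed
 ultimately show ?thesis by blast
qed

end

section \<open>The distance to a focal set\<close>

lemma inverse_sqrt_quadratic_antiderivative:
 fixes a b s :: real
 assumes s: "a < s" "s < b"
 shows "DERIV (%s. arcsin ((2 * s - a - b) / (b - a))) s :> 1 / sqrt ((s - a) * (b - s))"
proof -
 define z where "z = (2 * s - a - b) / (b - a)"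
 have z: "- 1 < z" "z < 1" using s by (auto simp: z_def field_simps)
 have "1 - z^2 = 4 * ((s - a) * (b - s)) / (b - a)^2"
  using s by (simp add: z_def power_divide field_simps) (simp add: power2_eq_square algebra_simps)
 hence "sqrt (1 - z^2) = 2 * sqrt ((s - a) * (b - s)) / (b - a)"
  using s by (simp add: real_sqrt_mult real_sqrt_divide)
 hence eq: "inverse (sqrt (1 - z^2)) * (2 / (b - a)) = 1 / sqrt ((s - a) * (b - s))"
  using s by (simp add: field_simps)
 have "DERIV (%s. 2 * s - a - b) s :> 2" by (auto intro!: derivative_eq_intros)
 hence "DERIV (%s. (2 * s - a - b) / (b - a)) s :> 2 / (b - a)" by (rule DERIV_cdivide)
 from DERIV_chain2[OF DERIV_arcsin[OF z, unfolded z_def] this] show ?thesis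
  unfolding z_def[symmetric] eq .
qed

context isoparametric_mfd begin

text \<open>Since \<open>A\<close> has simple zeros, \<open>1 / sqrt A\<close> is bounded by a multiple of the derivative of an arcsine, and its antiderivative extends continuously to the ends.\<close>
lemma T_exists:
 "EX T. continuous_on {a..b} T & T a = 0 & (ALL s. a < s --> s < b --> DERIV T s :> 1 / sqrt (A s))"
proof -
 have "continuous_on {a<..<b} (%s. 1 / sqrt (A s))"
  by (intro continuous_intros A_cont_Ioo) (use A_pos in fastforce)
 from antiderivative_Ioo[OF ab this] obtain T0
  where T0: "!!s. a < s ==> s < b ==> DERIV T0 s :> 1 / sqrt (A s)" by blast
 obtain c where c: "c > 0" "!!s. s : {a..b} ==> c * ((s - a) * (b - s)) <= A s" using A_lower by blast
 \<comment> \<open>The substitution that turns the lower bound for A into an arcsine.\<close>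
 define H where "H = (%s. arcsin ((2 * s - a - b) / (b - a)) / sqrt c)"
 have H: "DERIV H s :> 1 / sqrt (c * ((s - a) * (b - s)))" if "a < s" "s < b" for s
  unfolding H_def using DERIV_cdivide[OF inverse_sqrt_quadratic_antiderivative[OF that], of "sqrt c"]
  by (simp add: real_sqrt_mult mult.commute)
 have "continuous_on {a..b} H" unfolding H_def
  by (intro continuous_intros) (use ab c in "auto simp: field_simps")
 hence Hu: "uniformly_continuous_on {a..b} H" by (rule compact_uniformly_continuous) simp
 have le: "abs (T0 t - T0 s) <= abs (H t - H s)" if st: "a < s" "s <= t" "t < b" for s t
 proof -
  have "T0 s <= T0 t"
   by (rule DERIV_nonneg_imp_nondecreasing[OF st(2)]) (use st T0 A_pos in \<open>force intro!: exI[of _ "1 / sqrt (A _)"] less_imp_le\<close>)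
  moreover have "H s - T0 s <= H t - T0 t"
  proof (rule DERIV_nonneg_imp_nondecreasing[OF st(2), of "%s. H s - T0 s"])
   fix x assume x: "s <= x" "x <= t"
   hence x': "a < x" "x < b" using st by auto
   have "0 < c * ((x - a) * (b - x))" using c x' by simp
   moreover have "c * ((x - a) * (b - x)) <= A x" using c(2)[of x] x' by simp
   ultimately have "1 / sqrt (A x) <= 1 / sqrt (c * ((x - a) * (b - x)))" by (intro frac_le) auto
   thus "EX y. DERIV (%s. H s - T0 s) x :> y & 0 <= y"
    using DERIV_diff[OF H[OF x'] T0[OF x']] by fastforce
  qed
  ultimately show ?thesis by simp
 qed
 have "uniformly_continuous_on {a<..<b} T0" unfolding uniformly_continuous_on_def
 proof (intro allI impI)
  fix e :: real assume "0 < e"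
  then obtain d where d: "d > 0" "!!s t. s : {a..b} ==> t : {a..b} ==> dist t s < d ==> dist (H t) (H s) < e"
   using Hu unfolding uniformly_continuous_on_def by meson
  have "dist (T0 t) (T0 s) < e" if "s : {a<..<b}" "t : {a<..<b}" "dist t s < d" for s t
  proof -
   have "abs (T0 t - T0 s) <= abs (H t - H s)"
    using le[of s t] le[of t s] that by (cases "s <= t") (auto simp: abs_minus_commute)
   thus ?thesis using d(2)[of s t] that by (simp add: dist_real_def)
  qed
  thus "EX d>0. ALL x:{a<..<b}. ALL x':{a<..<b}. dist x' x < d --> dist (T0 x') (T0 x) < e" using d(1) by blast
 qed
 hence "EX T1. uniformly_continuous_on (closure {a<..<b}) T1 & (ALL x:{a<..<b}. T0 x = T1 x)"
 proof (rule uniformly_continuous_on_extension_on_closure)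
  fix g assume "uniformly_continuous_on (closure {a<..<b}) g" "!!x. x : {a<..<b} ==> T0 x = g x"
  thus ?thesis by (intro exI[of _ g]) simp
 qed
 then obtain T1 where T1: "uniformly_continuous_on (closure {a<..<b}) T1" "!!x. x : {a<..<b} ==> T0 x = T1 x"
  by (elim exE conjE) simp
 have T1c: "continuous_on {a..b} T1" using uniformly_continuous_imp_continuous[OF T1(1)] ab by simp
 have "DERIV (%s. T1 s - T1 a) s :> 1 / sqrt (A s)" if s: "a < s" "s < b" for s
 proof -
  have "DERIV T1 s :> 1 / sqrt (A s)"
   by (rule DERIV_local[OF T0[OF s], of "{a<..<b}"]) (use s T1(2) in auto)
  thus ?thesis by (auto intro!: derivative_eq_intros)
 qed
 thus ?thesis using T1c by (intro exI[of _ "%s. T1 s - T1 a"]) (auto intro!: continuous_intros)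
qed

definition "T = (SOME T. continuous_on {a..b} T & T a = 0 & (ALL s. a < s --> s < b --> DERIV T s :> 1 / sqrt (A s)))"

lemma T_cont: "continuous_on {a..b} T" and T_a: "T a = 0"
 and T_deriv: "a < s ==> s < b ==> DERIV T s :> 1 / sqrt (A s)"
 using someI_ex[OF T_exists] unfolding T_def[symmetric] by auto

lemma T_strict: assumes "a <= s" "s < t" "t <= b" shows "T s < T t"
proof (rule DERIV_pos_imp_increasing_open[OF assms(2)])
 show "EX y. DERIV T x :> y & 0 < y" if "s < x" "x < t" for x
  using T_deriv[of x] A_pos[of x] that assms by (intro exI[of _ "1 / sqrt (A x)"]) auto
qed (use assms in "auto intro: continuous_on_subset[OF T_cont]")

lemma T_mono: "a <= s ==> s <= t ==> t <= b ==> T s <= T t"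
 using T_strict[of s t] by (cases "s = t") auto

lemma T_unique:
 assumes c: "continuous_on {a..b} S" "S a = 0" and d: "!!s. a < s ==> s < b ==> DERIV S s :> 1 / sqrt (A s)"
 shows "S b = T b"
proof -
 have "(%s. S s - T s) b = (%s. S s - T s) a"
 proof (rule DERIV_isconst2[OF ab])
  show "DERIV (%s. S s - T s) x :> 0" if "a < x" "x < b" for x
   using DERIV_diff[OF d[OF that] T_deriv[OF that]] by simp
 qed (use ab in "auto intro!: continuous_intros c(1) T_cont")
 thus ?thesis using c(2) T_a by simp
qed

text \<open>The function \<open>T o F\<close> has gradient of norm one between the focal sets, so its derivative along a curve is at most the speed.\<close>
lemma T_length_between:
 assumes gamma: "piecewise_C1_curve M gamma" and cd: "0 <= c" "c <= d" "d <= 1"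
  and inside: "!!tau. c < tau ==> tau < d ==> a < F (gamma tau) & F (gamma tau) < b"
 shows "ennreal (abs (T (F (gamma d)) - T (F (gamma c)))) <= curve_length M gamma"
proof -
 obtain E where E: "finite E" "!!c. c : atlas M ==> (coords c o gamma) C1_differentiable_on (({0..1} - E) Int gamma -` domain c)"
  and gammac: "continuous_on {0..1} gamma" using gamma unfolding piecewise_C1_curve_def by blast
 have "EX e. DERIV (%s. T (F (gamma s))) s :> e & abs e <= speed M gamma s"
  if s: "c < s" "s < d" "s ~: E" for s
 proof -
  let ?c = "chart_at M (gamma s)"
  define y where "y = coords ?c (gamma s)"
  note ca = chart_at[of "gamma s"]
  have y: "y : U ?c" using ca by (simp add: y_def)
  obtain u where u: "(coords ?c o gamma has_vector_derivative u) (at s)"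
   using E(2)[OF ca(1)] ca(2) s cd unfolding C1_differentiable_on_def by force
  have "((F o param ?c) o (coords ?c o gamma) has_derivative (%v. dv ?c F y \<bullet> v) o (%t. t *\<^sub>R u)) (at s)"
   by (rule diff_chain_at[OF u[unfolded has_vector_derivative_def]])
     (use has_derivative_dv[OF F ca(1) y] in "simp add: y_def")
  hence "((F o param ?c) o (coords ?c o gamma) has_real_derivative dv ?c F y \<bullet> u) (at s)"
   unfolding has_field_derivative_def by (rule has_derivative_eq_rhs) (auto simp: fun_eq_iff)
  moreover have op: "open ({0<..<1} Int gamma -` domain ?c)"
   by (rule continuous_open_preimage) (auto intro: continuous_on_subset[OF gammac] open_domain[OF ca(1)])
  ultimately have Fd: "((%s. F (gamma s)) has_real_derivative dv ?c F y \<bullet> u) (at s)"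
   by (rule DERIV_local) (use ca s cd in auto)
  have in': "a < F (gamma s)" "F (gamma s) < b" using inside s by auto
  have Td: "DERIV (%s. T (F (gamma s))) s :> 1 / sqrt (A (F (gamma s))) * (dv ?c F y \<bullet> u)"
   by (rule DERIV_chain2[OF T_deriv[OF in'] Fd])
  have Ap: "0 < A (F (gamma s))" by (rule A_pos[OF in'])
  have "(dv ?c F y \<bullet> u)^2 <= A (F (gamma s)) * (u \<bullet> (g ?c y *v u))"
   using dv_bound[OF ca(1) y, of F u] Gam_FF[of "gamma s"] by (simp add: Gam_def y_def)
  hence "sqrt ((dv ?c F y \<bullet> u)^2) <= sqrt (A (F (gamma s)) * (u \<bullet> (g ?c y *v u)))" by (rule real_sqrt_le_mono)
  hence "abs (dv ?c F y \<bullet> u) <= sqrt (A (F (gamma s))) * speed M gamma s"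
   unfolding speed_eq[OF refl u] y_def[symmetric] by (simp add: real_sqrt_mult)
  hence "abs (1 / sqrt (A (F (gamma s))) * (dv ?c F y \<bullet> u)) <= speed M gamma s"
   using Ap by (simp add: abs_mult field_simps)
  thus ?thesis using Td by blast
 qed
 then obtain e where e: "!!s. c < s ==> s < d ==> s ~: E ==> DERIV (%s. T (F (gamma s))) s :> e s & abs (e s) <= speed M gamma s"
  by metis
 have hc: "continuous_on {c..d} (%s. T (F (gamma s)))"
  by (rule continuous_on_compose2[OF F_comp_cont[OF T_cont] continuous_on_subset[OF gammac]]) (use cd in auto)
 have "ennreal (abs (T (F (gamma d)) - T (F (gamma c)))) <= (\<integral>\<^sup>+s\<in>{c..d}. ennreal (speed M gamma s) \<partial>lborel)"
  by (rule variation_bound[OF cd(2) hc E(1), of e]) (use e in auto)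
 also have "... <= curve_length M gamma" unfolding curve_length_def
  by (rule nn_integral_mono) (use cd in "auto simp: indicator_def")
 finally show ?thesis .
qed

lemma T_length:
 assumes gamma: "piecewise_C1_curve M gamma" and le: "F (gamma 1) <= F (gamma 0)"
 shows "ennreal (T (F (gamma 0)) - T (F (gamma 1))) <= curve_length M gamma"
proof -
 have "continuous_on {0..1} (%s. F (gamma s))"
  by (rule continuous_on_compose2[OF F_cont]) (use gamma in "auto simp: piecewise_C1_curve_def")
 then obtain c d where cd: "0 <= c" "c <= d" "d <= 1" and e: "F (gamma 0) <= F (gamma c)" "F (gamma d) <= F (gamma 1)"
  and i: "!!t. c < t ==> t < d ==> F (gamma 1) < F (gamma t) & F (gamma t) < F (gamma 0)"
  using descending_interval[of "%s. F (gamma s)"] by blast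
 have "T (F (gamma 0)) <= T (F (gamma c))" "T (F (gamma d)) <= T (F (gamma 1))"
  using e F_range by (auto intro!: T_mono)
 hence "T (F (gamma 0)) - T (F (gamma 1)) <= abs (T (F (gamma d)) - T (F (gamma c)))" by linarith
 moreover have "ennreal (abs (T (F (gamma d)) - T (F (gamma c)))) <= curve_length M gamma"
 proof (rule T_length_between[OF gamma cd])
  show "a < F (gamma t) & F (gamma t) < b" if "c < t" "t < d" for t
   using i[OF that] F_range(2)[of "gamma 1"] F_range(3)[of "gamma 0"] by linarith
 qed
 ultimately show ?thesis by (meson ennreal_leI order_trans)
qed

lemma reach_all: "EX r. reach x y r"
proof -
 define S where "S = {y. EX r. reach x y r}"
 have "open S" unfolding open_subopen[of S]
 proof
  fix y assume "y : S"
  then obtain r where r: "reach x y r" by (auto simp: S_def)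
  obtain V where V: "open V" "y : V" "ALL z:V. reach y z 1 & reach z y 1" using reach_local[of 1 y] by auto
  hence "V <= S" using reach_trans[OF r] by (auto simp: S_def)
  thus "EX T. open T & y : T & T <= S" using V by blast
 qed
 moreover have "open (- S)" unfolding open_subopen[of "- S"]
 proof
  fix y assume y: "y : - S"
  obtain V where V: "open V" "y : V" "ALL z:V. reach y z 1 & reach z y 1" using reach_local[of 1 y] by auto
  have "z ~: S" if "z : V" for z
  proof
   assume "z : S"
   then obtain r where "reach x z r" by (auto simp: S_def)
   hence "reach x y (r + 1)" using V(3) that reach_trans by blast
   thus False using y by (auto simp: S_def)
  qed
  thus "EX T. open T & y : T & T <= - S" using V by blast
 qed
 moreover have "x : S" using reach_refl by (auto simp: S_def)
 ultimately have "S = UNIV"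
  using conn connected_clopen[of "UNIV :: 'a set"] by (simp flip: open_openin closed_closedin) (auto simp: closed_def)
 thus ?thesis by (auto simp: S_def)
qed

lemma T_le_rdist:
 assumes "F y <= F x" shows "T (F x) - T (F y) <= rdist M x y"
proof -
 let ?I = "INF gamma \<in> {gamma. piecewise_C1_curve M gamma & gamma 0 = x & gamma 1 = y}. curve_length M gamma"
 have "ennreal (T (F x) - T (F y)) <= ?I" using T_length assms by (intro INF_greatest) auto
 moreover obtain r where "reach x y r" using reach_all by blast
 hence "?I < \<infinity>" by (rule order_le_less_trans[OF reach_length]) simp
 ultimately have "enn2real (ennreal (T (F x) - T (F y))) <= enn2real ?I" by (intro enn2real_mono) auto
 moreover have "T (F y) <= T (F x)" using assms F_range by (intro T_mono) auto
 ultimately show ?thesis by (simp add: rdist_def)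
qed

text \<open>A continuous upper bound for the distance, defined by the curves admitted in \<open>reach\<close>.\<close>
definition dd :: "'a => 'a => real" where "dd x y = Inf {r. reach x y r}"

lemma dd_bdd: "bdd_below {r. reach x y r}" using reach_nonneg by (intro bdd_belowI[of _ 0]) auto

lemma dd_le: "reach x y r ==> dd x y <= r"
 unfolding dd_def by (rule cInf_lower[OF _ dd_bdd]) simp

lemma dd_greatest: "(!!r. reach x y r ==> t <= r) ==> t <= dd x y"
 unfolding dd_def using reach_all by (intro cInf_greatest) auto

lemma dd_right: "reach y z r ==> dd x z <= dd x y + r"
 using dd_greatest[of x y "dd x z - r"] dd_le[OF reach_trans] by force

lemma dd_left: "reach x y r ==> dd x z <= r + dd y z"
 using dd_greatest[of y z "dd x z - r"] dd_le[OF reach_trans] by force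

lemma dd_refl: "dd x x = 0"
proof (rule antisym)
 show "dd x x <= 0" by (rule dd_le[OF reach_refl])
 show "0 <= dd x x" by (rule dd_greatest) (rule reach_nonneg)
qed

lemma rdist_le_dd: "rdist M x y <= dd x y" by (rule dd_greatest) (rule reach_rdist)

lemma dd_cont: "continuous_on UNIV (dd x)"
 unfolding continuous_on_def
proof (intro ballI tendstoI)
 fix y and e :: real assume "0 < e"
 then obtain V where V: "open V" "y : V" "ALL z:V. reach y z (e / 2) & reach z y (e / 2)"
  using reach_local[of "e / 2" y] by auto
 have "dist (dd x z) (dd x y) < e" if "z : V" for z
  using dd_right[of y z "e / 2" x] dd_right[of z y "e / 2" x] V(3) that `0 < e` by (auto simp: dist_real_def abs_less_iff)
 thus "eventually (%z. dist (dd x z) (dd x y) < e) (at y within UNIV)"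
  unfolding eventually_at_topological using V by blast
qed

text \<open>Along the straight segment in a chart in the direction of \<open>- grad F\<close>, the function \<open>T o F\<close> decreases initially at unit rate with respect to length. The factors \<open>1 - eps / 2\<close> and \<open>1 + eps / 2\<close> leave room for the errors in both.\<close>
lemma descent:
 assumes y: "a < F y" "F y < b" and eps: "0 < eps" "eps < 1"
 shows "EX z r. reach y z r & T (F z) + (1 - eps) * r < T (F y)"
proof -
 let ?c = "chart_at M y"
 define y0 where "y0 = coords ?c y"
 note ca = chart_at[of y]
 have y0: "y0 : U ?c" "param ?c y0 = y" using ca by (auto simp: y0_def)
 define u where "u = - gradient_in M ?c F y0"
 define r where "r = sqrt (A (F y))"
 have r: "0 < r" "r^2 = A (F y)" using A_pos[OF y] by (auto simp: r_def)
 have Gamy: "gradient_in M ?c F y0 \<bullet> dv ?c F y0 = A (F y)"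
  using Gam_FF[of y] by (simp add: Gam_def ginner_def y0_def inner_commute)
 have quad: "u \<bullet> (g ?c y0 *v u) = r^2" and slope: "dv ?c F y0 \<bullet> u = - r\<^sup>2"
  unfolding u_def using Gamy g_gradient[OF ca(1) y0(1), of F] r(2)
  by (auto simp: inner_commute linear_neg[OF matrix_vector_mul_linear])
 define psi where "psi = (%t. T (F (param ?c (y0 + t *\<^sub>R u))))"
 have "((%t. y0 + t *\<^sub>R u) has_derivative (%t. t *\<^sub>R u)) (at 0)" by (auto intro!: derivative_eq_intros)
 from diff_chain_at[OF this, of "F o param ?c" "%v. dv ?c F y0 \<bullet> v"] has_derivative_dv[OF F ca(1) y0(1)]
 have "((%t. F (param ?c (y0 + t *\<^sub>R u))) has_derivative (%t. t * (- r\<^sup>2))) (at 0)"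
  by (simp add: o_def slope)
 hence "((%t. F (param ?c (y0 + t *\<^sub>R u))) has_real_derivative - r\<^sup>2) (at 0)"
  unfolding has_field_derivative_def by (rule has_derivative_eq_rhs) (auto simp: fun_eq_iff)
 from DERIV_chain2[OF T_deriv[of "F (param ?c (y0 + 0 *\<^sub>R u))"] this] y y0(2)
 have "(psi has_real_derivative 1 / r * - r\<^sup>2) (at 0)" by (simp add: psi_def r_def)
 hence psi: "DERIV psi (0) :> - r" using r(1) by (simp add: power2_eq_square)
 have "tendsto (%t. (psi t - psi 0) / t) (- r) (at_right 0)"
  using psi unfolding has_field_derivative_iff by (auto intro: filterlim_mono at_le)
 hence "eventually (%t. (psi t - psi 0) / t < - (1 - eps / 2) * r) (at_right 0)"
  by (rule order_tendstoD) (use eps r in "simp add: algebra_simps")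
 then obtain t1 where t1: "t1 > 0" "!!t. 0 < t ==> t < t1 ==> (psi t - psi 0) / t < - (1 - eps / 2) * r"
  unfolding eventually_at_right[OF zero_less_one] by blast
 define C where "C = (1 + eps / 2) * r"
 have rC: "r < C" using r eps by (auto simp: C_def algebra_simps)
 hence C: "r < C" "0 < C" using r(1) by auto
 define W where "W = U ?c Int (%z. u \<bullet> (g ?c z *v u)) -` {..<C\<^sup>2}"
 have "open W" unfolding W_def
  by (rule continuous_open_preimage[OF g_form_cont[OF ca(1)] open_U[OF ca(1)]]) simp
 moreover have "y0 : W" using y0 quad C r(1) by (auto simp: W_def intro!: power_strict_mono)
 ultimately obtain e where e: "e > 0" "ball y0 e <= W" using open_contains_ball by blast
 define t where "t = min (t1 / 2) (e / (2 * (norm u + 1)))"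
 have n: "0 < 2 * (norm u + 1)" by (simp add: add_nonneg_pos)
 have "0 < e / (2 * (norm u + 1))" by (rule divide_pos_pos[OF e(1) n])
 moreover have "t <= t1 / 2" unfolding t_def by (rule min.cobounded1)
 ultimately have t: "0 < t" "t < t1" using t1(1) by (auto simp: t_def)
 have tu: "t * norm u < e"
 proof -
  have "t * norm u <= e / (2 * (norm u + 1)) * norm u" by (intro mult_right_mono) (auto simp: t_def)
  also have "... = e * (norm u / (2 * (norm u + 1)))" by simp
  also have "... < e * 1"
  proof (rule mult_strict_left_mono[OF _ e(1)])
   have "norm u < 1 * (2 * (norm u + 1))" using norm_ge_zero[of u] unfolding mult_1 distrib_left by linarith
   thus "norm u / (2 * (norm u + 1)) < 1" unfolding pos_divide_less_eq[OF n] .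
  qed
  finally show ?thesis by simp
 qed
 have inW: "y0 + s *\<^sub>R (t *\<^sub>R u) : W" if s: "0 <= s" "s <= 1" for s
 proof -
  have "s * (t * norm u) <= 1 * (t * norm u)" using s t by (intro mult_right_mono) auto
  hence "s * (t * norm u) < e" using tu by linarith
  hence "y0 + s *\<^sub>R (t *\<^sub>R u) : ball y0 e" using s t by (simp add: dist_norm abs_mult)
  thus ?thesis using e(2) by blast
 qed
 define z where "z = param ?c (y0 + t *\<^sub>R u)"
 have "reach (param ?c y0) (param ?c (y0 + t *\<^sub>R u)) (t * C)"
 proof (rule reach_segment[OF ca(1)])
  fix s :: real assume s: "0 <= s" "s <= 1"
  show "y0 + s *\<^sub>R (t *\<^sub>R u) : U ?c" using inW[OF s] by (simp add: W_def)
  have "(t *\<^sub>R u) \<bullet> (g ?c (y0 + s *\<^sub>R (t *\<^sub>R u)) *v (t *\<^sub>R u)) = t^2 * (u \<bullet> (g ?c (y0 + s *\<^sub>R (t *\<^sub>R u)) *v u))"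
   by (simp add: matrix_vector_mult_scaleR power2_eq_square)
  also have "... <= t^2 * C^2" using inW[OF s] by (intro mult_left_mono) (auto simp: W_def)
  finally show "(t *\<^sub>R u) \<bullet> (g ?c (y0 + s *\<^sub>R (t *\<^sub>R u)) *v (t *\<^sub>R u)) <= (t * C)^2" by (simp add: power_mult_distrib)
 qed (use t C in simp)
 hence "reach y z (t * C)" using y0 by (simp add: z_def)
 moreover have "T (F z) + (1 - eps) * (t * C) < T (F y)"
 proof -
  have "psi t - psi 0 < - (1 - eps / 2) * r * t" using t1(2)[OF t] t(1) by (simp add: pos_divide_less_eq)
  moreover have "(1 - eps) * (t * C) <= (1 - eps / 2) * r * t"
  proof -
   have "(1 - eps) * (1 + eps / 2) <= 1 - eps / 2" by (simp add: algebra_simps)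
   from mult_right_mono[OF this, of "r * t"] show ?thesis using r t by (simp add: C_def mult_ac)
  qed
  moreover have "psi t = T (F z)" "psi 0 = T (F y)" using y0 by (auto simp: psi_def z_def)
  ultimately show ?thesis by linarith
 qed
 ultimately show ?thesis by blast
qed

lemma null_level:
 assumes s: "a < s" "s <= b" shows "measure vol (F -` {s}) = 0"
proof -
 have m: "F -` {s} : sets vol" using closed_vimage[OF closed_singleton F_cont] by simp
 have le: "measure vol (F -` {s}) <= V s - V r" if "a < r & r < s" for r
 proof -
  have "measure vol (F -` {s}) = (LINT x|vol. (if F x = s then 1 else 0))"
  proof -
   have "(%x. if F x = s then 1 else 0 :: real) = indicator (F -` {s})" by (auto simp: indicator_def fun_eq_iff)
   thus ?thesis using m by simp
  qed
  also have "... <= (LINT x|vol. (if r < F x & F x <= s then 1 else 0))"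
   by (rule integral_mono)
     (use that integrable_cut[OF continuous_on_const, of "%t. r < t & t <= s" 1]
      integrable_cut[OF continuous_on_const, of "%t. t = s" 1] in auto)
  also have "... = V s - V r" unfolding V_def using cum_diff[of "%_. 1" r s] that by simp
  finally show ?thesis .
 qed
 have "tendsto V (V s) (at s within {a..b})" using V_cont s by (auto simp: continuous_on)
 hence "tendsto V (V s) (at s within {a..s})" by (rule tendsto_within_subset) (use s in auto)
 hence "tendsto V (V s) (at_left s)" by (simp add: at_within_Icc_at_left[OF s(1)])
 hence "tendsto (%r. V s - V r) (V s - V s) (at_left s)" by (intro tendsto_intros)
 from tendsto_lowerbound[OF this eventually_mono[OF eventually_inside_left[OF s(1)] le]]
 have "measure vol (F -` {s}) <= 0" by simp
 thus ?thesis using measure_nonneg[of vol "F -` {s}"] by linarith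
qed

text \<open>The level \<open>F = b\<close> is a null set and therefore contains no open set.\<close>
lemma leave_b:
 assumes "0 < e" shows "EX z. reach x z e & F z < b"
proof -
 obtain W where W: "open W" "x : W" "ALL z:W. reach x z e & reach z x e" using reach_local[OF assms, of x] by auto
 have "~ W <= F -` {b}"
 proof
  assume "W <= F -` {b}"
  hence "emeasure vol W <= emeasure vol (F -` {b})"
   using closed_vimage[OF closed_singleton F_cont] by (intro emeasure_mono) auto
  also have "... = 0" using null_level[of b] ab by (simp add: finite_measure.emeasure_eq_measure[OF finite_vol])
  finally show False using open_vol_pos[OF W(1,2)] by simp
 qed
 then obtain z where "z : W" "F z ~= b" by blast
 thus ?thesis using W(3) F_range(3)[of z] by (intro exI[of _ z]) auto
qed

text \<open>Minimise \<open>T o F + (1 - eps) * dd x\<close> on the compact manifold, as in Ekeland's variational principle. At a minimum no descent step is possible, so it lies on \<open>F = a\<close>.\<close>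
lemma ekeland:
 assumes x: "F x < b" and eps: "0 < eps" "eps < 1"
 shows "EX p. F p = a & (1 - eps) * dd x p <= T (F x)"
proof -
 define Phi where "Phi = (%y. T (F y) + (1 - eps) * dd x y)"
 have "continuous_on UNIV Phi" unfolding Phi_def by (intro continuous_intros F_comp_cont T_cont dd_cont)
 from continuous_attains_inf[OF compact_M _ this] obtain y where y: "!!z. Phi y <= Phi z" by auto
 have ddn: "0 <= dd x y" by (rule dd_greatest) (rule reach_nonneg)
 have le: "Phi y <= T (F x)" using y[of x] by (simp add: Phi_def dd_refl)
 moreover have "T (F y) <= Phi y" using eps ddn by (simp add: Phi_def)
 ultimately have "T (F y) < T b" using T_strict[of "F x" b] x F_range by fastforce
 hence yb: "F y < b" using F_range(3)[of y] by (cases "F y = b") auto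
 have "F y = a"
 proof (rule ccontr)
  assume "F y ~= a"
  hence ya: "a < F y" using F_range(2)[of y] by simp
  obtain z r where zr: "reach y z r" "T (F z) + (1 - eps) * r < T (F y)" using descent[OF ya yb eps] by blast
  have "(1 - eps) * dd x z <= (1 - eps) * (dd x y + r)" using dd_right[OF zr(1)] eps by (intro mult_left_mono) auto
  hence "Phi z < Phi y" using zr(2) by (simp add: Phi_def algebra_simps)
  thus False using y[of z] by simp
 qed
 thus ?thesis using le T_a by (auto simp: Phi_def)
qed

text \<open>The upper bound is \<open>ekeland\<close> with \<open>eps \<rightarrow> 0\<close>; points with \<open>F x = b\<close>, where the descent step is not available, are first moved off that level.\<close>
theorem rho_eq: "rho M (F -` {a}) x = T (F x)"
proof -
 have ne: "F -` {a} ~= {}" using F_surj[of a] ab by auto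
 have bdd: "bdd_below (rdist M x ` (F -` {a}))" unfolding rdist_def by (intro bdd_belowI[of _ 0]) auto
 have low: "rho M (F -` {a}) x <= rdist M x p" if "F p = a" for p
  unfolding rho_def using that by (intro cINF_lower bdd) auto
 have up: "rho M (F -` {a}) z <= T (F z)" if z: "F z < b" for z
 proof (rule field_le_mult_one_interval)
  fix t :: real assume t: "0 < t" "t < 1"
  obtain p where p: "F p = a" "(1 - (1 - t)) * dd z p <= T (F z)" using ekeland[OF z, of "1 - t"] t by auto
  have "rho M (F -` {a}) z <= dd z p"
  proof -
   have "rho M (F -` {a}) z <= rdist M z p" unfolding rho_def
    by (rule cINF_lower) (use p in "auto simp: rdist_def intro!: bdd_belowI[of _ 0]")
   thus ?thesis using rdist_le_dd[of z p] by linarith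
  qed
  hence "t * rho M (F -` {a}) z <= t * dd z p" using t by (intro mult_left_mono) auto
  thus "t * rho M (F -` {a}) z <= T (F z)" using p(2) by simp
 qed
 have "rho M (F -` {a}) x <= T (F x)"
 proof (cases "F x < b")
  case True thus ?thesis by (rule up)
 next
  case False
  hence xb: "F x = b" using F_range(3)[of x] by simp
  show ?thesis
  proof (rule field_le_epsilon)
   fix e :: real assume e: "0 < e"
   obtain z where z: "reach x z (e / 2)" "F z < b" using leave_b[of "e / 2" x] e by auto
   have "t * (rho M (F -` {a}) x - e / 2) <= T b" if t: "0 < t" "t < 1" for t
   proof -
    obtain p where p: "F p = a" "(1 - (1 - t)) * dd z p <= T (F z)" using ekeland[OF z(2), of "1 - t"] t by auto
    have "rho M (F -` {a}) x <= e / 2 + dd z p"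
     using low[OF p(1)] rdist_le_dd[of x p] dd_left[OF z(1), of p] by linarith
    hence "t * (rho M (F -` {a}) x - e / 2) <= t * dd z p" using t by (intro mult_left_mono) auto
    moreover have "T (F z) <= T b" using F_range by (intro T_mono) auto
    ultimately show ?thesis using p(2) by simp
   qed
   hence "rho M (F -` {a}) x - e / 2 <= T b" by (rule field_le_mult_one_interval)
   thus "rho M (F -` {a}) x <= T (F x) + e" using e xb by simp
  qed
 qed
 moreover have "T (F x) <= rho M (F -` {a}) x" unfolding rho_def
 proof (rule cINF_greatest[OF ne])
  fix p assume "p : F -` {a}"
  thus "T (F x) <= rdist M x p" using T_le_rdist[of p x] T_a F_range(2)[of x] by simp
 qed
 ultimately show ?thesis by simp
qed

theorem focal_distance_eq: "focal_distance M (F -` {a}) (F -` {b}) = T b"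
proof -
 interpret neg: isoparametric_mfd M "%x. - F x" "- b" "- a" "%s. A (- s)" "%s. (- 1) * B (- s)"
  by (rule isoparametric_neg)
 obtain p where p: "F p = a" using F_surj[of a] ab by auto
 obtain q where q: "F q = b" using F_surj[of b] ab by auto
 have "neg.T (- a) - neg.T (- b) = T b"
 proof (rule T_unique[of "%s. neg.T (- a) - neg.T (- s)"])
  show "continuous_on {a..b} (%s. neg.T (- a) - neg.T (- s))"
   by (intro continuous_intros continuous_on_compose2[OF neg.T_cont]) auto
  fix s assume s: "a < s" "s < b"
  have "DERIV neg.T (- s) :> 1 / sqrt (A (- (- s)))" by (rule neg.T_deriv) (use s in auto)
  hence "DERIV (%s. neg.T (- s)) s :> 1 / sqrt (A (- (- s))) * - 1"
   by (rule DERIV_chain2) (auto intro!: derivative_eq_intros)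
  thus "DERIV (%s. neg.T (- a) - neg.T (- s)) s :> 1 / sqrt (A s)"
   by (auto intro!: derivative_eq_intros)
 qed simp
 hence nT: "neg.T (- a) = T b" using neg.T_a by simp
 have "(%x. - F x) -` {- b} = F -` {b}" by auto
 hence inf: "(INF q\<in>F -` {b}. rdist M p q) = T b"
  using neg.rho_eq[of p] p nT by (simp add: rho_def)
 have low: "T b <= rdist M p' q'" if "F p' = a" "F q' = b" for p' q'
  using neg.T_le_rdist[of q' p'] that nT neg.T_a ab by simp
 have ne: "F -` {a} \<times> F -` {b} ~= {}" using p q by auto
 show ?thesis unfolding focal_distance_def
 proof (rule antisym)
  show "(INF (p, q)\<in>F -` {a} \<times> F -` {b}. rdist M p q) <= T b"
   unfolding inf[symmetric]
  proof (rule cINF_greatest)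
   fix q' assume "q' : F -` {b}"
   moreover have "bdd_below ((%(p, q). rdist M p q) ` (F -` {a} \<times> F -` {b}))"
    by (rule bdd_belowI[of _ 0]) (auto simp: rdist_def)
   ultimately show "(INF (p, q)\<in>F -` {a} \<times> F -` {b}. rdist M p q) <= rdist M p q'"
    using cINF_lower[of "%(p, q). rdist M p q" "F -` {a} \<times> F -` {b}" "(p, q')"] p by simp
  qed (use q in auto)
  show "T b <= (INF (p, q)\<in>F -` {a} \<times> F -` {b}. rdist M p q)"
   by (rule cINF_greatest[OF ne]) (use low in auto)
 qed
qed

end

section \<open>Content functions and the Pompeiu property\<close>

text \<open>A set of reals that is infinite but finite below every bound is enumerated increasingly.\<close>
lemma nth_smallest:
 fixes S :: "real set"
 assumes inf: "infinite S" and fin: "!!L. finite {m : S. m <= L}"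
 shows "EX l. l : S & card {m : S. m < l} = n"
proof (induction n)
 case 0
 obtain l0 where l0: "l0 : S" using inf by fastforce
 define l where "l = Min {m : S. m <= l0}"
 have l: "l : {m : S. m <= l0}" unfolding l_def by (rule Min_in[OF fin]) (use l0 in auto)
 have "{m : S. m < l} = {}"
 proof (rule ccontr)
  assume "{m : S. m < l} ~= {}"
  then obtain m where m: "m : S" "m < l" by blast
  thus False using Min_le[OF fin, of m l0] l by (simp add: l_def)
 qed
 thus ?case using l by (intro exI[of _ l]) (auto simp del: Collect_empty_eq)
next
 case (Suc n)
 then obtain l where l: "l : S" "card {m : S. m < l} = n" by blast
 have "~ S <= {m : S. m <= l}" using inf fin finite_subset by blast
 then obtain l1 where "l1 : S" "~ l1 <= l" by blast
 hence l1: "l1 : S" "l < l1" by auto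
 define l' where "l' = Min {m : S. l < m & m <= l1}"
 have fin': "finite {m : S. l < m & m <= l1}" by (rule finite_subset[OF _ fin[of l1]]) auto
 have l': "l' : {m : S. l < m & m <= l1}" unfolding l'_def by (rule Min_in[OF fin']) (use l1 in auto)
 have "{m : S. m < l'} = insert l {m : S. m < l}"
 proof
  show "{m : S. m < l'} <= insert l {m : S. m < l}"
  proof
   fix m assume m: "m : {m : S. m < l'}"
   have "~ l < m"
   proof
    assume "l < m"
    hence "l' <= m" using m l' unfolding l'_def by (intro Min_le[OF fin']) auto
    thus False using m by simp
   qed
   thus "m : insert l {m : S. m < l}" using m by auto
  qed
 qed (use l l' in auto)
 moreover have "finite {m : S. m < l}" by (rule finite_subset[OF _ fin[of l]]) auto
 ultimately show ?case using l l' by (intro exI[of _ l']) auto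
qed

lemma nth_smallest_unique:
 fixes S :: "real set"
 assumes fin: "!!L. finite {m : S. m <= L}" and l: "l : S" "l' : S" and eq: "card {m : S. m < l} = card {m : S. m < l'}"
 shows "l = l'"
proof -
 have "~ l1 < l2" if "l1 : S" "card {m : S. m < l1} = card {m : S. m < l2}" for l1 l2
 proof
  assume "l1 < l2"
  hence "{m : S. m < l1} \<subset> {m : S. m < l2}" using that by force
  moreover have "finite {m : S. m < l2}" by (rule finite_subset[OF _ fin[of l2]]) auto
  ultimately show False using psubset_card_mono[of "{m : S. m < l2}" "{m : S. m < l1}"] that(2) by simp
 qed
 thus ?thesis using l eq by (metis linorder_neqE_linordered_idom)
qed

context isoparametric_mfd begin

abbreviation "P == F -` {a}"
abbreviation "Q == F -` {b}"

lemma T_inj: "inj_on T {a..b}"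
proof (rule inj_onI)
 fix s t assume "s : {a..b}" "t : {a..b}" "T s = T t"
 thus "s = t" using T_strict[of s t] T_strict[of t s] by (cases s t rule: linorder_cases) auto
qed

lemma radial_iff: "radial M P f = (EX h. f = (%x. h (F x)))"
proof
 assume "radial M P f"
 then obtain psi where "f = psi o rho M P" by (auto simp: radial_def)
 hence "f = (%x. (%s. psi (T s)) (F x))" by (auto simp: rho_eq)
 thus "EX h. f = (%x. h (F x))" by (rule exI[of _ "%s. psi (T s)"])
next
 assume "EX h. f = (%x. h (F x))"
 then obtain h where h: "f = (%x. h (F x))" by blast
 have "f = (%t. h (inv_into {a..b} T t)) o rho M P"
  using inv_into_f_f[OF T_inj] F_range by (auto simp: h rho_eq)
 thus "radial M P f" unfolding radial_def by (rule exI[of _ "%t. h (inv_into {a..b} T t)"])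
qed

lemma radial_eigenvalues_eq: "radial_eigenvalues M P = sl.eigenvalues"
 unfolding level_eigenvalues[symmetric] radial_eigenvalues_def radial_iff ..

lemma finite_radial_below: "finite {m : radial_eigenvalues M P. m <= L}"
 unfolding radial_eigenvalues_eq by (rule sl.finite_eigenvalues_below)

lemma radial_eigenvalue_eq:
 assumes "l : radial_eigenvalues M P"
 shows "radial_eigenvalue M P (Suc (card {m : radial_eigenvalues M P. m < l})) = l"
 unfolding radial_eigenvalue_def
proof (rule the_equality)
 have "finite {m : radial_eigenvalues M P. m < l}" by (rule finite_subset[OF _ finite_radial_below[of l]]) auto
 thus "l : radial_eigenvalues M P & finite {m : radial_eigenvalues M P. m < l} &
   Suc (card {m : radial_eigenvalues M P. m < l}) = Suc (card {m : radial_eigenvalues M P. m < l})"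
  using assms by simp
 fix l' assume "l' : radial_eigenvalues M P & finite {m : radial_eigenvalues M P. m < l'} &
   Suc (card {m : radial_eigenvalues M P. m < l'}) = Suc (card {m : radial_eigenvalues M P. m < l})"
 thus "l' = l" by (intro nth_smallest_unique[OF finite_radial_below _ assms]) auto
qed

lemma radial_eigenvalue_mem:
 assumes "1 <= k" shows "radial_eigenvalue M P k : radial_eigenvalues M P"
proof -
 have "infinite (radial_eigenvalues M P)" unfolding radial_eigenvalues_eq by (rule sl.infinite_eigenvalues)
 from nth_smallest[OF this finite_radial_below] obtain l
  where l: "l : radial_eigenvalues M P" "card {m : radial_eigenvalues M P. m < l} = k - 1" by blast
 thus ?thesis using radial_eigenvalue_eq[OF l(1)] assms by simp
qed

definition profile :: "nat => real => real" where
 "profile k = (SOME h. radial_eigenfunction M P k = (%x. h (F x)))"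

lemma radial_eigenfunction:
 assumes "1 <= k"
 shows "eigenfunction M (radial_eigenvalue M P k) (radial_eigenfunction M P k)"
  and "radial_eigenfunction M P k = (%x. profile k (F x))"
proof -
 have "EX f. eigenfunction M (radial_eigenvalue M P k) f & radial M P f"
  using radial_eigenvalue_mem[OF assms] by (simp add: radial_eigenvalues_def)
 from someI_ex[OF this] have f: "eigenfunction M (radial_eigenvalue M P k) (radial_eigenfunction M P k)"
  "radial M P (radial_eigenfunction M P k)" unfolding radial_eigenfunction_def[symmetric] by auto
 show "eigenfunction M (radial_eigenvalue M P k) (radial_eigenfunction M P k)" by (rule f(1))
 show "radial_eigenfunction M P k = (%x. profile k (F x))"
  using someI_ex[OF f(2)[unfolded radial_iff]] by (simp add: profile_def)
qed

lemma eigenfunctionD: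
 assumes "eigenfunction M l f"
 shows "C_fun (Suc (Suc 0)) f" "laplacian M f x = l * f x" "continuous_on UNIV f"
 using assms C_fun_cont[of 0 f] by (auto simp: eigenfunction_def smooth_fun_iff)

lemma profile:
 assumes k: "1 <= k"
 shows "sl.sol (radial_eigenvalue M P k) (profile k) (sl.I (profile k))"
  and "EX s. a < s & s < b & profile k s ~= 0"
  and "s : {a..b} ==> cum (radial_eigenfunction M P k) s = sl.I (profile k) s"
proof -
 note e = radial_eigenfunction[OF k]
 have eq: "radial_eigenfunction M P k x = profile k (F x)" for x unfolding e(2) ..
 note r = radial_profile[OF eigenfunctionD(1,2)[OF e(1)] eq]
 show "sl.sol (radial_eigenvalue M P k) (profile k) (sl.I (profile k))" by (rule r(2))
 show "s : {a..b} ==> cum (radial_eigenfunction M P k) s = sl.I (profile k) s" by (rule r(3))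
 obtain x where "radial_eigenfunction M P k x ~= 0" using e(1) by (auto simp: eigenfunction_def)
 hence "EX s:{a..b}. profile k s ~= 0" using eq F_range(1) by auto
 from sl.nonzero_inside[OF r(1) this] show "EX s. a < s & s < b & profile k s ~= 0" by blast
qed

lemma T_param: assumes "t : {0<..<T b}" obtains s where "a < s" "s < b" "T s = t"
proof -
 obtain s where s: "a <= s" "s <= b" "T s = t"
  using IVT'[of T a t b] assms T_a T_cont ab by auto
 moreover have "s ~= a" "s ~= b" using s assms T_a by auto
 ultimately show thesis using that by force
qed

lemma tube_eq: assumes "a < s" "s < b" shows "tube M P (T s) = {x. F x < s}"
proof -
 have "T (F x) < T s \<longleftrightarrow> F x < s" for x
  using T_strict[of "F x" s] T_mono[of s "F x"] F_range[of x] assms by (auto simp: not_less[symmetric])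
 thus ?thesis by (simp add: tube_def rho_eq)
qed

lemma sublevel_integral:
 assumes f: "continuous_on UNIV (f :: 'a => real)" and s: "a < s" "s < b"
 shows "set_lebesgue_integral vol {x. F x < s} f = cum f s"
proof -
 note [measurable] = cont_vol[OF f]
 have "{x. F x < s} = F -` {..<s}" by auto
 hence [measurable]: "{x. F x < s} : sets vol" using open_vimage[OF open_lessThan F_cont] by simp
 have cl: "F -` {s} : sets vol" using closed_vimage[OF closed_singleton F_cont] by simp
 have "emeasure vol (F -` {s}) = 0"
  using null_level[of s] s by (simp add: finite_measure.emeasure_eq_measure[OF finite_vol])
 hence "AE x in vol. x ~: F -` {s}" using cl by (intro AE_not_in) auto
 hence ae: "AE x in vol. indicator {x. F x < s} x *\<^sub>R f x = (if F x <= s then f x else 0)"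
  by eventually_elim (auto simp: indicator_def)
 show ?thesis unfolding set_lebesgue_integral_def cum_def
  by (rule integral_cong_AE[OF _ _ ae]) measurable
qed

text \<open>Levels are null sets, so the strict inequality in the tube and the weak one in \<open>cum\<close> give the same integral.\<close>
lemma content_eq:
 assumes k: "1 <= k" and s: "a < s" "s < b"
 shows "content_function M P k (T s) = sl.I (profile k) s"
 unfolding content_function_def tube_eq[OF s] sublevel_integral[OF eigenfunctionD(3)[OF radial_eigenfunction(1)[OF k]] s]
 using profile(3)[OF k, of s] s by simp

lemma content_zeros_eq:
 assumes k: "1 <= k"
 shows "content_zeros M P Q k = T ` {s : {a<..<b}. sl.I (profile k) s = 0}"
proof
 show "content_zeros M P Q k <= T ` {s : {a<..<b}. sl.I (profile k) s = 0}"
 proof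
  fix t assume "t : content_zeros M P Q k"
  hence t: "t : {0<..<T b}" "content_function M P k t = 0" by (auto simp: content_zeros_def focal_distance_eq)
  obtain s where s: "a < s" "s < b" "T s = t" using T_param[OF t(1)] by blast
  thus "t : T ` {s : {a<..<b}. sl.I (profile k) s = 0}" using t(2) content_eq[OF k s(1,2)] by auto
 qed
 show "T ` {s : {a<..<b}. sl.I (profile k) s = 0} <= content_zeros M P Q k"
 proof
  fix t assume "t : T ` {s : {a<..<b}. sl.I (profile k) s = 0}"
  then obtain s where s: "a < s" "s < b" "sl.I (profile k) s = 0" "t = T s" by auto
  thus "t : content_zeros M P Q k"
   using content_eq[OF k s(1,2)] T_strict[of a s] T_strict[of s b] T_a by (simp add: content_zeros_def focal_distance_eq)
 qed
qed

theorem tube_not_pompeiu: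
 assumes "t : all_content_zeros M P Q" shows "~ pompeiu_property M (tube M P t)"
proof
 assume pomp: "pompeiu_property M (tube M P t)"
 obtain k where k: "1 <= k" "t : content_zeros M P Q k" using assms by (auto simp: all_content_zeros_def)
 then obtain s where s: "a < s" "s < b" "sl.I (profile k) s = 0" "t = T s" unfolding content_zeros_eq[OF k(1)] by auto
 define f where "f = radial_eigenfunction M P k"
 define l where "l = radial_eigenvalue M P k"
 have f: "eigenfunction M l f" unfolding f_def l_def by (rule radial_eigenfunction(1)[OF k(1)])
 obtain r where r: "a < r" "r < b" "profile k r ~= 0" using profile(2)[OF k(1)] by blast
 have zero: "cum f' s = 0" if f': "eigenfunction M l f'" for f'
 proof -
  obtain phi where "sl.sol l phi (cum f')" using eigen_system[OF eigenfunctionD(1,2)[OF f']] by blast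
  from sl.sol_common_zero[OF profile(1)[OF k(1), folded l_def] this s(1,2,3) r] show ?thesis .
 qed
 have "set_lebesgue_integral vol (h ` tube M P t) f = 0" if h: "isometry M h" for h
 proof -
  interpret h: compact_isometry M h by unfold_locales (rule h)
  have tube: "tube M P t = F -` {..<s}" unfolding s(4) tube_eq[OF s(1,2)] by auto
  hence "tube M P t : sets borel" using open_vimage[OF open_lessThan F_cont] by simp
  hence im: "h ` tube M P t : sets borel" by (rule h.h_borel(2))
  have [measurable]: "f : borel_measurable borel" by (rule borel_measurable_continuous_onI[OF eigenfunctionD(3)[OF f]])
  note im[measurable]
  have "set_lebesgue_integral vol (h ` tube M P t) f = (LINT x|vol. indicator (h ` tube M P t) (h x) *\<^sub>R f (h x))"
   unfolding set_lebesgue_integral_def by (rule h.integral_h[symmetric]) measurable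
  also have "... = set_lebesgue_integral vol {x. F x < s} (f o h)"
   unfolding set_lebesgue_integral_def tube using inj_image_mem_iff[OF bij_is_inj[OF h.bij_h]]
   by (intro lebesgue_integral_cong) (auto simp: indicator_def)
  also have "... = cum (f o h) s"
   by (rule sublevel_integral[OF eigenfunctionD(3)[OF h.eigenfunction_h[OF f]] s(1,2)])
  also have "... = 0" by (rule zero[OF h.eigenfunction_h[OF f]])
  finally show ?thesis .
 qed
 hence "f x = 0" for x using pomp eigenfunctionD(3)[OF f] unfolding pompeiu_property_def by blast
 thus False using f by (auto simp: eigenfunction_def)
qed

theorem countable_content_zeros: "countable (all_content_zeros M P Q)"
 unfolding all_content_zeros_def
proof (rule countable_UN)
 fix k :: nat assume "k : {1..}"
 hence k: "1 <= k" by simp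
 obtain r where "a < r" "r < b" "profile k r ~= 0" using profile(2)[OF k] by blast
 from sl.sol_countable_zeros[OF profile(1)[OF k] this]
 show "countable (content_zeros M P Q k)" unfolding content_zeros_eq[OF k] by (rule countable_image)
qed simp

theorem content_zeros_dense: "{0<..<focal_distance M P Q} <= closure (all_content_zeros M P Q)"
proof
 fix t assume "t : {0<..<focal_distance M P Q}"
 hence t: "0 < t" "t < T b" by (auto simp: focal_distance_eq)
 show "t : closure (all_content_zeros M P Q)" unfolding closure_approachable
 proof (intro allI impI)
  fix e :: real assume e: "0 < e"
  have "0 < min e (min t (T b - t))" using e t by simp
  then obtain delta where "0 < delta" "delta < min e (min t (T b - t))" using dense by blast
  hence delta: "0 < delta" "delta < e" "0 < t - delta" "t + delta < T b" by auto
  obtain c where c: "a < c" "c < b" "T c = t - delta" using T_param[of "t - delta"] delta by auto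
  obtain d where d: "a < d" "d < b" "T d = t + delta" using T_param[of "t + delta"] delta by auto
  have cd: "c < d" using T_mono[of d c] c d delta by (cases "c < d") auto
  obtain L where L: "!!l phi G. l > L ==> sl.sol l phi G ==> EX s:{c..d}. G s = 0"
   using sl.sol_zeros_dense[OF c(1) cd d(2)] by blast
  have "~ radial_eigenvalues M P <= {m : radial_eigenvalues M P. m <= L}"
   using finite_radial_below[of L] sl.infinite_eigenvalues finite_subset unfolding radial_eigenvalues_eq by blast
  then obtain l where "l : radial_eigenvalues M P" "~ l <= L" by blast
  hence l: "l : radial_eigenvalues M P" "L < l" by auto
  define k where "k = Suc (card {m : radial_eigenvalues M P. m < l})"
  have k: "1 <= k" "radial_eigenvalue M P k = l" using radial_eigenvalue_eq[OF l(1)] by (auto simp: k_def)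
  from L[OF l(2) profile(1)[OF k(1), unfolded k(2)]] obtain s where s: "s : {c..d}" "sl.I (profile k) s = 0" by blast
  have "T s : content_zeros M P Q k" unfolding content_zeros_eq[OF k(1)] using s c d by auto
  hence "T s : all_content_zeros M P Q" using k(1) by (auto simp: all_content_zeros_def)
  moreover have "dist (T s) t < e"
   using T_mono[of c s] T_mono[of s d] s(1) c d delta(2) by (auto simp: dist_real_def abs_less_iff)
  ultimately show "EX y:all_content_zeros M P Q. dist y t < e" by blast
 qed
qed

end

theorem theorem21:
  fixes M :: "('a::{t2_space,second_countable_topology}, 'n::finite) riemannian"
    and F :: "'a \<Rightarrow> real" and a b :: real
  assumes "riemannian_manifold M"
    and "compact (UNIV :: 'a set)" and "connected (UNIV :: 'a set)"
    and "proper_isoparametric M F a b"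
  shows "(\<forall>t \<in> all_content_zeros M (F -` {a}) (F -` {b}).
            \<not> pompeiu_property M (tube M (F -` {a}) t)) \<and>
         countable (all_content_zeros M (F -` {a}) (F -` {b})) \<and>
         all_content_zeros M (F -` {a}) (F -` {b})
           \<subseteq> {0<..<focal_distance M (F -` {a}) (F -` {b})} \<and>
         {0<..<focal_distance M (F -` {a}) (F -` {b})}
           \<subseteq> closure (all_content_zeros M (F -` {a}) (F -` {b}))"
proof -
 obtain A B where iso: "a < b" "smooth_fun M F" "range F = {a..b}" "smooth_on {a..b} A" "smooth_on {a..b} B"
  "grad_norm_sq M F = A o F" "laplacian M F = B o F"
  using assms(4) unfolding proper_isoparametric_def isoparametric_def by blast
 interpret isoparametric_mfd M F a b A B
  by unfold_locales (use assms iso smooth_on_C_seg in "auto simp: o_def")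
 have "all_content_zeros M P Q <= {0<..<focal_distance M P Q}"
  by (auto simp: all_content_zeros_def content_zeros_def)
 thus ?thesis using tube_not_pompeiu countable_content_zeros content_zeros_dense by blast
qed

end
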